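(* Let $\tau>0$, $d\ge2$, $0<p<\infty$, $0<q\le\infty$. (i) If either $s>1/p$, or $s=1/p$ and $q\le1$, then every $f\in RB^s_{p,q}(\mathbb{R}^d)$ is uniformly continuous on the set $\{x\in\mathbb{R}^d:|x|\ge\tau\}$. (ii) If either $s>1/p$, or $s=1/p$ and $p\le1$, then every $f\in RF^s_{p,q}(\mathbb{R}^d)$ is uniformly continuous on the set $\{x\in\mathbb{R}^d:|x|\ge\tau\}$.
   Context: Besov and Lizorkin-Triebel spaces on $\mathbb{R}^n$: let $\varphi_0\in C_0^\infty(\mathbb{R}^n)$ with $\varphi_0(\xi)=1$ for $|\xi|\le1$ and $\varphi_0(\xi)=0$ for $|\xi|\ge 3/2$, and $\varphi_j(\xi)=\varphi_0(2^{-j}\xi)-\varphi_0(2^{-j+1}\xi)$, $j\ge1$. Then $B^s_{p,q}(\mathbb{R}^n)$ consists of all $f\in\mathcal{S}'(\mathbb{R}^n)$ with $\big(\sum_{j\ge0}2^{jsq}\|\mathcal{F}^{-1}[\varphi_j\mathcal{F}f]\|_{L_p}^q\big)^{1/q}<\infty$, and, for $p<\infty$, $F^s_{p,q}(\mathbb{R}^n)$ of all $f\in\mathcal{S}'(\mathbb{R}^n)$ with $\big\|\big(\sum_{j\ge0}2^{jsq}|\mathcal{F}^{-1}[\varphi_j\mathcal{F}f](\cdot)|^q\big)^{1/q}\big\|_{L_p}<\infty$ (usual modification for $q=\infty$); these expressions are the quasi-norms. $RE$ denotes the subset of radial elements of $E$ (invariant under all orthogonal transformations), with the quasi-norm of $E$.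 Convention: continuity of $f$ refers to existence of a continuous representative; i.e. outside the origin the distribution $f$ is given by a continuous function, and the assertion is about this function. *)

theory Defs
  imports "HOL-Analysis.Analysis"
begin

section \<open>Smooth functions, test functions, Schwartz functions\<close>

definition partial_deriv :: "'a::euclidean_space \<Rightarrow> ('a \<Rightarrow> complex) \<Rightarrow> 'a \<Rightarrow> complex" where
  "partial_deriv b f = (\<lambda>x. frechet_derivative f (at x) b)"

text \<open>A multi-index is given as a list of basis vectors, the directions of successive
  differentiation.\<close>

definition iterated_partial :: "'a::euclidean_space list \<Rightarrow> ('a \<Rightarrow> complex) \<Rightarrow> 'a \<Rightarrow> complex" where
  "iterated_partial bs f = foldr partial_deriv bs f"

definition smooth :: "('a::euclidean_space \<Rightarrow> complex) \<Rightarrow> bool" where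
  "smooth f \<longleftrightarrow> (\<forall>bs. set bs \<subseteq> Basis \<longrightarrow> (\<forall>x. iterated_partial bs f differentiable (at x)))"

definition support :: "('a::euclidean_space \<Rightarrow> complex) \<Rightarrow> 'a set" where
  "support f = closure {x. f x \<noteq> 0}"

definition test_function :: "('a::euclidean_space \<Rightarrow> complex) \<Rightarrow> bool" where
  "test_function f \<longleftrightarrow> smooth f \<and> compact (support f)"

definition schwartz :: "('a::euclidean_space \<Rightarrow> complex) set" where
  "schwartz = {f. smooth f \<and> (\<forall>k bs. set bs \<subseteq> Basis \<longrightarrow>
     bdd_above (range (\<lambda>x. norm x ^ k * norm (iterated_partial bs f x))))}"

definition schwartz_seminorm :: "nat \<Rightarrow> 'a::euclidean_space list \<Rightarrow> ('a \<Rightarrow> complex) \<Rightarrow> real" where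
  "schwartz_seminorm k bs f = (SUP x. norm x ^ k * norm (iterated_partial bs f x))"

definition schwartz_nbhd :: "('a::euclidean_space \<Rightarrow> complex) \<Rightarrow> nat \<Rightarrow> real \<Rightarrow> ('a \<Rightarrow> complex) set" where
  "schwartz_nbhd f N e = {g \<in> schwartz. \<forall>k bs. k \<le> N \<and> set bs \<subseteq> Basis \<and> length bs \<le> N \<longrightarrow>
     schwartz_seminorm k bs (\<lambda>x. g x - f x) < e}"

definition schwartz_topology :: "('a::euclidean_space \<Rightarrow> complex) topology" where
  "schwartz_topology =
     topology (\<lambda>U. U \<subseteq> schwartz \<and> (\<forall>f\<in>U. \<exists>N. \<exists>e>0. schwartz_nbhd f N e \<subseteq> U))"

lemma schwartz_nbhd_mono:
  assumes "M \<le> N" "e \<le> d"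
  shows "schwartz_nbhd f N e \<subseteq> schwartz_nbhd f M d"
proof
  fix g assume g: "g \<in> schwartz_nbhd f N e"
  have "schwartz_seminorm k bs (\<lambda>x. g x - f x) < d"
    if "k \<le> M" "set bs \<subseteq> Basis" "length bs \<le> M" for k bs
  proof -
    have "k \<le> N" "length bs \<le> N" using that assms(1) by linarith+
    then have "schwartz_seminorm k bs (\<lambda>x. g x - f x) < e"
      using g that(2) unfolding schwartz_nbhd_def by blast
    then show ?thesis using assms(2) by linarith
  qed
  then show "g \<in> schwartz_nbhd f M d"
    using g unfolding schwartz_nbhd_def by blast
qed

lemma openin_schwartz_topology:
  fixes U :: "('a::euclidean_space \<Rightarrow> complex) set"
  shows "openin schwartz_topology U \<longleftrightarrow>
     U \<subseteq> schwartz \<and> (\<forall>f\<in>U. \<exists>N. \<exists>e>0. schwartz_nbhd f N e \<subseteq> U)"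
proof -
  let ?L = "\<lambda>U::('a \<Rightarrow> complex) set.
    U \<subseteq> schwartz \<and> (\<forall>f\<in>U. \<exists>N. \<exists>e>0. schwartz_nbhd f N e \<subseteq> U)"
  have int: "?L (U \<inter> V)" if U: "?L U" and V: "?L V" for U V
  proof (intro conjI ballI)
    show "U \<inter> V \<subseteq> schwartz" using U by blast
    fix f assume f: "f \<in> U \<inter> V"
    obtain M d where 1: "d > 0" "schwartz_nbhd f M d \<subseteq> U" using U f by blast
    obtain N e where 2: "e > 0" "schwartz_nbhd f N e \<subseteq> V" using V f by blast
    have "schwartz_nbhd f (max M N) (min d e) \<subseteq> U \<inter> V"
      using 1(2) 2(2) schwartz_nbhd_mono[of M "max M N" "min d e" d f]
        schwartz_nbhd_mono[of N "max M N" "min d e" e f] by auto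
    moreover have "min d e > 0" using 1(1) 2(1) by simp
    ultimately show "\<exists>N. \<exists>e>0. schwartz_nbhd f N e \<subseteq> U \<inter> V" by blast
  qed
  have un: "?L (\<Union>K)" if K: "\<And>U. U \<in> K \<Longrightarrow> ?L U" for K
  proof (intro conjI ballI)
    show "\<Union>K \<subseteq> schwartz" using K by blast
    fix f assume "f \<in> \<Union>K"
    then obtain U where U: "U \<in> K" "f \<in> U" by blast
    then obtain N e where "e > 0" "schwartz_nbhd f N e \<subseteq> U" using K by blast
    then show "\<exists>N. \<exists>e>0. schwartz_nbhd f N e \<subseteq> \<Union>K" using U(1) by blast
  qed
  have "istopology ?L"
    unfolding istopology_def
    by (rule conjI, (rule allI impI)+, rule int, assumption, assumption,
        (rule allI impI)+, rule un, erule bspec, assumption)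
  then show ?thesis
    unfolding schwartz_topology_def by (rule topology_inverse'[THEN fun_cong])
qed

lemma topspace_schwartz_topology:
  "topspace schwartz_topology = (schwartz :: ('a::euclidean_space \<Rightarrow> complex) set)"
proof
  show "topspace schwartz_topology \<subseteq> (schwartz :: ('a \<Rightarrow> complex) set)"
    using openin_topspace[of "schwartz_topology :: ('a \<Rightarrow> complex) topology"]
    unfolding openin_schwartz_topology by (rule conjunct1)
  have "openin schwartz_topology (schwartz :: ('a \<Rightarrow> complex) set)"
    unfolding openin_schwartz_topology
  proof (intro conjI ballI)
    show "\<exists>N. \<exists>e>0. schwartz_nbhd f N e \<subseteq> schwartz" for f :: "'a \<Rightarrow> complex"
    proof (intro exI conjI)
      show "(0::real) < 1" by simp
      show "schwartz_nbhd f 0 1 \<subseteq> schwartz" unfolding schwartz_nbhd_def by blast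
    qed
  qed simp
  then show "(schwartz :: ('a \<Rightarrow> complex) set) \<subseteq> topspace schwartz_topology"
    by (rule openin_subset)
qed


section \<open>Tempered distributions\<close>

text \<open>Distributions are functionals on all functions; everything below depends only on their
  values on Schwartz functions.\<close>

type_synonym 'a distr = "('a \<Rightarrow> complex) \<Rightarrow> complex"

definition tempered :: "'a::euclidean_space distr \<Rightarrow> bool" where
  "tempered T \<longleftrightarrow>
     (\<forall>f\<in>schwartz. \<forall>g\<in>schwartz. \<forall>a b. T (\<lambda>x. a * f x + b * g x) = a * T f + b * T g) \<and>
     continuous_map schwartz_topology euclidean T"

definition given_by :: "'a::euclidean_space distr \<Rightarrow> ('a \<Rightarrow> complex) \<Rightarrow> bool" where
  "given_by T g \<longleftrightarrow> g \<in> borel_measurable borel \<and>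
     (\<forall>\<psi>\<in>schwartz. integrable lborel (\<lambda>x. g x * \<psi> x) \<and> T \<psi> = (LINT x|lborel. g x * \<psi> x))"

definition given_off_origin_by :: "'a::euclidean_space distr \<Rightarrow> ('a \<Rightarrow> complex) \<Rightarrow> bool" where
  "given_off_origin_by T g \<longleftrightarrow>
     (\<forall>\<psi>. test_function \<psi> \<and> 0 \<notin> support \<psi> \<longrightarrow>
        integrable lborel (\<lambda>x. g x * \<psi> x) \<and> T \<psi> = (LINT x|lborel. g x * \<psi> x))"

text \<open>Formally \<open>(T \<circ> A) \<psi> = T (\<psi> \<circ> inv A)\<close> for orthogonal \<open>A\<close>; as the orthogonal
  transformations form a group, the inverse may be dropped.\<close>

definition radial :: "'a::euclidean_space distr \<Rightarrow> bool" where
  "radial T \<longleftrightarrow> (\<forall>A. orthogonal_transformation A \<longrightarrow> (\<forall>\<psi>\<in>schwartz. T (\<psi> \<circ> A) = T \<psi>))"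

definition fourier :: "('a::euclidean_space \<Rightarrow> complex) \<Rightarrow> 'a \<Rightarrow> complex" where
  "fourier f \<xi> = of_real ((2 * pi) powr (- real DIM('a) / 2)) *
     (LINT x|lborel. exp (- (\<i> * of_real (x \<bullet> \<xi>))) * f x)"

definition inv_fourier :: "('a::euclidean_space \<Rightarrow> complex) \<Rightarrow> 'a \<Rightarrow> complex" where
  "inv_fourier f x = of_real ((2 * pi) powr (- real DIM('a) / 2)) *
     (LINT \<xi>|lborel. exp (\<i> * of_real (x \<bullet> \<xi>)) * f \<xi>)"

definition distr_fourier :: "'a::euclidean_space distr \<Rightarrow> 'a distr" where
  "distr_fourier T = (\<lambda>\<psi>. T (fourier \<psi>))"

definition distr_inv_fourier :: "'a::euclidean_space distr \<Rightarrow> 'a distr" where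
  "distr_inv_fourier T = (\<lambda>\<psi>. T (inv_fourier \<psi>))"

definition distr_mult :: "('a::euclidean_space \<Rightarrow> complex) \<Rightarrow> 'a distr \<Rightarrow> 'a distr" where
  "distr_mult m T = (\<lambda>\<psi>. T (\<lambda>\<xi>. m \<xi> * \<psi> \<xi>))"


section \<open>Besov and Lizorkin-Triebel spaces\<close>

definition dyadic_generator :: "('a::euclidean_space \<Rightarrow> complex) \<Rightarrow> bool" where
  "dyadic_generator \<phi>0 \<longleftrightarrow> test_function \<phi>0 \<and>
     (\<forall>\<xi>. norm \<xi> \<le> 1 \<longrightarrow> \<phi>0 \<xi> = 1) \<and> (\<forall>\<xi>. norm \<xi> \<ge> 3/2 \<longrightarrow> \<phi>0 \<xi> = 0)"

definition dyadic :: "('a::euclidean_space \<Rightarrow> complex) \<Rightarrow> nat \<Rightarrow> 'a \<Rightarrow> complex" where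
  "dyadic \<phi>0 j \<xi> = (if j = 0 then \<phi>0 \<xi>
     else \<phi>0 ((2 powr (- real j)) *\<^sub>R \<xi>) - \<phi>0 ((2 powr (- real j + 1)) *\<^sub>R \<xi>))"

definition dyadic_block :: "('a::euclidean_space \<Rightarrow> complex) \<Rightarrow> nat \<Rightarrow> 'a distr \<Rightarrow> 'a distr" where
  "dyadic_block \<phi>0 j T = distr_inv_fourier (distr_mult (dyadic \<phi>0 j) (distr_fourier T))"

text \<open>Only used with exponents \<open>r > 0\<close>.\<close>

definition ennpowr :: "ennreal \<Rightarrow> real \<Rightarrow> ennreal" where
  "ennpowr x r = (if x = \<infinity> then \<infinity> else ennreal (enn2real x powr r))"

definition Lp_qnorm :: "real \<Rightarrow> ('a::euclidean_space \<Rightarrow> ennreal) \<Rightarrow> ennreal" where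
  "Lp_qnorm p h = ennpowr (\<integral>\<^sup>+x. ennpowr (h x) p \<partial>lborel) (1 / p)"

definition lq_qnorm :: "ennreal \<Rightarrow> (nat \<Rightarrow> ennreal) \<Rightarrow> ennreal" where
  "lq_qnorm q a = (if q = \<infinity> then (SUP j. a j)
     else ennpowr (\<Sum>j. ennpowr (a j) (enn2real q)) (1 / enn2real q))"

text \<open>The quasi-norms are those of functions \<open>g j\<close> giving the (entire analytic) distributions
  \<open>dyadic_block \<phi>0 j f\<close>; such \<open>g j\<close> are unique up to null sets, which affect neither
  quasi-norm.\<close>

definition besov ::
  "('a::euclidean_space \<Rightarrow> complex) \<Rightarrow> real \<Rightarrow> real \<Rightarrow> ennreal \<Rightarrow> 'a distr set" where
  "besov \<phi>0 s p q = {f. tempered f \<and> (\<exists>g. (\<forall>j. given_by (dyadic_block \<phi>0 j f) (g j)) \<and>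
     lq_qnorm q (\<lambda>j. ennreal (2 powr (real j * s)) * Lp_qnorm p (\<lambda>x. ennreal (norm (g j x)))) < \<infinity>)}"

definition lizorkin_triebel ::
  "('a::euclidean_space \<Rightarrow> complex) \<Rightarrow> real \<Rightarrow> real \<Rightarrow> ennreal \<Rightarrow> 'a distr set" where
  "lizorkin_triebel \<phi>0 s p q = {f. tempered f \<and> (\<exists>g. (\<forall>j. given_by (dyadic_block \<phi>0 j f) (g j)) \<and>
     Lp_qnorm p (\<lambda>x. lq_qnorm q (\<lambda>j. ennreal (2 powr (real j * s) * norm (g j x)))) < \<infinity>)}"

definition radial_besov ::
  "('a::euclidean_space \<Rightarrow> complex) \<Rightarrow> real \<Rightarrow> real \<Rightarrow> ennreal \<Rightarrow> 'a distr set" where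
  "radial_besov \<phi>0 s p q = {f \<in> besov \<phi>0 s p q. radial f}"

definition radial_lizorkin_triebel ::
  "('a::euclidean_space \<Rightarrow> complex) \<Rightarrow> real \<Rightarrow> real \<Rightarrow> ennreal \<Rightarrow> 'a distr set" where
  "radial_lizorkin_triebel \<phi>0 s p q = {f \<in> lizorkin_triebel \<phi>0 s p q. radial f}"

text \<open>Off the origin, the distribution is given by a continuous function (necessarily unique
  there), and this function is uniformly continuous on \<open>{x. \<tau> \<le> norm x}\<close>.\<close>

definition uniformly_continuous_outside :: "real \<Rightarrow> 'a::euclidean_space distr \<Rightarrow> bool" where
  "uniformly_continuous_outside \<tau> f \<longleftrightarrow> (\<exists>g. continuous_on (- {0}) g \<and>
     given_off_origin_by f g \<and> uniformly_continuous_on {x. norm x \<ge> \<tau>} g)"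

end

theory Submission
  imports Defs "HOL-Probability.Characteristic_Functions" "HOL-Probability.Sinc_Integral"
begin

text \<open>Replace \<open>\<phi>0\<close> by a dyadic generator \<open>\<Phi>\<close> that is a function of \<open>norm \<xi>\<close>.  The
  blocks \<open>F j\<close> of the radial distribution \<open>f\<close> with respect to \<open>\<Phi>\<close> are radial, bounded and
  uniformly continuous, and \<open>f\<close> is the limit of their partial sums, so it suffices that
  \<open>\<Sum>j. norm (F j x)\<close> converges uniformly for \<open>norm x \<ge> t\<close>.  Each block is a convolution
  of \<open>v j\<close>, the sum of the given blocks with indices near \<open>j\<close>, with a kernel concentrated at
  the scale \<open>1 / 2^j\<close>.  By a maximal estimate of Peetre type \<open>norm (F j x) powr p\<close> is bounded by
  a mean of \<open>norm (v j) powr p\<close> at that scale around any point of the sphere through \<open>x\<close>, and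
  averaging over a shell of width about \<open>1 / 2^j\<close> gains a factor \<open>2^j\<close>: the supremum of
  \<open>norm (F j)\<close> off a ball is at most a constant times \<open>2 powr (j / p)\<close> times the \<open>p\<close>-norm of
  \<open>v j\<close>.  This sums in the Besov case and, if \<open>s > 1 / p\<close>, in the Lizorkin-Triebel case.

  For \<open>s = 1 / p\<close> and \<open>p \<le> 1\<close> in the Lizorkin-Triebel scale let \<open>G\<close> be the integrable
  function \<open>SUP j. 2^j * norm (g j) powr p\<close>.  In the maximal estimate a shell of width a small
  multiple of \<open>1 / 2^j\<close> around the sphere through \<open>x\<close> may be left out of the mean, because its share
  can be absorbed into the left-hand side.  The remaining weights of \<open>G z\<close> have a sum over \<open>j\<close>
  that is bounded uniformly in \<open>x\<close> and \<open>z\<close>, and the tails of the sum are small outside a thin shell,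
  on which the integral of \<open>G\<close> is uniformly small.\<close>

section \<open>Iterated partial derivatives\<close>

text \<open>The given \<open>\<phi>0\<close> need not be radial, and then neither need the blocks of
  a radial \<open>f\<close> be; hence the change of generator, with \<open>v j\<close> carrying the
  bounds on the given blocks \<open>g j\<close> over to the \<open>F j\<close>. The
  \<open>g j\<close> are only known to be integrable against every Schwartz function, so a
  polynomial growth bound has to be extracted before Fubini applies to them. At
  \<open>s = 1 / p\<close> in the Lizorkin-Triebel scale the obstacle is the weight
  \<open>wt 1 (2^j * (norm z - r))\<close> left by the averaging over a shell. For fixed
  \<open>z\<close> its sum over \<open>j\<close> is of the order of the logarithm of
  \<open>1 / \<bar>norm z - r\<bar>\<close> near the sphere and infinite on it, which an integrable
  \<open>G\<close> does not compensate. Removing the shell of relative scale \<open>c / 2^j\<close>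
  keeps only those \<open>j\<close> with \<open>c \<le> 2^j * \<bar>norm z - r\<bar>\<close>, a
  geometric series. The absorption that permits the removal uses \<open>p \<le> 1\<close>, and so
  does the passage from \<open>p\<close>-th powers to the sum itself:
  \<open>t \<le> t powr p\<close> for \<open>0 \<le> t \<le> 1\<close>.\<close>

lemma iterated_partial_Nil [simp]: "iterated_partial [] f = f"
  by (simp add: iterated_partial_def)

lemma iterated_partial_Cons: "iterated_partial (b # bs) f = partial_deriv b (iterated_partial bs f)"
  by (simp add: iterated_partial_def)

lemma iterated_partial_append: "iterated_partial (as @ bs) f = iterated_partial as (iterated_partial bs f)"
  by (simp add: iterated_partial_def)

lemma iterated_partial_snoc: "iterated_partial (bs @ [b]) f = iterated_partial bs (partial_deriv b f)"
  by (simp add: iterated_partial_append iterated_partial_Cons)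

lemma frechet_derivative_worksI:
  "f differentiable (at x) \<Longrightarrow> (f has_derivative frechet_derivative f (at x)) (at x)"
  using frechet_derivative_works by blast

lemma partial_deriv_eqI: "(f has_derivative D) (at x) \<Longrightarrow> partial_deriv b f x = D b"
  unfolding partial_deriv_def using frechet_derivative_at[of f D x] by simp

text \<open>The derivative is linear, so expanding \<open>h\<close> in the basis suffices. In this
  form bounds on the finitely many partial derivatives become bounds on the operator norm and hence
  on increments.\<close>

lemma has_derivative_partial_deriv:
  assumes "f differentiable (at x)"
  shows "(f has_derivative (\<lambda>h. \<Sum>b\<in>Basis. (h \<bullet> b) *\<^sub>R partial_deriv b f x)) (at x)"
proof -
  have D: "(f has_derivative frechet_derivative f (at x)) (at x)"
    using assms frechet_derivative_works by blast
  have lin: "linear (frechet_derivative f (at x))"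
    using D has_derivative_linear by blast
  have "frechet_derivative f (at x) h = (\<Sum>b\<in>Basis. (h \<bullet> b) *\<^sub>R partial_deriv b f x)" for h
  proof -
    have "frechet_derivative f (at x) (\<Sum>b\<in>Basis. (h \<bullet> b) *\<^sub>R b) = (\<Sum>b\<in>Basis. (h \<bullet> b) *\<^sub>R partial_deriv b f x)"
      unfolding partial_deriv_def by (simp add: linear_sum[OF lin] linear_scale[OF lin])
    then show ?thesis by (simp add: euclidean_representation)
  qed
  then have "frechet_derivative f (at x) = (\<lambda>h. \<Sum>b\<in>Basis. (h \<bullet> b) *\<^sub>R partial_deriv b f x)" by blast
  then show ?thesis using D by simp
qed

lemma smooth_imp_differentiable: "smooth f \<Longrightarrow> f differentiable (at x)"
  unfolding smooth_def by (drule spec[of _ "[]"]) simp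

lemma smooth_partial_deriv: "smooth f \<Longrightarrow> b \<in> Basis \<Longrightarrow> smooth (partial_deriv b f)"
  unfolding smooth_def
proof (intro allI impI)
  fix bs :: "'a list" and x
  assume *: "\<forall>bs. set bs \<subseteq> Basis \<longrightarrow> (\<forall>x. iterated_partial bs f differentiable at x)" "b \<in> Basis" "set bs \<subseteq> Basis"
  then have "set (bs @ [b]) \<subseteq> Basis" by simp
  with *(1) have "iterated_partial (bs @ [b]) f differentiable at x" by blast
  then show "iterated_partial bs (partial_deriv b f) differentiable at x"
    by (simp only: iterated_partial_snoc)
qed

lemma smooth_iterated_partial: "smooth f \<Longrightarrow> set bs \<subseteq> Basis \<Longrightarrow> smooth (iterated_partial bs f)"
  by (induction bs) (auto simp: iterated_partial_Cons intro: smooth_partial_deriv)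

lemma smooth_imp_continuous: "smooth f \<Longrightarrow> continuous_on S f"
  by (meson continuous_at_imp_continuous_on differentiable_imp_continuous_within smooth_imp_differentiable)

lemma smooth_imp_measurable [measurable_dest]: "smooth f \<Longrightarrow> f \<in> borel_measurable borel"
  by (intro borel_measurable_continuous_onI smooth_imp_continuous)

text \<open>Coinduction over iterated derivatives: a class closed under partial derivatives contains
  all of them. The second conclusion keeps the membership, so a decay estimate proved once for the
  class holds for every derivative.\<close>

lemma smooth_coinduct:
  assumes "f \<in> X"
    and "\<And>f x. f \<in> X \<Longrightarrow> f differentiable (at x)"
    and "\<And>f b. f \<in> X \<Longrightarrow> b \<in> Basis \<Longrightarrow> partial_deriv b f \<in> X"
  shows "smooth f" and "\<And>bs. set bs \<subseteq> Basis \<Longrightarrow> iterated_partial bs f \<in> X"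
proof -
  show *: "iterated_partial bs f \<in> X" if "set bs \<subseteq> Basis" for bs
    using that by (induction bs) (auto simp: iterated_partial_Cons assms)
  show "smooth f" unfolding smooth_def using * assms(2) by blast
qed

section \<open>Smoothness of sums, products and compositions\<close>

lemma partial_deriv_add:
  assumes "f differentiable (at x)" "g differentiable (at x)"
  shows "partial_deriv b (\<lambda>x. f x + g x) x = partial_deriv b f x + partial_deriv b g x"
proof -
  have "((\<lambda>x. f x + g x) has_derivative (\<lambda>h. frechet_derivative f (at x) h + frechet_derivative g (at x) h)) (at x)"
    using assms by (intro has_derivative_add) (simp_all only: frechet_derivative_worksI)
  from partial_deriv_eqI[OF this] show ?thesis by (simp add: partial_deriv_def)
qed

lemma partial_deriv_mult:
  assumes "f differentiable (at x)" "g differentiable (at x)"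
  shows "partial_deriv b (\<lambda>x. f x * g x) x = partial_deriv b f x * g x + f x * partial_deriv b g x"
proof -
  have "((\<lambda>x. f x * g x) has_derivative (\<lambda>h. f x * frechet_derivative g (at x) h + frechet_derivative f (at x) h * g x)) (at x)"
    using assms by (intro has_derivative_mult) (simp_all only: frechet_derivative_worksI)
  from partial_deriv_eqI[OF this] show ?thesis by (simp add: partial_deriv_def)
qed

lemma partial_deriv_const: "partial_deriv b (\<lambda>x. c) = (\<lambda>x. 0)"
  by (rule ext) (rule partial_deriv_eqI[OF has_derivative_const])

lemma partial_deriv_compose_bounded_linear:
  assumes "f differentiable (at x)" "bounded_linear L"
  shows "partial_deriv b (\<lambda>x. L (f x)) x = L (partial_deriv b f x)"
proof -
  have "((\<lambda>x. L (f x)) has_derivative (\<lambda>h. L (frechet_derivative f (at x) h))) (at x)"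
    by (rule bounded_linear.has_derivative[OF assms(2) frechet_derivative_worksI[OF assms(1)]])
  from partial_deriv_eqI[OF this] show ?thesis by (simp add: partial_deriv_def)
qed

lemma iterated_partial_add:
  assumes "smooth f" "smooth g" "set bs \<subseteq> Basis"
  shows "iterated_partial bs (\<lambda>x. f x + g x) = (\<lambda>x. iterated_partial bs f x + iterated_partial bs g x)"
  using assms(3)
proof (induction bs)
  case (Cons b bs)
  show ?case using Cons
    by (simp add: iterated_partial_Cons)
      (auto simp: fun_eq_iff intro!: partial_deriv_add smooth_imp_differentiable smooth_iterated_partial assms(1,2))
qed simp

lemma smooth_add: "smooth f \<Longrightarrow> smooth g \<Longrightarrow> smooth (\<lambda>x. f x + g x)"
  unfolding smooth_def[of "\<lambda>x. f x + g x"]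
proof (intro allI impI)
  fix bs :: "'a list" and x
  assume *: "smooth f" "smooth g" "set bs \<subseteq> Basis"
  then show "iterated_partial bs (\<lambda>x. f x + g x) differentiable at x"
    unfolding iterated_partial_add[OF *] by (intro differentiable_add smooth_imp_differentiable smooth_iterated_partial)
qed

lemma iterated_partial_compose_bounded_linear:
  assumes "smooth f" "bounded_linear L" "set bs \<subseteq> Basis"
  shows "iterated_partial bs (\<lambda>x. L (f x)) = (\<lambda>x. L (iterated_partial bs f x))"
  using assms(3)
proof (induction bs)
  case (Cons b bs)
  show ?case using Cons
    by (simp add: iterated_partial_Cons)
      (auto simp: fun_eq_iff intro!: partial_deriv_compose_bounded_linear smooth_imp_differentiable smooth_iterated_partial assms(1,2))
qed simp

lemma smooth_compose_bounded_linear: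
  assumes "smooth f" "bounded_linear L"
  shows "smooth (\<lambda>x. L (f x))"
  unfolding smooth_def[of "\<lambda>x. L (f x)"]
proof (intro allI impI)
  fix bs :: "'a list" and x assume "set bs \<subseteq> Basis"
  then have "iterated_partial bs f differentiable (at x)"
    using assms(1) smooth_def by blast
  moreover have "L differentiable (at y)" for y
    using assms(2) bounded_linear_imp_differentiable by blast
  ultimately show "iterated_partial bs (\<lambda>x. L (f x)) differentiable (at x)"
    using differentiable_chain_at[of "iterated_partial bs f" x L]
    by (simp add: iterated_partial_compose_bounded_linear[OF assms \<open>set bs \<subseteq> Basis\<close>] o_def)
qed

lemma smooth_cmult: "smooth f \<Longrightarrow> smooth (\<lambda>x. c * f x)"
  by (rule smooth_compose_bounded_linear) (auto intro: bounded_linear_mult_right)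

lemma smooth_diff: "smooth f \<Longrightarrow> smooth g \<Longrightarrow> smooth (\<lambda>x. f x - g x)"
  using smooth_add[of f "\<lambda>x. -1 * g x"] smooth_cmult[of g "-1"] by simp

lemma iterated_partial_diff:
  assumes "smooth f" "smooth g" "set bs \<subseteq> Basis"
  shows "iterated_partial bs (\<lambda>x. f x - g x) = (\<lambda>x. iterated_partial bs f x - iterated_partial bs g x)"
  using iterated_partial_add[OF assms(1) smooth_cmult[OF assms(2), of "-1"] assms(3)]
    iterated_partial_compose_bounded_linear[OF assms(2) bounded_linear_mult_right[of "-1"] assms(3)]
  by simp

lemma smooth_cnj: "smooth f \<Longrightarrow> smooth (\<lambda>x. cnj (f x))"
  by (rule smooth_compose_bounded_linear) (auto intro: bounded_linear_cnj)

lemma smooth_const: "smooth (\<lambda>x. c)"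
  by (rule smooth_coinduct(1)[where X="range (\<lambda>c x. c)"]) (auto simp: partial_deriv_const)

text \<open>The product and chain rules turn one function into a sum of functions of the same shape;
  closing the shape under sums avoids indexing these sums explicitly.\<close>

inductive_set sum_closure :: "('a \<Rightarrow> complex) set \<Rightarrow> ('a \<Rightarrow> complex) set" for X where
  base: "f \<in> X \<Longrightarrow> f \<in> sum_closure X"
| add: "f \<in> sum_closure X \<Longrightarrow> g \<in> sum_closure X \<Longrightarrow> (\<lambda>x. f x + g x) \<in> sum_closure X"

lemma smooth_coinduct_sums:
  assumes f: "f \<in> X"
    and d: "\<And>f x. f \<in> X \<Longrightarrow> f differentiable (at x)"
    and c: "\<And>f b. f \<in> X \<Longrightarrow> b \<in> Basis \<Longrightarrow> partial_deriv b f \<in> sum_closure X"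
  shows "smooth f"
proof (rule smooth_coinduct(1)[where X="sum_closure X"])
  show "f \<in> sum_closure X" using f by (rule base)
  show D: "f differentiable (at x)" if "f \<in> sum_closure X" for f x
    using that by induction (auto intro: d differentiable_add)
  show "partial_deriv b f \<in> sum_closure X" if "f \<in> sum_closure X" "b \<in> Basis" for f b
    using that
  proof induction
    case (add f g)
    have "partial_deriv b (\<lambda>x. f x + g x) = (\<lambda>x. partial_deriv b f x + partial_deriv b g x)"
      using add D by (auto simp: fun_eq_iff intro!: partial_deriv_add)
    with add show ?case by (auto intro: sum_closure.add)
  qed (auto intro: c)
qed

lemma smooth_mult:
  assumes "smooth f" "smooth g"
  shows "smooth (\<lambda>x. f x * g x)"
proof (rule smooth_coinduct_sums)
  let ?X = "{\<lambda>x. f x * g x |f g. smooth f \<and> smooth g}"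
  show "(\<lambda>x. f x * g x) \<in> ?X" using assms by blast
  fix h assume "h \<in> ?X"
  then obtain f g where h: "h = (\<lambda>x. f x * g x)" "smooth f" "smooth g" by blast
  show "h differentiable (at x)" for x
    unfolding h(1) by (rule differentiable_mult; rule smooth_imp_differentiable, fact)
  show "partial_deriv b h \<in> sum_closure ?X" if "b \<in> Basis" for b
  proof -
    have "partial_deriv b h = (\<lambda>x. partial_deriv b f x * g x + f x * partial_deriv b g x)"
      unfolding h(1) using h by (auto simp: fun_eq_iff intro!: partial_deriv_mult smooth_imp_differentiable)
    also have "\<dots> \<in> sum_closure ?X"
      using h(2,3) that smooth_partial_deriv
      by (intro sum_closure.add sum_closure.base CollectI; blast)
    finally show ?thesis .
  qed
qed

lemma smooth_scale:
  assumes "smooth f"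
  shows "smooth (\<lambda>x. f (c *\<^sub>R x))"
proof (rule smooth_coinduct(1))
  \<comment> \<open>The factor \<open>k\<close> collects the powers of \<open>c\<close> that the
    chain rule produces.\<close>
  let ?X = "{\<lambda>x. k * f (c *\<^sub>R x) |f k. smooth f}"
  show "(\<lambda>x. f (c *\<^sub>R x)) \<in> ?X" using assms by (auto intro!: exI[of _ f] exI[of _ 1])
  fix h assume "h \<in> ?X"
  then obtain f k where h: "h = (\<lambda>x. k * f (c *\<^sub>R x))" "smooth f" by blast
  have D: "(h has_derivative (\<lambda>v. k * frechet_derivative f (at (c *\<^sub>R x)) (c *\<^sub>R v))) (at x)" for x
  proof -
    have "(f has_derivative frechet_derivative f (at (c *\<^sub>R x))) (at (c *\<^sub>R x))"
      using smooth_imp_differentiable[OF h(2)] frechet_derivative_works by blast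
    moreover have "((\<lambda>x. c *\<^sub>R x) has_derivative (\<lambda>v. c *\<^sub>R v)) (at x)"
      by (auto intro!: derivative_eq_intros)
    ultimately have "((\<lambda>x. f (c *\<^sub>R x)) has_derivative (\<lambda>v. frechet_derivative f (at (c *\<^sub>R x)) (c *\<^sub>R v))) (at x)"
      using has_derivative_compose by blast
    then show ?thesis unfolding h(1) by (rule has_derivative_mult_right)
  qed
  then show "h differentiable (at x)" for x unfolding differentiable_def by blast
  show "partial_deriv b h \<in> ?X" if b: "b \<in> Basis" for b
  proof -
    have "partial_deriv b h = (\<lambda>x. (k * c) * partial_deriv b f (c *\<^sub>R x))"
    proof
      fix x
      have lin: "linear (frechet_derivative f (at (c *\<^sub>R x)))"
        using smooth_imp_differentiable[OF h(2)] linear_frechet_derivative by blast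
      show "partial_deriv b h x = (k * c) * partial_deriv b f (c *\<^sub>R x)"
        using partial_deriv_eqI[OF D, of b x] linear_scale[OF lin]
        by (simp add: partial_deriv_def scaleR_conv_of_real)
    qed
    then show ?thesis using smooth_partial_deriv[OF h(2) b] by blast
  qed
qed

lemma smooth_bounded_linear:
  assumes L: "bounded_linear L"
  shows "smooth L"
proof -
  have D: "(L has_derivative L) (at x)" for x using L by (simp add: bounded_linear_imp_has_derivative)
  have "partial_deriv b L = (\<lambda>x. L b)" for b
    by (auto simp: fun_eq_iff intro!: partial_deriv_eqI D)
  moreover have "(\<lambda>x. c) differentiable (at x)" for c :: complex and x :: 'a by simp
  moreover have "L differentiable (at x)" for x using D differentiable_def by blast
  ultimately show ?thesis
    by (intro smooth_coinduct(1)[where X="insert L (range (\<lambda>c x. c))"])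
      (auto simp: partial_deriv_const)
qed

text \<open>Passing through the polynomial \<open>x \<bullet> x\<close> keeps smoothness at the
  origin, where \<open>norm\<close> itself is not differentiable. Differentiation changes the smooth
  factor \<open>g\<close> or replaces \<open>f\<close> by its derivative along \<open>e\<close>, so
  products of this shape form a class to which \<open>smooth_coinduct_sums\<close> applies.\<close>

lemma smooth_radial_compose:
  assumes f: "smooth f" and e: "e \<in> Basis"
  shows "smooth (\<lambda>x. f ((x \<bullet> x) *\<^sub>R e))"
proof (rule smooth_coinduct_sums)
  let ?X = "{\<lambda>x. g x * f ((x \<bullet> x) *\<^sub>R e) |f g. smooth f \<and> smooth g}"
  show "(\<lambda>x. f ((x \<bullet> x) *\<^sub>R e)) \<in> ?X"
    using f smooth_const[of 1] by (intro CollectI exI[of _ f] exI[of _ "\<lambda>x. 1"]) auto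
  fix h assume "h \<in> ?X"
  then obtain f g where h: "h = (\<lambda>x. g x * f ((x \<bullet> x) *\<^sub>R e))" "smooth f" "smooth g" by blast
  let ?F = "\<lambda>x. f ((x \<bullet> x) *\<^sub>R e)"
  have DF: "(?F has_derivative (\<lambda>v. frechet_derivative f (at ((x \<bullet> x) *\<^sub>R e)) ((2 * (v \<bullet> x)) *\<^sub>R e))) (at x)" for x
  proof -
    have "(f has_derivative frechet_derivative f (at ((x \<bullet> x) *\<^sub>R e))) (at ((x \<bullet> x) *\<^sub>R e))"
      using smooth_imp_differentiable[OF h(2)] frechet_derivative_works by blast
    moreover have "((\<lambda>x. (x \<bullet> x) *\<^sub>R e) has_derivative (\<lambda>v. (2 * (v \<bullet> x)) *\<^sub>R e)) (at x)"
      by (auto intro!: derivative_eq_intros simp: inner_commute)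
    ultimately show ?thesis using has_derivative_compose by blast
  qed
  have dF: "?F differentiable (at x)" for x using DF unfolding differentiable_def by blast
  show "h differentiable (at x)" for x
    unfolding h(1) by (rule differentiable_mult[OF smooth_imp_differentiable[OF h(3)] dF])
  show "partial_deriv b h \<in> sum_closure ?X" if b: "b \<in> Basis" for b
  proof -
    have pF: "partial_deriv b ?F x = of_real (2 * (b \<bullet> x)) * partial_deriv e f ((x \<bullet> x) *\<^sub>R e)" for x
    proof -
      have lin: "linear (frechet_derivative f (at ((x \<bullet> x) *\<^sub>R e)))"
        using smooth_imp_differentiable[OF h(2)] linear_frechet_derivative by blast
      show ?thesis
        using partial_deriv_eqI[OF DF, of b x] linear_scale[OF lin]
        by (simp add: partial_deriv_def scaleR_conv_of_real)
    qed
    have "partial_deriv b h x = partial_deriv b g x * ?F x + g x * partial_deriv b ?F x" for x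
      unfolding h(1) by (rule partial_deriv_mult) (use h dF in \<open>auto intro: smooth_imp_differentiable\<close>)
    then have "partial_deriv b h = (\<lambda>x. partial_deriv b g x * ?F x +
        (g x * of_real (2 * (b \<bullet> x))) * partial_deriv e f ((x \<bullet> x) *\<^sub>R e))"
      by (auto simp: pF fun_eq_iff algebra_simps)
    moreover have "(\<lambda>x. partial_deriv b g x * ?F x) \<in> sum_closure ?X"
      using smooth_partial_deriv[OF h(3) b] h(2) by (intro base) blast
    moreover have "smooth (\<lambda>x. g x * of_real (2 * (b \<bullet> x)))"
      by (rule smooth_mult[OF h(3) smooth_bounded_linear])
        (auto intro!: bounded_linear_compose[OF bounded_linear_of_real] bounded_linear_mult_right[THEN bounded_linear_compose] bounded_linear_inner_right)
    then have "(\<lambda>x. (g x * of_real (2 * (b \<bullet> x))) * partial_deriv e f ((x \<bullet> x) *\<^sub>R e)) \<in> sum_closure ?X"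
      using smooth_partial_deriv[OF h(2) e]
      by (intro base CollectI exI[of _ "partial_deriv e f"] exI[of _ "\<lambda>x. g x * of_real (2 * (b \<bullet> x))"]) auto
    ultimately show ?thesis by (auto intro: sum_closure.add)
  qed
qed

section \<open>Rapidly decreasing functions and convolution\<close>

lemma lborel_affine_nn_integral:
  fixes t :: "'a::euclidean_space"
  assumes [measurable]: "f \<in> borel_measurable borel" and c: "c \<noteq> 0"
  shows "(\<integral>\<^sup>+x. f x \<partial>lborel) = ennreal (\<bar>c\<bar>^DIM('a)) * (\<integral>\<^sup>+x. f (t + c *\<^sub>R x) \<partial>lborel)"
  by (subst lborel_affine[OF c, of t])
    (simp add: nn_integral_density nn_integral_distr nn_integral_cmult)

lemma lborel_affine_integrable:
  fixes t :: "'a::euclidean_space" and f :: "'a \<Rightarrow> 'b::{banach, second_countable_topology}"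
  assumes f: "integrable lborel f" and c: "c \<noteq> 0"
  shows "integrable lborel (\<lambda>x. f (t + c *\<^sub>R x))"
proof -
  have [measurable]: "f \<in> borel_measurable borel" using f by simp
  have "integrable (density (distr lborel borel (\<lambda>x. t + c *\<^sub>R x)) (\<lambda>_. ennreal (\<bar>c\<bar>^DIM('a)))) f"
    using f by (subst (asm) lborel_affine[OF c, of t]) simp
  then have "integrable lborel (\<lambda>x. \<bar>c\<bar>^DIM('a) *\<^sub>R f (t + c *\<^sub>R x))"
    by (simp add: integrable_density integrable_distr_eq)
  from integrable_scaleR_right[OF this, of "1 / \<bar>c\<bar>^DIM('a)"] show ?thesis using c by simp
qed

lemma lborel_affine_integral:
  fixes t :: "'a::euclidean_space" and f :: "'a \<Rightarrow> 'b::{banach, second_countable_topology}"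
  assumes [measurable]: "f \<in> borel_measurable borel" and c: "c \<noteq> 0"
  shows "(\<integral>x. f x \<partial>lborel) = (\<bar>c\<bar>^DIM('a)) *\<^sub>R (\<integral>x. f (t + c *\<^sub>R x) \<partial>lborel)"
  by (subst lborel_affine[OF c, of t])
    (simp add: integral_density integral_distr)

lemma lborel_integral_shift_reflect:
  fixes t :: "'a::euclidean_space" and f :: "'a \<Rightarrow> 'b::{banach, second_countable_topology}"
  assumes [measurable]: "f \<in> borel_measurable borel"
  shows "(\<integral>x. f (t - x) \<partial>lborel) = (\<integral>x. f x \<partial>lborel)"
    and "(\<integral>x. f (x - t) \<partial>lborel) = (\<integral>x. f x \<partial>lborel)"
  using lborel_affine_integral[OF assms, of "-1" t] lborel_affine_integral[OF assms, of 1 "-t"] by simp_all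

lemma lborel_integrable_shift_reflect:
  fixes t :: "'a::euclidean_space" and f :: "'a \<Rightarrow> 'b::{banach, second_countable_topology}"
  assumes "integrable lborel f"
  shows "integrable lborel (\<lambda>x. f (t - x))" and "integrable lborel (\<lambda>x. f (x - t))"
  using lborel_affine_integrable[OF assms, of "-1" t] lborel_affine_integrable[OF assms, of 1 "-t"] by simp_all

text \<open>\<open>lborel\<close> is the image of the product measure under the coordinate map, so
  both claims transfer from there. They serve for the integrable majorant in
  \<open>integrable_wt\<close> and for the Gaussian.\<close>

lemma lborel_prod_integral:
  fixes f :: "'a::euclidean_space \<Rightarrow> real \<Rightarrow> complex"
  assumes "\<And>b. b \<in> Basis \<Longrightarrow> integrable lborel (f b)"
  shows "integrable lborel (\<lambda>x. \<Prod>b\<in>Basis. f b (x \<bullet> b))"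
    and "(\<integral>x. (\<Prod>b\<in>Basis. f b (x \<bullet> b)) \<partial>lborel) = (\<Prod>b\<in>Basis. \<integral>x. f b x \<partial>lborel)"
proof -
  interpret product_sigma_finite "\<lambda>_::'a. lborel :: real measure"
    by (simp add: product_sigma_finite_def lborel.sigma_finite_measure_axioms)
  have [measurable]: "f b \<in> borel_measurable borel" if "b \<in> Basis" for b using assms[OF that] by simp
  have meas: "(\<lambda>x::'a. \<Prod>b\<in>Basis. f b (x \<bullet> b)) \<in> borel_measurable borel"
    by measurable
  have T: "(\<lambda>f. \<Sum>b\<in>Basis. f b *\<^sub>R b) \<in> (\<Pi>\<^sub>M b\<in>(Basis::'a set). lborel) \<rightarrow>\<^sub>M borel"
    by measurable
  have eq: "(\<Prod>b\<in>Basis. f b ((\<Sum>b\<in>Basis. x b *\<^sub>R b) \<bullet> b)) = (\<Prod>b\<in>Basis. f b (x b))" for x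
    by (rule prod.cong) simp_all
  show "integrable lborel (\<lambda>x. \<Prod>b\<in>Basis. f b (x \<bullet> b))"
    by (subst lborel_eq, subst integrable_distr_eq[OF T]) (use meas assms in \<open>auto simp: eq intro!: product_integrable_prod\<close>)
  show "(\<integral>x. (\<Prod>b\<in>Basis. f b (x \<bullet> b)) \<partial>lborel) = (\<Prod>b\<in>Basis. \<integral>x. f b x \<partial>lborel)"
    by (subst lborel_eq, subst integral_distr[OF T]) (use meas assms in \<open>auto simp: eq intro!: product_integral_prod\<close>)
qed

section \<open>Polynomial weights, rapid decrease and Schwartz functions\<close>

definition wt :: "nat \<Rightarrow> 'a::real_normed_vector \<Rightarrow> real" where
  "wt n x = 1 / (1 + norm x) ^ n"

lemma wt_pos [simp]: "wt n x > 0" and wt_nonneg [simp]: "wt n x \<ge> 0" and wt_nz [simp]: "wt n x \<noteq> 0"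
  by (auto simp: wt_def add_pos_nonneg intro!: divide_pos_pos zero_less_power add_nonneg_eq_0_iff)
    (smt (verit) norm_ge_zero)

lemma wt_add: "wt (m + n) x = wt m x * wt n x"
  by (simp add: wt_def power_add)

lemma wt_0 [simp]: "wt 0 x = 1"
  by (simp add: wt_def)

lemma wt_le_1: "wt n x \<le> 1"
  by (auto simp: wt_def intro!: divide_le_eq_1_pos[THEN iffD2] add_pos_nonneg zero_less_power one_le_power)

lemma wt_mono: "m \<le> n \<Longrightarrow> wt n x \<le> wt m x"
  using wt_le_1[of "n - m" x] mult_left_mono[of "wt (n-m) x" 1 "wt m x"] by (simp add: wt_add[symmetric])

lemma wt_antimono_norm: "norm x \<le> norm y \<Longrightarrow> wt n y \<le> wt n x"
  unfolding wt_def by (intro divide_left_mono power_mono mult_pos_pos zero_less_power) (auto simp: add_pos_nonneg)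

lemma wt_minus [simp]: "wt n (- x) = wt n x" and wt_commute: "wt n (x - y) = wt n (y - x)"
  by (auto simp: wt_def norm_minus_commute)

lemma wt_mult_power [simp]: "wt n x * (1 + norm x)^n = 1" "(1 + norm x)^n * wt n x = 1"
  using wt_nz[of n x] by (auto simp: wt_def)

text \<open>Peetre's inequality: \<open>1 + norm x \<le> (1 + norm (x + y)) * (1 + norm y)\<close>,
  raised to the power \<open>n\<close>. It trades a translation for a polynomial factor, and most
  estimates below rest on it.\<close>

lemma wt_shift: "wt n (x + y) \<le> (1 + norm y)^n * wt n x"
proof -
  have "1 + norm x \<le> (1 + norm (x + y)) * (1 + norm y)"
    using norm_triangle_ineq4[of "x + y" y]
    by (simp add: algebra_simps) (smt (verit) mult_nonneg_nonneg norm_ge_zero)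
  then have "(1 + norm x)^n \<le> (1 + norm (x + y))^n * (1 + norm y)^n"
    by (simp add: power_mono power_mult_distrib[symmetric])
  then have "wt n x * ((1 + norm x)^n * wt n (x+y)) \<le> wt n x * (((1 + norm (x + y))^n * (1 + norm y)^n) * wt n (x+y))"
    by (intro mult_left_mono mult_right_mono) auto
  then have "(wt n x * (1 + norm x)^n) * wt n (x+y) \<le> wt n x * ((1 + norm y)^n * (wt n (x+y) * (1 + norm (x + y))^n))"
    by (simp only: mult_ac)
  then show ?thesis by (simp add: mult.commute)
qed

lemma wt_measurable [measurable]: "wt n \<in> borel_measurable borel"
  unfolding wt_def[abs_def] by measurable

text \<open>The exponent provides a factor \<open>(1 + norm x)^2\<close> for each coordinate, and
  each of these dominates \<open>1 + (x \<bullet> b)^2\<close>. The majorant is therefore a product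
  of integrable functions of one variable.\<close>

lemma integrable_wt:
  assumes "n \<ge> 2 * DIM('a)"
  shows "integrable lborel (wt n :: 'a::euclidean_space \<Rightarrow> real)"
proof -
  have "integrable lborel (\<lambda>x::real. inverse (1 + x^2))"
    using integrable_inverse_1_plus_square by (simp add: set_integrable_def)
  from integrable_of_real[OF this, where 'a=complex]
  have i1: "integrable lborel (\<lambda>x::real. complex_of_real (inverse (1 + x^2)))" .
  have "integrable lborel (\<lambda>x::'a. \<Prod>b\<in>Basis. complex_of_real (inverse (1 + (x \<bullet> b)^2)))"
    by (rule lborel_prod_integral) (rule i1)
  then show ?thesis
  proof (rule Bochner_Integration.integrable_bound)
    show "AE x in lborel. norm (wt n x) \<le> norm (\<Prod>b\<in>Basis. complex_of_real (inverse (1 + ((x::'a) \<bullet> b)^2)))"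
    proof (rule AE_I2)
      fix x :: 'a
      have "wt n x \<le> wt (2 * DIM('a)) x" by (rule wt_mono) (rule assms)
      also have "\<dots> = (\<Prod>b\<in>(Basis::'a set). wt 2 x)" by (simp add: wt_def power_mult power_one_over)
      also have "\<dots> \<le> (\<Prod>b\<in>Basis. inverse (1 + (x \<bullet> b)^2))"
      proof (rule prod_mono)
        fix b :: 'a assume b: "b \<in> Basis"
        have "(x \<bullet> b)^2 \<le> (norm x)^2" using Basis_le_norm[OF b, of x]
          by (metis abs_ge_zero power2_abs power_mono)
        then have "1 + (x \<bullet> b)^2 \<le> (1 + norm x)^2" using norm_ge_zero[of x] by (simp add: power2_sum del: norm_ge_zero)
        then show "0 \<le> wt 2 x \<and> wt 2 x \<le> inverse (1 + (x \<bullet> b)^2)"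
          by (auto simp: wt_def inverse_eq_divide intro!: divide_left_mono mult_pos_pos add_pos_nonneg zero_less_power)
      qed
      also have "\<dots> = norm (\<Prod>b\<in>Basis. complex_of_real (inverse (1 + (x \<bullet> b)^2)))"
        unfolding of_real_prod[symmetric] norm_of_real by (rule abs_of_nonneg[symmetric]) (simp add: prod_nonneg)
      finally show "norm (wt n x) \<le> norm (\<Prod>b\<in>Basis. complex_of_real (inverse (1 + (x \<bullet> b)^2)))" by simp
    qed
  qed auto
qed

definition rapid :: "('a::real_normed_vector \<Rightarrow> 'b::real_normed_vector) \<Rightarrow> bool" where
  "rapid f \<longleftrightarrow> (\<forall>n. \<exists>C\<ge>0. \<forall>x. norm (f x) \<le> C * wt n x)"

lemma rapidD: "rapid f \<Longrightarrow> \<exists>C\<ge>0. \<forall>x. norm (f x) \<le> C * wt n x"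
  by (simp add: rapid_def)

lemma rapidI: 
  assumes "\<And>n. \<exists>C. \<forall>x. norm (f x) \<le> C * wt n x"
  shows "rapid f"
  unfolding rapid_def
proof
  fix n
  obtain C where "\<forall>x. norm (f x) \<le> C * wt n x" using assms by blast
  moreover have "C * wt n x \<le> \<bar>C\<bar> * wt n x" for x :: 'a by (intro mult_right_mono) auto
  ultimately have "\<forall>x. norm (f x) \<le> \<bar>C\<bar> * wt n x" using order_trans by blast
  then show "\<exists>C\<ge>0. \<forall>x. norm (f x) \<le> C * wt n x" by (intro exI[of _ "\<bar>C\<bar>"]) auto
qed

lemma rapid_integrable:
  fixes f :: "'a::euclidean_space \<Rightarrow> 'b::{banach, second_countable_topology}"
  assumes "rapid f" and [measurable]: "f \<in> borel_measurable borel"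
  shows "integrable lborel (\<lambda>x. (1 + norm x)^n *\<^sub>R f x)"
proof -
  obtain C where C: "C \<ge> 0" "\<And>x. norm (f x) \<le> C * wt (n + 2 * DIM('a)) x"
    using rapidD[OF assms(1)] by blast
  have "integrable lborel (\<lambda>x::'a. C * wt (2 * DIM('a)) x)"
    by (intro integrable_mult_right integrable_wt) simp
  then show ?thesis
  proof (rule Bochner_Integration.integrable_bound)
    show "AE x in lborel. norm ((1 + norm x)^n *\<^sub>R f x) \<le> norm (C * wt (2 * DIM('a)) x)"
    proof (rule AE_I2)
      fix x :: 'a
      have "(1 + norm x)^n * norm (f x) \<le> (1 + norm x)^n * (C * wt (n + 2 * DIM('a)) x)"
        by (intro mult_left_mono C) simp
      also have "\<dots> = C * wt (2 * DIM('a)) x" by (simp add: wt_add mult.left_commute mult.assoc[symmetric])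
      finally show "norm ((1 + norm x)^n *\<^sub>R f x) \<le> norm (C * wt (2 * DIM('a)) x)" using C(1) by simp
    qed
  qed measurable
qed

text \<open>Boundedness for the two exponents \<open>0\<close> and \<open>n\<close> already gives
  decay of order \<open>n\<close>, because \<open>(1 + t)^n \<le> 2^n * (1 + t^n)\<close> for
  \<open>t \<ge> 0\<close>. From here on decay is expressed by \<open>wt\<close> alone.\<close>

lemma schwartz_iff:
  "f \<in> schwartz \<longleftrightarrow> smooth f \<and> (\<forall>bs. set bs \<subseteq> Basis \<longrightarrow> rapid (iterated_partial bs f))"
proof -
  have "(\<forall>k. bdd_above (range (\<lambda>x. norm x ^ k * norm (g x)))) \<longleftrightarrow> rapid g" for g :: "'a \<Rightarrow> complex"
  proof
    assume *: "\<forall>k. bdd_above (range (\<lambda>x. norm x ^ k * norm (g x)))"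
    show "rapid g"
    proof (rule rapidI)
      fix n
      obtain A B where AB: "\<And>x. norm x ^ 0 * norm (g x) \<le> A" "\<And>x. norm x ^ n * norm (g x) \<le> B"
        using *[rule_format, of 0] *[rule_format, of n] unfolding bdd_above_def by (metis rangeI)
      have "norm (g x) \<le> (2^n * (A + B)) * wt n x" for x
      proof -
        have "(1 + norm x)^n \<le> (2 * max 1 (norm x))^n" by (intro power_mono) auto
        also have "\<dots> \<le> 2^n * (1 + norm x ^ n)" by (auto simp: power_mult_distrib max_def)
        finally have "(1 + norm x)^n * norm (g x) \<le> 2^n * (1 + norm x ^ n) * norm (g x)" by (intro mult_right_mono) auto
        also have "\<dots> = 2^n * (norm x ^ 0 * norm (g x) + norm x ^ n * norm (g x))" by (simp add: algebra_simps)
        also have "\<dots> \<le> 2^n * (A + B)" using AB[of x] by (intro mult_left_mono) auto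
        finally have "wt n x * ((1 + norm x)^n * norm (g x)) \<le> wt n x * (2^n * (A + B))" by (intro mult_left_mono) auto
        then have "(wt n x * (1 + norm x)^n) * norm (g x) \<le> wt n x * (2^n * (A + B))" by (simp only: mult.assoc)
        then show ?thesis by (simp add: mult.commute)
      qed
      then show "\<exists>C. \<forall>x. norm (g x) \<le> C * wt n x" by blast
    qed
  next
    assume "rapid g"
    show "\<forall>k. bdd_above (range (\<lambda>x. norm x ^ k * norm (g x)))"
    proof
      fix k
      obtain C where C: "\<And>x. norm (g x) \<le> C * wt k x" using rapidD[OF \<open>rapid g\<close>] by blast
      have "norm x ^ k * norm (g x) \<le> C" for x
      proof -
        have "norm x ^ k * norm (g x) \<le> (1 + norm x)^k * (C * wt k x)"
          by (intro mult_mono C power_mono) auto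
        then show ?thesis by (simp add: mult.left_commute)
      qed
      then show "bdd_above (range (\<lambda>x. norm x ^ k * norm (g x)))" unfolding bdd_above_def by blast
    qed
  qed
  from this[symmetric] show ?thesis unfolding schwartz_def by auto
qed

lemma schwartz_smooth: "f \<in> schwartz \<Longrightarrow> smooth f"
  and schwartz_rapid: "f \<in> schwartz \<Longrightarrow> rapid f"
  and schwartz_rapid_iterated: "f \<in> schwartz \<Longrightarrow> set bs \<subseteq> Basis \<Longrightarrow> rapid (iterated_partial bs f)"
  and schwartz_measurable [measurable_dest]: "f \<in> schwartz \<Longrightarrow> f \<in> borel_measurable borel"
proof -
  show "f \<in> schwartz \<Longrightarrow> smooth f" by (simp add: schwartz_iff)
  then show "f \<in> schwartz \<Longrightarrow> f \<in> borel_measurable borel" by (rule smooth_imp_measurable)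
  show *: "f \<in> schwartz \<Longrightarrow> set bs \<subseteq> Basis \<Longrightarrow> rapid (iterated_partial bs f)" for bs
    by (simp add: schwartz_iff)
  show "f \<in> schwartz \<Longrightarrow> rapid f" using *[of "[]"] by simp
qed

lemma schwartz_partial_deriv: "f \<in> schwartz \<Longrightarrow> b \<in> Basis \<Longrightarrow> partial_deriv b f \<in> schwartz"
  unfolding schwartz_iff
proof (intro conjI allI impI; (elim conjE)?)
  fix bs :: "'a list"
  assume *: "\<forall>bs. set bs \<subseteq> Basis \<longrightarrow> rapid (iterated_partial bs f)" "b \<in> Basis" "set bs \<subseteq> Basis"
  then have "set (bs @ [b]) \<subseteq> Basis" by simp
  with *(1) have "rapid (iterated_partial (bs @ [b]) f)" by blast
  then show "rapid (iterated_partial bs (partial_deriv b f))" by (simp only: iterated_partial_snoc)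
qed (rule smooth_partial_deriv)

lemma schwartz_iterated_partial: "f \<in> schwartz \<Longrightarrow> set bs \<subseteq> Basis \<Longrightarrow> iterated_partial bs f \<in> schwartz"
  by (induction bs) (auto simp: iterated_partial_Cons intro: schwartz_partial_deriv)

lemma schwartz_integrable: "f \<in> schwartz \<Longrightarrow> integrable lborel f"
  using rapid_integrable[of f 0] by (simp add: schwartz_rapid schwartz_measurable)

text \<open>Mean value inequality on the ball of radius \<open>norm y\<close> about
  \<open>x\<close>; on it the partial derivatives decay as at \<open>x\<close>, up to the factor
  \<open>(1 + norm y)^n\<close> of Peetre's inequality. The retained decay in \<open>x\<close> makes
  differences of translates integrable.\<close>

lemma schwartz_lipschitz:
  fixes k :: "'a::euclidean_space \<Rightarrow> complex"
  assumes k: "k \<in> schwartz"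
  shows "\<exists>C\<ge>0. \<forall>x y. norm (k (x + y) - k x) \<le> C * norm y * (1 + norm y)^n * wt n x"
proof -
  have *: "\<forall>b\<in>Basis. \<exists>C\<ge>0. \<forall>x. norm (partial_deriv b k x) \<le> C * wt n x"
    by (intro ballI rapidD schwartz_rapid schwartz_partial_deriv k)
  obtain C where CC: "\<forall>b\<in>Basis. 0 \<le> C b \<and> (\<forall>x. norm (partial_deriv b k x) \<le> C b * wt n x)"
    using bchoice[OF *] by (elim exE)
  have C: "\<And>b. b \<in> Basis \<Longrightarrow> C b \<ge> 0" "\<And>b x. b \<in> Basis \<Longrightarrow> norm (partial_deriv b k x) \<le> C b * wt n x"
    using CC by auto
  define L where "L = sum C Basis"
  have L: "L \<ge> 0" using C(1) by (simp add: L_def sum_nonneg)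
  have "norm (k (x + y) - k x) \<le> L * norm y * (1 + norm y)^n * wt n x" for x y
  proof -
    have "norm (k (x + y) - k x) \<le> (L * ((1 + norm y)^n * wt n x)) * norm ((x + y) - x)"
    proof (rule differentiable_bound[where S="cball x (norm y)"])
      fix z assume z: "z \<in> cball x (norm y)"
      show "(k has_derivative (\<lambda>h. \<Sum>b\<in>Basis. (h \<bullet> b) *\<^sub>R partial_deriv b k z)) (at z within cball x (norm y))"
        by (rule has_derivative_at_withinI[OF has_derivative_partial_deriv[OF smooth_imp_differentiable[OF schwartz_smooth[OF k]]]])
      have "wt n z \<le> (1 + norm (z - x))^n * wt n x" using wt_shift[of n x "z - x"] by simp
      also have "\<dots> \<le> (1 + norm y)^n * wt n x"
        using z by (intro mult_right_mono power_mono) (auto simp: dist_norm norm_minus_commute)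
      finally have wz: "wt n z \<le> (1 + norm y)^n * wt n x" .
      show "onorm (\<lambda>h. \<Sum>b\<in>Basis. (h \<bullet> b) *\<^sub>R partial_deriv b k z) \<le> L * ((1 + norm y)^n * wt n x)"
      proof (rule onorm_bound)
        fix h :: 'a
        have "norm (\<Sum>b\<in>Basis. (h \<bullet> b) *\<^sub>R partial_deriv b k z) \<le> (\<Sum>b\<in>Basis. norm h * (C b * wt n z))"
        proof (rule sum_norm_le)
          fix b :: 'a assume b: "b \<in> Basis"
          show "norm ((h \<bullet> b) *\<^sub>R partial_deriv b k z) \<le> norm h * (C b * wt n z)"
            unfolding norm_scaleR by (intro mult_mono C(2)[OF b] Basis_le_norm[OF b]) auto
        qed
        also have "\<dots> = L * wt n z * norm h"
          by (simp add: L_def sum_distrib_left sum_distrib_right algebra_simps)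
        also have "\<dots> \<le> L * ((1 + norm y)^n * wt n x) * norm h"
          by (intro mult_right_mono mult_left_mono wz L) auto
        finally show "norm (\<Sum>b\<in>Basis. (h \<bullet> b) *\<^sub>R partial_deriv b k z) \<le> L * ((1 + norm y)^n * wt n x) * norm h" .
      qed (use L in auto)
    qed (auto simp: dist_norm)
    then show ?thesis by (simp add: algebra_simps)
  qed
  with L show ?thesis by blast
qed

text \<open>Mean value inequality for \<open>k\<close> minus its differential at \<open>x\<close>,
  whose derivative is controlled by the Lipschitz constants of the partial derivatives. The constant
  does not depend on \<open>x\<close>, as differentiation under an integral demands.\<close>

lemma schwartz_taylor:
  fixes k :: "'a::euclidean_space \<Rightarrow> complex"
  assumes k: "k \<in> schwartz"
  shows "\<exists>C\<ge>0. \<forall>x h. norm (k (x + h) - k x - (\<Sum>b\<in>Basis. (h \<bullet> b) *\<^sub>R partial_deriv b k x)) \<le> C * norm h ^ 2"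
proof -
  have *: "\<forall>b\<in>Basis. \<exists>C\<ge>0. \<forall>x y. norm (partial_deriv b k (x + y) - partial_deriv b k x) \<le> C * norm y"
    using schwartz_lipschitz[OF schwartz_partial_deriv[OF k], where n=0] by simp
  obtain C where CC: "\<forall>b\<in>Basis. 0 \<le> C b \<and> (\<forall>x y. norm (partial_deriv b k (x + y) - partial_deriv b k x) \<le> C b * norm y)"
    using bchoice[OF *] by (elim exE)
  have C: "\<And>b. b \<in> Basis \<Longrightarrow> C b \<ge> 0"
    "\<And>b x y. b \<in> Basis \<Longrightarrow> norm (partial_deriv b k (x + y) - partial_deriv b k x) \<le> C b * norm y" using CC by auto
  define L where "L = sum C Basis"
  have L: "L \<ge> 0" using C(1) by (simp add: L_def sum_nonneg)
  let ?D = "\<lambda>x h. \<Sum>b\<in>Basis. (h \<bullet> b) *\<^sub>R partial_deriv b k x"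
  have "norm (k (x + h) - k x - ?D x h) \<le> L * norm h ^ 2" for x h
  proof -
    have lin: "linear (?D x)"
      using has_derivative_linear[OF has_derivative_partial_deriv[OF smooth_imp_differentiable[OF schwartz_smooth[OF k]]]] .
    have "norm ((k (x + h) - ?D x (x + h)) - (k x - ?D x x)) \<le> (L * norm h) * norm ((x + h) - x)"
    proof (rule differentiable_bound[where S="cball x (norm h)"])
      fix z assume z: "z \<in> cball x (norm h)"
      show "((\<lambda>z. k z - ?D x z) has_derivative (\<lambda>v. ?D z v - ?D x v)) (at z within cball x (norm h))"
        by (rule has_derivative_at_withinI[OF has_derivative_diff[OF
              has_derivative_partial_deriv[OF smooth_imp_differentiable[OF schwartz_smooth[OF k]]]
              linear_imp_has_derivative[OF lin]]])
      show "onorm (\<lambda>v. ?D z v - ?D x v) \<le> L * norm h"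
      proof (rule onorm_bound)
        fix v :: 'a
        have "?D z v - ?D x v = (\<Sum>b\<in>Basis. (v \<bullet> b) *\<^sub>R (partial_deriv b k z - partial_deriv b k x))"
          by (simp add: sum_subtractf[symmetric] scaleR_diff_right)
        also have "norm \<dots> \<le> (\<Sum>b\<in>Basis. norm v * (C b * norm h))"
        proof (rule sum_norm_le)
          fix b :: 'a assume b: "b \<in> Basis"
          have "norm (partial_deriv b k z - partial_deriv b k x) \<le> C b * norm (z - x)"
            using C(2)[OF b, of x "z - x"] by simp
          also have "\<dots> \<le> C b * norm h" using z by (intro mult_left_mono C b) (auto simp: dist_norm norm_minus_commute)
          finally show "norm ((v \<bullet> b) *\<^sub>R (partial_deriv b k z - partial_deriv b k x)) \<le> norm v * (C b * norm h)"
            unfolding norm_scaleR by (intro mult_mono Basis_le_norm[OF b]) auto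
        qed
        also have "\<dots> = L * norm h * norm v"
          by (simp add: L_def sum_distrib_left sum_distrib_right algebra_simps)
        finally show "norm (?D z v - ?D x v) \<le> L * norm h * norm v" .
      qed (use L in auto)
    qed (auto simp: dist_norm)
    moreover have e: "?D x (x + h) = ?D x x + ?D x h" by (rule linear_add[OF lin])
    have "(k (x + h) - ?D x (x + h)) - (k x - ?D x x) = k (x + h) - k x - ?D x h" unfolding e by simp
    ultimately show ?thesis by (simp add: power2_eq_square mult.assoc)
  qed
  with L show ?thesis by blast
qed

section \<open>Convolution with a Schwartz kernel\<close>

definition conv :: "('a::euclidean_space \<Rightarrow> complex) \<Rightarrow> ('a \<Rightarrow> complex) \<Rightarrow> 'a \<Rightarrow> complex" where
  "conv k w x = (\<integral>y. k (x - y) * w y \<partial>lborel)"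

lemma conv_integrable:
  assumes "k \<in> schwartz" "integrable lborel w"
  shows "integrable lborel (\<lambda>y. k (x - y) * w y)"
proof -
  obtain C where C: "C \<ge> 0" "\<And>x. norm (k x) \<le> C" using rapidD[OF schwartz_rapid[OF assms(1)], of 0] by auto
  have [measurable]: "w \<in> borel_measurable borel" using assms(2) by simp
  note [measurable] = schwartz_measurable[OF assms(1)]
  have "integrable lborel (\<lambda>y. C *\<^sub>R norm (w y))" using assms(2) by auto
  then show ?thesis
    by (rule Bochner_Integration.integrable_bound)
      (use C in \<open>auto simp: norm_mult intro!: mult_right_mono\<close>)
qed

text \<open>The Taylor remainder of \<open>k\<close> is quadratic with a uniform constant, so
  integrating it against \<open>w\<close> leaves a remainder of at most a constant times the
  integral of \<open>norm (w y)\<close> times \<open>norm h ^ 2\<close>.\<close>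

lemma has_derivative_conv:
  assumes k: "k \<in> schwartz" and w: "integrable lborel w"
  shows "(conv k w has_derivative (\<lambda>h. \<Sum>b\<in>Basis. (h \<bullet> b) *\<^sub>R conv (partial_deriv b k) w x)) (at x)"
proof -
  obtain C where C: "C \<ge> 0" "\<And>x h. norm (k (x + h) - k x - (\<Sum>b\<in>Basis. (h \<bullet> b) *\<^sub>R partial_deriv b k x)) \<le> C * norm h ^ 2"
    using schwartz_taylor[OF k] by blast
  let ?D = "\<lambda>h. \<Sum>b\<in>Basis. (h \<bullet> b) *\<^sub>R conv (partial_deriv b k) w x"
  let ?I = "\<integral>y. norm (w y) \<partial>lborel"
  have ip: "b \<in> Basis \<Longrightarrow> integrable lborel (\<lambda>y. partial_deriv b k (x - y) * w y)" for b x
    by (intro conv_integrable schwartz_partial_deriv k w)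
  have bound: "norm (conv k w (x + h) - conv k w x - ?D h) \<le> C * ?I * norm h ^ 2" for h
  proof -
    let ?F = "\<lambda>y. (k (x + h - y) * w y - k (x - y) * w y) - (\<Sum>b\<in>Basis. (h \<bullet> b) *\<^sub>R (partial_deriv b k (x - y) * w y))"
    have "conv k w (x + h) - conv k w x - ?D h = (\<integral>y. ?F y \<partial>lborel)"
      unfolding conv_def using conv_integrable[OF k w] ip
      by (subst Bochner_Integration.integral_diff Bochner_Integration.integral_sum; (intro Bochner_Integration.integrable_diff Bochner_Integration.integrable_sum integrable_scaleR_right)?; simp)+
    also have "norm \<dots> \<le> (\<integral>y. (C * norm h ^ 2) * norm (w y) \<partial>lborel)"
    proof (rule Bochner_Integration.integral_norm_bound_integral)
      show "integrable lborel ?F"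
        using conv_integrable[OF k w] ip by (intro Bochner_Integration.integrable_diff Bochner_Integration.integrable_sum integrable_scaleR_right) auto
      show "integrable lborel (\<lambda>y. (C * norm h ^ 2) * norm (w y))" using w by auto
      fix y
      have "?F y = (k (x - y + h) - k (x - y) - (\<Sum>b\<in>Basis. (h \<bullet> b) *\<^sub>R partial_deriv b k (x - y))) * w y"
        by (simp add: algebra_simps sum_distrib_left sum_distrib_right)
      then show "norm (?F y) \<le> (C * norm h ^ 2) * norm (w y)"
        using C(2)[of "x - y" h] by (simp only: norm_mult) (intro mult_right_mono; simp)
    qed
    finally show ?thesis by (simp add: algebra_simps)
  qed
  have lim: "((\<lambda>h. C * ?I * norm h) \<longlongrightarrow> 0) (at (0::'a))"
    by (auto intro!: tendsto_eq_intros)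
  show ?thesis
    unfolding has_derivative_at
  proof (intro conjI)
    show "bounded_linear ?D"
      by (intro bounded_linear_sum bounded_linear_scaleR_left[THEN bounded_linear_compose] bounded_linear_inner_left)
    show "(\<lambda>h. norm (conv k w (x + h) - conv k w x - ?D h) / norm h) \<midarrow>0\<rightarrow> 0"
    proof (rule tendsto_sandwich[OF _ _ tendsto_const lim])
      show "\<forall>\<^sub>F h in at 0. norm (conv k w (x + h) - conv k w x - ?D h) / norm h \<le> C * ?I * norm h"
      proof (rule always_eventually, rule allI)
        fix h show "norm (conv k w (x + h) - conv k w x - ?D h) / norm h \<le> C * ?I * norm h"
          using bound[of h] by (cases "h = 0") (auto simp: divide_le_eq power2_eq_square algebra_simps)
      qed
    qed (auto intro!: always_eventually)
  qed
qed

lemma partial_deriv_conv: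
  assumes "k \<in> schwartz" "integrable lborel w" "b \<in> Basis"
  shows "partial_deriv b (conv k w) = conv (partial_deriv b k) w"
proof
  fix x
  have "(\<Sum>c\<in>Basis. (b \<bullet> c) *\<^sub>R conv (partial_deriv c k) w x) = (\<Sum>c\<in>Basis. if c = b then conv (partial_deriv c k) w x else 0)"
    by (rule sum.cong) (use assms(3) in \<open>auto simp: inner_Basis\<close>)
  then show "partial_deriv b (conv k w) x = conv (partial_deriv b k) w x"
    using partial_deriv_eqI[OF has_derivative_conv[OF assms(1,2)], of b x] assms(3) by simp
qed

lemma iterated_partial_conv:
  assumes "k \<in> schwartz" "integrable lborel w" "set bs \<subseteq> Basis"
  shows "iterated_partial bs (conv k w) = conv (iterated_partial bs k) w"
  using assms(3) by (induction bs)
    (auto simp: iterated_partial_Cons partial_deriv_conv[OF schwartz_iterated_partial[OF assms(1)] assms(2)])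

lemma smooth_conv:
  assumes "k \<in> schwartz" "integrable lborel w"
  shows "smooth (conv k w)"
  unfolding smooth_def
  by (auto simp: iterated_partial_conv[OF assms] differentiable_def intro!: exI has_derivative_conv schwartz_iterated_partial assms)

text \<open>By \<open>wt_shift\<close> the kernel at \<open>x - y\<close> decays like
  \<open>wt n x\<close> at the price of \<open>(1 + norm y)^n\<close>, which the decay of
  \<open>w\<close> absorbs.\<close>

lemma rapid_conv:
  assumes k: "k \<in> schwartz" and w: "rapid w" "w \<in> borel_measurable borel"
  shows "rapid (conv k w)"
proof (rule rapidI)
  fix n
  obtain C where C: "C \<ge> 0" "\<And>x. norm (k x) \<le> C * wt n x" using rapidD[OF schwartz_rapid[OF k]] by blast
  have iw: "integrable lborel w" using rapid_integrable[OF w, of 0] by simp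
  have "norm (conv k w x) \<le> (C * (\<integral>y. norm ((1 + norm y)^n *\<^sub>R w y) \<partial>lborel)) * wt n x" for x
  proof -
    have "norm (conv k w x) \<le> (\<integral>y. (C * wt n x) * norm ((1 + norm y)^n *\<^sub>R w y) \<partial>lborel)"
      unfolding conv_def
    proof (rule Bochner_Integration.integral_norm_bound_integral)
      show "integrable lborel (\<lambda>y. k (x - y) * w y)" by (rule conv_integrable[OF k iw])
      show "integrable lborel (\<lambda>y. (C * wt n x) * norm ((1 + norm y)^n *\<^sub>R w y))"
        using rapid_integrable[OF w, of n] by (intro integrable_mult_right integrable_norm)
      fix y
      have "norm (k (x - y)) \<le> C * ((1 + norm y)^n * wt n x)"
        using C(2)[of "x - y"] mult_left_mono[OF wt_shift[of n x "-y"] C(1)] by simp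
      then have "norm (k (x - y)) * norm (w y) \<le> C * ((1 + norm y)^n * wt n x) * norm (w y)"
        by (intro mult_right_mono) auto
      then show "norm (k (x - y) * w y) \<le> (C * wt n x) * norm ((1 + norm y)^n *\<^sub>R w y)"
        by (simp add: norm_mult algebra_simps)
    qed
    then show ?thesis by (simp only: integral_mult_right_zero) (simp only: mult_ac)
  qed
  then show "\<exists>C. \<forall>x. norm (conv k w x) \<le> C * wt n x" by blast
qed

text \<open>All derivatives fall on \<open>k\<close>, so \<open>w\<close> may be rough: it will be
  the indicator of a box in one place and a monotone radial weight in another.\<close>

lemma schwartz_conv:
  assumes "k \<in> schwartz" "rapid w" "w \<in> borel_measurable borel"
  shows "conv k w \<in> schwartz"
proof -
  have iw: "integrable lborel w" using rapid_integrable[OF assms(2,3), of 0] by simp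
  show ?thesis unfolding schwartz_iff
    by (auto simp: iterated_partial_conv[OF assms(1) iw] intro!: smooth_conv rapid_conv schwartz_iterated_partial assms iw)
qed

lemma conv_commute:
  assumes [measurable]: "k \<in> borel_measurable borel" "w \<in> borel_measurable borel"
  shows "conv k w x = conv w k x"
proof -
  have "(\<integral>y. k (x - y) * w y \<partial>lborel) = (\<integral>y. k (x - (x - y)) * w (x - y) \<partial>lborel)"
    by (rule lborel_integral_shift_reflect(1)[symmetric]) measurable
  then show ?thesis unfolding conv_def by (simp add: mult.commute)
qed

section \<open>Inverse Fourier transforms of test functions\<close>

lemma test_function_iff: "test_function f \<longleftrightarrow> smooth f \<and> (\<exists>R. \<forall>x. norm x > R \<longrightarrow> f x = 0)"
proof -
  have "compact (support f) \<longleftrightarrow> bounded {x. f x \<noteq> 0}"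
    unfolding support_def by (simp add: compact_closure)
  also have "\<dots> \<longleftrightarrow> (\<exists>R. \<forall>x. norm x > R \<longrightarrow> f x = 0)"
    unfolding bounded_iff by (intro ex_cong1) (auto simp: not_less[symmetric])
  finally show ?thesis by (simp add: test_function_def)
qed

lemma test_function_partial_deriv:
  assumes f: "test_function f" and b: "b \<in> Basis"
  shows "test_function (partial_deriv b f)"
proof -
  obtain R where R: "\<And>x. norm x > R \<Longrightarrow> f x = 0" using f test_function_iff by blast
  have "partial_deriv b f x = 0" if "norm x > R" for x
  proof -
    have "open {x::'a. R < norm x}" by (intro open_Collect_less continuous_intros)
    moreover have "((\<lambda>x. 0) has_derivative (\<lambda>h. 0)) (at x)" by simp
    ultimately have "(f has_derivative (\<lambda>h. 0)) (at x)"
      using that R by (rule_tac has_derivative_transform_within_open[where f="\<lambda>x. 0"]) auto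
    from partial_deriv_eqI[OF this] show ?thesis .
  qed
  then have "\<exists>R. \<forall>x. norm x > R \<longrightarrow> partial_deriv b f x = 0" by auto
  then show ?thesis unfolding test_function_iff using f b smooth_partial_deriv test_function_iff by blast
qed

lemma test_function_mult: "test_function f \<Longrightarrow> smooth g \<Longrightarrow> test_function (\<lambda>x. g x * f x)"
  unfolding test_function_iff using smooth_mult[of g f] by auto

lemma test_function_cmult: "test_function f \<Longrightarrow> test_function (\<lambda>x. c * f x)"
  by (rule test_function_mult) (auto intro: smooth_const)

lemma test_function_scale:
  assumes "test_function f" "c \<noteq> 0"
  shows "test_function (\<lambda>x. f (c *\<^sub>R x))"
proof -
  obtain R where R: "\<And>x. norm x > R \<Longrightarrow> f x = 0" using assms(1) test_function_iff by blast
  have "norm x > R / \<bar>c\<bar> \<Longrightarrow> f (c *\<^sub>R x) = 0" for x using assms(2) by (intro R) (simp add: field_simps)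
  then have "\<exists>R. \<forall>x. norm x > R \<longrightarrow> f (c *\<^sub>R x) = 0" by auto
  moreover have "smooth (\<lambda>x. f (c *\<^sub>R x))" using assms smooth_scale test_function_iff by blast
  ultimately show ?thesis unfolding test_function_iff by blast
qed

lemma test_function_add: "test_function f \<Longrightarrow> test_function g \<Longrightarrow> test_function (\<lambda>x. f x + g x)"
proof -
  assume f: "test_function f" and g: "test_function g"
  obtain R where R: "\<And>x. norm x > R \<Longrightarrow> f x = 0" using f test_function_iff by blast
  obtain S where S: "\<And>x. norm x > S \<Longrightarrow> g x = 0" using g test_function_iff by blast
  have "\<forall>x. norm x > max R S \<longrightarrow> f x + g x = 0" using R S by simp
  then have "\<exists>R. \<forall>x. norm x > R \<longrightarrow> f x + g x = 0" by blast
  moreover have "smooth (\<lambda>x. f x + g x)" using f g smooth_add test_function_iff by blast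
  ultimately show ?thesis unfolding test_function_iff by blast
qed

lemma test_function_diff: "test_function f \<Longrightarrow> test_function g \<Longrightarrow> test_function (\<lambda>x. f x - g x)"
  using test_function_add[of f "\<lambda>x. -1 * g x"] test_function_cmult[of g "-1"] by simp

lemma test_function_schwartz:
  assumes "test_function f"
  shows "f \<in> schwartz"
proof -
  have "rapid g" if g: "test_function g" for g :: "'a \<Rightarrow> complex"
  proof (rule rapidI)
    fix n
    obtain R where R: "\<And>x. norm x > R \<Longrightarrow> g x = 0" using g test_function_iff by blast
    have "compact ((\<lambda>x. (1 + norm x)^n *\<^sub>R g x) ` cball 0 R)"
      using g by (intro compact_continuous_image continuous_intros smooth_imp_continuous) (auto simp: test_function_iff)
    from compact_imp_bounded[OF this] obtain B where B: "\<And>x. x \<in> cball 0 R \<Longrightarrow> norm ((1 + norm x)^n *\<^sub>R g x) \<le> B"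
      unfolding bounded_iff by blast
    have "norm (g x) \<le> \<bar>B\<bar> * wt n x" for x
    proof (cases "norm x > R")
      case False
      then have "norm ((1 + norm x)^n *\<^sub>R g x) \<le> \<bar>B\<bar>" using B[of x] by fastforce
      then have "wt n x * ((1 + norm x)^n * norm (g x)) \<le> wt n x * \<bar>B\<bar>" by (intro mult_left_mono) auto
      then have "(wt n x * (1 + norm x)^n) * norm (g x) \<le> wt n x * \<bar>B\<bar>" by (simp only: mult.assoc)
      then show ?thesis by (simp add: mult.commute)
    qed (simp add: R)
    then show "\<exists>C. \<forall>x. norm (g x) \<le> C * wt n x" by blast
  qed
  moreover have "test_function (iterated_partial bs f)" if "set bs \<subseteq> Basis" for bs
    using that by (induction bs) (auto simp: iterated_partial_Cons assms intro: test_function_partial_deriv)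
  moreover have "smooth f" using assms test_function_def by blast
  ultimately show ?thesis unfolding schwartz_iff by blast
qed

text \<open>Integration by parts without boundary terms. The difference quotients integrate to 0 by
  translation invariance; as the steps \<open>t i\<close> are at most 1,
  \<open>schwartz_lipschitz\<close> dominates them by \<open>C * 2^n * wt n x\<close>, and the limit
  may be taken under the integral.\<close>

lemma integral_partial_deriv_eq_0:
  fixes h :: "'a::euclidean_space \<Rightarrow> complex"
  assumes h: "h \<in> schwartz" and b: "b \<in> Basis"
  shows "(\<integral>x. partial_deriv b h x \<partial>lborel) = 0"
proof -
  define n where "n = 2 * DIM('a)"
  define t where "t i = 1 / real (Suc i)" for i
  have t: "t i > 0" "t i \<le> 1" for i by (auto simp: t_def)
  have t0: "t \<longlonglongrightarrow> 0" unfolding t_def by (rule LIMSEQ_Suc) (rule lim_1_over_n)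
  note [measurable] = schwartz_measurable[OF h]
  obtain C where C: "C \<ge> 0" "\<And>x y. norm (h (x + y) - h x) \<le> C * norm y * (1 + norm y)^n * wt n x"
    using schwartz_lipschitz[OF h] by blast
  obtain T where T: "\<And>x y. norm (h (x + y) - h x - (\<Sum>b\<in>Basis. (y \<bullet> b) *\<^sub>R partial_deriv b h x)) \<le> T * norm y ^ 2"
    using schwartz_taylor[OF h] by blast
  let ?q = "\<lambda>i x. (h (x + t i *\<^sub>R b) - h x) /\<^sub>R t i"
  have "(\<lambda>i. \<integral>x. ?q i x \<partial>lborel) \<longlonglongrightarrow> (\<integral>x. partial_deriv b h x \<partial>lborel)"
  proof (rule integral_dominated_convergence)
    show "integrable lborel (\<lambda>x::'a. C * 2^n * wt n x)"
      by (intro integrable_mult_right integrable_wt) (simp add: n_def)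
    show "AE x in lborel. (\<lambda>i. ?q i x) \<longlonglongrightarrow> partial_deriv b h x"
    proof (rule AE_I2)
      fix x
      have "norm (?q i x - partial_deriv b h x) \<le> T * t i" for i
      proof -
        have "(\<Sum>c\<in>Basis. (t i *\<^sub>R b \<bullet> c) *\<^sub>R partial_deriv c h x) = (\<Sum>c\<in>Basis. if c = b then t i *\<^sub>R partial_deriv c h x else 0)"
          by (rule sum.cong) (use b in \<open>auto simp: inner_Basis\<close>)
        then have "norm (h (x + t i *\<^sub>R b) - h x - t i *\<^sub>R partial_deriv b h x) \<le> T * (t i)^2"
          using T[of x "t i *\<^sub>R b"] b t(1)[of i] by (simp add: power2_eq_square)
        moreover have "?q i x - partial_deriv b h x = (h (x + t i *\<^sub>R b) - h x - t i *\<^sub>R partial_deriv b h x) /\<^sub>R t i"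
          using t(1)[of i] by (simp add: scaleR_diff_right)
        ultimately show ?thesis
          using t(1)[of i] by (simp add: inverse_eq_divide pos_divide_le_eq power2_eq_square mult.assoc)
      qed
      then have "\<forall>\<^sub>F i in sequentially. norm (?q i x - partial_deriv b h x) \<le> T * t i" by simp
      moreover have "(\<lambda>i. T * t i) \<longlonglongrightarrow> 0" using tendsto_mult_left[OF t0, of T] by simp
      ultimately have "(\<lambda>i. ?q i x - partial_deriv b h x) \<longlonglongrightarrow> 0"
        by (rule Lim_null_comparison)
      then show "(\<lambda>i. ?q i x) \<longlonglongrightarrow> partial_deriv b h x" by (rule LIM_zero_cancel)
    qed
    show "AE x in lborel. norm (?q i x) \<le> C * 2^n * wt n x" for i
    proof (rule AE_I2)
      fix x
      have "norm (h (x + t i *\<^sub>R b) - h x) \<le> C * t i * (1 + t i)^n * wt n x"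
        using C(2)[of x "t i *\<^sub>R b"] t[of i] b by simp
      also have "\<dots> \<le> C * t i * 2^n * wt n x"
        using t[of i] C(1) by (intro mult_right_mono mult_left_mono power_mono) auto
      finally show "norm (?q i x) \<le> C * 2^n * wt n x"
        using t(1)[of i] by (simp add: inverse_eq_divide pos_divide_le_eq) (simp only: mult_ac)
    qed
    show "?q i \<in> borel_measurable lborel" for i by measurable
    show "partial_deriv b h \<in> borel_measurable lborel"
      using schwartz_measurable[OF schwartz_partial_deriv[OF h b]] by simp
  qed
  moreover have "(\<integral>x. ?q i x \<partial>lborel) = 0" for i
  proof -
    have "integrable lborel (\<lambda>x. h (x + t i *\<^sub>R b))"
      using lborel_integrable_shift_reflect(2)[OF schwartz_integrable[OF h], of "- (t i *\<^sub>R b)"] by simp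
    moreover have "(\<integral>x. h (x + t i *\<^sub>R b) \<partial>lborel) = (\<integral>x. h x \<partial>lborel)"
      using lborel_integral_shift_reflect(2)[of h "- (t i *\<^sub>R b)"] by simp
    ultimately show ?thesis using schwartz_integrable[OF h] by simp
  qed
  ultimately have "(\<lambda>i. 0) \<longlonglongrightarrow> (\<integral>x. partial_deriv b h x \<partial>lborel)" by (simp only:)
  then show ?thesis by (simp add: LIMSEQ_const_iff)
qed

section \<open>Kernels of Fourier multipliers\<close>

lemma norm_exp_i [simp]: "norm (exp (\<i> * of_real t)) = 1" "norm (exp (- (\<i> * of_real t))) = 1"
  using norm_exp_i_times[of t] norm_exp_i_times[of "-t"] by simp_all

lemma has_derivative_exp_inner:
  fixes z :: "'a::euclidean_space"
  shows "((\<lambda>x. exp (- (\<i> * of_real (x \<bullet> z)))) has_derivative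
    (\<lambda>h. exp (- (\<i> * of_real (x \<bullet> z))) * (- (\<i> * of_real (h \<bullet> z))))) (at x)"
proof -
  have 1: "((\<lambda>x. - (\<i> * complex_of_real (x \<bullet> z))) has_derivative (\<lambda>h. - (\<i> * of_real (h \<bullet> z)))) (at x)"
    by (intro bounded_linear_imp_has_derivative bounded_linear_minus bounded_linear_mult_right[THEN bounded_linear_compose]
       bounded_linear_compose[OF bounded_linear_of_real] bounded_linear_inner_left)
  have 2: "(exp has_derivative (*) (exp (- (\<i> * complex_of_real (x \<bullet> z))))) (at (- (\<i> * complex_of_real (x \<bullet> z))))"
    using DERIV_exp by (simp add: has_field_derivative_def)
  show ?thesis by (rule has_derivative_compose[OF 1 2])
qed

lemma smooth_exp_inner:
  fixes z :: "'a::euclidean_space"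
  shows "smooth (\<lambda>x. exp (- (\<i> * of_real (x \<bullet> z))))"
proof (rule smooth_coinduct(1))
  let ?X = "{\<lambda>x::'a. c * exp (- (\<i> * of_real (x \<bullet> z))) |c. True}"
  show "(\<lambda>x. exp (- (\<i> * of_real (x \<bullet> z)))) \<in> ?X" by (rule CollectI, rule exI[of _ 1]) simp
  fix f assume "f \<in> ?X"
  then obtain c where f: "f = (\<lambda>x. c * exp (- (\<i> * of_real (x \<bullet> z))))" by blast
  have D: "(f has_derivative (\<lambda>h. (c * (- (\<i> * of_real (h \<bullet> z)))) * exp (- (\<i> * of_real (x \<bullet> z))))) (at x)" for x
    using has_derivative_mult_right[OF has_derivative_exp_inner, of c z x] unfolding f by (simp add: mult_ac)
  show "f differentiable at x" for x using D differentiable_def by blast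
  show "partial_deriv b f \<in> ?X" for b
    by (rule CollectI, rule exI[of _ "c * (- (\<i> * of_real (b \<bullet> z)))"])
      (rule conjI, rule ext, rule partial_deriv_eqI[OF D], rule TrueI)
qed

lemma partial_deriv_exp_inner:
  "partial_deriv b (\<lambda>x. exp (- (\<i> * of_real (x \<bullet> z)))) x = - (\<i> * of_real (b \<bullet> z)) * exp (- (\<i> * of_real (x \<bullet> z)))"
  using partial_deriv_eqI[OF has_derivative_exp_inner[of z x], of b] by simp

text \<open>Convolution with \<open>kern m\<close> is the transpose of the multiplier
  \<open>m\<close>: it acts on the test function, see \<open>fourier_mult_inv_fourier\<close>. This
  is why \<open>fourier\<close> occurs in place of \<open>inv_fourier\<close>; the second power of
  the normalising constant is that of the convolution theorem.\<close>

definition kern :: "('a::euclidean_space \<Rightarrow> complex) \<Rightarrow> 'a \<Rightarrow> complex" where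
  "kern m z = of_real ((2 * pi) powr (- real DIM('a) / 2)) * fourier m z"

abbreviation pc :: "'a::euclidean_space itself \<Rightarrow> complex" where
  "pc t \<equiv> of_real ((2 * pi) powr (- real DIM('a) / 2))"

lemma kern_def': "kern m z = (pc TYPE('a) * pc TYPE('a)) * (\<integral>\<xi>. exp (- (\<i> * of_real (\<xi> \<bullet> z))) * m \<xi> \<partial>lborel)"
  for m :: "'a::euclidean_space \<Rightarrow> complex"
  by (simp add: kern_def fourier_def)

lemma exp_inner_integrable:
  fixes m :: "'a::euclidean_space \<Rightarrow> complex"
  assumes "integrable lborel m"
  shows "integrable lborel (\<lambda>\<xi>. exp (- (\<i> * of_real (\<xi> \<bullet> z))) * m \<xi>)"
    and "integrable lborel (\<lambda>\<xi>. exp (\<i> * of_real (\<xi> \<bullet> z)) * m \<xi>)"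
proof -
  have [measurable]: "m \<in> borel_measurable borel" using assms by simp
  show "integrable lborel (\<lambda>\<xi>. exp (- (\<i> * of_real (\<xi> \<bullet> z))) * m \<xi>)"
    by (rule Bochner_Integration.integrable_bound[OF assms]) (auto simp: norm_mult)
  show "integrable lborel (\<lambda>\<xi>. exp (\<i> * of_real (\<xi> \<bullet> z)) * m \<xi>)"
    by (rule Bochner_Integration.integrable_bound[OF assms]) (auto simp: norm_mult)
qed

lemma kern_diff:
  assumes "integrable lborel f" "integrable lborel g"
  shows "kern (\<lambda>x. f x - g x) z = kern f z - kern g z"
  using exp_inner_integrable(1)[OF assms(1)] exp_inner_integrable(1)[OF assms(2)]
  by (simp add: kern_def' right_diff_distrib)

lemma kern_sum:
  assumes "\<And>i. i \<in> I \<Longrightarrow> integrable lborel (f i)"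
  shows "kern (\<lambda>x. \<Sum>i\<in>I. f i x) z = (\<Sum>i\<in>I. kern (f i) z)"
  using exp_inner_integrable(1)[OF assms]
  by (simp add: kern_def' sum_distrib_left Bochner_Integration.integral_sum)

lemma test_function_integrable: "test_function m \<Longrightarrow> integrable lborel m"
  by (intro schwartz_integrable test_function_schwartz)

lemma test_function_inner_mult: "test_function m \<Longrightarrow> test_function (\<lambda>\<xi>. - (\<i> * of_real (b \<bullet> \<xi>)) * m \<xi>)"
  by (rule test_function_mult, assumption, rule smooth_bounded_linear)
    (auto intro!: bounded_linear_minus bounded_linear_mult_right[THEN bounded_linear_compose]
       bounded_linear_compose[OF bounded_linear_of_real] bounded_linear_inner_right)

text \<open>Differentiation under the integral: \<open>iexp s\<close> differs from its linear part
  by at most \<open>s^2 / 2\<close>, and the second moment of the rapidly decreasing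
  \<open>m\<close> is finite.\<close>

lemma has_derivative_kern:
  fixes m :: "'a::euclidean_space \<Rightarrow> complex"
  assumes m: "test_function m"
  shows "(kern m has_derivative (\<lambda>h. \<Sum>b\<in>Basis. (h \<bullet> b) *\<^sub>R kern (\<lambda>\<xi>. - (\<i> * of_real (b \<bullet> \<xi>)) * m \<xi>) z)) (at z)"
proof -
  let ?M = "\<lambda>b \<xi>. - (\<i> * of_real (b \<bullet> \<xi>)) * m \<xi>"
  let ?e = "\<lambda>z \<xi>. exp (- (\<i> * of_real (\<xi> \<bullet> z)))"
  define c where "c = pc TYPE('a) * pc TYPE('a)"
  have kc: "kern m z = c * (\<integral>\<xi>. ?e z \<xi> * m \<xi> \<partial>lborel)" for m :: "'a \<Rightarrow> complex" and z
    by (simp only: kern_def' c_def)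
  let ?D = "\<lambda>h. \<Sum>b\<in>Basis. (h \<bullet> b) *\<^sub>R kern (?M b) z"
  have i2: "integrable lborel (\<lambda>\<xi>. (norm \<xi>)^2 * norm (m \<xi>))"
  proof -
    have "integrable lborel (\<lambda>\<xi>. norm ((1 + norm \<xi>)^2 *\<^sub>R m \<xi>))"
      by (intro integrable_norm rapid_integrable schwartz_rapid schwartz_measurable test_function_schwartz m)
    then show ?thesis
      by (rule Bochner_Integration.integrable_bound)
        (use schwartz_measurable[OF test_function_schwartz[OF m]] in \<open>auto intro!: mult_right_mono power_mono\<close>)
  qed
  let ?I = "\<integral>\<xi>. (norm \<xi>)^2 * norm (m \<xi>) \<partial>lborel"
  have im: "integrable lborel m" and iM: "\<And>b. integrable lborel (?M b)"
    by (intro test_function_integrable test_function_inner_mult m)+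
  have bound: "norm (kern m (z + h) - kern m z - ?D h) \<le> norm c * ?I * norm h ^ 2" for h
  proof -
    let ?F = "\<lambda>\<xi>. (?e (z + h) \<xi> * m \<xi> - ?e z \<xi> * m \<xi>) - (\<Sum>b\<in>Basis. (h \<bullet> b) *\<^sub>R (?e z \<xi> * ?M b \<xi>))"
    have iF: "integrable lborel ?F"
      by (intro Bochner_Integration.integrable_diff Bochner_Integration.integrable_sum integrable_scaleR_right exp_inner_integrable im iM)
    have "(\<integral>\<xi>. ?F \<xi> \<partial>lborel) = (\<integral>\<xi>. ?e (z + h) \<xi> * m \<xi> \<partial>lborel) - (\<integral>\<xi>. ?e z \<xi> * m \<xi> \<partial>lborel)
        - (\<Sum>b\<in>Basis. (h \<bullet> b) *\<^sub>R (\<integral>\<xi>. ?e z \<xi> * ?M b \<xi> \<partial>lborel))"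
      using exp_inner_integrable(1)[OF im] exp_inner_integrable(1)[OF iM]
      by (subst Bochner_Integration.integral_diff Bochner_Integration.integral_sum integral_scaleR_right; (intro Bochner_Integration.integrable_diff Bochner_Integration.integrable_sum integrable_scaleR_right)?; simp)+
    then have "kern m (z + h) - kern m z - ?D h = c * (\<integral>\<xi>. ?F \<xi> \<partial>lborel)"
      by (simp only: kc right_diff_distrib sum_distrib_left mult_scaleR_right)
    also have "norm \<dots> \<le> norm c * (\<integral>\<xi>. norm h ^ 2 * ((norm \<xi>)^2 * norm (m \<xi>)) \<partial>lborel)"
      unfolding norm_mult
    proof (intro mult_left_mono Bochner_Integration.integral_norm_bound_integral iF)
      show "integrable lborel (\<lambda>\<xi>. norm h ^ 2 * ((norm \<xi>)^2 * norm (m \<xi>)))" using i2 by auto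
      fix \<xi>
      have s: "(\<Sum>b\<in>Basis. (h \<bullet> b) *\<^sub>R (?e z \<xi> * ?M b \<xi>)) = - (\<i> * of_real (h \<bullet> \<xi>)) * (?e z \<xi> * m \<xi>)"
      proof -
        have "h \<bullet> \<xi> = (\<Sum>b\<in>Basis. (h \<bullet> b) * (b \<bullet> \<xi>))"
          by (subst euclidean_inner) (simp add: inner_commute)
        then have "- (\<i> * of_real (h \<bullet> \<xi>)) * (?e z \<xi> * m \<xi>) = (\<Sum>b\<in>Basis. - (\<i> * of_real ((h \<bullet> b) * (b \<bullet> \<xi>))) * (?e z \<xi> * m \<xi>))"
          by (simp add: sum_distrib_left sum_distrib_right sum_negf)
        then show ?thesis by (simp add: scaleR_conv_of_real mult_ac)
      qed
      have ee: "?e (z + h) \<xi> = ?e z \<xi> * iexp (- (h \<bullet> \<xi>))"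
        by (simp add: inner_add_right exp_add[symmetric] algebra_simps inner_commute)
      have "?F \<xi> = (?e z \<xi> * m \<xi>) * (iexp (- (h \<bullet> \<xi>)) - (1 + \<i> * of_real (- (h \<bullet> \<xi>))))"
        unfolding s ee by (simp add: algebra_simps)
      also have "norm \<dots> = norm (m \<xi>) * norm (iexp (- (h \<bullet> \<xi>)) - (1 + \<i> * of_real (- (h \<bullet> \<xi>))))"
        by (simp only: norm_mult norm_exp_i mult_1_left)
      also have "\<dots> \<le> norm (m \<xi>) * (norm h * norm \<xi>)^2"
      proof (intro mult_left_mono)
        have "norm (iexp (- (h \<bullet> \<xi>)) - (1 + \<i> * of_real (- (h \<bullet> \<xi>)))) \<le> \<bar>- (h \<bullet> \<xi>)\<bar>^2 / 2"
          using iexp_approx1[of "- (h \<bullet> \<xi>)" 1] by (simp add: power2_eq_square)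
        also have "\<dots> \<le> \<bar>h \<bullet> \<xi>\<bar>^2" by simp
        also have "\<dots> \<le> (norm h * norm \<xi>)^2" by (intro power_mono Cauchy_Schwarz_ineq2) auto
        finally show "norm (iexp (- (h \<bullet> \<xi>)) - (1 + \<i> * of_real (- (h \<bullet> \<xi>)))) \<le> (norm h * norm \<xi>)^2" .
      qed simp
      finally show "norm (?F \<xi>) \<le> norm h ^ 2 * ((norm \<xi>)^2 * norm (m \<xi>))" by (simp add: power_mult_distrib mult_ac)
    qed simp
    finally show ?thesis
      by (simp only: Bochner_Integration.integral_mult_right_zero) (simp only: mult_ac)
  qed
  have lim: "((\<lambda>h. norm c * ?I * norm h) \<longlongrightarrow> 0) (at (0::'a))"
    by (auto intro!: tendsto_eq_intros)
  show ?thesis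
    unfolding has_derivative_at
  proof (intro conjI)
    show "bounded_linear ?D"
      by (intro bounded_linear_sum bounded_linear_scaleR_left[THEN bounded_linear_compose] bounded_linear_inner_left)
    show "(\<lambda>h. norm (kern m (z + h) - kern m z - ?D h) / norm h) \<midarrow>0\<rightarrow> 0"
    proof (rule tendsto_sandwich[OF _ _ tendsto_const lim])
      show "\<forall>\<^sub>F h in at 0. norm (kern m (z + h) - kern m z - ?D h) / norm h \<le> norm c * ?I * norm h"
      proof (rule always_eventually, rule allI)
        fix h show "norm (kern m (z + h) - kern m z - ?D h) / norm h \<le> norm c * ?I * norm h"
          using bound[of h] by (cases "h = 0") (auto simp: divide_le_eq power2_eq_square algebra_simps)
      qed
    qed (auto intro!: always_eventually)
  qed
qed

lemma partial_deriv_kern: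
  assumes "test_function m" "b \<in> Basis"
  shows "partial_deriv b (kern m) = kern (\<lambda>\<xi>. - (\<i> * of_real (b \<bullet> \<xi>)) * m \<xi>)"
proof
  fix z
  have "(\<Sum>c\<in>Basis. (b \<bullet> c) *\<^sub>R kern (\<lambda>\<xi>. - (\<i> * of_real (c \<bullet> \<xi>)) * m \<xi>) z)
      = (\<Sum>c\<in>Basis. if c = b then kern (\<lambda>\<xi>. - (\<i> * of_real (c \<bullet> \<xi>)) * m \<xi>) z else 0)"
    by (rule sum.cong) (use assms(2) in \<open>auto simp: inner_Basis\<close>)
  then show "partial_deriv b (kern m) z = kern (\<lambda>\<xi>. - (\<i> * of_real (b \<bullet> \<xi>)) * m \<xi>) z"
    using partial_deriv_eqI[OF has_derivative_kern[OF assms(1)], of b z] assms(2) by simp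
qed

text \<open>The derivative of exponential times \<open>m\<close> has integral 0; the product rule
  turns this into the exchange of a coordinate of \<open>z\<close> for a derivative of
  \<open>m\<close>.\<close>

lemma inner_mult_kern:
  fixes m :: "'a::euclidean_space \<Rightarrow> complex"
  assumes m: "test_function m" and b: "b \<in> Basis"
  shows "of_real (z \<bullet> b) * kern m z = kern (\<lambda>\<xi>. - \<i> * partial_deriv b m \<xi>) z"
proof -
  let ?e = "\<lambda>\<xi>. exp (- (\<i> * of_real (\<xi> \<bullet> z)))"
  have sm: "smooth m" using m test_function_def by blast
  have i1: "integrable lborel (\<lambda>\<xi>. ?e \<xi> * m \<xi>)" "integrable lborel (\<lambda>\<xi>. ?e \<xi> * partial_deriv b m \<xi>)"
    by (intro exp_inner_integrable test_function_integrable test_function_partial_deriv m b)+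
  have "partial_deriv b (\<lambda>\<xi>. ?e \<xi> * m \<xi>) \<xi> = - (\<i> * of_real (b \<bullet> z)) * (?e \<xi> * m \<xi>) + ?e \<xi> * partial_deriv b m \<xi>" for \<xi>
    using partial_deriv_mult[OF smooth_imp_differentiable[OF smooth_exp_inner] smooth_imp_differentiable[OF sm], of b z \<xi>]
    by (simp add: partial_deriv_exp_inner)
  moreover have "(\<integral>\<xi>. partial_deriv b (\<lambda>\<xi>. ?e \<xi> * m \<xi>) \<xi> \<partial>lborel) = 0"
    by (intro integral_partial_deriv_eq_0 b test_function_schwartz test_function_mult m smooth_exp_inner)
  ultimately have "0 = (\<integral>\<xi>. - (\<i> * of_real (b \<bullet> z)) * (?e \<xi> * m \<xi>) + ?e \<xi> * partial_deriv b m \<xi> \<partial>lborel)" by simp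
  also have "\<dots> = - (\<i> * of_real (b \<bullet> z)) * (\<integral>\<xi>. ?e \<xi> * m \<xi> \<partial>lborel) + (\<integral>\<xi>. ?e \<xi> * partial_deriv b m \<xi> \<partial>lborel)"
    using i1 by (subst Bochner_Integration.integral_add) auto
  finally have "(\<integral>\<xi>. ?e \<xi> * partial_deriv b m \<xi> \<partial>lborel) = \<i> * of_real (b \<bullet> z) * (\<integral>\<xi>. ?e \<xi> * m \<xi> \<partial>lborel)"
    by (simp add: algebra_simps)
  then have "(\<integral>\<xi>. ?e \<xi> * (- \<i> * partial_deriv b m \<xi>) \<partial>lborel) = of_real (b \<bullet> z) * (\<integral>\<xi>. ?e \<xi> * m \<xi> \<partial>lborel)"
    by (simp add: mult.left_commute[of _ \<i>] mult.left_commute[of _ "-\<i>"]) (simp add: mult.assoc[symmetric])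
  then show ?thesis by (simp add: kern_def' inner_commute mult_ac)
qed

text \<open>Induction on the exponent, for all test functions at once: a further factor
  \<open>1 + norm z\<close> is at most 1 plus the sum of the
  \<open>\<bar>z \<bullet> b\<bar>\<close>, and each of these passes to the multiplier as a
  derivative.\<close>

lemma rapid_kern:
  assumes "test_function m"
  shows "rapid (kern m)"
proof (rule rapidI)
  fix n
  have "\<exists>C. \<forall>z. (1 + norm z)^n * norm (kern m z) \<le> C" using assms
  proof (induction n arbitrary: m)
    case 0
    have "norm (kern m z) \<le> norm (pc TYPE('a) * pc TYPE('a)) * (\<integral>\<xi>. norm (m \<xi>) \<partial>lborel)" for z
      unfolding kern_def' norm_mult[of _ "integral\<^sup>L lborel _"]
      by (intro mult_left_mono Bochner_Integration.integral_norm_bound_integral exp_inner_integrable test_function_integrable 0 integrable_norm)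
        (auto simp: norm_mult)
    then show ?case by auto
  next
    case (Suc n)
    obtain C where C: "\<And>z. (1 + norm z)^n * norm (kern m z) \<le> C" using Suc by blast
    have "\<forall>b\<in>Basis. \<exists>C. \<forall>z. (1 + norm z)^n * norm (kern (\<lambda>\<xi>. - \<i> * partial_deriv b m \<xi>) z) \<le> C"
      by (intro ballI Suc.IH test_function_cmult test_function_partial_deriv Suc.prems)
    from bchoice[OF this] obtain D where D: "\<forall>b\<in>Basis. \<forall>z. (1 + norm z)^n * norm (kern (\<lambda>\<xi>. - \<i> * partial_deriv b m \<xi>) z) \<le> D b"
      by (elim exE)
    have "(1 + norm z)^Suc n * norm (kern m z) \<le> C + sum D Basis" for z
    proof -
      have "(1 + norm z)^Suc n * norm (kern m z) = (1 + norm z)^n * norm (kern m z) + norm z * ((1 + norm z)^n * norm (kern m z))"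
        by (simp add: algebra_simps)
      also have "\<dots> \<le> C + (\<Sum>b\<in>Basis. \<bar>z \<bullet> b\<bar>) * ((1 + norm z)^n * norm (kern m z))"
        by (intro add_mono C mult_right_mono norm_le_l1) auto
      also have "(\<Sum>b\<in>Basis. \<bar>z \<bullet> b\<bar>) * ((1 + norm z)^n * norm (kern m z)) = (\<Sum>b\<in>Basis. (1 + norm z)^n * norm (of_real (z \<bullet> b) * kern m z))"
        unfolding sum_distrib_right norm_mult norm_of_real by (simp only: mult_ac)
      also have "\<dots> = (\<Sum>b\<in>Basis. (1 + norm z)^n * norm (kern (\<lambda>\<xi>. - \<i> * partial_deriv b m \<xi>) z))"
        by (rule sum.cong) (simp_all only: inner_mult_kern[OF Suc.prems])
      also have "\<dots> \<le> sum D Basis" by (rule sum_mono) (use D in blast)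
      finally show ?thesis by simp
    qed
    then show ?case by blast
  qed
  then obtain C where C: "\<And>z. (1 + norm z)^n * norm (kern m z) \<le> C" by blast
  have "norm (kern m z) \<le> C * wt n z" for z
    using mult_right_mono[OF C[of z] wt_nonneg[of n z]] by (simp add: mult.commute[of "(1 + norm z)^n"] mult.assoc)
  then show "\<exists>C. \<forall>z. norm (kern m z) \<le> C * wt n z" by blast
qed

text \<open>The kernels of test functions form a class of rapidly decreasing functions closed under
  partial derivatives, since these multiply \<open>m\<close> by a coordinate.\<close>

lemma schwartz_kern:
  fixes m :: "'a::euclidean_space \<Rightarrow> complex"
  assumes m: "test_function m"
  shows "kern m \<in> schwartz"
proof -
  let ?X = "{kern m |m :: 'a \<Rightarrow> complex. test_function m}"
  have 0: "kern m \<in> ?X" using m by blast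
  have 1: "f differentiable (at x)" if "f \<in> ?X" for f x
  proof -
    obtain m where m: "f = kern m" "test_function m" using \<open>f \<in> ?X\<close> by auto
    show ?thesis unfolding m(1) differentiable_def by (rule exI, rule has_derivative_kern[OF m(2)])
  qed
  have 2: "partial_deriv b f \<in> ?X" if "f \<in> ?X" "b \<in> Basis" for f b
  proof -
    obtain m where m: "f = kern m" "test_function m" using \<open>f \<in> ?X\<close> by auto
    show ?thesis unfolding m(1) partial_deriv_kern[OF m(2) \<open>b \<in> Basis\<close>]
      by (rule CollectI, rule exI, rule conjI, rule refl, rule test_function_inner_mult, rule m)
  qed
  show ?thesis unfolding schwartz_iff
  proof (intro conjI allI impI)
    show "smooth (kern m)" by (rule smooth_coinduct(1)[of "kern m" ?X, OF 0 1 2])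
    fix bs :: "'a list" assume bs: "set bs \<subseteq> Basis"
    have "iterated_partial bs (kern m) \<in> ?X"
      by (rule smooth_coinduct(2)[where f="kern m" and X="?X"]) (fact 0, fact 1, fact 2, fact bs)
    then show "rapid (iterated_partial bs (kern m))" using rapid_kern by auto
  qed
qed

section \<open>Fourier inversion\<close>

lemma lborel_pair_integrable:
  fixes F :: "'a::euclidean_space \<Rightarrow> 'b::euclidean_space \<Rightarrow> complex"
  assumes u: "integrable lborel (u :: 'a \<Rightarrow> real)" and v: "integrable lborel (v :: 'b \<Rightarrow> real)"
    and F [measurable]: "(\<lambda>(x, y). F x y) \<in> borel_measurable (lborel \<Otimes>\<^sub>M lborel)"
    and le: "\<And>x y. norm (F x y) \<le> u x * v y"
  shows "integrable (lborel \<Otimes>\<^sub>M lborel) (\<lambda>(x, y). F x y)"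
proof -
  have [measurable]: "u \<in> borel_measurable borel" "v \<in> borel_measurable borel" using u v by auto
  have "integrable (lborel \<Otimes>\<^sub>M lborel) (\<lambda>z::'a \<times> 'b. u (fst z) * v (snd z))"
  proof (rule lborel_pair.Fubini_integrable)
    show "integrable lborel (\<lambda>x. \<integral>y. norm (u (fst (x, y)) * v (snd (x, y))) \<partial>lborel)"
      using u by (simp add: abs_mult)
    show "AE x in lborel. integrable lborel (\<lambda>y. u (fst (x, y)) * v (snd (x, y)))"
      using v by simp
  qed measurable
  then show ?thesis
    by (rule Bochner_Integration.integrable_bound) (auto intro!: AE_I2 order_trans[OF le])
qed

lemma lborel_fubini_swap:
  fixes F :: "'a::euclidean_space \<Rightarrow> 'b::euclidean_space \<Rightarrow> complex"
  assumes "integrable lborel (u :: 'a \<Rightarrow> real)" "integrable lborel (v :: 'b \<Rightarrow> real)"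
    and "(\<lambda>(x, y). F x y) \<in> borel_measurable (lborel \<Otimes>\<^sub>M lborel)"
    and "\<And>x y. norm (F x y) \<le> u x * v y"
  shows "(\<integral>x. (\<integral>y. F x y \<partial>lborel) \<partial>lborel) = (\<integral>y. (\<integral>x. F x y \<partial>lborel) \<partial>lborel)"
  using lborel_pair.Fubini_integral[OF lborel_pair_integrable[OF assms]] by simp

text \<open>The product form reduces the transform to the characteristic function of the normal
  distribution on the line.\<close>

definition gauss :: "'a::euclidean_space \<Rightarrow> complex" where
  "gauss x = (\<Prod>b\<in>Basis. of_real (std_normal_density (x \<bullet> b)))"

lemma std_normal_char:
  "integrable lborel (\<lambda>x. iexp (t * x) * of_real (std_normal_density x))"
  "(\<integral>x. iexp (t * x) * of_real (std_normal_density x) \<partial>lborel) = of_real (exp (- (t^2) / 2))"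
proof -
  have i0: "integrable lborel (\<lambda>x. complex_of_real (std_normal_density x))"
    using integrable_std_normal_moment[of 0] by (intro integrable_of_real) simp
  show "integrable lborel (\<lambda>x. iexp (t * x) * of_real (std_normal_density x))"
    by (rule Bochner_Integration.integrable_bound[OF i0]) (auto simp: norm_mult)
  have "char std_normal_distribution t = (\<integral>x. std_normal_density x *\<^sub>R iexp (t * x) \<partial>lborel)"
    unfolding char_def by (rule integral_density) auto
  then show "(\<integral>x. iexp (t * x) * of_real (std_normal_density x) \<partial>lborel) = of_real (exp (- (t^2) / 2))"
    by (simp add: char_std_normal_distribution scaleR_conv_of_real mult.commute)
qed

lemma gauss_char:
  fixes t :: "'a::euclidean_space"
  shows "integrable lborel (\<lambda>x. exp (\<i> * of_real (x \<bullet> t)) * gauss x)"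
    and "(\<integral>x. exp (\<i> * of_real (x \<bullet> t)) * gauss x \<partial>lborel) = of_real (exp (- ((norm t)^2) / 2))"
proof -
  have eq: "exp (\<i> * of_real (x \<bullet> t)) * gauss x = (\<Prod>b\<in>Basis. iexp ((t \<bullet> b) * (x \<bullet> b)) * of_real (std_normal_density (x \<bullet> b)))" for x
  proof -
    have "x \<bullet> t = (\<Sum>b\<in>Basis. (t \<bullet> b) * (x \<bullet> b))" by (subst euclidean_inner) (simp add: mult.commute)
    then have "exp (\<i> * of_real (x \<bullet> t)) = (\<Prod>b\<in>Basis. iexp ((t \<bullet> b) * (x \<bullet> b)))"
      by (simp add: sum_distrib_left exp_sum)
    then show ?thesis by (simp add: gauss_def prod.distrib)
  qed
  show "integrable lborel (\<lambda>x. exp (\<i> * of_real (x \<bullet> t)) * gauss x)"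
    unfolding eq by (rule lborel_prod_integral(1)) (rule std_normal_char(1))
  have "(norm t)^2 = (\<Sum>b\<in>Basis. (t \<bullet> b)^2)"
    unfolding power2_norm_eq_inner by (subst euclidean_inner) (simp add: power2_eq_square)
  then have "- ((norm t)^2) / 2 = (\<Sum>b\<in>Basis. - ((t \<bullet> b)^2) / 2)"
    by (simp add: sum_negf sum_divide_distrib)
  then have "(\<Prod>b\<in>Basis. complex_of_real (exp (- ((t \<bullet> b)^2) / 2))) = of_real (exp (- ((norm t)^2) / 2))"
    by (simp only: exp_sum[OF finite_Basis] of_real_prod)
  then show "(\<integral>x. exp (\<i> * of_real (x \<bullet> t)) * gauss x \<partial>lborel) = of_real (exp (- ((norm t)^2) / 2))"
    unfolding eq by (subst lborel_prod_integral(2)[OF std_normal_char(1)]) (simp only: std_normal_char(2))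
qed

lemma gauss_eq: "gauss x = pc TYPE('a) * of_real (exp (- ((norm x)^2) / 2))" for x :: "'a::euclidean_space"
proof -
  have "(norm x)^2 = (\<Sum>b\<in>Basis. (x \<bullet> b)^2)"
    unfolding power2_norm_eq_inner by (subst euclidean_inner) (simp add: power2_eq_square)
  then have e: "- ((norm x)^2) / 2 = (\<Sum>b\<in>Basis. - ((x \<bullet> b)^2) / 2)"
    by (simp add: sum_negf sum_divide_distrib)
  have h: "(2 * pi) powr (- (1/2)) = 1 / sqrt (2 * pi)"
    using powr_minus[of "2 * pi" "1/2"] powr_half_sqrt[of "2 * pi"] by (simp add: inverse_eq_divide)
  have "(1 / sqrt (2 * pi)) ^ DIM('a) = ((2 * pi) powr (- (1/2))) powr (real DIM('a))"
    unfolding h by (rule powr_realpow[symmetric]) simp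
  also have "\<dots> = (2 * pi) powr (- real DIM('a) / 2)" by (simp add: powr_powr)
  finally have c: "(1 / sqrt (2 * pi)) ^ DIM('a) = (2 * pi) powr (- real DIM('a) / 2)" .
  have "gauss x = of_real (\<Prod>b\<in>Basis. 1 / sqrt (2 * pi) * exp (- ((x \<bullet> b)^2) / 2))"
    by (simp only: gauss_def of_real_prod std_normal_density_def)
  also have "(\<Prod>b\<in>Basis. 1 / sqrt (2 * pi) * exp (- ((x \<bullet> b)^2) / 2)) = (1 / sqrt (2 * pi)) ^ DIM('a) * exp (- ((norm x)^2) / 2)"
    by (simp only: prod.distrib prod_constant e exp_sum[OF finite_Basis])
  finally show ?thesis by (simp only: c of_real_mult)
qed

lemma gauss_integrable: "integrable lborel gauss"
  and gauss_integral: "(\<integral>x. gauss x \<partial>lborel) = 1"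
  using gauss_char[of 0] by simp_all

lemma gauss_measurable [measurable]: "gauss \<in> borel_measurable borel"
  unfolding gauss_def[abs_def] by measurable

text \<open>Without the Gaussian factor the double integral is not absolutely convergent. With it
  Fubini applies, and the inner integral is evaluated because the Gaussian is its own transform up
  to constants.\<close>

lemma inversion_regularised:
  fixes m :: "'a::euclidean_space \<Rightarrow> complex"
  assumes m: "integrable lborel m" and e: "e > 0"
  shows "(\<integral>z. exp (\<i> * of_real (z \<bullet> \<xi>)) * kern m z * of_real (exp (- ((norm (e *\<^sub>R z))^2) / 2)) \<partial>lborel)
       = (\<integral>x. m (\<xi> - e *\<^sub>R x) * gauss x \<partial>lborel)"
proof -
  have [measurable]: "m \<in> borel_measurable borel" using m by simp
  let ?c = "pc TYPE('a)"
  \<comment> \<open>One of the two constants \<open>pc\<close> in \<open>kern\<close> has been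
    absorbed into \<open>gauss\<close>, see \<open>gauss_eq\<close>.\<close>
  let ?F = "\<lambda>z \<eta>. (exp (\<i> * of_real (z \<bullet> (\<xi> - \<eta>))) * gauss (e *\<^sub>R z)) * (?c * m \<eta>)"
  have ge: "integrable lborel (\<lambda>z. gauss (e *\<^sub>R z))"
    using lborel_affine_integrable[OF gauss_integrable, of e 0] e by simp
  have inner: "(\<integral>z. exp (\<i> * of_real (z \<bullet> t)) * gauss (e *\<^sub>R z) \<partial>lborel) = of_real (1 / e^DIM('a)) * of_real (exp (- ((norm (t /\<^sub>R e))^2) / 2))" for t :: 'a
  proof -
    have "of_real (exp (- ((norm (t /\<^sub>R e))^2) / 2)) = (\<integral>x. exp (\<i> * of_real (x \<bullet> (t /\<^sub>R e))) * gauss x \<partial>lborel)"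
      by (rule gauss_char(2)[symmetric])
    also have "\<dots> = \<bar>e\<bar>^DIM('a) *\<^sub>R (\<integral>x. exp (\<i> * of_real ((0 + e *\<^sub>R x) \<bullet> (t /\<^sub>R e))) * gauss (0 + e *\<^sub>R x) \<partial>lborel)"
      by (rule lborel_affine_integral) (use e in \<open>auto intro!: measurable_compose[OF _ gauss_measurable]\<close>)
    also have "\<dots> = \<bar>e\<bar>^DIM('a) *\<^sub>R (\<integral>z. exp (\<i> * of_real (z \<bullet> t)) * gauss (e *\<^sub>R z) \<partial>lborel)"
    proof -
      have "(0 + e *\<^sub>R x) \<bullet> (t /\<^sub>R e) = x \<bullet> t" for x using e by simp
      moreover have "exp (\<i> * of_real (z \<bullet> t)) * gauss (e *\<^sub>R z) = exp (\<i> * of_real (z \<bullet> t)) * gauss (0 + e *\<^sub>R z)" for z :: 'a by simp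
      ultimately show ?thesis by (simp only:)
    qed
    finally show ?thesis using e by (simp add: scaleR_conv_of_real field_simps)
  qed
  have "(\<integral>z. exp (\<i> * of_real (z \<bullet> \<xi>)) * kern m z * of_real (exp (- ((norm (e *\<^sub>R z))^2) / 2)) \<partial>lborel)
      = (\<integral>z. (\<integral>\<eta>. ?F z \<eta> \<partial>lborel) \<partial>lborel)"
  proof (rule Bochner_Integration.integral_cong[OF refl])
    fix z :: 'a
    have "(\<integral>\<eta>. ?F z \<eta> \<partial>lborel) = (\<integral>\<eta>. (exp (\<i> * of_real (z \<bullet> \<xi>)) * gauss (e *\<^sub>R z) * ?c) * (exp (- (\<i> * of_real (\<eta> \<bullet> z))) * m \<eta>) \<partial>lborel)"
      by (rule Bochner_Integration.integral_cong[OF refl])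
        (simp add: inner_diff_right inner_commute right_diff_distrib exp_diff exp_minus field_simps)
    also have "\<dots> = (exp (\<i> * of_real (z \<bullet> \<xi>)) * gauss (e *\<^sub>R z) * ?c) * (\<integral>\<eta>. exp (- (\<i> * of_real (\<eta> \<bullet> z))) * m \<eta> \<partial>lborel)"
      by simp
    finally show "exp (\<i> * of_real (z \<bullet> \<xi>)) * kern m z * of_real (exp (- ((norm (e *\<^sub>R z))^2) / 2)) = (\<integral>\<eta>. ?F z \<eta> \<partial>lborel)"
      by (simp only: kern_def' gauss_eq mult_ac)
  qed
  also have "\<dots> = (\<integral>\<eta>. (\<integral>z. ?F z \<eta> \<partial>lborel) \<partial>lborel)"
  proof (rule lborel_fubini_swap)
    show "integrable lborel (\<lambda>z. norm (gauss (e *\<^sub>R z)))" using ge by (rule integrable_norm)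
    show "integrable lborel (\<lambda>\<eta>. norm (?c * m \<eta>))" using m by (intro integrable_norm integrable_mult_right)
    show "(\<lambda>(z, \<eta>). ?F z \<eta>) \<in> borel_measurable (lborel \<Otimes>\<^sub>M lborel)" by measurable
    show "norm (?F z \<eta>) \<le> norm (gauss (e *\<^sub>R z)) * norm (?c * m \<eta>)" for z \<eta>
      by (simp only: norm_mult norm_exp_i mult_1_left)
  qed
  also have "\<dots> = (\<integral>\<eta>. m \<eta> * (of_real (1 / e^DIM('a)) * gauss ((\<xi> - \<eta>) /\<^sub>R e)) \<partial>lborel)"
    by (rule Bochner_Integration.integral_cong[OF refl], subst integral_mult_left_zero, subst inner) (simp only: gauss_eq mult_ac)
  also have "\<dots> = (\<integral>x. m (\<xi> - e *\<^sub>R x) * gauss x \<partial>lborel)"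
    by (subst lborel_affine_integral[where c="-e" and t=\<xi>]) (use e in \<open>auto simp: scaleR_conv_of_real\<close>)
  finally show ?thesis .
qed

text \<open>Let the regularisation tend to 0 on both sides of \<open>inversion_regularised\<close>:
  on the left \<open>kern m\<close> is an integrable majorant, on the right stands an average of the
  continuous bounded \<open>m\<close> over points tending to \<open>\<xi>\<close>.\<close>

lemma fourier_inversion:
  fixes m :: "'a::euclidean_space \<Rightarrow> complex"
  assumes m: "test_function m"
  shows "(\<integral>z. exp (\<i> * of_real (z \<bullet> \<xi>)) * kern m z \<partial>lborel) = m \<xi>"
proof -
  define e where "e n = 1 / real (Suc n)" for n
  have e: "e n > 0" for n by (simp add: e_def)
  have e0: "e \<longlonglongrightarrow> 0" unfolding e_def by (rule LIMSEQ_Suc) (rule lim_1_over_n)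
  have mS: "m \<in> schwartz" by (rule test_function_schwartz[OF m])
  note [measurable] = schwartz_measurable[OF mS] schwartz_measurable[OF schwartz_kern[OF m]]
  obtain C where C: "C \<ge> 0" "\<And>x. norm (m x) \<le> C" using rapidD[OF schwartz_rapid[OF mS], of 0] by auto
  have "(\<lambda>n. \<integral>x. m (\<xi> - e n *\<^sub>R x) * gauss x \<partial>lborel) \<longlonglongrightarrow> (\<integral>x. m \<xi> * gauss (x::'a) \<partial>lborel)"
  proof (rule integral_dominated_convergence[where w="\<lambda>x. C * norm (gauss x)"])
    show "integrable lborel (\<lambda>x. C * norm (gauss (x::'a)))" using gauss_integrable by auto
    show "AE x in lborel. (\<lambda>n. m (\<xi> - e n *\<^sub>R x) * gauss x) \<longlonglongrightarrow> m \<xi> * gauss x"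
    proof (rule AE_I2)
      fix x :: 'a
      have "isCont m \<xi>" using smooth_imp_continuous[OF schwartz_smooth[OF mS], of UNIV] by (simp add: continuous_on_eq_continuous_at)
      moreover have "(\<lambda>n. \<xi> - e n *\<^sub>R x) \<longlonglongrightarrow> \<xi>" by (rule tendsto_eq_intros e0 refl)+ simp
      ultimately have "(\<lambda>n. m (\<xi> - e n *\<^sub>R x)) \<longlonglongrightarrow> m \<xi>" by (rule isCont_tendsto_compose)
      then show "(\<lambda>n. m (\<xi> - e n *\<^sub>R x) * gauss x) \<longlonglongrightarrow> m \<xi> * gauss x" by (rule tendsto_mult_right)
    qed
    show "AE x in lborel. norm (m (\<xi> - e n *\<^sub>R x) * gauss x) \<le> C * norm (gauss x)" for n
      by (rule AE_I2) (auto simp: norm_mult intro!: mult_right_mono C)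
  qed measurable
  then have A: "(\<lambda>n. \<integral>x. m (\<xi> - e n *\<^sub>R x) * gauss x \<partial>lborel) \<longlonglongrightarrow> m \<xi>" by (simp add: gauss_integral)
  have "(\<lambda>n. \<integral>z. exp (\<i> * of_real (z \<bullet> \<xi>)) * kern m z * of_real (exp (- ((norm (e n *\<^sub>R z))^2) / 2)) \<partial>lborel)
     \<longlonglongrightarrow> (\<integral>z. exp (\<i> * of_real (z \<bullet> \<xi>)) * kern m z \<partial>lborel)"
  proof (rule integral_dominated_convergence)
    show "integrable lborel (\<lambda>z. norm (kern m z))" by (intro integrable_norm schwartz_integrable schwartz_kern m)
    show "AE z in lborel. (\<lambda>n. exp (\<i> * of_real (z \<bullet> \<xi>)) * kern m z * of_real (exp (- ((norm (e n *\<^sub>R z))^2) / 2)))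
       \<longlonglongrightarrow> exp (\<i> * of_real (z \<bullet> \<xi>)) * kern m z"
    proof (rule AE_I2)
      fix z :: 'a
      have "(\<lambda>n. exp (- ((norm (e n *\<^sub>R z))^2) / 2)) \<longlonglongrightarrow> exp (- ((norm (0 *\<^sub>R z))^2) / 2)"
        by (intro tendsto_intros e0) simp
      then have "(\<lambda>n. complex_of_real (exp (- ((norm (e n *\<^sub>R z))^2) / 2))) \<longlonglongrightarrow> of_real 1"
        by (intro tendsto_of_real) simp
      from tendsto_mult_left[OF this, of "exp (\<i> * of_real (z \<bullet> \<xi>)) * kern m z"]
      show "(\<lambda>n. exp (\<i> * of_real (z \<bullet> \<xi>)) * kern m z * of_real (exp (- ((norm (e n *\<^sub>R z))^2) / 2)))
       \<longlonglongrightarrow> exp (\<i> * of_real (z \<bullet> \<xi>)) * kern m z" by simp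
    qed
    show "AE z in lborel. norm (exp (\<i> * of_real (z \<bullet> \<xi>)) * kern m z * of_real (exp (- ((norm (e n *\<^sub>R z))^2) / 2))) \<le> norm (kern m z)" for n
      by (rule AE_I2) (simp add: norm_mult mult_left_le)
  qed measurable
  then have "(\<lambda>n. \<integral>x. m (\<xi> - e n *\<^sub>R x) * gauss x \<partial>lborel) \<longlonglongrightarrow> (\<integral>z. exp (\<i> * of_real (z \<bullet> \<xi>)) * kern m z \<partial>lborel)"
    by (simp only: inversion_regularised[OF test_function_integrable[OF m] e])
  from LIMSEQ_unique[OF this A] show ?thesis .
qed

lemma kern_integral: "test_function m \<Longrightarrow> (\<integral>z. kern m z \<partial>lborel) = m 0"
  using fourier_inversion[of m 0] by simp

text \<open>The left-hand side is what a dyadic block of a distribution does to a test function.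
  Blocks thereby become \<open>f\<close> applied to convolutions, and later estimates involve only
  the kernels.\<close>

lemma fourier_mult_inv_fourier:
  fixes m \<psi> :: "'a::euclidean_space \<Rightarrow> complex"
  assumes m: "integrable lborel m" and \<psi>: "integrable lborel \<psi>"
  shows "fourier (\<lambda>\<xi>. m \<xi> * inv_fourier \<psi> \<xi>) = conv (kern m) \<psi>"
proof
  fix x :: 'a
  have [measurable]: "m \<in> borel_measurable borel" "\<psi> \<in> borel_measurable borel" using m \<psi> by auto
  let ?c = "pc TYPE('a)"
  let ?F = "\<lambda>\<xi> y. (exp (- (\<i> * of_real (\<xi> \<bullet> (x - y)))) * m \<xi>) * ((?c * ?c) * \<psi> y)"
  have "fourier (\<lambda>\<xi>. m \<xi> * inv_fourier \<psi> \<xi>) x = (\<integral>\<xi>. (\<integral>y. ?F \<xi> y \<partial>lborel) \<partial>lborel)"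
  proof -
    have "(\<integral>y. ?F \<xi> y \<partial>lborel) = ?c * (exp (- (\<i> * of_real (\<xi> \<bullet> x))) * (m \<xi> * inv_fourier \<psi> \<xi>))" for \<xi>
    proof -
      have "(\<integral>y. ?F \<xi> y \<partial>lborel) = (\<integral>y. (?c * exp (- (\<i> * of_real (\<xi> \<bullet> x))) * m \<xi> * ?c) * (exp (\<i> * of_real (\<xi> \<bullet> y)) * \<psi> y) \<partial>lborel)"
        by (rule Bochner_Integration.integral_cong[OF refl])
          (simp add: inner_diff_right right_diff_distrib exp_diff exp_minus field_simps)
      also have "\<dots> = (?c * exp (- (\<i> * of_real (\<xi> \<bullet> x))) * m \<xi> * ?c) * (\<integral>y. exp (\<i> * of_real (\<xi> \<bullet> y)) * \<psi> y \<partial>lborel)"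
        by (rule integral_mult_right_zero)
      finally show ?thesis unfolding inv_fourier_def by (simp only: mult_ac)
    qed
    then have "(\<integral>\<xi>. (\<integral>y. ?F \<xi> y \<partial>lborel) \<partial>lborel) = ?c * (\<integral>\<xi>. exp (- (\<i> * of_real (\<xi> \<bullet> x))) * (m \<xi> * inv_fourier \<psi> \<xi>) \<partial>lborel)"
      by (simp only: integral_mult_right_zero)
    then show ?thesis unfolding fourier_def by simp
  qed
  also have "\<dots> = (\<integral>y. (\<integral>\<xi>. ?F \<xi> y \<partial>lborel) \<partial>lborel)"
  proof (rule lborel_fubini_swap)
    show "integrable lborel (\<lambda>\<xi>. norm (m \<xi>))" using m by (rule integrable_norm)
    show "integrable lborel (\<lambda>y. norm ((?c * ?c) * \<psi> y))" using \<psi> by (intro integrable_norm integrable_mult_right)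
    show "(\<lambda>(\<xi>, y). ?F \<xi> y) \<in> borel_measurable (lborel \<Otimes>\<^sub>M lborel)" by measurable
    show "norm (?F \<xi> y) \<le> norm (m \<xi>) * norm ((?c * ?c) * \<psi> y)" for \<xi> y
      by (simp only: norm_mult norm_exp_i mult_1_left)
  qed
  also have "\<dots> = conv (kern m) \<psi> x"
    unfolding conv_def kern_def' by (rule Bochner_Integration.integral_cong[OF refl], subst integral_mult_left_zero) (simp only: mult_ac)
  finally show "fourier (\<lambda>\<xi>. m \<xi> * inv_fourier \<psi> \<xi>) x = conv (kern m) \<psi> x" .
qed

lemma inv_fourier_conv_kern:
  fixes \<rho> \<psi> :: "'a::euclidean_space \<Rightarrow> complex"
  assumes \<rho>: "test_function \<rho>" and \<psi>: "integrable lborel \<psi>"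
  shows "inv_fourier (conv (kern \<rho>) \<psi>) \<xi> = \<rho> \<xi> * inv_fourier \<psi> \<xi>"
proof -
  note [measurable] = schwartz_measurable[OF schwartz_kern[OF \<rho>]]
  have [measurable]: "\<psi> \<in> borel_measurable borel" using \<psi> by auto
  let ?e = "\<lambda>x. exp (\<i> * of_real (\<xi> \<bullet> x))"
  have "(\<integral>x. ?e x * conv (kern \<rho>) \<psi> x \<partial>lborel) = (\<integral>x. (\<integral>y. ?e x * (kern \<rho> (x - y) * \<psi> y) \<partial>lborel) \<partial>lborel)"
    unfolding conv_def by simp
  also have "\<dots> = (\<integral>y. (\<integral>x. ?e x * (kern \<rho> (x - y) * \<psi> y) \<partial>lborel) \<partial>lborel)"
  proof -
    have "integrable (lborel \<Otimes>\<^sub>M lborel) (\<lambda>(y, x). ?e x * (kern \<rho> (x - y) * \<psi> y))"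
    proof (rule lborel_pair.Fubini_integrable)
      have "(\<integral>x. norm (case (y, x) of (y, x) \<Rightarrow> ?e x * (kern \<rho> (x - y) * \<psi> y)) \<partial>lborel) = (\<integral>x. norm (kern \<rho> x) \<partial>lborel) * norm (\<psi> y)" for y
        using lborel_integral_shift_reflect(2)[of "\<lambda>x. norm (kern \<rho> x)" y] by (simp add: norm_mult)
      then show "integrable lborel (\<lambda>y. \<integral>x. norm (case (y, x) of (y, x) \<Rightarrow> ?e x * (kern \<rho> (x - y) * \<psi> y)) \<partial>lborel)"
        using \<psi> by simp
      have "integrable lborel (\<lambda>x. ?e x * (kern \<rho> (x - y) * \<psi> y))" for y
      proof -
        have "integrable lborel (\<lambda>x. kern \<rho> (x - y) * \<psi> y)"
          by (intro integrable_mult_left lborel_integrable_shift_reflect schwartz_integrable schwartz_kern \<rho>)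
        then show ?thesis by (rule Bochner_Integration.integrable_bound) (auto simp: norm_mult)
      qed
      then show "AE y in lborel. integrable lborel (\<lambda>x. case (y, x) of (y, x) \<Rightarrow> ?e x * (kern \<rho> (x - y) * \<psi> y))" by simp
    qed measurable
    from lborel_pair.Fubini_integral[OF this] show ?thesis .
  qed
  also have "\<dots> = (\<integral>y. \<rho> \<xi> * (?e y * \<psi> y) \<partial>lborel)"
  proof (rule Bochner_Integration.integral_cong[OF refl])
    fix y :: 'a
    have "(\<integral>x. ?e x * (kern \<rho> (x - y) * \<psi> y) \<partial>lborel) = (\<integral>x. ?e y * \<psi> y * ((\<lambda>x. ?e x * kern \<rho> x) (x - y)) \<partial>lborel)"
      by (rule Bochner_Integration.integral_cong[OF refl]) (simp add: inner_diff_right right_diff_distrib exp_diff)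
    also have "\<dots> = ?e y * \<psi> y * (\<integral>x. ?e x * kern \<rho> x \<partial>lborel)"
      using lborel_integral_shift_reflect(2)[of "\<lambda>x. ?e x * kern \<rho> x" y] by simp
    also have "(\<integral>x. ?e x * kern \<rho> x \<partial>lborel) = \<rho> \<xi>" using fourier_inversion[OF \<rho>, of \<xi>] by (simp add: inner_commute)
    finally show "(\<integral>x. ?e x * (kern \<rho> (x - y) * \<psi> y) \<partial>lborel) = \<rho> \<xi> * (?e y * \<psi> y)" by (simp add: mult_ac)
  qed
  finally show ?thesis unfolding inv_fourier_def by simp
qed

text \<open>Composition of multipliers, read off on the frequency side: both members are
  \<open>fourier\<close> of the same product with \<open>inv_fourier \<psi>\<close>.\<close>

lemma conv_kern_kern:
  fixes m \<rho> :: "'a::euclidean_space \<Rightarrow> complex"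
  assumes m: "test_function m" and \<rho>: "test_function \<rho>" and \<psi>: "\<psi> \<in> schwartz"
  shows "conv (kern m) (conv (kern \<rho>) \<psi>) = conv (kern (\<lambda>\<xi>. m \<xi> * \<rho> \<xi>)) \<psi>"
proof -
  have i: "integrable lborel m" "integrable lborel \<psi>" "integrable lborel (\<lambda>\<xi>. m \<xi> * \<rho> \<xi>)"
    by (intro test_function_integrable m schwartz_integrable \<psi> test_function_mult \<rho> schwartz_smooth test_function_schwartz)+
  have "integrable lborel (conv (kern \<rho>) \<psi>)"
    by (intro schwartz_integrable schwartz_conv schwartz_kern \<rho> schwartz_rapid schwartz_measurable \<psi>)
  from fourier_mult_inv_fourier[OF i(1) this, symmetric] show ?thesis
    using fourier_mult_inv_fourier[OF i(3,2)] by (simp add: inv_fourier_conv_kern[OF \<rho> i(2)] mult.assoc)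
qed

section \<open>Approximation of the identity on Schwartz functions and on tempered
  distributions\<close>

lemma kern_scale:
  fixes m :: "'a::euclidean_space \<Rightarrow> complex"
  assumes [measurable]: "m \<in> borel_measurable borel" and c: "c > 0"
  shows "kern (\<lambda>\<xi>. m (\<xi> /\<^sub>R c)) z = of_real (c ^ DIM('a)) * kern m (c *\<^sub>R z)"
proof -
  have "(\<integral>\<xi>. exp (- (\<i> * of_real (\<xi> \<bullet> z))) * m (\<xi> /\<^sub>R c) \<partial>lborel)
      = \<bar>c\<bar>^DIM('a) *\<^sub>R (\<integral>\<xi>. exp (- (\<i> * of_real ((0 + c *\<^sub>R \<xi>) \<bullet> z))) * m ((0 + c *\<^sub>R \<xi>) /\<^sub>R c) \<partial>lborel)"
    by (rule lborel_affine_integral) (use c in auto)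
  also have "\<dots> = of_real (c ^ DIM('a)) * (\<integral>\<xi>. exp (- (\<i> * of_real (\<xi> \<bullet> (c *\<^sub>R z)))) * m \<xi> \<partial>lborel)"
    using c by (simp add: scaleR_conv_of_real)
  finally show ?thesis unfolding kern_def' by (simp only: mult_ac)
qed

lemma schwartz_diff: "f \<in> schwartz \<Longrightarrow> g \<in> schwartz \<Longrightarrow> (\<lambda>x. f x - g x) \<in> schwartz"
  for f g :: "'a::euclidean_space \<Rightarrow> complex"
proof -
  assume f: "f \<in> schwartz" and g: "g \<in> schwartz"
  have "rapid (iterated_partial bs (\<lambda>x. f x - g x))" if bs: "set bs \<subseteq> Basis" for bs
  proof (rule rapidI)
    fix n
    obtain C where C: "\<And>x. norm (iterated_partial bs f x) \<le> C * wt n x"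
      using rapidD[OF schwartz_rapid_iterated[OF f bs]] by blast
    obtain D where D: "\<And>x. norm (iterated_partial bs g x) \<le> D * wt n x"
      using rapidD[OF schwartz_rapid_iterated[OF g bs]] by blast
    have "norm (iterated_partial bs (\<lambda>x. f x - g x) x) \<le> (C + D) * wt n x" for x
      unfolding iterated_partial_diff[OF schwartz_smooth[OF f] schwartz_smooth[OF g] bs]
      using C[of x] D[of x] norm_triangle_ineq4[of "iterated_partial bs f x" "iterated_partial bs g x"]
      by (simp add: distrib_right)
    then show "\<exists>C. \<forall>x. norm (iterated_partial bs (\<lambda>x. f x - g x) x) \<le> C * wt n x" by blast
  qed
  then show ?thesis unfolding schwartz_iff using smooth_diff[OF schwartz_smooth[OF f] schwartz_smooth[OF g]] by blast
qed

text \<open>The kernel has integral \<open>\<Phi> 0 = 1\<close>, so the difference is a mean of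
  increments of \<open>g\<close> over vectors of length \<open>norm w / c\<close>. By
  \<open>schwartz_lipschitz\<close> these are of order \<open>1 / c\<close> and still decay in
  \<open>x\<close>.\<close>

lemma conv_approx:
  fixes \<Phi> :: "'a::euclidean_space \<Rightarrow> complex"
  assumes \<Phi>: "test_function \<Phi>" and \<Phi>0: "\<Phi> 0 = 1" and g: "g \<in> schwartz"
  shows "\<exists>B. \<forall>c\<ge>1. \<forall>x. norm (conv (kern (\<lambda>\<xi>. \<Phi> (\<xi> /\<^sub>R c))) g x - g x) \<le> B / c * wt n x"
proof -
  note K = schwartz_kern[OF \<Phi>]
  note [measurable] = schwartz_measurable[OF K] schwartz_measurable[OF g] schwartz_measurable[OF test_function_schwartz[OF \<Phi>]]
  obtain C where C: "C \<ge> 0" "\<And>x y. norm (g (x + y) - g x) \<le> C * norm y * (1 + norm y)^n * wt n x"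
    using schwartz_lipschitz[OF g] by blast
  let ?I = "\<integral>w. norm ((1 + norm w)^Suc n *\<^sub>R kern \<Phi> w) \<partial>lborel"
  have iI: "integrable lborel (\<lambda>w. norm ((1 + norm w)^Suc n *\<^sub>R kern \<Phi> w))"
    by (intro integrable_norm rapid_integrable schwartz_rapid schwartz_measurable K)
  have "norm (conv (kern (\<lambda>\<xi>. \<Phi> (\<xi> /\<^sub>R c))) g x - g x) \<le> (C * ?I) / c * wt n x" if c: "c \<ge> 1" for c x
  proof -
    have c0: "c > 0" using c by simp
    obtain G where G: "\<And>x. norm (g x) \<le> G" using rapidD[OF schwartz_rapid[OF g], of 0] by auto
    have i1: "integrable lborel (\<lambda>w. kern \<Phi> w * g (x - w /\<^sub>R c))"
    proof (rule Bochner_Integration.integrable_bound)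
      show "integrable lborel (\<lambda>w. norm (kern \<Phi> w) * G)" by (intro integrable_mult_left integrable_norm schwartz_integrable K)
    qed (auto simp: norm_mult intro!: AE_I2 order_trans[OF mult_left_mono[OF G] abs_ge_self])
    have "conv (kern (\<lambda>\<xi>. \<Phi> (\<xi> /\<^sub>R c))) g x = (\<integral>y. of_real (c ^ DIM('a)) * kern \<Phi> (c *\<^sub>R (x - y)) * g y \<partial>lborel)"
      unfolding conv_def using c0 by (subst kern_scale) auto
    \<comment> \<open>Substitution \<open>y = x - w / c\<close>, written as the affine map with
      factor \<open>- (1/c)\<close>.\<close>
    also have "\<dots> = \<bar>- (1/c)\<bar>^DIM('a) *\<^sub>R (\<integral>w. of_real (c ^ DIM('a)) * kern \<Phi> (c *\<^sub>R (x - (x + (- (1/c)) *\<^sub>R w))) * g (x + (- (1/c)) *\<^sub>R w) \<partial>lborel)"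
      by (rule lborel_affine_integral) (use c0 in auto)
    also have "\<dots> = (\<integral>w. kern \<Phi> w * g (x - w /\<^sub>R c) \<partial>lborel)"
    proof -
      have "of_real (c ^ DIM('a)) * kern \<Phi> (c *\<^sub>R (x - (x + (- (1/c)) *\<^sub>R w))) * g (x + (- (1/c)) *\<^sub>R w) = of_real (c ^ DIM('a)) * (kern \<Phi> w * g (x - w /\<^sub>R c))" for w
        using c0 by (simp add: inverse_eq_divide)
      then have "(\<integral>w. of_real (c ^ DIM('a)) * kern \<Phi> (c *\<^sub>R (x - (x + (- (1/c)) *\<^sub>R w))) * g (x + (- (1/c)) *\<^sub>R w) \<partial>lborel) = of_real (c ^ DIM('a)) * (\<integral>w. kern \<Phi> w * g (x - w /\<^sub>R c) \<partial>lborel)"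
        by (simp only: integral_mult_right_zero)
      then show ?thesis using c0 by (simp add: scaleR_conv_of_real power_one_over)
    qed
    finally have "conv (kern (\<lambda>\<xi>. \<Phi> (\<xi> /\<^sub>R c))) g x - g x = (\<integral>w. kern \<Phi> w * g (x - w /\<^sub>R c) \<partial>lborel) - (\<integral>w. kern \<Phi> w * g x \<partial>lborel)"
      using kern_integral[OF \<Phi>] \<Phi>0 by simp
    also have "\<dots> = (\<integral>w. kern \<Phi> w * (g (x - w /\<^sub>R c) - g x) \<partial>lborel)"
      using i1 schwartz_integrable[OF K]
      by (subst Bochner_Integration.integral_diff[symmetric]) (auto simp: right_diff_distrib)
    also have "norm \<dots> \<le> (\<integral>w. (C / c * wt n x) * norm ((1 + norm w)^Suc n *\<^sub>R kern \<Phi> w) \<partial>lborel)"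
    proof (rule Bochner_Integration.integral_norm_bound_integral)
      show "integrable lborel (\<lambda>w. kern \<Phi> w * (g (x - w /\<^sub>R c) - g x))"
        using i1 schwartz_integrable[OF K] by (simp add: right_diff_distrib)
      show "integrable lborel (\<lambda>w. (C / c * wt n x) * norm ((1 + norm w)^Suc n *\<^sub>R kern \<Phi> w))"
        using iI by (rule integrable_mult_right)
      fix w :: 'a
      have nw: "norm (- (w /\<^sub>R c)) = norm w / c" using c0 by (simp add: inverse_eq_divide)
      have nle: "norm w / c \<le> norm w" using c by (simp add: divide_le_eq mult_left_le_one_le mult_le_cancel_left1)
      have "norm (g (x - w /\<^sub>R c) - g x) \<le> C * (norm w / c) * (1 + norm w / c)^n * wt n x"
        using C(2)[of x "- (w /\<^sub>R c)"] unfolding nw by simp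
      also have "\<dots> \<le> C * ((1 + norm w) / c) * (1 + norm w)^n * wt n x"
        using C(1) c0 nle by (intro mult_right_mono mult_mono mult_left_mono power_mono divide_right_mono) auto
      finally have "norm (kern \<Phi> w) * norm (g (x - w /\<^sub>R c) - g x) \<le> norm (kern \<Phi> w) * (C * ((1 + norm w) / c) * (1 + norm w)^n * wt n x)"
        by (rule mult_left_mono) simp
      then show "norm (kern \<Phi> w * (g (x - w /\<^sub>R c) - g x)) \<le> (C / c * wt n x) * norm ((1 + norm w)^Suc n *\<^sub>R kern \<Phi> w)"
        using c0 by (simp add: norm_mult mult_ac)
    qed
    also have "\<dots> = (C * ?I) / c * wt n x" by simp
    finally show ?thesis .
  qed
  then show ?thesis by (intro exI[of _ "C * ?I"]) auto
qed

text \<open>A basic neighbourhood of \<open>\<psi>\<close> involves only the finitely many seminorms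
  whose power and length are at most \<open>N\<close>, so convergence in each seminorm separately is
  enough.\<close>

lemma tempered_tendsto:
  fixes T :: "'a::euclidean_space distr"
  assumes T: "tempered T" and \<psi>: "\<psi> \<in> schwartz" "\<And>i. \<Psi> i \<in> schwartz"
    and lim: "\<And>k bs e. set bs \<subseteq> Basis \<Longrightarrow> e > 0 \<Longrightarrow>
      \<forall>\<^sub>F i in sequentially. schwartz_seminorm k bs (\<lambda>x. \<Psi> i x - \<psi> x) < e"
  shows "(\<lambda>i. T (\<Psi> i)) \<longlonglongrightarrow> T \<psi>"
proof (rule topological_tendstoI)
  fix S assume S: "open S" "T \<psi> \<in> S"
  have "openin schwartz_topology {f \<in> topspace schwartz_topology. T f \<in> S}"
    using T S(1) unfolding tempered_def by (intro openin_continuous_map_preimage[of _ euclidean]) auto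
  then obtain N e where e: "e > 0" "schwartz_nbhd \<psi> N e \<subseteq> {f \<in> schwartz. T f \<in> S}"
    using S(2) \<psi>(1) unfolding openin_schwartz_topology topspace_schwartz_topology by blast
  let ?P = "{..N} \<times> {bs::'a list. set bs \<subseteq> Basis \<and> length bs \<le> N}"
  have "finite ?P" by (intro finite_cartesian_product finite_atMost finite_lists_length_le finite_Basis)
  then have "\<forall>\<^sub>F i in sequentially. \<forall>p\<in>?P. schwartz_seminorm (fst p) (snd p) (\<lambda>x. \<Psi> i x - \<psi> x) < e"
    by (rule eventually_ball_finite) (auto intro!: lim e(1))
  then show "\<forall>\<^sub>F i in sequentially. T (\<Psi> i) \<in> S"
  proof eventually_elim
    case (elim i)
    then have "\<Psi> i \<in> schwartz_nbhd \<psi> N e" unfolding schwartz_nbhd_def using \<psi>(2) by auto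
    with e(2) show ?case by blast
  qed
qed

text \<open>Derivatives commute with the convolution, so \<open>conv_approx\<close> for each
  derivative of \<open>\<psi>\<close> gives convergence of order \<open>1 / 2^i\<close> in every
  seminorm.\<close>

lemma tempered_conv_approx:
  fixes \<Phi> :: "'a::euclidean_space \<Rightarrow> complex"
  assumes T: "tempered T" and \<Phi>: "test_function \<Phi>" and \<Phi>0: "\<Phi> 0 = 1" and \<psi>: "\<psi> \<in> schwartz"
  shows "(\<lambda>i. T (conv (kern (\<lambda>\<xi>. \<Phi> (\<xi> /\<^sub>R 2^i))) \<psi>)) \<longlonglongrightarrow> T \<psi>"
proof (rule tempered_tendsto[OF T \<psi>])
  have tf: "test_function (\<lambda>\<xi>. \<Phi> (\<xi> /\<^sub>R 2^i))" for i by (rule test_function_scale[OF \<Phi>]) simp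
  note KS = schwartz_kern[OF tf]
  show "conv (kern (\<lambda>\<xi>. \<Phi> (\<xi> /\<^sub>R 2^i))) \<psi> \<in> schwartz" for i
    by (intro schwartz_conv KS schwartz_rapid schwartz_measurable \<psi>)
  fix k :: nat and bs :: "'a list" and e :: real
  assume bs: "set bs \<subseteq> Basis" and e: "e > 0"
  note g = schwartz_iterated_partial[OF \<psi> bs]
  obtain B where B: "\<And>c x. c \<ge> 1 \<Longrightarrow> norm (conv (kern (\<lambda>\<xi>. \<Phi> (\<xi> /\<^sub>R c))) (iterated_partial bs \<psi>) x - iterated_partial bs \<psi> x) \<le> B / c * wt k x"
    using conv_approx[OF \<Phi> \<Phi>0 g] by blast
  have bound: "schwartz_seminorm k bs (\<lambda>x. conv (kern (\<lambda>\<xi>. \<Phi> (\<xi> /\<^sub>R 2^i))) \<psi> x - \<psi> x) \<le> B / 2^i" for i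
    unfolding schwartz_seminorm_def
  proof (rule cSUP_least)
    fix x :: 'a
    have comm: "conv (kern (\<lambda>\<xi>. \<Phi> (\<xi> /\<^sub>R 2^i))) h = conv h (kern (\<lambda>\<xi>. \<Phi> (\<xi> /\<^sub>R 2^i)))" if "h \<in> schwartz" for h
      by (rule ext, rule conv_commute) (intro schwartz_measurable KS that)+
    have "iterated_partial bs (\<lambda>x. conv (kern (\<lambda>\<xi>. \<Phi> (\<xi> /\<^sub>R 2^i))) \<psi> x - \<psi> x) = (\<lambda>x. iterated_partial bs (conv (kern (\<lambda>\<xi>. \<Phi> (\<xi> /\<^sub>R 2^i))) \<psi>) x - iterated_partial bs \<psi> x)"
      by (intro iterated_partial_diff smooth_conv KS schwartz_integrable schwartz_smooth \<psi> bs)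
    also have "iterated_partial bs (conv (kern (\<lambda>\<xi>. \<Phi> (\<xi> /\<^sub>R 2^i))) \<psi>) = conv (kern (\<lambda>\<xi>. \<Phi> (\<xi> /\<^sub>R 2^i))) (iterated_partial bs \<psi>)"
      unfolding comm[OF \<psi>] comm[OF g] by (intro iterated_partial_conv \<psi> schwartz_integrable KS bs)
    finally have "norm (iterated_partial bs (\<lambda>x. conv (kern (\<lambda>\<xi>. \<Phi> (\<xi> /\<^sub>R 2^i))) \<psi> x - \<psi> x) x) \<le> B / 2^i * wt k x"
      using B[of "2^i" x] by simp
    then have "norm x ^ k * norm (iterated_partial bs (\<lambda>x. conv (kern (\<lambda>\<xi>. \<Phi> (\<xi> /\<^sub>R 2^i))) \<psi> x - \<psi> x) x) \<le> (1 + norm x)^k * (B / 2^i * wt k x)"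
      by (intro mult_mono power_mono) auto
    then show "norm x ^ k * norm (iterated_partial bs (\<lambda>x. conv (kern (\<lambda>\<xi>. \<Phi> (\<xi> /\<^sub>R 2^i))) \<psi> x - \<psi> x) x) \<le> B / 2^i"
      by (simp add: mult.left_commute[of "(1 + norm x)^k"])
  qed simp
  have "(\<lambda>i. B / 2^i) \<longlonglongrightarrow> 0" by (rule LIMSEQ_divide_realpow_zero) simp
  then have "\<forall>\<^sub>F i in sequentially. B / 2^i < e" using e by (rule order_tendstoD)
  then show "\<forall>\<^sub>F i in sequentially. schwartz_seminorm k bs (\<lambda>x. conv (kern (\<lambda>\<xi>. \<Phi> (\<xi> /\<^sub>R 2^i))) \<psi> x - \<psi> x) < e"
    by eventually_elim (use bound in \<open>auto intro: le_less_trans\<close>)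
qed

section \<open>Functions as tempered distributions\<close>

lemma rapid_indicator_bounded:
  assumes "bounded U"
  shows "rapid (indicator U :: 'a::real_normed_vector \<Rightarrow> complex)"
proof (rule rapidI)
  fix n
  obtain R where R: "\<And>x. x \<in> U \<Longrightarrow> norm x \<le> R" using assms bounded_iff by blast
  have "norm (indicator U x :: complex) \<le> (1 + \<bar>R\<bar>)^n * wt n x" for x :: 'a
  proof (cases "x \<in> U")
    case True
    have "(1 + norm x)^n * wt n x \<le> (1 + \<bar>R\<bar>)^n * wt n x"
      using R[OF True] by (intro mult_right_mono power_mono) auto
    then show ?thesis using True by simp
  qed simp
  then show "\<exists>C. \<forall>x. norm (indicator U x :: complex) \<le> C * wt n x" by blast
qed

lemma wt_integrable_mult:
  fixes h :: "'a::euclidean_space \<Rightarrow> complex"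
  assumes "integrable lborel (\<lambda>x. wt L x *\<^sub>R h x)" and [measurable]: "h \<in> borel_measurable borel" "\<psi> \<in> borel_measurable borel"
    and "\<And>x. norm (\<psi> x) \<le> C * wt L x"
  shows "integrable lborel (\<lambda>x. h x * \<psi> x)"
proof (rule Bochner_Integration.integrable_bound)
  show "integrable lborel (\<lambda>x. C *\<^sub>R (wt L x *\<^sub>R h x))" using assms(1) by (rule integrable_scaleR_right)
  show "AE x in lborel. norm (h x * \<psi> x) \<le> norm (C *\<^sub>R (wt L x *\<^sub>R h x))"
  proof (rule AE_I2)
    fix x
    have "norm (h x) * norm (\<psi> x) \<le> norm (h x) * \<bar>C * wt L x\<bar>"
      by (rule mult_left_mono[OF order_trans[OF assms(4) abs_ge_self]]) simp
    then show "norm (h x * \<psi> x) \<le> norm (C *\<^sub>R (wt L x *\<^sub>R h x))" by (simp add: norm_mult abs_mult mult_ac)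
  qed
qed measurable

text \<open>Indicators of bounded sets as limits of smooth rapidly decreasing functions: the first
  claim is the common majorant for dominated convergence, the second the limit at every point near
  which the indicator is constant.\<close>

lemma conv_approx_indicator:
  fixes \<Phi> :: "'a::euclidean_space \<Rightarrow> complex"
  assumes \<Phi>: "test_function \<Phi>" and \<Phi>0: "\<Phi> 0 = 1" and U: "bounded U" "U \<in> sets borel"
  shows "\<exists>B. \<forall>i x. norm (conv (kern (\<lambda>\<xi>. \<Phi> (\<xi> /\<^sub>R 2^i))) (indicator U) x) \<le> B * wt L x"
    and "open V \<Longrightarrow> x \<in> V \<Longrightarrow> (\<And>y. y \<in> V \<Longrightarrow> indicator U y = (a::complex)) \<Longrightarrow>
       (\<lambda>i. conv (kern (\<lambda>\<xi>. \<Phi> (\<xi> /\<^sub>R 2^i))) (indicator U) x) \<longlonglongrightarrow> a"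
proof -
  note K = schwartz_kern[OF \<Phi>]
  note [measurable] = schwartz_measurable[OF K] schwartz_measurable[OF test_function_schwartz[OF \<Phi>]] U(2)
  have eq: "conv (kern (\<lambda>\<xi>. \<Phi> (\<xi> /\<^sub>R 2^i))) (indicator U) x = (\<integral>w. kern \<Phi> w * indicator U (x - w /\<^sub>R 2^i) \<partial>lborel)" for i x
  proof -
    define c :: real where "c = 2^i"
    have c0: "c > 0" by (simp add: c_def)
    have "conv (kern (\<lambda>\<xi>. \<Phi> (\<xi> /\<^sub>R c))) (indicator U) x = (\<integral>y. of_real (c ^ DIM('a)) * kern \<Phi> (c *\<^sub>R (x - y)) * indicator U y \<partial>lborel)"
      unfolding conv_def using c0 by (subst kern_scale) auto
    also have "\<dots> = \<bar>- (1/c)\<bar>^DIM('a) *\<^sub>R (\<integral>w. of_real (c ^ DIM('a)) * kern \<Phi> (c *\<^sub>R (x - (x + (- (1/c)) *\<^sub>R w))) * indicator U (x + (- (1/c)) *\<^sub>R w) \<partial>lborel)"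
      by (rule lborel_affine_integral) (use c0 in auto)
    also have "\<dots> = (\<integral>w. kern \<Phi> w * indicator U (x - w /\<^sub>R c) \<partial>lborel)"
    proof -
      have "of_real (c ^ DIM('a)) * kern \<Phi> (c *\<^sub>R (x - (x + (- (1/c)) *\<^sub>R w))) * indicator U (x + (- (1/c)) *\<^sub>R w) = of_real (c ^ DIM('a)) * (kern \<Phi> w * indicator U (x - w /\<^sub>R c))" for w
        using c0 by (simp add: inverse_eq_divide)
      then have "(\<integral>w. of_real (c ^ DIM('a)) * kern \<Phi> (c *\<^sub>R (x - (x + (- (1/c)) *\<^sub>R w))) * indicator U (x + (- (1/c)) *\<^sub>R w) \<partial>lborel) = of_real (c ^ DIM('a)) * (\<integral>w. kern \<Phi> w * indicator U (x - w /\<^sub>R c) \<partial>lborel)"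
        by (simp only: integral_mult_right_zero)
      then show ?thesis using c0 by (simp add: scaleR_conv_of_real power_one_over)
    qed
    finally show ?thesis by (simp add: c_def)
  qed
  have ii: "integrable lborel (\<lambda>w. kern \<Phi> w * indicator U (x - w /\<^sub>R 2^i))" for x i
    by (rule Bochner_Integration.integrable_bound[OF schwartz_integrable[OF K]])
      (auto simp: norm_mult indicator_def)
  obtain C where C: "C \<ge> 0" "\<And>x. norm (indicator U x :: complex) \<le> C * wt L x"
    using rapidD[OF rapid_indicator_bounded[OF U(1)]] by blast
  let ?I = "\<integral>w. norm ((1 + norm w)^L *\<^sub>R kern \<Phi> w) \<partial>lborel"
  have iI: "integrable lborel (\<lambda>w. norm ((1 + norm w)^L *\<^sub>R kern \<Phi> w))"
    by (intro integrable_norm rapid_integrable schwartz_rapid schwartz_measurable K)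
  have "norm (conv (kern (\<lambda>\<xi>. \<Phi> (\<xi> /\<^sub>R 2^i))) (indicator U) x) \<le> (C * ?I) * wt L x" for i x
  proof -
    have "norm (\<integral>w. kern \<Phi> w * indicator U (x - w /\<^sub>R 2^i) \<partial>lborel) \<le> (\<integral>w. (C * wt L x) * norm ((1 + norm w)^L *\<^sub>R kern \<Phi> w) \<partial>lborel)"
    proof (rule Bochner_Integration.integral_norm_bound_integral[OF ii])
      show "integrable lborel (\<lambda>w. (C * wt L x) * norm ((1 + norm w)^L *\<^sub>R kern \<Phi> w))"
        using iI by (rule integrable_mult_right)
      fix w :: 'a
      have "norm (- (w /\<^sub>R 2^i)) \<le> norm w"
        by (simp add: mult_left_le_one_le inverse_le_1_iff)
      then have "(1 + norm (- (w /\<^sub>R 2^i)))^L * wt L x \<le> (1 + norm w)^L * wt L x"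
        by (intro mult_right_mono power_mono) auto
      then have "wt L (x - w /\<^sub>R 2^i) \<le> (1 + norm w)^L * wt L x"
        using wt_shift[of L x "- (w /\<^sub>R 2^i)"] by (metis (no_types) order_trans uminus_add_conv_diff add.commute)
      then have "norm (indicator U (x - w /\<^sub>R 2^i) :: complex) \<le> C * ((1 + norm w)^L * wt L x)"
        using C order_trans mult_left_mono by blast
      then have "norm (kern \<Phi> w) * norm (indicator U (x - w /\<^sub>R 2^i) :: complex) \<le> norm (kern \<Phi> w) * (C * ((1 + norm w)^L * wt L x))"
        by (rule mult_left_mono) simp
      then show "norm (kern \<Phi> w * indicator U (x - w /\<^sub>R 2^i)) \<le> (C * wt L x) * norm ((1 + norm w)^L *\<^sub>R kern \<Phi> w)"
        by (simp only: norm_mult norm_scaleR) (simp add: mult_ac)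
    qed
    also have "\<dots> = (C * ?I) * wt L x" by simp
    finally show ?thesis unfolding eq .
  qed
  then show "\<exists>B. \<forall>i x. norm (conv (kern (\<lambda>\<xi>. \<Phi> (\<xi> /\<^sub>R 2^i))) (indicator U) x) \<le> B * wt L x" by blast
  assume V: "open V" "x \<in> V" "\<And>y. y \<in> V \<Longrightarrow> indicator U y = a"
  have "(\<lambda>i. \<integral>w. kern \<Phi> w * indicator U (x - w /\<^sub>R 2^i) \<partial>lborel) \<longlonglongrightarrow> (\<integral>w. kern \<Phi> w * a \<partial>lborel)"
  proof (rule integral_dominated_convergence[where w="\<lambda>w. norm (kern \<Phi> w)"])
    show "integrable lborel (\<lambda>w. norm (kern \<Phi> w))" by (intro integrable_norm schwartz_integrable K)
    show "AE w in lborel. (\<lambda>i. kern \<Phi> w * indicator U (x - w /\<^sub>R 2^i)) \<longlonglongrightarrow> kern \<Phi> w * a"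
    proof (rule AE_I2)
      fix w :: 'a
      have "(\<lambda>i. inverse ((2::real)^i)) \<longlonglongrightarrow> 0" using LIMSEQ_inverse_realpow_zero[of 2] by simp
      then have "(\<lambda>i. x - inverse ((2::real)^i) *\<^sub>R w) \<longlonglongrightarrow> x - 0 *\<^sub>R w" by (intro tendsto_intros)
      then have "\<forall>\<^sub>F i in sequentially. x - w /\<^sub>R 2^i \<in> V" using V(1,2) by (simp add: topological_tendstoD)
      then have "\<forall>\<^sub>F i in sequentially. kern \<Phi> w * indicator U (x - w /\<^sub>R 2^i) = kern \<Phi> w * a"
        by eventually_elim (simp add: V(3))
      then show "(\<lambda>i. kern \<Phi> w * indicator U (x - w /\<^sub>R 2^i)) \<longlonglongrightarrow> kern \<Phi> w * a" by (rule tendsto_eventually)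
    qed
    show "AE w in lborel. norm (kern \<Phi> w * indicator U (x - w /\<^sub>R 2^i)) \<le> norm (kern \<Phi> w)" for i
      by (rule AE_I2) (auto simp: norm_mult indicator_def)
  qed measurable
  then show "(\<lambda>i. conv (kern (\<lambda>\<xi>. \<Phi> (\<xi> /\<^sub>R 2^i))) (indicator U) x) \<longlonglongrightarrow> a"
    unfolding eq by (simp add: kern_integral[OF \<Phi>] \<Phi>0)
qed

text \<open>Indicators of boxes are limits of Schwartz functions under a common majorant, hence
  \<open>h\<close> has integral 0 over each box; a Dynkin class argument extends this to Borel sets.
  \<open>\<Phi>\<close> supplies the approximate identity.\<close>

lemma AE_zero_of_schwartz_pairing:
  fixes h :: "'a::euclidean_space \<Rightarrow> complex"
  assumes \<Phi>: "test_function \<Phi>" and \<Phi>0: "\<Phi> (0::'a) = 1"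
    and hm [measurable]: "h \<in> borel_measurable borel" and hL: "integrable lborel (\<lambda>x. wt L x *\<^sub>R h x)"
    and zero: "\<And>\<psi>. \<psi> \<in> schwartz \<Longrightarrow> (\<integral>x. h x * \<psi> x \<partial>lborel) = 0"
  shows "AE x in lborel. h x = 0"
proof -
  have tf: "test_function (\<lambda>\<xi>. \<Phi> (\<xi> /\<^sub>R 2^i))" for i by (rule test_function_scale[OF \<Phi>]) simp
  have box0: "(\<integral>x. h x * indicator (box a b) x \<partial>lborel) = 0" for a b :: 'a
  proof -
    let ?U = "box a b"
    let ?\<psi> = "\<lambda>i. conv (kern (\<lambda>\<xi>. \<Phi> (\<xi> /\<^sub>R 2^i))) (indicator ?U)"
    have S: "?\<psi> i \<in> schwartz" for i
      by (intro schwartz_conv schwartz_kern tf rapid_indicator_bounded) (auto simp: bounded_box)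
    note [measurable] = schwartz_measurable[OF S]
    obtain B where B: "\<And>i x. norm (?\<psi> i x) \<le> B * wt L x"
      using conv_approx_indicator(1)[OF \<Phi> \<Phi>0, of ?U L] by (auto simp: bounded_box)
    \<comment> \<open>On the faces of the box the convolutions need not converge to the indicator,
      but the faces form a null set.\<close>
    have fr: "AE x in lborel. x \<notin> cbox a b - ?U"
    proof (rule AE_not_in, rule null_setsI)
      show "emeasure lborel (cbox a b - ?U) = 0"
        by (subst emeasure_Diff) (auto simp: emeasure_lborel_box_eq emeasure_lborel_cbox_eq box_subset_cbox)
    qed auto
    have "(\<lambda>i. \<integral>x. h x * ?\<psi> i x \<partial>lborel) \<longlonglongrightarrow> (\<integral>x. h x * indicator ?U x \<partial>lborel)"
    proof (rule integral_dominated_convergence[where w="\<lambda>x. \<bar>B\<bar> * norm (wt L x *\<^sub>R h x)"])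
      show "integrable lborel (\<lambda>x. \<bar>B\<bar> * norm (wt L x *\<^sub>R h x))" using hL by (intro integrable_mult_right integrable_norm)
      show "AE x in lborel. (\<lambda>i. h x * ?\<psi> i x) \<longlonglongrightarrow> h x * indicator ?U x"
        using fr
      proof eventually_elim
        case (elim x)
        have "(\<lambda>i. ?\<psi> i x) \<longlonglongrightarrow> indicator ?U x"
        proof (cases "x \<in> ?U")
          case True
          then show ?thesis by (intro conv_approx_indicator(2)[OF \<Phi> \<Phi>0, where V="?U"]) (auto simp: bounded_box)
        next
          case False
          then have "x \<in> - cbox a b" using elim by blast
          moreover have "y \<in> - cbox a b \<Longrightarrow> indicator ?U y = (0::complex)" for y using box_subset_cbox by (auto simp: indicator_def)
          ultimately show ?thesis using False
            by (intro conv_approx_indicator(2)[OF \<Phi> \<Phi>0, where V="- cbox a b"]) (auto simp: bounded_box closed_cbox)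
        qed
        then show ?case by (rule tendsto_mult_left)
      qed
      show "AE x in lborel. norm (h x * ?\<psi> i x) \<le> \<bar>B\<bar> * norm (wt L x *\<^sub>R h x)" for i
      proof (rule AE_I2)
        fix x
        have "norm (?\<psi> i x) \<le> \<bar>B\<bar> * wt L x"
          using B[of i x] mult_right_mono[OF abs_ge_self[of B] wt_nonneg[of L x]] by linarith
        from mult_left_mono[OF this norm_ge_zero[of "h x"]]
        show "norm (h x * ?\<psi> i x) \<le> \<bar>B\<bar> * norm (wt L x *\<^sub>R h x)" by (simp add: norm_mult mult_ac)
      qed
    qed measurable
    moreover have "(\<integral>x. h x * ?\<psi> i x \<partial>lborel) = 0" for i by (rule zero[OF S])
    ultimately have "(\<lambda>i. 0) \<longlonglongrightarrow> (\<integral>x. h x * indicator ?U x \<partial>lborel)" by (simp only:)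
    then show ?thesis by (simp add: LIMSEQ_const_iff)
  qed
  \<comment> \<open>Only the weighted \<open>h\<close> is known to be integrable; cutting
    \<open>h\<close> off to a bounded box makes it integrable, as \<open>density_zero\<close>
    demands.\<close>
  have "AE x in lborel. indicator (box (- (real n *\<^sub>R One)) (real n *\<^sub>R One)) x *\<^sub>R h x = 0" for n
  proof -
    let ?Q = "box (- (real n *\<^sub>R One)) (real n *\<^sub>R One) :: 'a set"
    let ?f = "\<lambda>x. indicator ?Q x *\<^sub>R h x"
    have int: "integrable lborel ?f"
    proof -
      obtain C where C: "C \<ge> 0" "\<And>x. norm (indicator ?Q x :: complex) \<le> C * wt L x"
        using rapidD[OF rapid_indicator_bounded[OF bounded_box]] by blast
      have "integrable lborel (\<lambda>x. h x * (indicator ?Q x :: complex))"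
        by (rule wt_integrable_mult[OF hL]) (use C in auto)
      moreover have "(\<lambda>x. h x * (indicator ?Q x :: complex)) = ?f" by (auto simp: indicator_def)
      ultimately show ?thesis by simp
    qed
    show ?thesis
    proof (rule sigma_finite_measure.density_zero[OF sigma_finite_lborel int])
      fix A :: "'a set" assume "A \<in> sets lborel"
      then have A: "A \<in> sigma_sets UNIV (range (\<lambda>(a, b). box a b))" by (simp add: borel_eq_box)
      have Int: "Int_stable (range (\<lambda>(a, b). box a b :: 'a set))"
        by (auto simp: Int_stable_def box_Int_box)
      have Pow: "range (\<lambda>(a, b). box a b :: 'a set) \<subseteq> Pow UNIV" by simp
      \<comment> \<open>Boxes are stable under intersection and generate the Borel sets; the sets
        over which the integral vanishes are closed under complements and disjoint unions.\<close>
      from Int Pow A show "(LINT x:A|lborel. ?f x) = 0"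
      proof (induction rule: sigma_sets_induct_disjoint)
        case (basic A)
        then obtain a b where A: "A = box a b" by auto
        obtain c d where cd: "box a b \<inter> ?Q = box c d" using box_Int_box by blast
        have "(LINT x:A|lborel. ?f x) = (\<integral>x. h x * indicator (box c d) x \<partial>lborel)"
          unfolding set_lebesgue_integral_def A cd[symmetric]
          by (rule Bochner_Integration.integral_cong[OF refl]) (auto simp: indicator_def)
        then show ?case using box0 by simp
      next
        case empty show ?case by (simp add: set_lebesgue_integral_def)
      next
        case (compl A)
        have Am [measurable]: "A \<in> sets borel" using compl(1) by (simp add: borel_eq_box)
        have "(LINT x:UNIV - A|lborel. ?f x) = (\<integral>x. ?f x - indicator A x *\<^sub>R ?f x \<partial>lborel)"
          unfolding set_lebesgue_integral_def
          by (rule Bochner_Integration.integral_cong[OF refl]) (auto simp: indicator_def)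
        also have "\<dots> = (\<integral>x. ?f x \<partial>lborel) - (\<integral>x. indicator A x *\<^sub>R ?f x \<partial>lborel)"
          by (rule Bochner_Integration.integral_diff[OF int integrable_mult_indicator[OF _ int]]) simp
        also have "(\<integral>x. ?f x \<partial>lborel) = (\<integral>x. h x * indicator ?Q x \<partial>lborel)"
          by (rule Bochner_Integration.integral_cong[OF refl]) (auto simp: indicator_def)
        also have "\<dots> = 0" by (rule box0)
        finally show ?case using compl(2) by (simp add: set_lebesgue_integral_def)
      next
        case (union A)
        have [measurable]: "A i \<in> sets borel" for i using union(2) by (auto simp: borel_eq_box)
        have "set_integrable lborel (\<Union>i. A i) ?f"
          unfolding set_integrable_def by (rule integrable_mult_indicator[OF _ int]) simp
        then have "(LINT x:(\<Union>i. A i)|lborel. ?f x) = (\<Sum>i. (LINT x:(A i)|lborel. ?f x))"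
          by (intro lebesgue_integral_countable_add)
            (use union(1) in \<open>auto simp: disjoint_family_on_def\<close>)
        then show ?case using union(3) by simp
      qed
    qed
  qed
  then have "AE x in lborel. \<forall>n. indicator (box (- (real n *\<^sub>R One)) (real n *\<^sub>R One)) x *\<^sub>R h x = 0"
    unfolding AE_all_countable by blast
  then show ?thesis
  proof eventually_elim
    case (elim x)
    obtain n where "norm x < real n" using reals_Archimedean2 by blast
    then have "x \<in> box (- (real n *\<^sub>R One)) (real n *\<^sub>R One)"
      using Basis_le_norm[of _ x] by (fastforce simp: box_def abs_le_iff)
    then show ?case using elim[rule_format, of n] by simp
  qed
qed

text \<open>A decreasing radial weight of rapid decay need not be smooth, but a constant times the
  Schwartz function \<open>conv \<rho> w\<close> dominates it: \<open>\<rho>\<close> is nonnegative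
  and equals 1 on the unit ball, and on the unit ball about \<open>x\<close> the shifted weight is
  at least \<open>v (norm x)\<close>.\<close>

lemma integrable_against_decreasing:
  fixes g :: "'a::euclidean_space \<Rightarrow> complex"
  assumes g [measurable]: "g \<in> borel_measurable borel"
    and gint: "\<And>\<psi>. \<psi> \<in> schwartz \<Longrightarrow> integrable lborel (\<lambda>x. g x * \<psi> x)"
    and \<rho>: "test_function (\<rho> :: 'a \<Rightarrow> complex)" "\<And>x. \<rho> x = of_real (r x)" "\<And>x. r x \<ge> 0" "\<And>x. norm x \<le> 1 \<Longrightarrow> r x = 1" "\<And>x. norm x \<ge> 2 \<Longrightarrow> r x = 0"
    and v: "antimono v" "\<And>t. v t \<ge> 0" "\<And>n. \<exists>C. \<forall>t. v t \<le> C / (1 + max 0 t)^n"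
  shows "integrable lborel (\<lambda>x. v (norm x) *\<^sub>R g x)"
proof -
  have [measurable]: "v \<in> borel_measurable borel"
  proof -
    have "mono (\<lambda>t. - v t)" using v(1) by (auto simp: mono_def antimono_def)
    from borel_measurable_mono[OF this] have "(\<lambda>t. - v t) \<in> borel_measurable borel" .
    then have "(\<lambda>t. - (- v t)) \<in> borel_measurable borel" by measurable
    then show ?thesis by simp
  qed
  \<comment> \<open>The weight is shifted outwards by 2, which exceeds the radius 1 of the ball over
    which the lower bound averages.\<close>
  define w where "w y = complex_of_real (v (norm y - 2))" for y :: 'a
  have [measurable]: "w \<in> borel_measurable borel" unfolding w_def[abs_def] by measurable
  have "rapid w"
  proof (rule rapidI)
    fix n
    obtain C where C: "\<And>t. v t \<le> C / (1 + max 0 t)^n" using v(3) by blast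
    have C0: "C \<ge> 0" using C[of 0] v(2)[of 0] by simp
    have "norm (w y) \<le> (C * 3^n) * wt n y" for y
    proof -
      have "(1 + norm y)^n \<le> (3 * (1 + max 0 (norm y - 2)))^n" by (intro power_mono) (auto simp: max_def)
      then have "C * (1 + norm y)^n \<le> C * (3^n * (1 + max 0 (norm y - 2))^n)"
        using C0 by (intro mult_left_mono) (simp_all only: power_mult_distrib)
      moreover have p: "(1 + max 0 (norm y - 2))^n > 0" "(1 + norm y)^n > 0" by (auto intro!: zero_less_power add_pos_nonneg)
      ultimately have "C / (1 + max 0 (norm y - 2))^n \<le> (C * 3^n) * wt n y"
        unfolding wt_def by (simp add: field_simps)
      then show ?thesis using C[of "norm y - 2"] v(2) by (simp add: w_def)
    qed
    then show "\<exists>C. \<forall>y. norm (w y) \<le> C * wt n y" by blast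
  qed
  then have S: "conv \<rho> w \<in> schwartz" by (intro schwartz_conv test_function_schwartz \<rho>) measurable
  have iw: "integrable lborel w" using rapid_integrable[OF \<open>rapid w\<close>, of 0] by simp
  note [measurable] = schwartz_measurable[OF test_function_schwartz[OF \<rho>(1)]]
  have ball_pos: "measure lborel (ball (0::'a) 1) > 0" by (rule content_ball_pos) simp
  have lower: "v (norm x) * measure lborel (ball (0::'a) 1) \<le> norm (conv \<rho> w x)" for x
  proof -
    have eq: "\<rho> (x - y) * w y = of_real (r (x - y) * v (norm y - 2))" for y by (simp add: \<rho>(2) w_def)
    have i1: "integrable lborel (\<lambda>y. \<rho> (x - y) * w y)"
      by (intro conv_integrable test_function_schwartz \<rho> iw)
    then have i2: "integrable lborel (\<lambda>y. r (x - y) * v (norm y - 2))"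
      unfolding eq by (simp only: complex_of_real_integrable_eq)
    have "conv \<rho> w x = of_real (\<integral>y. r (x - y) * v (norm y - 2) \<partial>lborel)"
      unfolding conv_def eq by (rule integral_complex_of_real)
    moreover have "(\<integral>y. v (norm x) * indicator (ball x 1) y \<partial>lborel) \<le> (\<integral>y. r (x - y) * v (norm y - 2) \<partial>lborel)"
    proof (rule integral_mono[OF _ i2])
      show "integrable lborel (\<lambda>y. v (norm x) * indicator (ball x 1) y)"
        by (intro integrable_mult_right integrable_real_indicator) (auto intro!: emeasure_bounded_finite[unfolded infinity_ennreal_def])
      fix y
      show "v (norm x) * indicator (ball x 1) y \<le> r (x - y) * v (norm y - 2)"
      proof (cases "y \<in> ball x 1")
        case True
        then have "norm (x - y) \<le> 1" by (simp add: dist_norm)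
        moreover from this have "norm y - 2 \<le> norm x" using norm_triangle_ineq2[of y x] by (simp add: norm_minus_commute)
        ultimately show ?thesis using True \<rho>(4)[of "x - y"] antimonoD[OF v(1)] by simp
      qed (simp add: \<rho>(3) v(2))
    qed
    moreover have "(\<integral>y. v (norm x) * indicator (ball x 1) y \<partial>lborel) = v (norm x) * measure lborel (ball (0::'a) 1)"
    proof -
      have "measure lborel (ball x 1) = measure lborel (ball (0::'a) 1)"
        using content_ball_conv_unit_ball[of 1 x] by simp
      then show ?thesis by simp
    qed
    ultimately show ?thesis by (simp only: norm_of_real)
  qed
  show ?thesis
  proof (rule Bochner_Integration.integrable_bound)
    show "integrable lborel (\<lambda>x. (1 / measure lborel (ball (0::'a) 1)) *\<^sub>R (g x * conv \<rho> w x))"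
      by (intro integrable_scaleR_right gint S)
    show "AE x in lborel. norm (v (norm x) *\<^sub>R g x) \<le> norm ((1 / measure lborel (ball (0::'a) 1)) *\<^sub>R (g x * conv \<rho> w x))"
    proof (rule AE_I2)
      fix x
      have "v (norm x) \<le> norm (conv \<rho> w x) / measure lborel (ball (0::'a) 1)"
        using lower[of x] ball_pos by (simp add: pos_le_divide_eq)
      from mult_left_mono[OF this norm_ge_zero[of "g x"]]
      show "norm (v (norm x) *\<^sub>R g x) \<le> norm ((1 / measure lborel (ball (0::'a) 1)) *\<^sub>R (g x * conv \<rho> w x))"
        using v(2)[of "norm x"] ball_pos by (simp add: norm_mult mult_ac)
    qed
  qed measurable
qed

text \<open>Let \<open>b n\<close> be the integral of \<open>norm (g x)\<close> over the shell with
  index \<open>n\<close>. If no polynomial bounds \<open>b\<close>, choose shells \<open>N L\<close>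
  with mass at least of order \<open>L\<close>, and a decreasing \<open>v\<close> whose power rises
  at these shells. Then \<open>v\<close> decays faster than any power, although every chosen shell
  contributes at least 1 to the integral of \<open>v (norm x) * norm (g x)\<close>, contradicting
  \<open>integrable_against_decreasing\<close>.\<close>

lemma slow_growth:
  fixes g :: "'a::euclidean_space \<Rightarrow> complex"
  assumes g [measurable]: "g \<in> borel_measurable borel"
    and gint: "\<And>\<psi>. \<psi> \<in> schwartz \<Longrightarrow> integrable lborel (\<lambda>x. g x * \<psi> x)"
    and \<rho>: "test_function (\<rho> :: 'a \<Rightarrow> complex)" "\<And>x. \<rho> x = of_real (r x)" "\<And>x. r x \<ge> 0" "\<And>x. norm x \<le> 1 \<Longrightarrow> r x = 1" "\<And>x. norm x \<ge> 2 \<Longrightarrow> r x = 0"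
  shows "\<exists>L. integrable lborel (\<lambda>x. wt L x *\<^sub>R g x)"
proof -
  let ?A = "\<lambda>n::nat. {x::'a. real n \<le> norm x \<and> norm x < real n + 1}"
  define b where "b n = (\<integral>x. indicator (?A n) x * norm (g x) \<partial>lborel)" for n
  note dec = integrable_against_decreasing[OF g gint \<rho>]
  have ib: "integrable lborel (\<lambda>x. indicator (?A n) x * norm (g x))" for n
  proof -
    let ?v = "\<lambda>t::real. if t \<le> real n + 1 then 1 else 0 :: real"
    have "integrable lborel (\<lambda>x. ?v (norm x) *\<^sub>R g x)"
    proof (rule dec)
      show "antimono ?v" by (auto simp: antimono_def)
      fix k
      have "?v t \<le> (real n + 2)^k / (1 + max 0 t)^k" for t
        by (auto simp: pos_le_divide_eq intro!: power_mono)
      then show "\<exists>C. \<forall>t. ?v t \<le> C / (1 + max 0 t)^k" by blast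
    qed auto
    from integrable_norm[OF this] show ?thesis
      by (rule Bochner_Integration.integrable_bound) (auto simp: indicator_def)
  qed
  have b0: "b n \<ge> 0" for n unfolding b_def by simp
  have "\<exists>L C. \<forall>n. b n \<le> C * (real n + 1)^L"
  proof (rule ccontr)
    assume neg: "\<nexists>L C. \<forall>n. b n \<le> C * (real n + 1)^L"
    \<comment> \<open>Any initial segment of shells can be absorbed in the constant, so the bound
      fails beyond every index. The offset 3 matches \<open>2 + norm x \<le> real n + 3\<close> on
      the shell with index \<open>n\<close>.\<close>
    have ex: "\<exists>n>N. b n \<ge> (real n + 3)^L" for N L
    proof (rule ccontr)
      assume "\<not> (\<exists>n>N. b n \<ge> (real n + 3)^L)"
      then have small: "b n < (real n + 3)^L" if "n > N" for n using that not_less by blast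
      have "b n \<le> (3^L + (\<Sum>k\<le>N. b k)) * (real n + 1)^L" for n
      proof (cases "n > N")
        case True
        have "(real n + 3)^L \<le> (3 * (real n + 1))^L" by (intro power_mono) auto
        also have "\<dots> \<le> (3^L + (\<Sum>k\<le>N. b k)) * (real n + 1)^L"
          unfolding power_mult_distrib by (intro mult_right_mono) (auto simp: sum_nonneg b0)
        finally show ?thesis using small[OF True] by simp
      next
        case False
        then have "b n \<le> (\<Sum>k\<le>N. b k)" by (intro member_le_sum) (auto simp: b0)
        also have "\<dots> \<le> (3^L + (\<Sum>k\<le>N. b k)) * 1" by simp
        also have "\<dots> \<le> (3^L + (\<Sum>k\<le>N. b k)) * (real n + 1)^L"
          by (intro mult_left_mono one_le_power) (auto simp: sum_nonneg b0 add_nonneg_nonneg)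
        finally show ?thesis .
      qed
      with neg show False by blast
    qed
    have "\<exists>N. \<forall>L. b (N L) \<ge> (real (N L) + 3)^L \<and> N L < N (Suc L)"
      by (rule dependent_nat_choice) (use ex in blast)+
    then obtain N where N: "\<And>L. b (N L) \<ge> (real (N L) + 3)^L" "\<And>L. N L < N (Suc L)" by blast
    have sm: "strict_mono N" using N(2) by (rule strict_monoI_Suc)
    \<comment> \<open>The exponent in force at radius \<open>t\<close>: it equals \<open>L\<close>
      on the shell \<open>N L\<close> and increases once that shell has been passed.\<close>
    define l where "l t = (LEAST L. t < real (N L) + 1)" for t
    have exL: "\<exists>L. t < real (N L) + 1" for t
    proof -
      obtain L where "t < real L" using reals_Archimedean2 by blast
      moreover have "L \<le> N L" using sm by (rule strict_mono_imp_increasing)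
      ultimately show ?thesis by (intro exI[of _ L]) simp
    qed
    have l1: "t < real (N (l t)) + 1" for t unfolding l_def by (rule LeastI_ex[OF exL])
    have l2: "l t \<le> L" if "t < real (N L) + 1" for t L unfolding l_def by (rule Least_le[of "\<lambda>L. t < real (N L) + 1", OF that])
    have lmono: "l s \<le> l t" if "s \<le> t" for s t using l2[of s "l t"] l1[of t] that by simp
    have lN: "l t = L" if "real (N L) \<le> t" "t < real (N L) + 1" for t L
    proof (rule antisym[OF l2[OF that(2)]])
      show "L \<le> l t"
      proof (rule ccontr)
        assume "\<not> L \<le> l t"
        then have "N (l t) < N L" using sm by (simp add: strict_mono_less)
        then show False using l1[of t] that(1) by linarith
      qed
    qed
    define v where "v t = 1 / (2 + max 0 t)^(l t)" for t
    have vint: "integrable lborel (\<lambda>x. v (norm x) *\<^sub>R g x)"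
    proof (rule dec)
      show "antimono v"
      proof (rule antimonoI)
        fix s t :: real assume st: "s \<le> t"
        have "(2 + max 0 s)^(l s) \<le> (2 + max 0 t)^(l s)" using st by (intro power_mono) auto
        also have "\<dots> \<le> (2 + max 0 t)^(l t)" using lmono[OF st] by (intro power_increasing) auto
        finally show "v t \<le> v s" unfolding v_def by (intro divide_left_mono) (auto intro!: mult_pos_pos zero_less_power add_pos_nonneg)
      qed
      show "v t \<ge> 0" for t unfolding v_def by (auto intro!: divide_nonneg_nonneg zero_le_power)
      fix k
      have "v t \<le> (real (N k) + 2)^k / (1 + max 0 t)^k" for t
      proof (cases "t < real (N k) + 1")
        case True
        have "v t \<le> 1" unfolding v_def by (auto simp: divide_le_eq intro!: one_le_power)
        also have "1 \<le> (real (N k) + 2)^k / (1 + max 0 t)^k"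
          using True by (auto simp: pos_le_divide_eq intro!: power_mono)
        finally show ?thesis .
      next
        case False
        then have "N k \<le> N (l t)" using l1[of t] by linarith
        then have "k \<le> l t" using sm by (simp add: strict_mono_less_eq)
        have "(1 + max 0 t)^k \<le> (2 + max 0 t)^k" by (intro power_mono) auto
        also have "\<dots> \<le> (2 + max 0 t)^(l t)" using \<open>k \<le> l t\<close> by (intro power_increasing) auto
        finally have "v t \<le> 1 / (1 + max 0 t)^k" unfolding v_def by (intro divide_left_mono) (auto intro!: mult_pos_pos zero_less_power add_pos_nonneg)
        also have "\<dots> \<le> (real (N k) + 2)^k / (1 + max 0 t)^k" by (intro divide_right_mono one_le_power) auto
        finally show ?thesis .
      qed
      then show "\<exists>C. \<forall>t. v t \<le> C / (1 + max 0 t)^k" by blast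
    qed
    have iv: "integrable lborel (\<lambda>x. v (norm x) * norm (g x))"
    proof -
      have "norm (v (norm x) *\<^sub>R g x) = v (norm x) * norm (g x)" for x
        unfolding v_def by (auto simp: abs_of_nonneg)
      then show ?thesis using integrable_norm[OF vint] by (simp only:)
    qed
    \<comment> \<open>Each of the first \<open>m\<close> chosen shells contributes at least 1,
      because \<open>v\<close> on it is at least the reciprocal of
      \<open>(real (N L) + 3)^L\<close>.\<close>
    have part: "real m \<le> (\<integral>x. v (norm x) * norm (g x) \<partial>lborel)" for m
    proof -
      have "real m = (\<Sum>L<m. 1)" by simp
      also have "\<dots> \<le> (\<Sum>L<m. 1 / (real (N L) + 3)^L * b (N L))"
        by (rule sum_mono) (use N(1) in \<open>auto simp: pos_le_divide_eq\<close>)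
      also have "\<dots> = (\<integral>x. (\<Sum>L<m. 1 / (real (N L) + 3)^L * (indicator (?A (N L)) x * norm (g x))) \<partial>lborel)"
        unfolding b_def using ib by (subst Bochner_Integration.integral_sum) (auto intro!: integrable_mult_right)
      also have "\<dots> \<le> (\<integral>x. v (norm x) * norm (g x) \<partial>lborel)"
      proof (rule integral_mono[OF _ iv])
        show "integrable lborel (\<lambda>x. \<Sum>L<m. 1 / (real (N L) + 3)^L * (indicator (?A (N L)) x * norm (g x)))"
          by (intro Bochner_Integration.integrable_sum integrable_mult_right ib)
        fix x
        have le: "1 / (real (N L) + 3)^L * (indicator (?A (N L)) x * norm (g x)) \<le> (if L = l (norm x) then v (norm x) * norm (g x) else 0)" for L
        proof (cases "x \<in> ?A (N L)")
          case True
          then have "l (norm x) = L" by (intro lN) auto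
          have "1 / (real (N L) + 3)^L \<le> 1 / (2 + norm x)^L"
            using True by (intro divide_left_mono power_mono) (auto intro!: mult_pos_pos zero_less_power add_pos_nonneg)
          from mult_right_mono[OF this norm_ge_zero[of "g x"]] \<open>l (norm x) = L\<close> show ?thesis
            using True by (simp add: v_def)
        next
          case False
          moreover have "v (norm x) \<ge> 0" unfolding v_def by auto
          ultimately show ?thesis by auto
        qed
        have "(\<Sum>L<m. 1 / (real (N L) + 3)^L * (indicator (?A (N L)) x * norm (g x))) \<le> (\<Sum>L<m. if L = l (norm x) then v (norm x) * norm (g x) else 0)"
          by (intro sum_mono le)
        also have "\<dots> \<le> v (norm x) * norm (g x)" by (auto simp: v_def)
        finally show "(\<Sum>L<m. 1 / (real (N L) + 3)^L * (indicator (?A (N L)) x * norm (g x))) \<le> v (norm x) * norm (g x)" .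
      qed
      finally show ?thesis .
    qed
    obtain m where "(\<integral>x. v (norm x) * norm (g x) \<partial>lborel) < real m" using reals_Archimedean2 by blast
    with part[of m] show False by simp
  qed
  then obtain L C where LC: "\<And>n. b n \<le> C * (real n + 1)^L" by blast
  have C0: "C \<ge> 0" using LC[of 0] b0[of 0] by simp
  \<comment> \<open>The two additional powers leave the summable bound
    \<open>C / (real n + 1)^2\<close> for the shell with index \<open>n\<close>.\<close>
  have "integrable lborel (\<lambda>x. wt (L + 2) x *\<^sub>R g x)"
  proof (rule integrableI_bounded)
    have "(\<integral>\<^sup>+x. ennreal (norm (wt (L + 2) x *\<^sub>R g x)) \<partial>lborel) = (\<integral>\<^sup>+x. (\<Sum>n. ennreal (indicator (?A n) x * norm (wt (L + 2) x *\<^sub>R g x))) \<partial>lborel)"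
    proof (rule nn_integral_cong)
      fix x :: 'a
      have u: "x \<in> ?A n \<longleftrightarrow> n = nat \<lfloor>norm x\<rfloor>" for n
        using floor_eq_iff[of "norm x" "int n"] by auto
      have "(\<Sum>n. ennreal (indicator (?A n) x * norm (wt (L + 2) x *\<^sub>R g x))) = (\<Sum>n\<in>{nat \<lfloor>norm x\<rfloor>}. ennreal (indicator (?A n) x * norm (wt (L + 2) x *\<^sub>R g x)))"
        by (rule suminf_finite) (use u in \<open>auto simp: indicator_def\<close>)
      also have "\<dots> = ennreal (norm (wt (L + 2) x *\<^sub>R g x))" using u[of "nat \<lfloor>norm x\<rfloor>"] by (auto simp: indicator_def)
      finally show "ennreal (norm (wt (L + 2) x *\<^sub>R g x)) = (\<Sum>n. ennreal (indicator (?A n) x * norm (wt (L + 2) x *\<^sub>R g x)))" by simp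
    qed
    also have "\<dots> = (\<Sum>n. \<integral>\<^sup>+x. ennreal (indicator (?A n) x * norm (wt (L + 2) x *\<^sub>R g x)) \<partial>lborel)"
      by (rule nn_integral_suminf) measurable
    also have "\<dots> \<le> (\<Sum>n. ennreal (C * (1 / (real n + 1)^2)))"
    proof (rule suminf_le)
      fix n
      have "(\<integral>\<^sup>+x. ennreal (indicator (?A n) x * norm (wt (L + 2) x *\<^sub>R g x)) \<partial>lborel)
          \<le> (\<integral>\<^sup>+x. ennreal (1 / (real n + 1)^(L + 2) * (indicator (?A n) x * norm (g x))) \<partial>lborel)"
      proof (intro nn_integral_mono ennreal_leI)
        fix x :: 'a
        have "wt (L + 2) x \<le> 1 / (real n + 1)^(L + 2)" if "x \<in> ?A n"
          unfolding wt_def using that by (intro divide_left_mono power_mono) (auto intro!: mult_pos_pos zero_less_power add_pos_nonneg)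
        then show "indicator (?A n) x * norm (wt (L + 2) x *\<^sub>R g x) \<le> 1 / (real n + 1)^(L + 2) * (indicator (?A n) x * norm (g x))"
          using mult_right_mono[OF _ norm_ge_zero[of "g x"], of "wt (L + 2) x" "1 / (real n + 1)^(L + 2)"]
          by (cases "x \<in> ?A n") simp_all
      qed
      also have "\<dots> = ennreal (1 / (real n + 1)^(L + 2) * b n)"
        unfolding b_def using ib by (subst nn_integral_eq_integral) (auto intro!: integrable_mult_right)
      also have "\<dots> \<le> ennreal (C * (1 / (real n + 1)^2))"
      proof (rule ennreal_leI)
        have "1 / (real n + 1)^(L + 2) * b n \<le> 1 / (real n + 1)^(L + 2) * (C * (real n + 1)^L)"
          by (intro mult_left_mono LC) auto
        then show "1 / (real n + 1)^(L + 2) * b n \<le> C * (1 / (real n + 1)^2)" by (simp add: power_add power2_eq_square)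
      qed
      finally show "(\<integral>\<^sup>+x. ennreal (indicator (?A n) x * norm (wt (L + 2) x *\<^sub>R g x)) \<partial>lborel) \<le> ennreal (C * (1 / (real n + 1)^2))" .
    qed auto
    also have "\<dots> < \<infinity>"
    proof -
      have "summable (\<lambda>n. 1 / (real n + 1)^2)"
        using inverse_power_summable[of 2, where 'a=real] summable_Suc_iff[of "\<lambda>n. inverse (real n ^ 2)"]
        by (simp add: inverse_eq_divide add.commute)
      then have "summable (\<lambda>n. C * (1 / (real n + 1)^2))" by (rule summable_mult)
      then show ?thesis using C0 by (subst suminf_ennreal2) auto
    qed
    finally show "(\<integral>\<^sup>+x. ennreal (norm (wt (L + 2) x *\<^sub>R g x)) \<partial>lborel) < \<infinity>" .
  qed measurable
  then show ?thesis by blast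
qed

section \<open>Maximal estimates\<close>

text \<open>By scaling this is the mass of the kernels
  \<open>a^DIM('a) * wt K (a *\<^sub>R z)\<close> for all \<open>a > 0\<close>; constants built from
  it are the same for every dyadic scale.\<close>

definition wt_mass :: "'a::euclidean_space itself \<Rightarrow> nat \<Rightarrow> real" where
  "wt_mass _ K = (\<integral>x. wt K (x::'a) \<partial>lborel)"

lemma wt_mass_nonneg: "wt_mass TYPE('a::euclidean_space) K \<ge> 0"
  unfolding wt_mass_def by simp

lemma nn_integral_wt_scaled:
  fixes x :: "'a::euclidean_space"
  assumes K: "K \<ge> 2 * DIM('a)" and a: "a > 0"
  shows "(\<integral>\<^sup>+y. ennreal (a^DIM('a) * wt K (a *\<^sub>R (x - y))) \<partial>lborel) = ennreal (wt_mass TYPE('a) K)"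
    and "(\<integral>\<^sup>+y. ennreal (a^DIM('a) * wt K (a *\<^sub>R (y - x))) \<partial>lborel) = ennreal (wt_mass TYPE('a) K)"
proof -
  have "ennreal (wt_mass TYPE('a) K) = (\<integral>\<^sup>+y. ennreal (wt K (y::'a)) \<partial>lborel)"
    unfolding wt_mass_def by (rule nn_integral_eq_integral[symmetric]) (auto intro: integrable_wt[OF K])
  also have "\<dots> = ennreal (\<bar>- a\<bar>^DIM('a)) * (\<integral>\<^sup>+y. ennreal (wt K (a *\<^sub>R x + (-a) *\<^sub>R y)) \<partial>lborel)"
    using a by (intro lborel_affine_nn_integral) auto
  also have "\<dots> = (\<integral>\<^sup>+y. ennreal (a^DIM('a) * wt K (a *\<^sub>R (x - y))) \<partial>lborel)"
    using a by (simp add: ennreal_mult' nn_integral_cmult scaleR_diff_right)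
  finally show *: "(\<integral>\<^sup>+y. ennreal (a^DIM('a) * wt K (a *\<^sub>R (x - y))) \<partial>lborel) = ennreal (wt_mass TYPE('a) K)" by simp
  have "wt K (a *\<^sub>R (y - x)) = wt K (a *\<^sub>R (x - y))" for y
    by (metis minus_diff_eq scaleR_minus_right wt_minus)
  then show "(\<integral>\<^sup>+y. ennreal (a^DIM('a) * wt K (a *\<^sub>R (y - x))) \<partial>lborel) = ennreal (wt_mass TYPE('a) K)"
    using * by simp
qed

text \<open>Peetre's inequality spends \<open>M\<close> of the \<open>N\<close> powers to move the
  base point of the weight from \<open>u\<close> to \<open>y\<close>; the other \<open>N - M\<close>
  remain as an integrable kernel.\<close>

lemma wt_split_shift:
  fixes x u y :: "'a::real_normed_vector"
  assumes "M \<le> N"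
  shows "wt N (a *\<^sub>R (u - y)) * wt M (a *\<^sub>R (x - u)) \<le> wt M (a *\<^sub>R (x - y)) * wt (N - M) (a *\<^sub>R (u - y))"
proof -
  have "wt M (a *\<^sub>R (x - u)) \<le> (1 + norm (a *\<^sub>R (u - y)))^M * wt M (a *\<^sub>R (x - y))"
    using wt_shift[of M "a *\<^sub>R (x - y)" "a *\<^sub>R (y - u)"]
    by (simp add: scaleR_add_right[symmetric] norm_minus_commute)
  then have "wt N (a *\<^sub>R (u - y)) * wt M (a *\<^sub>R (x - u)) \<le> wt N (a *\<^sub>R (u - y)) * ((1 + norm (a *\<^sub>R (u - y)))^M * wt M (a *\<^sub>R (x - y)))"
    by (intro mult_left_mono) auto
  also have "\<dots> = wt M (a *\<^sub>R (x - y)) * wt (N - M) (a *\<^sub>R (u - y)) * (wt M (a *\<^sub>R (u - y)) * (1 + norm (a *\<^sub>R (u - y)))^M)"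
    using wt_add[of M "N - M" "a *\<^sub>R (u - y)"] assms by (simp add: mult_ac)
  also have "\<dots> = wt M (a *\<^sub>R (x - y)) * wt (N - M) (a *\<^sub>R (u - y))" by (simp only: wt_mult_power mult_1_right)
  finally show ?thesis .
qed

text \<open>\<open>S\<close> is the Peetre maximal function of \<open>v\<close> at \<open>x\<close>,
  described by its defining properties. Apply the reproducing inequality at a point \<open>u\<close>
  and split the integral. On \<open>D\<close> the factor \<open>?m y\<close> is at most
  \<open>S\<close> and the kernel has mass at most 1/2; off \<open>D\<close> use
  \<open>?m y \<le> S powr (1 - p) * ?m y powr p\<close>. This gives
  \<open>S \<le> S / 2 + S powr (1 - p) * I / 2\<close>, and as \<open>S\<close> is finite the first
  term can be absorbed and the power of \<open>S\<close> divided out.\<close>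

lemma peetre_maximal_bound:
  fixes v :: "'a::euclidean_space \<Rightarrow> complex"
  assumes v [measurable]: "v \<in> borel_measurable borel" and a: "a > 0" and A: "A \<ge> 0" and p: "0 < p" "p \<le> 1" and MN: "M \<le> N"
    and rep: "\<And>x. ennreal (norm (v x)) \<le> (\<integral>\<^sup>+y. ennreal (A * norm (v y) * (a^DIM('a) * wt N (a *\<^sub>R (x - y)))) \<partial>lborel)"
    and bad: "D \<in> sets borel" "\<And>x. (\<integral>\<^sup>+y. indicator D y * ennreal (A * (a^DIM('a) * wt (N - M) (a *\<^sub>R (x - y)))) \<partial>lborel) \<le> ennreal (1/2)"
    and fin: "\<And>y. norm (v y) * wt M (a *\<^sub>R (x - y)) \<le> S" and S: "S \<ge> 0"
    and least: "\<And>T. (\<And>y. norm (v y) * wt M (a *\<^sub>R (x - y)) \<le> T) \<Longrightarrow> S \<le> T"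
  shows "ennreal (S powr p) \<le> (\<integral>\<^sup>+y. indicator (- D) y * ennreal (2 * A * ((norm (v y) * wt M (a *\<^sub>R (x - y))) powr p * a^DIM('a))) \<partial>lborel)" (is "_ \<le> ?R")
proof (cases "S = 0 \<or> ?R = \<infinity>")
  case True then show ?thesis using p by auto
next
  case False
  then have S0: "S > 0" and Rf: "?R < \<infinity>" using S by (auto simp: top.not_eq_extremum)
  note [measurable] = bad(1)
  define I where "I = enn2real ?R"
  have I: "?R = ennreal I" "I \<ge> 0" using Rf by (auto simp: I_def)
  let ?m = "\<lambda>y. norm (v y) * wt M (a *\<^sub>R (x - y))"
  let ?B = "\<lambda>u. \<integral>\<^sup>+y. indicator D y * ennreal (A * (a^DIM('a) * wt (N - M) (a *\<^sub>R (u - y)))) \<partial>lborel"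
  have "?m u \<le> S / 2 + (S powr (1 - p)) * I / 2" for u
  proof -
    have pw: "A * norm (v y) * (a^DIM('a) * wt N (a *\<^sub>R (u - y))) * wt M (a *\<^sub>R (x - u)) \<le> A * a^DIM('a) * (?m y * wt (N - M) (a *\<^sub>R (u - y)))" for y
    proof -
      have "(A * norm (v y) * a^DIM('a)) * (wt N (a *\<^sub>R (u - y)) * wt M (a *\<^sub>R (x - u))) \<le> (A * norm (v y) * a^DIM('a)) * (wt M (a *\<^sub>R (x - y)) * wt (N - M) (a *\<^sub>R (u - y)))"
        by (intro mult_left_mono wt_split_shift MN) (use A a in auto)
      then show ?thesis by (simp add: mult_ac)
    qed
    have pw2: "ennreal (A * a^DIM('a) * (?m y * wt (N - M) (a *\<^sub>R (u - y))))
       \<le> ennreal S * (indicator D y * ennreal (A * (a^DIM('a) * wt (N - M) (a *\<^sub>R (u - y)))))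
         + ennreal (S powr (1 - p) / 2) * (indicator (- D) y * ennreal (2 * A * (?m y powr p * a^DIM('a))))" for y
    proof (cases "y \<in> D")
      case True
      have "A * a^DIM('a) * (?m y * wt (N - M) (a *\<^sub>R (u - y))) \<le> A * a^DIM('a) * (S * wt (N - M) (a *\<^sub>R (u - y)))"
        by (intro mult_left_mono mult_right_mono fin) (use A a in auto)
      then have "ennreal (A * a^DIM('a) * (?m y * wt (N - M) (a *\<^sub>R (u - y)))) \<le> ennreal (S * (A * (a^DIM('a) * wt (N - M) (a *\<^sub>R (u - y)))))"
        by (intro ennreal_leI) (simp add: mult_ac)
      then show ?thesis using True S by (simp add: ennreal_mult')
    next
      case False
      have "?m y = ?m y powr (1 - p) * ?m y powr p"
      proof (cases "?m y = 0")
        case False then show ?thesis by (simp add: powr_add[symmetric] abs_of_nonneg)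
      qed (use p in simp)
      also have "\<dots> \<le> S powr (1 - p) * ?m y powr p"
        using p fin[of y] by (intro mult_right_mono powr_mono2) auto
      finally have "?m y * wt (N - M) (a *\<^sub>R (u - y)) \<le> (S powr (1 - p) * ?m y powr p) * 1"
        by (rule mult_mono[OF _ wt_le_1]) auto
      then have "A * a^DIM('a) * (?m y * wt (N - M) (a *\<^sub>R (u - y))) \<le> A * a^DIM('a) * (S powr (1 - p) * ?m y powr p)"
        by (intro mult_left_mono) (use A a in auto)
      also have "\<dots> = S powr (1 - p) / 2 * (2 * A * (?m y powr p * a^DIM('a)))" by (simp add: mult_ac)
      finally show ?thesis using False by (simp add: ennreal_mult'[symmetric] ennreal_leI)
    qed
    have "ennreal (?m u) = ennreal (norm (v u)) * ennreal (wt M (a *\<^sub>R (x - u)))" by (simp add: ennreal_mult')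
    also have "\<dots> \<le> (\<integral>\<^sup>+y. ennreal (A * norm (v y) * (a^DIM('a) * wt N (a *\<^sub>R (u - y)))) \<partial>lborel) * ennreal (wt M (a *\<^sub>R (x - u)))"
      by (intro mult_right_mono rep) simp
    also have "\<dots> = (\<integral>\<^sup>+y. ennreal (A * norm (v y) * (a^DIM('a) * wt N (a *\<^sub>R (u - y))) * wt M (a *\<^sub>R (x - u))) \<partial>lborel)"
      by (subst nn_integral_multc[symmetric]) (auto simp: ennreal_mult''[symmetric])
    also have "\<dots> \<le> (\<integral>\<^sup>+y. ennreal S * (indicator D y * ennreal (A * (a^DIM('a) * wt (N - M) (a *\<^sub>R (u - y)))))
         + ennreal (S powr (1 - p) / 2) * (indicator (- D) y * ennreal (2 * A * (?m y powr p * a^DIM('a)))) \<partial>lborel)"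
      by (intro nn_integral_mono order_trans[OF ennreal_leI[OF pw] pw2])
    also have "\<dots> = ennreal S * ?B u + ennreal (S powr (1 - p) / 2) * ?R"
      by (subst nn_integral_add) (auto simp: nn_integral_cmult)
    also have "\<dots> \<le> ennreal S * ennreal (1/2) + ennreal (S powr (1 - p) / 2) * ennreal I"
      unfolding I(1) by (intro add_right_mono mult_left_mono bad(2)) simp
    also have "\<dots> = ennreal (S / 2 + S powr (1 - p) * I / 2)"
    proof -
      have "ennreal S * ennreal (1/2) = ennreal (S / 2)" "ennreal (S powr (1 - p) / 2) * ennreal I = ennreal (S powr (1 - p) * I / 2)"
        using S by (subst ennreal_mult'[symmetric]; simp)+
      then show ?thesis using S I(2) by (simp only: ennreal_plus[symmetric] divide_nonneg_nonneg mult_nonneg_nonneg powr_ge_zero zero_le_numeral)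
    qed
    finally show ?thesis using S I(2) by (subst (asm) ennreal_le_iff) auto
  qed
  from least[OF this] have "S \<le> S powr (1 - p) * I" by simp
  moreover have "S = S powr (1 - p) * S powr p" using S0 by (simp add: powr_add[symmetric])
  ultimately have "S powr (1 - p) * S powr p \<le> S powr (1 - p) * I" by simp
  then have "S powr p \<le> I" using S0 by (subst (asm) mult_le_cancel_left_pos) auto
  then show ?thesis unfolding I(1) by (rule ennreal_leI)
qed

lemma wt_powr_le:
  assumes "real Q \<le> real M * p"
  shows "wt M x powr p \<le> wt Q x"
proof -
  have n: "1 + norm x > 0" by (simp add: add_pos_nonneg)
  have "wt M x powr p = (1 + norm x) powr (- (real M * p))"
    unfolding wt_def using n by (simp add: powr_divide powr_realpow[symmetric] powr_powr powr_minus_divide)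
  also have "\<dots> \<le> (1 + norm x) powr (- real Q)" using assms by (intro powr_mono) auto
  also have "\<dots> = wt Q x" unfolding wt_def using n by (simp add: powr_minus_divide powr_realpow)
  finally show ?thesis .
qed

text \<open>The growth bound makes the maximal function finite, and the constant obtained does not
  involve \<open>G\<close>. A number \<open>F\<close> in place of \<open>norm (v x)\<close> covers
  every function dominated by the same integral, in particular the radial blocks.\<close>

lemma quasi_local_bound_le1:
  fixes v :: "'a::euclidean_space \<Rightarrow> complex"
  assumes v [measurable]: "v \<in> borel_measurable borel" and a: "a > 0" and A: "A > 0" and p: "0 < p" "p \<le> 1"
    and MN: "M + 2 * DIM('a) \<le> N" and MQ: "real Q \<le> real M * p"
    and rep: "\<And>x. ennreal (norm (v x)) \<le> (\<integral>\<^sup>+y. ennreal (A * norm (v y) * (a^DIM('a) * wt N (a *\<^sub>R (x - y)))) \<partial>lborel)"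
    and bad: "D \<in> sets borel" "\<And>x. (\<integral>\<^sup>+y. indicator D y * ennreal (A * (a^DIM('a) * wt (N - M) (a *\<^sub>R (x - y)))) \<partial>lborel) \<le> ennreal (1/2)"
    and growth: "\<And>y. norm (v y) \<le> G * (1 + norm (a *\<^sub>R y))^M"
    and F: "F \<ge> 0" "ennreal F \<le> (\<integral>\<^sup>+y. ennreal (A * norm (v y) * (a^DIM('a) * wt N (a *\<^sub>R (x - y)))) \<partial>lborel)"
  shows "ennreal (F powr p) \<le> ennreal (2 * A * (A * wt_mass TYPE('a) (N - M)) powr p) *
     (\<integral>\<^sup>+y. indicator (- D) y * ennreal (norm (v y) powr p * (a^DIM('a) * wt Q (a *\<^sub>R (x - y)))) \<partial>lborel)"
proof -
  let ?m = "\<lambda>y. norm (v y) * wt M (a *\<^sub>R (x - y))"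
  define S where "S = (SUP y. ?m y)"
  have G0: "G \<ge> 0" using order_trans[OF norm_ge_zero growth[of 0]] by simp
  have bdd: "bdd_above (range ?m)"
  proof (rule bdd_aboveI2)
    fix y
    have "wt M (a *\<^sub>R (x - y)) \<le> (1 + norm (a *\<^sub>R x))^M * wt M (a *\<^sub>R y)"
      using wt_shift[of M "- (a *\<^sub>R y)" "a *\<^sub>R x"] by (simp add: scaleR_diff_right)
    then have "?m y \<le> (G * (1 + norm (a *\<^sub>R y))^M) * ((1 + norm (a *\<^sub>R x))^M * wt M (a *\<^sub>R y))"
      by (intro mult_mono growth) (auto simp: G0)
    also have "\<dots> = G * (1 + norm (a *\<^sub>R x))^M * ((1 + norm (a *\<^sub>R y))^M * wt M (a *\<^sub>R y))" by (simp only: mult_ac)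
    also have "\<dots> = G * (1 + norm (a *\<^sub>R x))^M" by (simp only: wt_mult_power mult_1_right)
    finally show "?m y \<le> G * (1 + norm (a *\<^sub>R x))^M" .
  qed
  have fin: "?m y \<le> S" for y unfolding S_def by (intro cSUP_upper bdd) simp
  have S0: "S \<ge> 0" using fin[of x] by (rule order_trans[rotated]) simp
  have least: "S \<le> T" if "\<And>y. ?m y \<le> T" for T unfolding S_def using that by (intro cSUP_least) auto
  have main: "ennreal (S powr p) \<le> (\<integral>\<^sup>+y. indicator (- D) y * ennreal (2 * A * (?m y powr p * a^DIM('a))) \<partial>lborel)"
    by (rule peetre_maximal_bound[OF v a _ p _ rep bad fin S0 least]) (use A MN in auto)
  let ?J = "wt_mass TYPE('a) (N - M)"
  have J0: "?J \<ge> 0" by (rule wt_mass_nonneg)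
  \<comment> \<open>Of the \<open>N\<close> powers in the kernel, \<open>M\<close> are used to form
    \<open>?m y\<close>, hence \<open>S\<close>, and the remaining \<open>N - M\<close> integrate to
    the constant \<open>?J\<close>.\<close>
  have "ennreal F \<le> (\<integral>\<^sup>+y. ennreal (A * S) * ennreal (a^DIM('a) * wt (N - M) (a *\<^sub>R (x - y))) \<partial>lborel)"
  proof (rule order_trans[OF F(2)], rule nn_integral_mono)
    fix y
    have "wt N (a *\<^sub>R (x - y)) = wt M (a *\<^sub>R (x - y)) * wt (N - M) (a *\<^sub>R (x - y))"
      using wt_add[of M "N - M"] MN by simp
    then have "A * norm (v y) * (a^DIM('a) * wt N (a *\<^sub>R (x - y))) = (A * (a^DIM('a) * wt (N - M) (a *\<^sub>R (x - y)))) * ?m y" by (simp add: mult_ac)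
    also have "\<dots> \<le> (A * (a^DIM('a) * wt (N - M) (a *\<^sub>R (x - y)))) * S" by (intro mult_left_mono fin) (use A a in auto)
    finally show "ennreal (A * norm (v y) * (a^DIM('a) * wt N (a *\<^sub>R (x - y)))) \<le> ennreal (A * S) * ennreal (a^DIM('a) * wt (N - M) (a *\<^sub>R (x - y)))"
      using A S0 by (subst ennreal_mult'[symmetric]) (auto intro!: ennreal_leI simp: mult_ac)
  qed
  also have "\<dots> = ennreal (A * S) * (\<integral>\<^sup>+y. ennreal (a^DIM('a) * wt (N - M) (a *\<^sub>R (x - y))) \<partial>lborel)"
    by (rule nn_integral_cmult) measurable
  also have "(\<integral>\<^sup>+y. ennreal (a^DIM('a) * wt (N - M) (a *\<^sub>R (x - y))) \<partial>lborel) = ennreal ?J"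
    by (rule nn_integral_wt_scaled(1)) (use MN a in auto)
  also have "ennreal (A * S) * ennreal ?J = ennreal (A * ?J * S)"
    using A S0 J0 by (subst ennreal_mult'[symmetric]) (auto simp: mult_ac)
  finally have "F \<le> A * ?J * S" using A S0 J0 by (subst (asm) ennreal_le_iff) auto
  then have "F powr p \<le> (A * ?J * S) powr p" using F(1) p by (intro powr_mono2) auto
  also have "\<dots> = (A * ?J) powr p * S powr p" using A S0 J0 by (simp add: powr_mult)
  finally have "ennreal (F powr p) \<le> ennreal ((A * ?J) powr p) * ennreal (S powr p)"
    by (subst ennreal_mult'[symmetric]) (auto intro: ennreal_leI)
  also have "\<dots> \<le> ennreal ((A * ?J) powr p) * (\<integral>\<^sup>+y. ennreal (2 * A) * (indicator (- D) y * ennreal (norm (v y) powr p * (a^DIM('a) * wt Q (a *\<^sub>R (x - y))))) \<partial>lborel)"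
  proof (intro mult_left_mono order_trans[OF main] nn_integral_mono)
    fix y
    have "?m y powr p = norm (v y) powr p * wt M (a *\<^sub>R (x - y)) powr p" by (simp add: powr_mult)
    also have "\<dots> \<le> norm (v y) powr p * wt Q (a *\<^sub>R (x - y))" by (intro mult_left_mono wt_powr_le MQ) auto
    finally have "2 * A * (?m y powr p * a^DIM('a)) \<le> 2 * A * (norm (v y) powr p * wt Q (a *\<^sub>R (x - y)) * a^DIM('a))"
      by (intro mult_left_mono mult_right_mono) (use A a in auto)
    also have "\<dots> = 2 * A * (norm (v y) powr p * (a^DIM('a) * wt Q (a *\<^sub>R (x - y))))" by (simp only: mult_ac)
    finally have "ennreal (2 * A * (?m y powr p * a^DIM('a))) \<le> ennreal (2 * A) * ennreal (norm (v y) powr p * (a^DIM('a) * wt Q (a *\<^sub>R (x - y))))"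
      using A by (subst ennreal_mult'[symmetric]) (auto intro: ennreal_leI)
    from mult_left_mono[OF this, of "indicator (- D) y"]
    show "indicator (- D) y * ennreal (2 * A * (?m y powr p * a^DIM('a))) \<le> ennreal (2 * A) * (indicator (- D) y * ennreal (norm (v y) powr p * (a^DIM('a) * wt Q (a *\<^sub>R (x - y)))))"
      by (simp add: mult.left_commute)
  qed auto
  also have "\<dots> = ennreal (2 * A * (A * ?J) powr p) * (\<integral>\<^sup>+y. indicator (- D) y * ennreal (norm (v y) powr p * (a^DIM('a) * wt Q (a *\<^sub>R (x - y)))) \<partial>lborel)"
    using bad(1) A by (subst nn_integral_cmult) (auto simp: ennreal_mult' mult_ac)
  finally show ?thesis .
qed

text \<open>For \<open>p \<ge> 1\<close> the elementary inequality \<open>t \<le> c + c powr (1 - p) * t powr p\<close>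
  with the optimal \<open>c\<close> replaces Hoelder's inequality.\<close>

lemma quasi_local_bound_ge1:
  fixes v :: "'a::euclidean_space \<Rightarrow> complex"
  assumes v [measurable]: "v \<in> borel_measurable borel" and a: "a > 0" and A: "A > 0" and p: "p \<ge> 1"
    and Q: "2 * DIM('a) \<le> Q"
    and F: "F \<ge> 0" "ennreal F \<le> (\<integral>\<^sup>+y. ennreal (A * norm (v y) * (a^DIM('a) * wt Q (a *\<^sub>R (x - y)))) \<partial>lborel)"
  shows "ennreal (F powr p) \<le> ennreal ((A * (wt_mass TYPE('a) Q + 1)) powr p) *
     (\<integral>\<^sup>+y. ennreal (norm (v y) powr p * (a^DIM('a) * wt Q (a *\<^sub>R (x - y)))) \<partial>lborel)" (is "_ \<le> _ * ?R")
proof -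
  let ?J = "wt_mass TYPE('a) Q"
  have J0: "?J \<ge> 0" by (rule wt_mass_nonneg)
  let ?k = "\<lambda>y. a^DIM('a) * wt Q (a *\<^sub>R (x - y))"
  have le: "ennreal F \<le> ennreal (A * (c * ?J)) + ennreal (A * c powr (1 - p)) * ?R" if c: "c > 0" for c
  proof -
    have "ennreal F \<le> (\<integral>\<^sup>+y. ennreal (A * c) * ennreal (?k y) + ennreal (A * c powr (1 - p)) * ennreal (norm (v y) powr p * ?k y) \<partial>lborel)"
    proof (rule order_trans[OF F(2)], rule nn_integral_mono)
      fix y
      have "norm (v y) \<le> c + c powr (1 - p) * norm (v y) powr p"
      proof (cases "norm (v y) \<le> c")
        case False
        then have t: "norm (v y) > c" by simp
        have "norm (v y) = norm (v y) powr (1 - p) * norm (v y) powr p" using t c by (simp add: powr_add[symmetric])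
        also have "\<dots> \<le> c powr (1 - p) * norm (v y) powr p"
          using t c p by (intro mult_right_mono powr_mono2') auto
        finally show ?thesis using c by simp
      qed (simp add: add_increasing2)
      then have "(A * ?k y) * norm (v y) \<le> (A * ?k y) * (c + c powr (1 - p) * norm (v y) powr p)"
        by (intro mult_left_mono) (use A a in auto)
      then have "A * norm (v y) * ?k y \<le> A * c * ?k y + A * c powr (1 - p) * (norm (v y) powr p * ?k y)"
        by (simp add: algebra_simps)
      then show "ennreal (A * norm (v y) * ?k y) \<le> ennreal (A * c) * ennreal (?k y) + ennreal (A * c powr (1 - p)) * ennreal (norm (v y) powr p * ?k y)"
        using A a c by (simp add: ennreal_mult'[symmetric] ennreal_plus[symmetric] ennreal_leI del: ennreal_plus)
    qed
    also have "\<dots> = ennreal (A * c) * (\<integral>\<^sup>+y. ennreal (?k y) \<partial>lborel) + ennreal (A * c powr (1 - p)) * ?R"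
      by (subst nn_integral_add) (auto simp: nn_integral_cmult)
    also have "(\<integral>\<^sup>+y. ennreal (?k y) \<partial>lborel) = ennreal ?J" by (rule nn_integral_wt_scaled(1)[OF Q a])
    also have "ennreal (A * c) * ennreal ?J = ennreal (A * (c * ?J))"
      using A c J0 by (subst ennreal_mult'[symmetric]) (auto simp: mult_ac)
    finally show ?thesis .
  qed
  show ?thesis
  proof (cases "?R = \<infinity>")
    case True
    have "A * (?J + 1) > 0" using A J0 by simp
    then have "ennreal ((A * (?J + 1)) powr p) > 0" using powr_gt_zero[of "A * (?J + 1)" p] by (simp only: ennreal_less_zero_iff)
    then show ?thesis unfolding True by (simp add: ennreal_mult_top)
  next
    case False
    define I where "I = enn2real ?R"
    have I: "?R = ennreal I" "I \<ge> 0" using False by (auto simp: I_def top.not_eq_extremum)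
    have leI: "F \<le> A * (c * ?J) + A * c powr (1 - p) * I" if c: "c > 0" for c
    proof -
      have "ennreal F \<le> ennreal (A * (c * ?J) + A * c powr (1 - p) * I)"
        using le[OF c] A c J0 I by (simp add: ennreal_mult'[symmetric] ennreal_plus[symmetric] del: ennreal_plus)
      then show ?thesis using A c J0 I(2) by (subst (asm) ennreal_le_iff) auto
    qed
    have "F powr p \<le> (A * (?J + 1)) powr p * I"
    proof (cases "I = 0")
      case True
      have "F \<le> e" if e: "e > 0" for e
      proof -
        have "F \<le> A * (e / (A * (?J + 1)) * ?J)" using leI[of "e / (A * (?J + 1))"] True A J0 e by simp
        also have "\<dots> = e * (?J / (?J + 1))" using A J0 by simp
        also have "\<dots> \<le> e * 1" using e J0 by (intro mult_left_mono) (auto simp: divide_le_eq)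
        finally show ?thesis by simp
      qed
      then have "F \<le> 0" by (rule field_le_epsilon) simp
      then show ?thesis using F(1) True by simp
    next
      case False
      then have I0: "I > 0" using I(2) by simp
      \<comment> \<open>With this choice the two terms balance:
        \<open>c powr (1 - p) * I = c\<close>.\<close>
      define c where "c = I powr (1 / p)"
      have c: "c > 0" and cp: "c powr p = I" using I0 p by (auto simp: c_def powr_powr)
      have "c powr (1 - p) * I = c" unfolding cp[symmetric] using c by (simp add: powr_add[symmetric])
      then have "F \<le> A * (c * ?J) + A * c" using leI[OF c] by (simp add: mult.assoc)
      also have "\<dots> = (A * (?J + 1)) * c" by (simp add: algebra_simps)
      finally have "F powr p \<le> ((A * (?J + 1)) * c) powr p" using F(1) p by (intro powr_mono2) auto
      also have "\<dots> = (A * (?J + 1)) powr p * I" using A J0 c by (simp add: powr_mult cp)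
      finally show ?thesis .
    qed
    then show ?thesis unfolding I(1) by (subst ennreal_mult'[symmetric]) (auto intro: ennreal_leI)
  qed
qed

text \<open>Dilating the shell by suitable factors between \<open>1\<close> and \<open>2\<close> gives \<open>m\<close> disjoint copies,
  none of which has much less mass than the shell itself.\<close>

lemma thin_shell_mass:
  fixes x :: "'a::euclidean_space"
  assumes a: "a > 0" and r: "a * r \<ge> 1" and m: "m \<ge> 1" and K: "K \<ge> 2 * DIM('a)"
  defines "c \<equiv> 1 / (6 * real m)"
  shows "ennreal (real m) * (\<integral>\<^sup>+y. indicator {y. \<bar>norm y - r\<bar> < c / a} y * ennreal (a^DIM('a) * wt K (a *\<^sub>R (x - y))) \<partial>lborel)
     \<le> ennreal (2^K * wt_mass TYPE('a) K)"
proof -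
  let ?B = "{y::'a. \<bar>norm y - r\<bar> < c / a}"
  let ?w = "\<lambda>y. ennreal (a^DIM('a) * wt K (a *\<^sub>R (x - y)))"
  have Bm [measurable]: "?B \<in> sets borel" by measurable
  have c: "c > 0" "6 * real m * c = 1" using m by (auto simp: c_def)
  have r0: "r > 0" using a r by (smt (verit) mult_nonneg_nonpos)
  \<comment> \<open>Half the width of the shell relative to its radius, so that
    \<open>c / a = s * r\<close>.\<close>
  define s where "s = c / (a * r)"
  have cle: "c \<le> 1 / 6" using m by (simp add: c_def divide_le_eq)
  have s: "s > 0" "s \<le> c" "6 * real m * s \<le> 1"
  proof -
    show "s > 0" using a r0 c by (simp add: s_def)
    show sc: "s \<le> c" unfolding s_def using r c mult_left_mono[OF r, of c] by (simp add: divide_le_eq a r0)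
    show "6 * real m * s \<le> 1" using mult_left_mono[OF sc, of "6 * real m"] c by simp
  qed
  \<comment> \<open>Consecutive factors differ by \<open>3 * s\<close>, while the shell has relative
    width \<open>2 * s\<close>; since \<open>6 * real m * s \<le> 1\<close>, the quadratic terms do
    not use up the difference and the copies are disjoint. The choice
    \<open>6 * real m * c = 1\<close> also keeps every point within \<open>1 / a\<close> of its
    image, at the cost of \<open>2^K\<close> in the weight.\<close>
  define l where "l k = 1 + 3 * real k * s" for k :: nat
  have l1: "l k \<ge> 1" for k using s by (simp add: l_def)
  have cas: "c / a = s * r" using a r0 by (simp add: s_def)
  let ?T = "\<lambda>k. {z::'a. z /\<^sub>R l k \<in> ?B}"
  have Tm [measurable]: "?T k \<in> sets borel" for k by measurable
  have disj: "?T k \<inter> ?T j = {}" if kj: "k < j" "j < m" for k j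
  proof (rule ccontr)
    assume "?T k \<inter> ?T j \<noteq> {}"
    then obtain z where z: "z /\<^sub>R l k \<in> ?B" "z /\<^sub>R l j \<in> ?B" by blast
    have lp: "l k > 0" "l j > 0" using l1[of k] l1[of j] by linarith+
    have "norm z / l k < r + s * r" using z(1) lp
      unfolding mem_Collect_eq cas norm_scaleR by (simp add: abs_less_iff divide_inverse mult.commute)
    then have 1: "norm z < (r + s * r) * l k" using lp by (simp add: pos_divide_less_eq)
    have "norm z / l j > r - s * r" using z(2) lp
      unfolding mem_Collect_eq cas norm_scaleR by (simp add: abs_less_iff divide_inverse mult.commute)
    then have 2: "(r - s * r) * l j < norm z" using lp by (simp add: pos_less_divide_eq)
    have "real (k + 1) \<le> real j" using kj by linarith
    then have "l (k + 1) \<le> l j" unfolding l_def using s by (intro add_left_mono mult_right_mono mult_left_mono) auto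
    moreover have "r - s * r \<ge> 0" using s cle r0 by (simp add: algebra_simps)
    ultimately have "(r - s * r) * l (k + 1) \<le> (r - s * r) * l j" by (intro mult_left_mono)
    with 1 2 have "(r - s * r) * l (k + 1) < (r + s * r) * l k" by linarith
    then have "r * ((1 - s) * l (k + 1)) < r * ((1 + s) * l k)" by (simp add: algebra_simps)
    then have "(1 - s) * l (k + 1) < (1 + s) * l k" using r0 by simp
    then have "s * (1 - 6 * real k * s - 3 * s) < 0" unfolding l_def by (simp add: algebra_simps)
    then have "1 < 6 * real k * s + 3 * s" using s(1) by (simp add: mult_less_0_iff)
    moreover have "(6 * real k + 3) * s \<le> (6 * real m) * s"
      using kj s by (intro mult_right_mono) auto
    ultimately show False using s(3) by (simp add: algebra_simps)
  qed
  have each: "(\<integral>\<^sup>+y. indicator ?B y * ?w y \<partial>lborel) \<le> ennreal (2^K) * (\<integral>\<^sup>+z. indicator (?T k) z * ?w z \<partial>lborel)" if k: "k < m" for k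
  proof -
    have lp: "l k > 0" using l1[of k] by linarith
    have pt: "indicator ?B y * ?w y \<le> ennreal (2^K) * (indicator (?T k) (0 + l k *\<^sub>R y) * ?w (0 + l k *\<^sub>R y))" for y
    proof (cases "y \<in> ?B")
      case True
      have "norm y < r + s * r" using True by (simp add: cas abs_less_iff)
      moreover have "s * r \<le> 1 * r" using s cle r0 by (intro mult_right_mono) auto
      ultimately have "norm y \<le> 2 * r" by simp
      have "norm (a *\<^sub>R (l k *\<^sub>R y - y)) = a * (3 * real k * s) * norm y"
      proof -
        have "l k *\<^sub>R y - y = (3 * real k * s) *\<^sub>R y" by (simp add: l_def scaleR_add_left)
        then show ?thesis using a s by simp
      qed
      also have "\<dots> \<le> a * (3 * real k * s) * (2 * r)"
        using a s \<open>norm y \<le> 2 * r\<close> by (intro mult_left_mono) auto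
      also have "\<dots> = 6 * real k * c" using a r0 by (simp add: s_def)
      also have "\<dots> \<le> 6 * real m * c" using k c by (intro mult_right_mono) auto
      finally have n1: "norm (a *\<^sub>R (l k *\<^sub>R y - y)) \<le> 1" using c by simp
      have "wt K (a *\<^sub>R (x - y)) \<le> (1 + norm (a *\<^sub>R (l k *\<^sub>R y - y)))^K * wt K (a *\<^sub>R (x - l k *\<^sub>R y))"
        using wt_shift[of K "a *\<^sub>R (x - l k *\<^sub>R y)" "a *\<^sub>R (l k *\<^sub>R y - y)"] by (simp add: scaleR_add_right[symmetric])
      also have "\<dots> \<le> 2^K * wt K (a *\<^sub>R (x - l k *\<^sub>R y))" using n1 by (intro mult_right_mono power_mono) auto
      finally have "a^DIM('a) * wt K (a *\<^sub>R (x - y)) \<le> a^DIM('a) * (2^K * wt K (a *\<^sub>R (x - l k *\<^sub>R y)))"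
        using a by (intro mult_left_mono) auto
      then have "?w y \<le> ennreal (2^K) * ?w (l k *\<^sub>R y)"
        by (subst ennreal_mult'[symmetric]) (auto intro!: ennreal_leI simp: mult_ac)
      moreover have "(l k *\<^sub>R y) /\<^sub>R l k = y" using lp by simp
      then have "l k *\<^sub>R y \<in> ?T k" using True by (simp only: mem_Collect_eq)
      ultimately show ?thesis using True by (simp only: indicator_simps add_0 mult_1_left)
    qed simp
    have "(\<integral>\<^sup>+y. indicator ?B y * ?w y \<partial>lborel) \<le> (\<integral>\<^sup>+y. ennreal (2^K) * (indicator (?T k) (0 + l k *\<^sub>R y) * ?w (0 + l k *\<^sub>R y)) \<partial>lborel)"
      by (rule nn_integral_mono) (rule pt)
    also have "\<dots> = ennreal (2^K) * (\<integral>\<^sup>+y. indicator (?T k) (0 + l k *\<^sub>R y) * ?w (0 + l k *\<^sub>R y) \<partial>lborel)"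
      by (rule nn_integral_cmult) measurable
    \<comment> \<open>The Jacobian of the dilation is at least 1, so inserting it only enlarges the
      bound.\<close>
    also have "\<dots> \<le> ennreal (2^K) * (ennreal (\<bar>l k\<bar>^DIM('a)) * (\<integral>\<^sup>+y. indicator (?T k) (0 + l k *\<^sub>R y) * ?w (0 + l k *\<^sub>R y) \<partial>lborel))"
    proof (intro mult_left_mono)
      have "1 \<le> ennreal (\<bar>l k\<bar>^DIM('a))" using l1[of k] by (simp add: one_le_power)
      from mult_right_mono[OF this, of "\<integral>\<^sup>+y. indicator (?T k) (0 + l k *\<^sub>R y) * ?w (0 + l k *\<^sub>R y) \<partial>lborel"]
      show "(\<integral>\<^sup>+y. indicator (?T k) (0 + l k *\<^sub>R y) * ?w (0 + l k *\<^sub>R y) \<partial>lborel) \<le> ennreal (\<bar>l k\<bar>^DIM('a)) * (\<integral>\<^sup>+y. indicator (?T k) (0 + l k *\<^sub>R y) * ?w (0 + l k *\<^sub>R y) \<partial>lborel)" by simp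
    qed simp
    also have "ennreal (\<bar>l k\<bar>^DIM('a)) * (\<integral>\<^sup>+y. indicator (?T k) (0 + l k *\<^sub>R y) * ?w (0 + l k *\<^sub>R y) \<partial>lborel) = (\<integral>\<^sup>+z. indicator (?T k) z * ?w z \<partial>lborel)"
      by (rule lborel_affine_nn_integral[symmetric]) (use lp in auto)
    finally show ?thesis .
  qed
  have "ennreal (real m) * (\<integral>\<^sup>+y. indicator ?B y * ?w y \<partial>lborel) = (\<Sum>k<m. (\<integral>\<^sup>+y. indicator ?B y * ?w y \<partial>lborel))"
    by (simp add: ennreal_of_nat_eq_real_of_nat)
  also have "\<dots> \<le> (\<Sum>k<m. ennreal (2^K) * (\<integral>\<^sup>+z. indicator (?T k) z * ?w z \<partial>lborel))"
    by (rule sum_mono) (use each in auto)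
  also have "\<dots> = ennreal (2^K) * (\<integral>\<^sup>+z. (\<Sum>k<m. indicator (?T k) z * ?w z) \<partial>lborel)"
    by (subst nn_integral_sum) (auto simp: sum_distrib_left)
  also have "\<dots> \<le> ennreal (2^K) * (\<integral>\<^sup>+z. ?w z \<partial>lborel)"
  proof (intro mult_left_mono nn_integral_mono)
    fix z
    have "(\<Sum>k<m. indicator (?T k) z :: ennreal) \<le> 1"
    proof (cases "\<exists>k<m. z \<in> ?T k")
      case True
      then obtain k where k: "k < m" "z \<in> ?T k" by blast
      have "(\<Sum>j<m. indicator (?T j) z :: ennreal) = (\<Sum>j<m. if j = k then 1 else 0)"
      proof (rule sum.cong[OF refl])
        fix j assume "j \<in> {..<m}"
        then show "(indicator (?T j) z :: ennreal) = (if j = k then 1 else 0)"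
          using k disj[of j k] disj[of k j] by (cases j k rule: linorder_cases) (auto simp: indicator_def)
      qed
      then show ?thesis using k by simp
    next
      case False
      then have "(\<Sum>j<m. indicator (?T j) z :: ennreal) = 0" by (intro sum.neutral) (auto simp: indicator_def)
      then show ?thesis by simp
    qed
    from mult_right_mono[OF this, of "?w z"] show "(\<Sum>k<m. indicator (?T k) z * ?w z) \<le> ?w z"
      by (simp add: sum_distrib_right)
  qed simp
  also have "(\<integral>\<^sup>+z. ?w z \<partial>lborel) = ennreal (wt_mass TYPE('a) K)" by (rule nn_integral_wt_scaled(1)[OF K a])
  finally show ?thesis by (subst ennreal_mult) (simp_all add: wt_mass_nonneg)
qed

section \<open>Averages over spherical shells\<close>

text \<open>With d the dimension, \<open>(r + h)^d \<ge> r^(d - 1) * (r + h)\<close>, so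
  \<open>(r + h)^d - r^d \<ge> r^(d - 1) * h\<close>.\<close>

lemma shell_measure:
  assumes r: "r > 0" and h: "h > 0"
  shows "measure lborel (ball (0::'a::euclidean_space) 1) * r^(DIM('a) - 1) * h
     \<le> measure lborel {y::'a. r \<le> norm y \<and> norm y \<le> r + h}"
proof -
  let ?w = "measure lborel (ball (0::'a) 1)"
  have eq: "{y::'a. r \<le> norm y \<and> norm y \<le> r + h} = cball 0 (r + h) - ball 0 r" by (auto simp: not_less)
  have m: "measure lborel (ball (0::'a) t) = t^DIM('a) * ?w" if "t > 0" for t
    using content_ball_conv_unit_ball[of t "0::'a"] that by simp
  have "measure lborel (cball (0::'a) (r + h) - ball 0 r) = measure lborel (cball (0::'a) (r + h)) - measure lborel (ball (0::'a) r)"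
  proof (rule measure_Diff)
    show "emeasure lborel (cball (0::'a) (r + h)) \<noteq> \<infinity>"
      using emeasure_bounded_finite[OF bounded_cball, of "0::'a" "r + h"] by (rule less_imp_neq)
    show "ball (0::'a) r \<subseteq> cball 0 (r + h)"
      by (rule subset_trans[OF ball_subset_cball subset_cball]) (use h in simp)
    show "cball (0::'a) (r + h) \<in> sets lborel" unfolding sets_lborel by (rule borel_closed[OF closed_cball])
    show "ball (0::'a) r \<in> sets lborel" unfolding sets_lborel by (rule borel_open[OF open_ball])
  qed
  also have "\<dots> = ?w * ((r + h)^DIM('a) - r^DIM('a))"
    unfolding content_cball_conv_ball m[OF add_pos_pos[OF r h]] m[OF r] by (simp add: right_diff_distrib mult.commute)
  finally have M: "measure lborel (cball (0::'a) (r + h) - ball 0 r) = ?w * ((r + h)^DIM('a) - r^DIM('a))" .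
  have "(r + h)^DIM('a) = (r + h)^(DIM('a) - 1) * (r + h)" by (rule power_minus_mult[symmetric]) simp
  also have "\<dots> \<ge> r^(DIM('a) - 1) * (r + h)" using r h by (intro mult_right_mono power_mono) auto
  finally have "r^(DIM('a) - 1) * r + r^(DIM('a) - 1) * h \<le> (r + h)^DIM('a)" by (simp add: algebra_simps)
  moreover have "r^DIM('a) = r^(DIM('a) - 1) * r" by (rule power_minus_mult[symmetric]) simp
  ultimately have "r^(DIM('a) - 1) * h \<le> (r + h)^DIM('a) - r^DIM('a)" by simp
  from mult_left_mono[OF this, of ?w] show ?thesis unfolding eq M by (simp add: mult.assoc)
qed

text \<open>The point \<open>y\<close> has radius within \<open>1 / a\<close> of \<open>r\<close>,
  so \<open>norm (y - z)\<close> is at least \<open>\<bar>norm z - r\<bar> - 1 / a\<close>; after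
  scaling this is a loss of 1, which costs the factor \<open>2^q\<close>.\<close>

lemma wt_radial_shift:
  fixes y z :: "'a::real_normed_vector"
  assumes a: "a > 0" and y: "r \<le> norm y" "norm y \<le> r + 1 / a"
  shows "wt q (a *\<^sub>R (y - z)) \<le> 2^q * wt q (a * (norm z - r))"
proof -
  have "\<bar>norm z - r\<bar> \<le> norm (y - z) + 1 / a"
    using y norm_triangle_ineq3[of z y] by (simp add: norm_minus_commute abs_le_iff)
  then have "a * \<bar>norm z - r\<bar> \<le> a * (norm (y - z) + 1 / a)" using a by (intro mult_left_mono) auto
  moreover have "norm (a * (norm z - r)) = a * \<bar>norm z - r\<bar>" "norm (a *\<^sub>R (y - z)) = a * norm (y - z)"
    using a by (simp_all add: abs_mult)
  moreover have "a * (norm (y - z) + 1 / a) = a * norm (y - z) + 1" using a by (simp add: distrib_left)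
  moreover have "a * norm (y - z) \<ge> 0" using a by simp
  moreover have "1 + P \<le> 2 * (1 + P')" if "P \<le> P' + 1" "P' \<ge> 0" for P P' :: real using that by simp
  ultimately have "1 + norm (a * (norm z - r)) \<le> 2 * (1 + norm (a *\<^sub>R (y - z)))" by (simp only:)
  then have "(1 + norm (a * (norm z - r)))^q \<le> (2 * (1 + norm (a *\<^sub>R (y - z))))^q" by (rule power_mono) simp
  then have "(wt q (a *\<^sub>R (y - z)) * wt q (a * (norm z - r))) * (1 + norm (a * (norm z - r)))^q
     \<le> (wt q (a *\<^sub>R (y - z)) * wt q (a * (norm z - r))) * (2^q * (1 + norm (a *\<^sub>R (y - z)))^q)"
    unfolding power_mult_distrib by (intro mult_left_mono) auto
  then have "wt q (a *\<^sub>R (y - z)) * (wt q (a * (norm z - r)) * (1 + norm (a * (norm z - r)))^q)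
     \<le> 2^q * wt q (a * (norm z - r)) * (wt q (a *\<^sub>R (y - z)) * (1 + norm (a *\<^sub>R (y - z)))^q)"
    by (simp only: mult_ac)
  then show ?thesis by (simp only: wt_mult_power mult_1_right)
qed

text \<open>The gain from radial symmetry. \<open>X\<close> is bounded by a kernel mean around every
  point of the sphere, hence up to constants around every point of a shell of width
  \<open>1 / a\<close>. Integrate over this shell and exchange the integrals:
  \<open>2 * DIM('a)\<close> powers of the weight integrate out together with
  \<open>a^DIM('a)\<close>, and \<open>q\<close> powers survive as decay in
  \<open>norm z - r\<close>. The volume of the shell is at least a constant times
  \<open>1 / a\<close>, so that division by it leaves the factor \<open>a\<close> in place of
  \<open>a^DIM('a)\<close>.\<close>

lemma radial_shell_average:
  fixes g :: "'a::euclidean_space \<Rightarrow> ennreal"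
  assumes a: "a > 0" and t: "0 < t" "t \<le> r" and g [measurable]: "g \<in> borel_measurable borel" and C: "C \<ge> 0"
    and Q: "Q = 2 * DIM('a) + q"
    and hyp: "\<And>x. norm x = r \<Longrightarrow> ennreal X \<le> ennreal C * (\<integral>\<^sup>+z. g z * ennreal (a^DIM('a) * wt Q (a *\<^sub>R (x - z))) \<partial>lborel)"
  shows "ennreal X \<le> ennreal (C * 2^Q * 2^q * wt_mass TYPE('a) (2 * DIM('a)) / (measure lborel (ball (0::'a) 1) * t^(DIM('a) - 1)) * a) *
     (\<integral>\<^sup>+z. g z * ennreal (wt q (a * (norm z - r))) \<partial>lborel)"
proof -
  have r: "r > 0" using t by simp
  let ?d = "DIM('a)"
  let ?J = "wt_mass TYPE('a) (2 * ?d)"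
  let ?S = "{y::'a. r \<le> norm y \<and> norm y \<le> r + 1 / a}"
  let ?w = "measure lborel (ball (0::'a) 1)"
  let ?R = "\<integral>\<^sup>+z. g z * ennreal (wt q (a * (norm z - r))) \<partial>lborel"
  have w0: "?w > 0" by (rule content_ball_pos) simp
  have J0: "?J \<ge> 0" by (rule wt_mass_nonneg)
  have Sm [measurable]: "?S \<in> sets borel" by measurable
  have pt: "ennreal X * indicator ?S y \<le> ennreal (C * 2^Q) * (\<integral>\<^sup>+z. g z * ennreal (a^?d * wt Q (a *\<^sub>R (y - z))) * indicator ?S y \<partial>lborel)" for y
  proof (cases "y \<in> ?S")
    case True
    then have y: "r \<le> norm y" "norm y \<le> r + 1 / a" "norm y > 0" using r by auto
    \<comment> \<open>The radial projection of \<open>y\<close> onto the sphere of radius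
      \<open>r\<close>; it moves \<open>y\<close> by at most \<open>1 / a\<close>.\<close>
    define x where "x = (r / norm y) *\<^sub>R y"
    have nx: "norm x = r" using y r by (simp add: x_def)
    have "x - y = (r / norm y - 1) *\<^sub>R y" by (simp add: x_def scaleR_diff_left)
    then have "norm (x - y) = \<bar>(r / norm y - 1) * norm y\<bar>" by (simp add: abs_mult)
    also have "(r / norm y - 1) * norm y = r - norm y" using y by (simp add: field_simps)
    finally have "norm (x - y) \<le> 1 / a" using y by simp
    then have "a * norm (x - y) \<le> a * (1 / a)" using a by (intro mult_left_mono) auto
    then have n1: "norm (a *\<^sub>R (x - y)) \<le> 1" using a by simp
    have kz: "a^?d * wt Q (a *\<^sub>R (x - z)) \<le> 2^Q * (a^?d * wt Q (a *\<^sub>R (y - z)))" for z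
    proof -
      have "wt Q (a *\<^sub>R (x - z)) \<le> (1 + norm (a *\<^sub>R (x - y)))^Q * wt Q (a *\<^sub>R (y - z))"
        using wt_shift[of Q "a *\<^sub>R (y - z)" "a *\<^sub>R (x - y)"] by (simp add: scaleR_add_right[symmetric])
      also have "\<dots> \<le> 2^Q * wt Q (a *\<^sub>R (y - z))" using n1 by (intro mult_right_mono power_mono) auto
      finally have "a^?d * wt Q (a *\<^sub>R (x - z)) \<le> a^?d * (2^Q * wt Q (a *\<^sub>R (y - z)))" using a by (intro mult_left_mono) auto
      then show ?thesis by (simp add: mult_ac)
    qed
    have "ennreal X \<le> ennreal C * (\<integral>\<^sup>+z. g z * ennreal (a^?d * wt Q (a *\<^sub>R (x - z))) \<partial>lborel)" by (rule hyp[OF nx])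
    also have "\<dots> \<le> ennreal C * (\<integral>\<^sup>+z. ennreal (2^Q) * (g z * ennreal (a^?d * wt Q (a *\<^sub>R (y - z)))) \<partial>lborel)"
    proof (intro mult_left_mono nn_integral_mono)
      fix z
      have "ennreal (a^?d * wt Q (a *\<^sub>R (x - z))) \<le> ennreal (2^Q) * ennreal (a^?d * wt Q (a *\<^sub>R (y - z)))"
        using kz[of z] by (subst ennreal_mult'[symmetric]) (auto intro: ennreal_leI)
      from mult_left_mono[OF this, of "g z"]
      show "g z * ennreal (a^?d * wt Q (a *\<^sub>R (x - z))) \<le> ennreal (2^Q) * (g z * ennreal (a^?d * wt Q (a *\<^sub>R (y - z))))"
        by (simp only: mult_ac) simp
    qed simp_all
    also have "\<dots> = ennreal (C * 2^Q) * (\<integral>\<^sup>+z. g z * ennreal (a^?d * wt Q (a *\<^sub>R (y - z))) \<partial>lborel)"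
      using C by (subst nn_integral_cmult) (auto simp: ennreal_mult mult.assoc)
    finally show ?thesis using True by simp
  qed simp
  have "ennreal X * emeasure lborel ?S = (\<integral>\<^sup>+y. ennreal X * indicator ?S y \<partial>lborel)"
    by (subst nn_integral_cmult_indicator) auto
  also have "\<dots> \<le> (\<integral>\<^sup>+y. ennreal (C * 2^Q) * (\<integral>\<^sup>+z. g z * ennreal (a^?d * wt Q (a *\<^sub>R (y - z))) * indicator ?S y \<partial>lborel) \<partial>lborel)"
    by (rule nn_integral_mono) (rule pt)
  also have "\<dots> = ennreal (C * 2^Q) * (\<integral>\<^sup>+y. (\<integral>\<^sup>+z. g z * ennreal (a^?d * wt Q (a *\<^sub>R (y - z))) * indicator ?S y \<partial>lborel) \<partial>lborel)"
    by (rule nn_integral_cmult) measurable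
  also have "(\<integral>\<^sup>+y. (\<integral>\<^sup>+z. g z * ennreal (a^?d * wt Q (a *\<^sub>R (y - z))) * indicator ?S y \<partial>lborel) \<partial>lborel)
      = (\<integral>\<^sup>+z. (\<integral>\<^sup>+y. g z * ennreal (a^?d * wt Q (a *\<^sub>R (y - z))) * indicator ?S y \<partial>lborel) \<partial>lborel)"
    by (rule lborel_pair.Fubini') measurable
  also have "\<dots> \<le> (\<integral>\<^sup>+z. ennreal (2^q * ?J) * (g z * ennreal (wt q (a * (norm z - r)))) \<partial>lborel)"
  proof (rule nn_integral_mono)
    fix z
    have "(\<integral>\<^sup>+y. g z * ennreal (a^?d * wt Q (a *\<^sub>R (y - z))) * indicator ?S y \<partial>lborel)
       \<le> (\<integral>\<^sup>+y. (g z * ennreal (2^q * wt q (a * (norm z - r)))) * ennreal (a^?d * wt (2 * ?d) (a *\<^sub>R (y - z))) \<partial>lborel)"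
    proof (rule nn_integral_mono)
      fix y
      show "g z * ennreal (a^?d * wt Q (a *\<^sub>R (y - z))) * indicator ?S y \<le> (g z * ennreal (2^q * wt q (a * (norm z - r)))) * ennreal (a^?d * wt (2 * ?d) (a *\<^sub>R (y - z)))"
      proof (cases "y \<in> ?S")
        case True
        then have "wt q (a *\<^sub>R (y - z)) \<le> 2^q * wt q (a * (norm z - r))" by (intro wt_radial_shift a) auto
        then have "a^?d * wt (2 * ?d) (a *\<^sub>R (y - z)) * wt q (a *\<^sub>R (y - z)) \<le> a^?d * wt (2 * ?d) (a *\<^sub>R (y - z)) * (2^q * wt q (a * (norm z - r)))"
          using a by (intro mult_left_mono) auto
        then have "a^?d * wt Q (a *\<^sub>R (y - z)) \<le> (2^q * wt q (a * (norm z - r))) * (a^?d * wt (2 * ?d) (a *\<^sub>R (y - z)))"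
          unfolding Q wt_add by (simp add: mult_ac)
        then have "ennreal (a^?d * wt Q (a *\<^sub>R (y - z))) \<le> ennreal (2^q * wt q (a * (norm z - r))) * ennreal (a^?d * wt (2 * ?d) (a *\<^sub>R (y - z)))"
          using a by (subst ennreal_mult'[symmetric]) (auto intro: ennreal_leI)
        from mult_left_mono[OF this, of "g z"] show ?thesis using True by (simp add: mult.assoc)
      qed simp
    qed
    also have "\<dots> = (g z * ennreal (2^q * wt q (a * (norm z - r)))) * (\<integral>\<^sup>+y. ennreal (a^?d * wt (2 * ?d) (a *\<^sub>R (y - z))) \<partial>lborel)"
      by (rule nn_integral_cmult) measurable
    also have "(\<integral>\<^sup>+y. ennreal (a^?d * wt (2 * ?d) (a *\<^sub>R (y - z))) \<partial>lborel) = ennreal ?J"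
      by (rule nn_integral_wt_scaled(2)[OF order_refl a])
    also have "(g z * ennreal (2^q * wt q (a * (norm z - r)))) * ennreal ?J = ennreal (2^q * ?J) * (g z * ennreal (wt q (a * (norm z - r))))"
      using J0 by (simp add: ennreal_mult mult_ac)
    finally show "(\<integral>\<^sup>+y. g z * ennreal (a^?d * wt Q (a *\<^sub>R (y - z))) * indicator ?S y \<partial>lborel) \<le> ennreal (2^q * ?J) * (g z * ennreal (wt q (a * (norm z - r))))" .
  qed
  also have "\<dots> = ennreal (2^q * ?J) * ?R" by (rule nn_integral_cmult) measurable
  finally have 1: "ennreal X * emeasure lborel ?S \<le> ennreal (C * 2^Q) * (ennreal (2^q * ?J) * ?R)"
    by (simp add: mult_left_mono)
  have "?w * t^(?d - 1) * (1 / a) \<le> ?w * r^(?d - 1) * (1 / a)"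
    using t a w0 by (intro mult_right_mono mult_left_mono power_mono) auto
  also have "\<dots> \<le> measure lborel ?S" by (rule shell_measure) (use r a in auto)
  finally have "ennreal (?w * t^(?d - 1) * (1 / a)) \<le> emeasure lborel ?S"
  proof (rule order_trans[OF ennreal_leI])
    have "bounded ?S" unfolding bounded_iff by blast
    then have "emeasure lborel ?S < \<infinity>" by (rule emeasure_bounded_finite)
    then show "ennreal (measure lborel ?S) \<le> emeasure lborel ?S" by (simp add: emeasure_eq_ennreal_measure)
  qed
  then have 2: "ennreal X * ennreal (?w * t^(?d - 1) * (1 / a)) \<le> ennreal (C * 2^Q) * (ennreal (2^q * ?J) * ?R)"
    using 1 by (meson mult_left_mono order_trans zero_le)
  let ?k = "a / (?w * t^(?d - 1))"
  have k0: "?k > 0" using a w0 t by simp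
  have "ennreal X = ennreal ?k * (ennreal X * ennreal (?w * t^(?d - 1) * (1 / a)))"
  proof -
    have "ennreal ?k * ennreal (?w * t^(?d - 1) * (1 / a)) = ennreal 1"
      using k0 a w0 t by (subst ennreal_mult'[symmetric]) auto
    then show ?thesis by (metis (no_types) ennreal_1 mult.assoc mult.commute mult.right_neutral)
  qed
  also have "\<dots> \<le> ennreal ?k * (ennreal (C * 2^Q) * (ennreal (2^q * ?J) * ?R))" by (intro mult_left_mono 2) simp
  also have "\<dots> = ennreal (C * 2^Q * 2^q * ?J / (?w * t^(?d - 1)) * a) * ?R"
  proof -
    have "ennreal ?k * (ennreal (C * 2^Q) * ennreal (2^q * ?J)) = ennreal (?k * (C * 2^Q * (2^q * ?J)))"
    proof -
      have "ennreal (C * 2^Q) * ennreal (2^q * ?J) = ennreal ((C * 2^Q) * (2^q * ?J))"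
        by (rule ennreal_mult'[symmetric]) (use C in simp)
      then show ?thesis using k0 by (simp only: ennreal_mult'[OF less_imp_le[OF k0]])
    qed
    also have "?k * (C * 2^Q * (2^q * ?J)) = C * 2^Q * 2^q * ?J / (?w * t^(?d - 1)) * a" by simp
    finally show ?thesis by (simp add: mult.assoc[symmetric])
  qed
  finally show ?thesis .
qed

text \<open>A geometric series that starts at the first index with \<open>c \<le> 2^j * u\<close>;
  its sum is at most twice its first term. For \<open>u = 0\<close> every term vanishes because
  \<open>c > 0\<close>. The induction runs downwards in \<open>J\<close>.\<close>

lemma dyadic_tail_sum:
  assumes c: "c > (0::real)" and u: "u \<ge> 0"
  shows "(\<Sum>j\<in>{J..<n}. if c \<le> 2^j * u then 1 / (2^j * u) else 0) \<le> 2 / max c (2^J * u)"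
proof (induction "n - J" arbitrary: J)
  case 0
  then have "{J..<n} = {}" by simp
  then show ?case using c by (simp add: max_def)
next
  case (Suc k)
  then have J: "J < n" "k = n - Suc J" by auto
  let ?t = "\<lambda>j. if c \<le> 2^j * u then 1 / (2^j * u) else (0::real)"
  have "sum ?t {J..<n} = ?t J + sum ?t {Suc J..<n}" using J(1) by (rule sum.atLeast_Suc_lessThan)
  also have "\<dots> \<le> ?t J + 2 / max c (2^Suc J * u)" using Suc(1)[OF J(2)] by simp
  also have "\<dots> \<le> 2 / max c (2^J * u)"
  proof (cases "c \<le> 2^J * u")
    case True
    then have "2 * (2^J * u) \<ge> c" using c by simp
    then show ?thesis using True c by (simp add: max_def mult.assoc mult.commute[of u])
  next
    case False
    have "2 / max c (2^Suc J * u) \<le> 2 / c" using c by (intro divide_left_mono) auto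
    then show ?thesis using False c by (simp add: max_def)
  qed
  finally show ?case .
qed

text \<open>The integral \<open>F r\<close> of \<open>G\<close> over the ball of radius
  \<open>r\<close> is monotone with finite limit at infinity, and it is continuous because spheres
  are null sets. The shell integral is at most \<open>F (r + h) - F (r - h)\<close>, small uniformly
  in \<open>r\<close>: near infinity by convergence, elsewhere by uniform continuity on a compact
  interval.\<close>

lemma small_shell_integral:
  fixes G :: "'a::euclidean_space \<Rightarrow> real"
  assumes G: "integrable lborel G" and G0: "\<And>x. G x \<ge> 0" and e: "e > 0"
  shows "\<exists>h>0. \<forall>r. (\<integral>z. indicator {z. \<bar>norm z - r\<bar> < h} z * G z \<partial>lborel) \<le> e"
proof -
  have [measurable]: "G \<in> borel_measurable borel" using G by simp
  define F where "F r = (\<integral>z. indicator {z. norm z \<le> r} z * G z \<partial>lborel)" for r :: real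
  have iA: "integrable lborel (\<lambda>z. indicator A z * G z)" if "A \<in> sets borel" for A
    using integrable_mult_indicator[of A lborel G] that G by simp
  have iF: "integrable lborel (\<lambda>z. indicator {z. norm z \<le> r} z * G z)" for r by (rule iA) measurable
  have conv: "(\<lambda>n. F (s n)) \<longlonglongrightarrow> F r" if "s \<longlonglongrightarrow> r" for s r
    unfolding F_def
  proof (rule integral_dominated_convergence[OF _ _ G])
    have "AE z in lborel. z \<notin> sphere (0::'a) r"
    proof (rule AE_not_in)
      have "negligible (sphere (0::'a) r)" by (rule negligible_sphere)
      then show "sphere (0::'a) r \<in> null_sets lborel"
        by (simp add: negligible_iff_null_sets null_sets_completion_iff)
    qed
    then show "AE z in lborel. (\<lambda>n. indicator {z. norm z \<le> s n} z * G z) \<longlonglongrightarrow> indicator {z. norm z \<le> r} z * G z"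
    proof eventually_elim
      case (elim z)
      then have "norm z < r \<or> norm z > r" by auto
      then have "\<forall>\<^sub>F n in sequentially. indicator {z. norm z \<le> s n} z * G z = indicator {z. norm z \<le> r} z * G z"
      proof
        assume z: "norm z < r"
        then have "\<forall>\<^sub>F n in sequentially. norm z < s n" using that order_tendstoD(1) by blast
        then show ?thesis by eventually_elim (use z in \<open>auto simp: indicator_def\<close>)
      next
        assume z: "norm z > r"
        then have "\<forall>\<^sub>F n in sequentially. norm z > s n" using that order_tendstoD(2) by blast
        then show ?thesis by eventually_elim (use z in \<open>auto simp: indicator_def\<close>)
      qed
      then show ?case by (rule tendsto_eventually)
    qed
    show "AE z in lborel. norm (indicator {z. norm z \<le> s n} z * G z) \<le> G z" for n
      by (rule AE_I2) (auto simp: indicator_def G0)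
  qed measurable
  have cF: "continuous_on UNIV F"
    unfolding continuous_on_sequentially using conv by (auto simp: o_def)
  have Fmono: "F r \<le> F s" if "r \<le> s" for r s
    unfolding F_def by (intro integral_mono iF) (use that G0 in \<open>auto simp: indicator_def\<close>)
  have Fle: "F r \<le> (\<integral>z. G z \<partial>lborel)" for r
    unfolding F_def by (intro integral_mono iF G) (auto simp: indicator_def G0)
  have "(\<lambda>n. F (real n)) \<longlonglongrightarrow> (\<integral>z. G z \<partial>lborel)"
    unfolding F_def
  proof (rule integral_dominated_convergence[OF _ _ G])
    show "AE z in lborel. (\<lambda>n. indicator {z. norm z \<le> real n} z * G z) \<longlonglongrightarrow> G z"
    proof (rule AE_I2, rule tendsto_eventually)
      fix z :: 'a
      show "\<forall>\<^sub>F n in sequentially. indicator {z. norm z \<le> real n} z * G z = G z"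
        using eventually_ge_at_top[of "nat \<lceil>norm z\<rceil>"] by eventually_elim (auto simp: indicator_def nat_le_iff ceiling_le_iff)
    qed
    show "AE z in lborel. norm (indicator {z. norm z \<le> real n} z * G z) \<le> G z" for n
      by (rule AE_I2) (auto simp: indicator_def G0)
  qed measurable
  then have "\<forall>\<^sub>F n in sequentially. F (real n) > (\<integral>z. G z \<partial>lborel) - e"
    by (rule order_tendstoD(1)) (use e in simp)
  then obtain N where N: "F (real N) > (\<integral>z. G z \<partial>lborel) - e" unfolding eventually_sequentially by blast
  \<comment> \<open>As \<open>2 * h \<le> 1\<close>, this interval contains \<open>r - h\<close> and
    \<open>r + h\<close> unless \<open>r - h \<ge> real N\<close> or
    \<open>r + h < 0\<close>.\<close>
  have "uniformly_continuous_on {-1..real N + 2} F"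
    by (intro compact_uniformly_continuous continuous_on_subset[OF cF]) auto
  then obtain d where d: "d > 0" "\<And>x y. x \<in> {-1..real N + 2} \<Longrightarrow> y \<in> {-1..real N + 2} \<Longrightarrow> dist y x < d \<Longrightarrow> dist (F y) (F x) < e"
    unfolding uniformly_continuous_on_def using e by metis
  define h where "h = min (1/2) (d / 3)"
  have h: "h > 0" "h \<le> 1/2" "2 * h < d" using d(1) by (auto simp: h_def)
  have "(\<integral>z. indicator {z. \<bar>norm z - r\<bar> < h} z * G z \<partial>lborel) \<le> e" for r
  proof -
    have "(\<integral>z. indicator {z. \<bar>norm z - r\<bar> < h} z * G z \<partial>lborel) \<le> (\<integral>z. indicator {z. norm z \<le> r + h} z * G z - indicator {z. norm z \<le> r - h} z * G z \<partial>lborel)"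
      by (intro integral_mono iA Bochner_Integration.integrable_diff) (use G0 h in \<open>auto simp: indicator_def\<close>)
    also have "\<dots> = F (r + h) - F (r - h)" unfolding F_def by (rule Bochner_Integration.integral_diff[OF iF iF])
    finally have le: "(\<integral>z. indicator {z. \<bar>norm z - r\<bar> < h} z * G z \<partial>lborel) \<le> F (r + h) - F (r - h)" .
    consider "r - h \<ge> real N" | "r + h < 0" | "r - h < real N" "r + h \<ge> 0" by linarith
    then show ?thesis
    proof cases
      case 1 then show ?thesis using le N Fle[of "r + h"] Fmono[of "real N" "r - h"] by linarith
    next
      case 2
      then have "\<not> norm z \<le> r + h" for z :: 'a using norm_ge_zero[of z] by linarith
      then have "indicator {z::'a. norm z \<le> r + h} z = (0::real)" for z by (simp add: indicator_def)
      then have "F (r + h) = 0" unfolding F_def by simp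
      moreover have "F (r - h) \<ge> 0" unfolding F_def by (intro integral_nonneg_AE AE_I2) (auto simp: indicator_def G0)
      ultimately show ?thesis using le e by linarith
    next
      case 3
      have "dist (F (r + h)) (F (r - h)) < e"
        by (rule d(2)) (use 3 h in \<open>auto simp: dist_real_def\<close>)
      then show ?thesis using le by (simp add: dist_real_def)
    qed
  qed
  with h(1) show ?thesis by blast
qed

text \<open>Off the removed shells \<open>wt 1\<close> is at most \<open>1 / (2^j * u)\<close> with
  \<open>u = \<bar>norm z - r\<bar>\<close>, and \<open>dyadic_tail_sum\<close> bounds the sum by
  \<open>2 / max c (2^J * u)\<close>. For \<open>u < h\<close> this is at most \<open>2 / c\<close>,
  and the integral of \<open>G\<close> over that shell is at most \<open>e * c / 4\<close>; for the
  other \<open>z\<close> it is at most \<open>2 / (2^J * h)\<close>, small for large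
  \<open>J\<close>. Each part contributes at most \<open>e / 2\<close>.\<close>

lemma uniform_dyadic_shell_tail:
  fixes G :: "'a::euclidean_space \<Rightarrow> real"
  assumes G: "integrable lborel G" and G0: "\<And>x. G x \<ge> 0" and c: "c > 0" and e: "e > 0"
  shows "\<exists>J. \<forall>n r. (\<Sum>j\<in>{J..<n}. \<integral>\<^sup>+z. indicator (- {z. \<bar>norm z - r\<bar> < c / 2^j}) z * ennreal (G z * wt 1 (2^j * (norm z - r))) \<partial>lborel) \<le> ennreal e"
proof -
  have [measurable]: "G \<in> borel_measurable borel" using G by simp
  define I where "I = (\<integral>z. G z \<partial>lborel)"
  have I0: "I \<ge> 0" unfolding I_def using G0 by simp
  obtain h where h: "h > 0" "\<And>r. (\<integral>z. indicator {z. \<bar>norm z - r\<bar> < h} z * G z \<partial>lborel) \<le> e * c / 4"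
    using small_shell_integral[OF G G0, of "e * c / 4"] e c by auto
  \<comment> \<open>\<open>I + 1\<close> keeps the numerator positive also when \<open>G\<close> has
    integral 0; the choice yields the bound \<open>e / 2\<close> far from the sphere.\<close>
  obtain J :: nat where J: "4 * (I + 1) / (h * e) < 2^J" using real_arch_pow[of 2] by auto
  have JJ: "2 / (2^J * h) * I \<le> e / 2"
  proof -
    have "4 * I \<le> 4 * (I + 1)" by simp
    also have "\<dots> \<le> 2^J * (h * e)" using J h(1) e by (simp add: divide_less_eq)
    finally show ?thesis using h(1) by (simp add: field_simps)
  qed
  have "(\<Sum>j\<in>{J..<n}. \<integral>\<^sup>+z. indicator (- {z. \<bar>norm z - r\<bar> < c / 2^j}) z * ennreal (G z * wt 1 (2^j * (norm z - r))) \<partial>lborel) \<le> ennreal e" for n r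
  proof -
    let ?H = "{z::'a. \<bar>norm z - r\<bar> < h}"
    have iH: "integrable lborel (\<lambda>z. indicator ?H z * G z)"
      using integrable_mult_indicator[of ?H lborel G] G by simp
    have "(\<Sum>j\<in>{J..<n}. \<integral>\<^sup>+z. indicator (- {z. \<bar>norm z - r\<bar> < c / 2^j}) z * ennreal (G z * wt 1 (2^j * (norm z - r))) \<partial>lborel)
      = (\<integral>\<^sup>+z. (\<Sum>j\<in>{J..<n}. indicator (- {z. \<bar>norm z - r\<bar> < c / 2^j}) z * ennreal (G z * wt 1 (2^j * (norm z - r)))) \<partial>lborel)"
      by (rule nn_integral_sum[symmetric]) measurable
    also have "\<dots> \<le> (\<integral>\<^sup>+z. ennreal (2 / c * (indicator ?H z * G z) + 2 / (2^J * h) * G z) \<partial>lborel)"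
    proof (rule nn_integral_mono)
      fix z :: 'a
      let ?u = "\<bar>norm z - r\<bar>"
      have "indicator (- {z. \<bar>norm z - r\<bar> < c / 2^j}) z * ennreal (G z * wt 1 (2^j * (norm z - r)))
          \<le> ennreal (G z * (if c \<le> 2^j * ?u then 1 / (2^j * ?u) else 0))" for j
      proof (cases "c \<le> 2^j * ?u")
        case True
        then have "2^j * ?u > 0" using c by linarith
        then have "wt 1 (2^j * (norm z - r)) \<le> 1 / (2^j * ?u)"
          unfolding wt_def by (simp add: abs_mult) (intro divide_left_mono; simp)
        then have "G z * wt 1 (2^j * (norm z - r)) \<le> G z * (1 / (2^j * ?u))" by (intro mult_left_mono G0)
        then show ?thesis using True by (auto simp: indicator_def ennreal_leI)
      next
        case False
        then have "?u < c / 2^j" by (simp add: field_simps)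
        then show ?thesis by simp
      qed
      then have "(\<Sum>j\<in>{J..<n}. indicator (- {z. \<bar>norm z - r\<bar> < c / 2^j}) z * ennreal (G z * wt 1 (2^j * (norm z - r))))
          \<le> (\<Sum>j\<in>{J..<n}. ennreal (G z * (if c \<le> 2^j * ?u then 1 / (2^j * ?u) else 0)))"
        by (rule sum_mono)
      also have "\<dots> = ennreal (G z * (\<Sum>j\<in>{J..<n}. if c \<le> 2^j * ?u then 1 / (2^j * ?u) else 0))"
        using G0 by (subst sum_ennreal) (auto simp: sum_distrib_left)
      also have "\<dots> \<le> ennreal (2 / c * (indicator ?H z * G z) + 2 / (2^J * h) * G z)"
      proof (rule ennreal_leI)
        have "G z * (\<Sum>j\<in>{J..<n}. if c \<le> 2^j * ?u then 1 / (2^j * ?u) else 0) \<le> G z * (2 / max c (2^J * ?u))"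
          by (intro mult_left_mono dyadic_tail_sum c G0) simp
        also have "\<dots> \<le> 2 / c * (indicator ?H z * G z) + 2 / (2^J * h) * G z"
        proof (cases "?u < h")
          case True
          have "2 / max c (2^J * ?u) \<le> 2 / c" using c by (intro divide_left_mono) auto
          then have "G z * (2 / max c (2^J * ?u)) \<le> G z * (2 / c)" by (intro mult_left_mono G0)
          moreover have "2 / (2^J * h) * G z \<ge> 0" using h(1) G0 by simp
          moreover have "G z * (2 / c) = 2 / c * (indicator ?H z * G z)" using True by simp
          ultimately show ?thesis by linarith
        next
          case False
          have "2^J * h \<le> max c (2^J * ?u)" using False by (simp add: le_max_iff_disj)
          then have "2 / max c (2^J * ?u) \<le> 2 / (2^J * h)" using h(1) c by (intro divide_left_mono) auto
          then have "G z * (2 / max c (2^J * ?u)) \<le> G z * (2 / (2^J * h))" by (intro mult_left_mono G0)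
          then show ?thesis using False by (simp add: mult.commute)
        qed
        finally show "G z * (\<Sum>j\<in>{J..<n}. if c \<le> 2^j * ?u then 1 / (2^j * ?u) else 0) \<le> 2 / c * (indicator ?H z * G z) + 2 / (2^J * h) * G z" .
      qed
      finally show "(\<Sum>j\<in>{J..<n}. indicator (- {z. \<bar>norm z - r\<bar> < c / 2^j}) z * ennreal (G z * wt 1 (2^j * (norm z - r))))
          \<le> ennreal (2 / c * (indicator ?H z * G z) + 2 / (2^J * h) * G z)" .
    qed
    also have "\<dots> = ennreal (\<integral>z. 2 / c * (indicator ?H z * G z) + 2 / (2^J * h) * G z \<partial>lborel)"
      by (rule nn_integral_eq_integral) (use iH G G0 c h(1) in auto)
    also have "(\<integral>z. 2 / c * (indicator ?H z * G z) + 2 / (2^J * h) * G z \<partial>lborel) = 2 / c * (\<integral>z. indicator ?H z * G z \<partial>lborel) + 2 / (2^J * h) * I"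
      unfolding I_def using iH G by (subst Bochner_Integration.integral_add) auto
    also have "\<dots> \<le> 2 / c * (e * c / 4) + e / 2"
      using h(2)[of r] c JJ by (intro add_mono mult_left_mono) auto
    also have "\<dots> = e" using c by simp
    finally show ?thesis by (simp add: ennreal_leI)
  qed
  then show ?thesis by blast
qed

section \<open>Dyadic decompositions\<close>

definition dil :: "('a::euclidean_space \<Rightarrow> complex) \<Rightarrow> nat \<Rightarrow> 'a \<Rightarrow> complex" where
  "dil \<phi> n = (\<lambda>\<xi>. \<phi> (\<xi> /\<^sub>R 2^n))"

text \<open>\<open>dyadic\<close> with integer powers of 2; as differences of consecutive dilations
  the partial sums telescope to \<open>dil\<close>.\<close>

definition ann :: "('a::euclidean_space \<Rightarrow> complex) \<Rightarrow> nat \<Rightarrow> 'a \<Rightarrow> complex" where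
  "ann \<phi> j = (\<lambda>\<xi>. if j = 0 then dil \<phi> 0 \<xi> else dil \<phi> j \<xi> - dil \<phi> (j - 1) \<xi>)"

lemma dyadic_eq_ann: "dyadic \<phi> j = ann \<phi> j"
proof
  fix \<xi>
  show "dyadic \<phi> j \<xi> = ann \<phi> j \<xi>"
  proof (cases j)
    case (Suc k)
    have "(2::real) powr (- real (Suc k)) = inverse (2^Suc k)" using powr_realpow[of 2 "Suc k"] by (simp only: powr_minus)
    moreover have "(2::real) powr (- real (Suc k) + 1) = inverse (2^k)"
      using powr_realpow[of 2 k] by (simp add: powr_minus)
    ultimately show ?thesis unfolding dyadic_def ann_def dil_def Suc by (simp only:) simp
  qed (simp add: dyadic_def ann_def dil_def)
qed

lemma sum_ann: "(\<Sum>i\<le>n. ann \<phi> i \<xi>) = dil \<phi> n \<xi>"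
  by (induction n) (auto simp: ann_def)

lemma test_function_dil: "test_function \<phi> \<Longrightarrow> test_function (dil \<phi> n)"
  unfolding dil_def by (rule test_function_scale) auto

lemma test_function_ann:
  assumes "test_function \<phi>"
  shows "test_function (ann \<phi> j)"
proof (cases "j = 0")
  case True
  then have "ann \<phi> j = dil \<phi> 0" by (auto simp: ann_def)
  then show ?thesis using test_function_dil[OF assms] by simp
next
  case False
  then have "ann \<phi> j = (\<lambda>\<xi>. dil \<phi> j \<xi> - dil \<phi> (j - 1) \<xi>)" by (auto simp: ann_def)
  then show ?thesis using test_function_diff[OF test_function_dil[OF assms] test_function_dil[OF assms]] by simp
qed

lemma test_function_sum:
  assumes "finite I" "\<And>i. i \<in> I \<Longrightarrow> test_function (f i)"
  shows "test_function (\<lambda>x. \<Sum>i\<in>I. f i x)"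
  using assms
proof (induction I rule: finite_induct)
  case empty show ?case using smooth_const[of 0] by (simp add: test_function_iff)
next
  case (insert i I) then show ?case using test_function_add[of "f i" "\<lambda>x. \<Sum>i\<in>I. f i x"] by simp
qed

context
  fixes \<phi> :: "'a::euclidean_space \<Rightarrow> complex"
  assumes gen: "dyadic_generator \<phi>"
begin

lemma gen_test: "test_function \<phi>" and gen_1: "norm \<xi> \<le> 1 \<Longrightarrow> \<phi> \<xi> = 1" and gen_0: "norm \<xi> \<ge> 3/2 \<Longrightarrow> \<phi> \<xi> = 0"
  using gen by (auto simp: dyadic_generator_def)

lemma dil_1: "norm \<xi> \<le> 2^n \<Longrightarrow> dil \<phi> n \<xi> = 1"
  unfolding dil_def by (rule gen_1) (simp add: inverse_eq_divide)

lemma dil_0: "norm \<xi> \<ge> 3/2 * 2^n \<Longrightarrow> dil \<phi> n \<xi> = 0"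
  unfolding dil_def by (rule gen_0) (simp add: inverse_eq_divide pos_le_divide_eq)

lemma ann_0_large: "norm \<xi> \<ge> 3/2 * 2^j \<Longrightarrow> ann \<phi> j \<xi> = 0"
proof -
  assume *: "norm \<xi> \<ge> 3/2 * 2^j"
  have "(2::real)^(j-1) \<le> 2^j" by (rule power_increasing) auto
  then have "norm \<xi> \<ge> 3/2 * 2^(j-1)" using * by linarith
  then show ?thesis using dil_0[OF *] dil_0[of "j-1" \<xi>] by (auto simp: ann_def)
qed

lemma ann_0_small: "j > 0 \<Longrightarrow> norm \<xi> \<le> 2^(j-1) \<Longrightarrow> ann \<phi> j \<xi> = 0"
proof -
  assume *: "j > 0" "norm \<xi> \<le> 2^(j-1)"
  have "(2::real)^(j-1) \<le> 2^j" by (rule power_increasing) auto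
  then have "norm \<xi> \<le> 2^j" using *(2) by linarith
  then show ?thesis using * dil_1[of \<xi> j] dil_1[of \<xi> "j-1"] by (auto simp: ann_def)
qed

text \<open>In this region \<open>ann \<phi> i\<close> vanishes for \<open>i + 2 \<le> j\<close>,
  and the full sum up to \<open>Suc j\<close> is the dilation \<open>dil \<phi> (Suc j)\<close>,
  which is 1 there. For \<open>j = 0\<close> the truncated difference makes the range
  \<open>{0..1}\<close>.\<close>

lemma sum_near_ann_1:
  assumes "norm \<xi> \<le> 3/2 * 2^j" "j = 0 \<or> norm \<xi> \<ge> 2^(j-1)"
  shows "(\<Sum>i\<in>{j-1..Suc j}. ann \<phi> i \<xi>) = 1"
proof -
  have "(\<Sum>i\<le>Suc j. ann \<phi> i \<xi>) = (\<Sum>i\<in>{j-1..Suc j}. ann \<phi> i \<xi>)"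
  proof (rule sum.mono_neutral_right)
    show "\<forall>i\<in>{..Suc j} - {j-1..Suc j}. ann \<phi> i \<xi> = 0"
    proof
      fix i assume i: "i \<in> {..Suc j} - {j-1..Suc j}"
      then have ij: "i + 2 \<le> j" by auto
      have "(2::real)^(i+1) \<le> 2^(j-1)" using ij by (intro power_increasing) auto
      moreover have "3/2 * (2::real)^i \<le> 2^(i+1)" by simp
      ultimately have "norm \<xi> \<ge> 3/2 * 2^i" using assms(2) ij by linarith
      then show "ann \<phi> i \<xi> = 0" by (rule ann_0_large)
    qed
  qed auto
  moreover have "dil \<phi> (Suc j) \<xi> = 1"
  proof (rule dil_1)
    have "3/2 * (2::real)^j \<le> 2^Suc j" by simp
    then show "norm \<xi> \<le> 2^Suc j" using assms(1) by linarith
  qed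
  ultimately show ?thesis using sum_ann[where \<phi>=\<phi> and n="Suc j" and \<xi>=\<xi>] by simp
qed

text \<open>The near sum vanishes for \<open>norm \<xi> \<ge> 3/2 * 2^(j + 1)\<close>, a radius
  below \<open>2^(j + 2)\<close>, and up to the latter the dilated generator is 1. This is the
  origin of the scale \<open>2^(j + 2)\<close> in the estimates of the blocks.\<close>

lemma sum_near_ann_mult_dil:
  assumes "dyadic_generator \<Phi>"
  shows "(\<Sum>i\<in>{j-1..Suc j}. ann \<phi> i \<xi>) * dil \<Phi> (j + 2) \<xi> = (\<Sum>i\<in>{j-1..Suc j}. ann \<phi> i \<xi>)"
proof (cases "norm \<xi> \<le> 2^(j+2)")
  case True
  have "\<Phi> (\<xi> /\<^sub>R 2^(j+2)) = 1" using assms True by (auto simp: dyadic_generator_def inverse_eq_divide)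
  then show ?thesis by (simp add: dil_def)
next
  case False
  have "ann \<phi> i \<xi> = 0" if "i \<in> {j-1..Suc j}" for i
  proof (rule ann_0_large)
    have "(2::real)^i \<le> 2^Suc j" using that by (intro power_increasing) auto
    moreover have "(2::real)^(j+2) = 2 * 2^Suc j" by simp
    moreover have "(0::real) < 2^Suc j" by simp
    ultimately have "3/2 * (2::real)^i \<le> 2^(j+2)" by linarith
    then show "3/2 * 2^i \<le> norm \<xi>" using False by linarith
  qed
  then show ?thesis by simp
qed

end

text \<open>Both generators obey the same support conditions, so the near sum of one is 1 where the
  annulus function of the other is nonzero. This is the passage from the given generator to the
  radial one.\<close>

lemma sum_near_ann_mult_ann:
  assumes "dyadic_generator \<phi>" "dyadic_generator \<Phi>"
  shows "(\<Sum>i\<in>{j-1..Suc j}. ann \<phi> i \<xi>) * ann \<Phi> j \<xi> = ann \<Phi> j \<xi>"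
proof (cases "norm \<xi> \<le> 3/2 * 2^j \<and> (j = 0 \<or> norm \<xi> \<ge> 2^(j-1))")
  case True
  then show ?thesis using sum_near_ann_1[OF assms(1), of \<xi> j] by simp
next
  case False
  then have "ann \<Phi> j \<xi> = 0"
    using ann_0_large[OF assms(2), of j \<xi>] ann_0_small[OF assms(2), of j \<xi>] by force
  then show ?thesis by simp
qed

text \<open>Evaluate \<open>\<phi>\<close> at \<open>(\<xi> \<bullet> \<xi>) *\<^sub>R e\<close>, a
  point of norm \<open>norm \<xi> ^ 2\<close>. Squaring preserves the unit ball and
  \<open>(3/2)^2 \<ge> 3/2\<close>, so both conditions on a generator survive.\<close>

lemma radial_generator:
  assumes gen: "dyadic_generator (\<phi> :: 'a::euclidean_space \<Rightarrow> complex)"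
  shows "\<exists>\<Phi>::'a \<Rightarrow> complex. dyadic_generator \<Phi> \<and> (\<forall>\<xi> \<eta>. norm \<xi> = norm \<eta> \<longrightarrow> \<Phi> \<xi> = \<Phi> \<eta>)"
proof -
  obtain e :: 'a where e: "e \<in> Basis" using nonempty_Basis by blast
  define \<Phi> where "\<Phi> = (\<lambda>\<xi>::'a. \<phi> ((\<xi> \<bullet> \<xi>) *\<^sub>R e))"
  have n: "norm ((\<xi> \<bullet> \<xi>) *\<^sub>R e) = norm \<xi> ^ 2" for \<xi> :: 'a using e by (simp add: power2_norm_eq_inner)
  have one: "\<Phi> \<xi> = 1" if "norm \<xi> \<le> 1" for \<xi>
    unfolding \<Phi>_def by (rule gen_1[OF gen]) (use that in \<open>simp only: n, simp add: power_le_one\<close>)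
  have zero: "\<Phi> \<xi> = 0" if "norm \<xi> \<ge> 3/2" for \<xi>
  proof -
    have "(3/2)^2 \<le> norm \<xi> ^ 2" using that by (rule power_mono) simp
    moreover have "(3/2 :: real) \<le> (3/2)^2" by (simp add: power2_eq_square)
    ultimately have "3/2 \<le> norm ((\<xi> \<bullet> \<xi>) *\<^sub>R e)" unfolding n by linarith
    then show ?thesis unfolding \<Phi>_def by (rule gen_0[OF gen])
  qed
  have "smooth \<phi>" using gen_test[OF gen] test_function_def by blast
  from smooth_radial_compose[OF this e] have "smooth \<Phi>" unfolding \<Phi>_def .
  moreover have "\<exists>R. \<forall>x. norm x > R \<longrightarrow> \<Phi> x = 0" by (rule exI[of _ "3/2"]) (auto intro!: zero)
  ultimately have "test_function \<Phi>" unfolding test_function_iff by blast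
  with one zero have "dyadic_generator \<Phi>" unfolding dyadic_generator_def by (intro conjI allI impI)
  moreover have "\<Phi> \<xi> = \<Phi> \<eta>" if "norm \<xi> = norm \<eta>" for \<xi> \<eta>
    unfolding \<Phi>_def using that by (simp add: power2_norm_eq_inner[symmetric])
  ultimately show ?thesis by (intro exI[of _ \<Phi>] conjI allI impI)
qed

lemma kern_dil_bound:
  assumes "test_function (\<Phi> :: 'a::euclidean_space \<Rightarrow> complex)"
  shows "\<exists>A>0. \<forall>n z. norm (kern (dil \<Phi> n) z) \<le> A * ((2^n)^DIM('a) * wt N ((2^n) *\<^sub>R z))"
proof -
  obtain C where C: "C \<ge> 0" "\<And>z. norm (kern \<Phi> z) \<le> C * wt N z"
    using rapidD[OF schwartz_rapid[OF schwartz_kern[OF assms]]] by blast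
  have "norm (kern (dil \<Phi> n) z) \<le> (C + 1) * ((2^n)^DIM('a) * wt N ((2^n) *\<^sub>R z))" for n z
  proof -
    have "norm (kern (dil \<Phi> n) z) = (2^n)^DIM('a) * norm (kern \<Phi> ((2^n) *\<^sub>R z))"
      unfolding dil_def using kern_scale[OF schwartz_measurable[OF test_function_schwartz[OF assms]], of "2^n" z]
      by (simp add: norm_mult norm_power)
    also have "\<dots> \<le> (2^n)^DIM('a) * ((C + 1) * wt N ((2^n) *\<^sub>R z))"
      using C(2)[of "(2^n) *\<^sub>R z"] by (intro mult_left_mono) (auto simp: distrib_right add_increasing2)
    finally show ?thesis by (simp only: mult_ac)
  qed
  moreover have "C + 1 > 0" using C(1) by simp
  ultimately show ?thesis by blast
qed

lemma wt_scale_le: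
  fixes z :: "'a::real_normed_vector"
  assumes "0 < b" "b \<le> a"
  shows "wt N (b *\<^sub>R z) \<le> (a / b)^N * wt N (a *\<^sub>R z)"
proof -
  have "1 + norm (a *\<^sub>R z) \<le> (a / b) * (1 + norm (b *\<^sub>R z))"
    using assms by (simp add: field_simps)
  then have "(1 + norm (a *\<^sub>R z))^N \<le> ((a / b) * (1 + norm (b *\<^sub>R z)))^N" by (rule power_mono) simp
  then have "(wt N (a *\<^sub>R z) * wt N (b *\<^sub>R z)) * (1 + norm (a *\<^sub>R z))^N \<le> (wt N (a *\<^sub>R z) * wt N (b *\<^sub>R z)) * ((a / b)^N * (1 + norm (b *\<^sub>R z))^N)"
    unfolding power_mult_distrib by (intro mult_left_mono) auto
  then have "wt N (b *\<^sub>R z) * (wt N (a *\<^sub>R z) * (1 + norm (a *\<^sub>R z))^N) \<le> (a / b)^N * wt N (a *\<^sub>R z) * (wt N (b *\<^sub>R z) * (1 + norm (b *\<^sub>R z))^N)"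
    by (simp only: mult_ac)
  then show ?thesis by (simp only: wt_mult_power mult_1_right)
qed

text \<open>All kernels are measured at the one scale \<open>2^(j + 2)\<close>. The coarsest
  dilation that occurs is \<open>j - 1\<close>, off by at most a factor 8, which costs
  \<open>8^N\<close> in the weight.\<close>

lemma kern_block_bounds:
  assumes "test_function (\<Phi> :: 'a::euclidean_space \<Rightarrow> complex)"
  shows "\<exists>A>0. \<forall>j z. norm (kern (dil \<Phi> (j + 2)) z) \<le> A * ((2^(j+2))^DIM('a) * wt N ((2^(j+2)) *\<^sub>R z))
     \<and> norm (kern (ann \<Phi> j) z) \<le> A * ((2^(j+2))^DIM('a) * wt N ((2^(j+2)) *\<^sub>R z))"
proof -
  obtain A where A: "A > 0" "\<And>n z. norm (kern (dil \<Phi> n) z) \<le> A * ((2^n)^DIM('a) * wt N ((2^n) *\<^sub>R z))"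
    using kern_dil_bound[OF assms] by blast
  have coarse: "norm (kern (dil \<Phi> n) z) \<le> A * 8^N * ((2^(j+2))^DIM('a) * wt N ((2^(j+2)) *\<^sub>R z))" if "n \<le> j + 2" "j + 2 \<le> n + 3" for n j z
  proof -
    have "wt N ((2^n) *\<^sub>R z) \<le> (2^(j+2) / 2^n)^N * wt N ((2^(j+2)) *\<^sub>R z)"
      using that by (intro wt_scale_le power_increasing) auto
    also have "\<dots> \<le> 8^N * wt N ((2^(j+2)) *\<^sub>R z)"
    proof (intro mult_right_mono power_mono)
      have "(2::real)^(j+2) \<le> 2^(n+3)" using that by (intro power_increasing) auto
      then show "(2::real)^(j+2) / 2^n \<le> 8" by (simp add: divide_le_eq power_add)
    qed auto
    finally have "A * ((2^n)^DIM('a) * wt N ((2^n) *\<^sub>R z)) \<le> A * ((2^(j+2))^DIM('a) * (8^N * wt N ((2^(j+2)) *\<^sub>R z)))"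
      using A(1) that by (intro mult_left_mono mult_mono power_mono power_increasing) auto
    then show ?thesis using A(2)[of n z] by (simp add: mult_ac)
  qed
  have "norm (kern (ann \<Phi> j) z) \<le> (2 * (A * 8^N)) * ((2^(j+2))^DIM('a) * wt N ((2^(j+2)) *\<^sub>R z))" for j z
  proof (cases "j = 0")
    case True
    then have "kern (ann \<Phi> j) z = kern (dil \<Phi> 0) z" by (simp add: ann_def)
    moreover have "0 \<le> A * 8^N * ((2^(j+2))^DIM('a) * wt N ((2^(j+2)) *\<^sub>R z))" using A(1) by simp
    ultimately show ?thesis using coarse[of 0 j z] True by simp
  next
    case False
    then have "kern (ann \<Phi> j) z = kern (dil \<Phi> j) z - kern (dil \<Phi> (j - 1)) z"
      unfolding ann_def by (simp add: kern_diff test_function_integrable test_function_dil[OF assms])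
    moreover have "norm (kern (dil \<Phi> j) z) \<le> A * 8^N * ((2^(j+2))^DIM('a) * wt N ((2^(j+2)) *\<^sub>R z))"
      by (rule coarse) auto
    moreover have "norm (kern (dil \<Phi> (j-1)) z) \<le> A * 8^N * ((2^(j+2))^DIM('a) * wt N ((2^(j+2)) *\<^sub>R z))"
      by (rule coarse) auto
    ultimately show ?thesis
      using norm_triangle_ineq4[of "kern (dil \<Phi> j) z" "kern (dil \<Phi> (j-1)) z"] by (simp only:)
  qed
  moreover have "norm (kern (dil \<Phi> (j + 2)) z) \<le> (2 * (A * 8^N)) * ((2^(j+2))^DIM('a) * wt N ((2^(j+2)) *\<^sub>R z))" for j z
  proof -
    have "0 \<le> A * 8^N * ((2^(j+2))^DIM('a) * wt N ((2^(j+2)) *\<^sub>R z))" using A(1) by simp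
    then show ?thesis using coarse[of "j+2" j z] by simp
  qed
  moreover have "2 * (A * 8^N) > 0" using A(1) by simp
  ultimately show ?thesis by blast
qed

section \<open>Blocks of a distribution as functions\<close>

lemma tempered_sum:
  fixes T :: "'a::euclidean_space distr"
  assumes T: "tempered T" and "finite I" and "\<And>i. i \<in> I \<Longrightarrow> f i \<in> schwartz"
  shows "T (\<lambda>x. \<Sum>i\<in>I. f i x) = (\<Sum>i\<in>I. T (f i)) \<and> (\<lambda>x. \<Sum>i\<in>I. f i x) \<in> schwartz"
proof -
  have lin: "T (\<lambda>x. a * f x + b * g x) = a * T f + b * T g" if "f \<in> schwartz" "g \<in> schwartz" for f g a b
    using T that unfolding tempered_def by blast
  have z: "(\<lambda>x::'a. 0::complex) \<in> schwartz"
    by (rule test_function_schwartz) (simp add: test_function_iff smooth_const)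
  have T0: "T (\<lambda>x. 0) = 0" using lin[OF z z, of 0 0] by simp
  show ?thesis using assms(2,3)
  proof (induction I rule: finite_induct)
    case (insert i I)
    then have S: "(\<lambda>x. \<Sum>i\<in>I. f i x) \<in> schwartz" "f i \<in> schwartz" by auto
    have "(\<lambda>x. f i x - (0 - (\<Sum>i\<in>I. f i x))) \<in> schwartz" by (intro schwartz_diff S z)
    then show ?case using insert lin[OF S(2,1), of 1 1] by simp
  qed (use T0 z in simp)
qed

text \<open>The transpose of convolution with \<open>k\<close> under the bilinear pairing, see
  \<open>integral_conv_eq_corr\<close>; it is what a multiplier does to the function representing a
  distribution.\<close>

definition corr :: "('a::euclidean_space \<Rightarrow> complex) \<Rightarrow> ('a \<Rightarrow> complex) \<Rightarrow> 'a \<Rightarrow> complex" where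
  "corr h k x = (\<integral>y. h y * k (y - x) \<partial>lborel)"

lemma corr_measurable [measurable]:
  assumes [measurable]: "h \<in> borel_measurable borel" "k \<in> borel_measurable borel"
  shows "corr h k \<in> borel_measurable borel"
  unfolding corr_def[abs_def] by measurable

lemma corr_cong_AE:
  assumes "AE y in lborel. h y = h' y" and [measurable]: "h \<in> borel_measurable borel" "h' \<in> borel_measurable borel" "k \<in> borel_measurable borel"
  shows "corr h k = corr h' k"
  unfolding corr_def by (rule ext, rule integral_cong_AE) (use assms(1) in auto)

lemma corr_growth:
  fixes h :: "'a::euclidean_space \<Rightarrow> complex"
  assumes hL: "integrable lborel (\<lambda>x. wt L x *\<^sub>R h x)" and [measurable]: "h \<in> borel_measurable borel" and k: "k \<in> schwartz"
  shows "\<exists>C\<ge>0. \<forall>x. norm (corr h k x) \<le> C * (1 + norm x)^L"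
    and "integrable lborel (\<lambda>y. h y * k (y - x))"
proof -
  note [measurable] = schwartz_measurable[OF k]
  obtain C where C: "C \<ge> 0" "\<And>x. norm (k x) \<le> C * wt L x" using rapidD[OF schwartz_rapid[OF k]] by blast
  have b: "norm (k (y - x)) \<le> (C * (1 + norm x)^L) * wt L y" for x y
  proof -
    have "C * wt L (y - x) \<le> C * ((1 + norm x)^L * wt L y)"
      using wt_shift[of L y "-x"] C(1) by (intro mult_left_mono) auto
    then show ?thesis using C(2)[of "y - x"] by (simp add: mult.assoc)
  qed
  show int: "integrable lborel (\<lambda>y. h y * k (y - x))" for x
    by (rule wt_integrable_mult[OF hL]) (use b[of _ x] in auto)
  have "norm (corr h k x) \<le> (C * (\<integral>y. norm (wt L y *\<^sub>R h y) \<partial>lborel)) * (1 + norm x)^L" for x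
  proof -
    have "norm (corr h k x) \<le> (\<integral>y. (C * (1 + norm x)^L) * norm (wt L y *\<^sub>R h y) \<partial>lborel)"
      unfolding corr_def
    proof (rule Bochner_Integration.integral_norm_bound_integral[OF int])
      show "integrable lborel (\<lambda>y. (C * (1 + norm x)^L) * norm (wt L y *\<^sub>R h y))"
        by (intro integrable_mult_right integrable_norm hL)
      fix y
      show "norm (h y * k (y - x)) \<le> (C * (1 + norm x)^L) * norm (wt L y *\<^sub>R h y)"
        using mult_left_mono[OF b[of y x] norm_ge_zero[of "h y"]] by (simp add: norm_mult mult_ac)
    qed
    then show ?thesis by (simp only: integral_mult_right_zero) (simp only: mult_ac)
  qed
  then show "\<exists>C\<ge>0. \<forall>x. norm (corr h k x) \<le> C * (1 + norm x)^L"
    by (intro exI[of _ "C * (\<integral>y. norm (wt L y *\<^sub>R h y) \<partial>lborel)"]) (use C(1) in auto)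
qed

lemma integral_conv_eq_corr:
  fixes h :: "'a::euclidean_space \<Rightarrow> complex"
  assumes hL: "integrable lborel (\<lambda>x. wt L x *\<^sub>R h x)" and [measurable]: "h \<in> borel_measurable borel"
    and k: "k \<in> schwartz" and \<psi>: "\<psi> \<in> schwartz"
  shows "(\<integral>y. h y * conv k \<psi> y \<partial>lborel) = (\<integral>x. corr h k x * \<psi> x \<partial>lborel)"
proof -
  note [measurable] = schwartz_measurable[OF k] schwartz_measurable[OF \<psi>]
  obtain C where C: "C \<ge> 0" "\<And>x. norm (k x) \<le> C * wt L x" using rapidD[OF schwartz_rapid[OF k]] by blast
  have "(\<integral>y. (\<integral>x. h y * (k (y - x) * \<psi> x) \<partial>lborel) \<partial>lborel) = (\<integral>x. (\<integral>y. h y * (k (y - x) * \<psi> x) \<partial>lborel) \<partial>lborel)"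
  proof (rule lborel_fubini_swap)
    show "integrable lborel (\<lambda>y. norm (wt L y *\<^sub>R h y))" using hL by (rule integrable_norm)
    show "integrable lborel (\<lambda>x. C * norm ((1 + norm x)^L *\<^sub>R \<psi> x))"
      by (intro integrable_mult_right integrable_norm rapid_integrable schwartz_rapid schwartz_measurable \<psi>)
    fix y x
    have "norm (k (y - x)) \<le> C * ((1 + norm x)^L * wt L y)"
      using C(2)[of "y - x"] mult_left_mono[OF wt_shift[of L y "-x"] C(1)] by simp
    then have "norm (h y) * (norm (k (y - x)) * norm (\<psi> x)) \<le> norm (h y) * ((C * ((1 + norm x)^L * wt L y)) * norm (\<psi> x))"
      by (intro mult_left_mono mult_right_mono) auto
    then show "norm (h y * (k (y - x) * \<psi> x)) \<le> norm (wt L y *\<^sub>R h y) * (C * norm ((1 + norm x)^L *\<^sub>R \<psi> x))"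
      by (simp add: norm_mult mult_ac)
  qed measurable
  moreover have "(\<integral>y. h y * (k (y - x) * \<psi> x) \<partial>lborel) = corr h k x * \<psi> x" for x
    unfolding corr_def by (simp add: mult.assoc[symmetric])
  ultimately show ?thesis unfolding conv_def by simp
qed

text \<open>A product of multipliers is a composition of convolutions on the test function; the
  inner one is moved onto \<open>h\<close> by transposition.\<close>

lemma block_representation:
  fixes f :: "'a::euclidean_space distr"
  assumes rep: "\<And>\<psi>. \<psi> \<in> schwartz \<Longrightarrow> f (conv (kern \<eta>) \<psi>) = (\<integral>x. h x * \<psi> x \<partial>lborel)"
    and hL: "integrable lborel (\<lambda>x. wt L x *\<^sub>R h x)" and hm: "h \<in> borel_measurable borel"
    and \<eta>: "test_function \<eta>" and m: "test_function m" and \<psi>: "\<psi> \<in> schwartz"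
  shows "f (conv (kern (\<lambda>\<xi>. \<eta> \<xi> * m \<xi>)) \<psi>) = (\<integral>x. corr h (kern m) x * \<psi> x \<partial>lborel)"
proof -
  have S: "conv (kern m) \<psi> \<in> schwartz" by (intro schwartz_conv schwartz_kern m schwartz_rapid schwartz_measurable \<psi>)
  have "f (conv (kern (\<lambda>\<xi>. \<eta> \<xi> * m \<xi>)) \<psi>) = f (conv (kern \<eta>) (conv (kern m) \<psi>))"
    by (simp only: conv_kern_kern[OF \<eta> m \<psi>])
  also have "\<dots> = (\<integral>x. h x * conv (kern m) \<psi> x \<partial>lborel)" by (rule rep[OF S])
  also have "\<dots> = (\<integral>x. corr h (kern m) x * \<psi> x \<partial>lborel)" by (rule integral_conv_eq_corr[OF hL hm schwartz_kern[OF m] \<psi>])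
  finally show ?thesis .
qed

lemma growth_imp_wt_integrable:
  fixes w :: "'a::euclidean_space \<Rightarrow> complex"
  assumes [measurable]: "w \<in> borel_measurable borel" and C: "\<And>x. norm (w x) \<le> C * (1 + norm x)^L"
  shows "integrable lborel (\<lambda>x. wt (L + 2 * DIM('a)) x *\<^sub>R w x)"
proof (rule Bochner_Integration.integrable_bound)
  show "integrable lborel (\<lambda>x::'a. C * wt (2 * DIM('a)) x)" by (intro integrable_mult_right integrable_wt) simp
  show "AE x in lborel. norm (wt (L + 2 * DIM('a)) x *\<^sub>R w x) \<le> norm (C * wt (2 * DIM('a)) x)"
  proof (rule AE_I2)
    fix x :: 'a
    have "wt (L + 2 * DIM('a)) x * norm (w x) \<le> (wt L x * wt (2 * DIM('a)) x) * (C * (1 + norm x)^L)"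
      unfolding wt_add by (intro mult_left_mono C) auto
    also have "\<dots> = C * wt (2 * DIM('a)) x * (wt L x * (1 + norm x)^L)" by (simp only: mult_ac)
    also have "\<dots> = C * wt (2 * DIM('a)) x" by (simp only: wt_mult_power mult_1_right)
    finally show "norm (wt (L + 2 * DIM('a)) x *\<^sub>R w x) \<le> norm (C * wt (2 * DIM('a)) x)" by simp
  qed
qed measurable

text \<open>The multiplier \<open>m\<close> is 1 where \<open>\<eta>\<close> is nonzero, so
  \<open>corr h (kern m)\<close> and \<open>h\<close> represent the same distribution and agree
  almost everywhere. Both are of polynomial growth in a weighted sense, which makes the pairings
  absolutely convergent.\<close>

lemma reproducing_AE:
  fixes f :: "'a::euclidean_space distr"
  assumes gen: "dyadic_generator (\<Phi> :: 'a \<Rightarrow> complex)"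
    and rep: "\<And>\<psi>. \<psi> \<in> schwartz \<Longrightarrow> f (conv (kern \<eta>) \<psi>) = (\<integral>x. h x * \<psi> x \<partial>lborel)"
    and hL: "integrable lborel (\<lambda>x. wt L x *\<^sub>R h x)" and hm [measurable]: "h \<in> borel_measurable borel"
    and \<eta>: "test_function \<eta>" and m: "test_function m" and eq: "\<And>\<xi>. \<eta> \<xi> * m \<xi> = \<eta> \<xi>"
  shows "AE x in lborel. corr h (kern m) x = h x"
proof -
  have K: "kern m \<in> schwartz" by (rule schwartz_kern[OF m])
  note [measurable] = schwartz_measurable[OF K]
  have cm [measurable]: "corr h (kern m) \<in> borel_measurable borel" by measurable
  obtain C where C: "\<And>x. norm (corr h (kern m) x) \<le> C * (1 + norm x)^L"
    using corr_growth(1)[OF hL hm K] by blast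
  define L' where "L' = L + 2 * DIM('a)"
  have cL: "integrable lborel (\<lambda>x. wt L' x *\<^sub>R corr h (kern m) x)"
    unfolding L'_def by (rule growth_imp_wt_integrable[OF cm C])
  have hL': "integrable lborel (\<lambda>x. wt L' x *\<^sub>R h x)"
  proof (rule Bochner_Integration.integrable_bound[OF hL])
    show "AE x in lborel. norm (wt L' x *\<^sub>R h x) \<le> norm (wt L x *\<^sub>R h x)"
      by (rule AE_I2) (auto simp: L'_def intro!: mult_right_mono wt_mono)
  qed measurable
  have int: "integrable lborel (\<lambda>x. w x * \<psi> x)" if w: "integrable lborel (\<lambda>x. wt L' x *\<^sub>R w x)" "w \<in> borel_measurable borel" and \<psi>: "\<psi> \<in> schwartz" for w \<psi> :: "'a \<Rightarrow> complex"
  proof -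
    obtain D where "\<And>x. norm (\<psi> x) \<le> D * wt L' x" using rapidD[OF schwartz_rapid[OF \<psi>]] by blast
    then show ?thesis by (intro wt_integrable_mult[OF w schwartz_measurable[OF \<psi>]])
  qed
  have "AE x in lborel. corr h (kern m) x - h x = 0"
  proof (rule AE_zero_of_schwartz_pairing)
    show "test_function \<Phi>" by (rule gen_test[OF gen])
    show "\<Phi> 0 = 1" by (rule gen_1[OF gen]) simp
    show "integrable lborel (\<lambda>x. wt L' x *\<^sub>R (corr h (kern m) x - h x))"
      using Bochner_Integration.integrable_diff[OF cL hL'] by (simp add: scaleR_diff_right)
    fix \<psi> :: "'a \<Rightarrow> complex" assume \<psi>: "\<psi> \<in> schwartz"
    have "(\<integral>x. corr h (kern m) x * \<psi> x \<partial>lborel) = (\<integral>x. h x * \<psi> x \<partial>lborel)"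
      using block_representation[OF rep hL hm \<eta> m \<psi>] rep[OF \<psi>] by (simp add: eq)
    then show "(\<integral>x. (corr h (kern m) x - h x) * \<psi> x \<partial>lborel) = 0"
      using int[OF cL cm \<psi>] int[OF hL' hm \<psi>] by (simp add: left_diff_distrib)
  qed measurable
  then show ?thesis by simp
qed

text \<open>\<open>\<phi>\<close> is complex valued; its squared modulus is a nonnegative bump with
  the same plateau, as the lower bound in \<open>integrable_against_decreasing\<close>
  demands.\<close>

lemma generator_square:
  assumes gen: "dyadic_generator (\<phi> :: 'a::euclidean_space \<Rightarrow> complex)"
  shows "\<exists>\<rho> r. test_function (\<rho> :: 'a \<Rightarrow> complex) \<and> (\<forall>x. \<rho> x = of_real (r x)) \<and> (\<forall>x. r x \<ge> 0) \<and>
    (\<forall>x. norm x \<le> 1 \<longrightarrow> r x = 1) \<and> (\<forall>x. norm x \<ge> 2 \<longrightarrow> r x = (0::real))"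
proof (intro exI conjI allI impI)
  have "smooth \<phi>" using gen_test[OF gen] test_function_def by blast
  then show "test_function (\<lambda>x. cnj (\<phi> x) * \<phi> x)"
    by (intro test_function_mult gen_test[OF gen] smooth_cnj)
  show "cnj (\<phi> x) * \<phi> x = of_real (norm (\<phi> x)^2)" for x
    using complex_norm_square[of "\<phi> x"] by (simp add: mult.commute)
  show "norm x \<le> 1 \<Longrightarrow> norm (\<phi> x)^2 = 1" for x by (simp add: gen_1[OF gen])
  show "norm x \<ge> 2 \<Longrightarrow> norm (\<phi> x)^2 = 0" for x by (simp add: gen_0[OF gen])
qed simp

lemma given_by_slow_growth:
  assumes gen: "dyadic_generator (\<phi> :: 'a::euclidean_space \<Rightarrow> complex)" and g: "given_by T (g :: 'a \<Rightarrow> complex)"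
  shows "\<exists>L. integrable lborel (\<lambda>x. wt L x *\<^sub>R g x)"
proof -
  obtain \<rho> r where \<rho>: "test_function (\<rho> :: 'a \<Rightarrow> complex)" "\<And>x. \<rho> x = of_real (r x)" "\<And>x. r x \<ge> 0"
    "\<And>x. norm x \<le> 1 \<Longrightarrow> r x = 1" "\<And>x. norm x \<ge> 2 \<Longrightarrow> r x = (0::real)"
    using generator_square[OF gen] by blast
  show ?thesis
    by (rule slow_growth[OF _ _ \<rho>]) (use g in \<open>auto simp: given_by_def\<close>)
qed

text \<open>The sum of neighbouring given blocks is the function from which the radial blocks are
  recovered by a further multiplier, so its growth and its representation are recorded
  together.\<close>

lemma near_block:
  fixes f :: "'a::euclidean_space distr"
  assumes gen: "dyadic_generator \<phi>" and f: "tempered f" and g: "\<And>j. given_by (dyadic_block \<phi> j f) (g j)"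
  defines "\<eta> \<equiv> \<lambda>j \<xi>. \<Sum>i\<in>{j-1..Suc j}. ann \<phi> i \<xi>" and "h \<equiv> \<lambda>j x. \<Sum>i\<in>{j-1..Suc j}. g i x"
  shows "h j \<in> borel_measurable borel" and "test_function (\<eta> j)" and "\<exists>L. integrable lborel (\<lambda>x. wt L x *\<^sub>R h j x)"
    and "\<psi> \<in> schwartz \<Longrightarrow> f (conv (kern (\<eta> j)) \<psi>) = (\<integral>x. h j x * \<psi> x \<partial>lborel)"
proof -
  let ?I = "{j-1..Suc j}"
  have gm [measurable]: "g i \<in> borel_measurable borel" for i using g[of i] by (simp add: given_by_def)
  show "h j \<in> borel_measurable borel" unfolding h_def by measurable
  note ta = test_function_ann[OF gen_test[OF gen]]
  show "test_function (\<eta> j)" unfolding \<eta>_def by (intro test_function_sum ta) simp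
  have "\<forall>i. \<exists>L. integrable lborel (\<lambda>x. wt L x *\<^sub>R g i x)" using given_by_slow_growth[OF gen g] by blast
  from choice[OF this] obtain L where L: "\<And>i. integrable lborel (\<lambda>x. wt (L i) x *\<^sub>R g i x)" by blast
  \<comment> \<open>The growth exponents of the summands may differ; the largest serves them
    all.\<close>
  have "integrable lborel (\<lambda>x. \<Sum>i\<in>?I. wt (Max (L ` ?I)) x *\<^sub>R g i x)"
  proof (rule Bochner_Integration.integrable_sum)
    fix i assume i: "i \<in> ?I"
    show "integrable lborel (\<lambda>x. wt (Max (L ` ?I)) x *\<^sub>R g i x)"
    proof (rule Bochner_Integration.integrable_bound[OF L[of i]])
      show "AE x in lborel. norm (wt (Max (L ` ?I)) x *\<^sub>R g i x) \<le> norm (wt (L i) x *\<^sub>R g i x)"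
        by (rule AE_I2) (use i in \<open>auto intro!: mult_right_mono wt_mono Max_ge\<close>)
    qed measurable
  qed
  then show "\<exists>L. integrable lborel (\<lambda>x. wt L x *\<^sub>R h j x)" unfolding h_def scaleR_sum_right by blast
  assume \<psi>: "\<psi> \<in> schwartz"
  have each: "f (conv (kern (ann \<phi> i)) \<psi>) = (\<integral>x. g i x * \<psi> x \<partial>lborel)" "integrable lborel (\<lambda>x. g i x * \<psi> x)" for i
  proof -
    have "dyadic_block \<phi> i f \<psi> = f (conv (kern (ann \<phi> i)) \<psi>)"
      unfolding dyadic_block_def distr_inv_fourier_def distr_mult_def distr_fourier_def dyadic_eq_ann
      using fourier_mult_inv_fourier[OF test_function_integrable[OF ta] schwartz_integrable[OF \<psi>]] by simp
    then show "f (conv (kern (ann \<phi> i)) \<psi>) = (\<integral>x. g i x * \<psi> x \<partial>lborel)" "integrable lborel (\<lambda>x. g i x * \<psi> x)"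
      using g[of i] \<psi> by (auto simp: given_by_def)
  qed
  have S: "conv (kern (ann \<phi> i)) \<psi> \<in> schwartz" for i
    by (intro schwartz_conv schwartz_kern ta schwartz_rapid schwartz_measurable \<psi>)
  have "conv (kern (\<eta> j)) \<psi> = (\<lambda>x. \<Sum>i\<in>?I. conv (kern (ann \<phi> i)) \<psi> x)"
  proof
    fix x
    have "kern (\<eta> j) z = (\<Sum>i\<in>?I. kern (ann \<phi> i) z)" for z
      unfolding \<eta>_def by (rule kern_sum) (intro test_function_integrable ta)
    then have "conv (kern (\<eta> j)) \<psi> x = (\<integral>y. (\<Sum>i\<in>?I. kern (ann \<phi> i) (x - y) * \<psi> y) \<partial>lborel)"
      unfolding conv_def by (simp only: sum_distrib_right)
    also have "\<dots> = (\<Sum>i\<in>?I. conv (kern (ann \<phi> i)) \<psi> x)"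
      unfolding conv_def by (rule Bochner_Integration.integral_sum) (rule conv_integrable[OF schwartz_kern[OF ta] schwartz_integrable[OF \<psi>]])
    finally show "conv (kern (\<eta> j)) \<psi> x = (\<Sum>i\<in>?I. conv (kern (ann \<phi> i)) \<psi> x)" .
  qed
  then have "f (conv (kern (\<eta> j)) \<psi>) = (\<Sum>i\<in>?I. f (conv (kern (ann \<phi> i)) \<psi>))"
    using tempered_sum[OF f, of ?I "\<lambda>i. conv (kern (ann \<phi> i)) \<psi>"] S by simp
  also have "\<dots> = (\<integral>x. (\<Sum>i\<in>?I. g i x * \<psi> x) \<partial>lborel)"
    unfolding each(1) by (rule Bochner_Integration.integral_sum[symmetric]) (rule each(2))
  finally show "f (conv (kern (\<eta> j)) \<psi>) = (\<integral>x. h j x * \<psi> x \<partial>lborel)"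
    unfolding h_def by (simp only: sum_distrib_right)
qed

section \<open>Radial estimates\<close>

text \<open>Both \<open>lborel\<close> and its image under \<open>A\<close> are translation invariant; Tonelli makes them
  proportional, and they agree on the unit ball.\<close>

lemma lborel_distr_orthogonal:
  fixes A :: "'a::euclidean_space \<Rightarrow> 'a"
  assumes A: "orthogonal_transformation A"
  shows "distr lborel borel A = lborel"
proof -
  have lin: "linear A" using A orthogonal_transformation_linear by blast
  have Am [measurable]: "A \<in> borel_measurable borel"
    by (intro borel_measurable_continuous_onI linear_continuous_on linear_conv_bounded_linear[THEN iffD1] lin)
  have nA: "norm (A x) = norm x" for x using A orthogonal_transformation_norm by blast
  have surj: "A (inv A y) = y" for y
    using orthogonal_transformation_surj[OF A] by (rule surj_f_inv_f)
  define f :: "'a \<Rightarrow> ennreal" where "f = indicator (ball 0 1)"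
  define W where "W = (\<integral>\<^sup>+x. f x \<partial>lborel)"
  have [measurable]: "f \<in> borel_measurable borel" unfolding f_def by (rule borel_measurable_indicator) simp
  have fA: "f (A x) = f x" for x by (simp add: f_def indicator_def nA)
  have W: "W = emeasure lborel (ball (0::'a) 1)" unfolding W_def f_def by simp
  have Wfin: "W \<noteq> \<infinity>" unfolding W using emeasure_bounded_finite[OF bounded_ball, of "0::'a" 1] by (rule less_imp_neq)
  have W0: "W \<noteq> 0"
  proof
    assume "W = 0"
    then have "measure lborel (ball (0::'a) 1) = 0" by (simp add: W measure_def)
    then show False using content_ball_pos[of 1 "0::'a"] by simp
  qed
  have shift: "(\<integral>\<^sup>+y. g (t + y) \<partial>lborel) = (\<integral>\<^sup>+y. g y \<partial>lborel)" "(\<integral>\<^sup>+y. g (t - y) \<partial>lborel) = (\<integral>\<^sup>+y. g y \<partial>lborel)"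
    if [measurable]: "g \<in> borel_measurable borel" for g :: "'a \<Rightarrow> ennreal" and t
    using lborel_affine_nn_integral[OF that, of 1 t] lborel_affine_nn_integral[OF that, of "-1" t] by simp_all
  have eq: "(\<integral>\<^sup>+x. g (A x) \<partial>lborel) = (\<integral>\<^sup>+x. g x \<partial>lborel)" if g [measurable]: "g \<in> borel_measurable borel" for g :: "'a \<Rightarrow> ennreal"
  proof -
    have "W * (\<integral>\<^sup>+y. g y \<partial>lborel) = (\<integral>\<^sup>+x. f (A x) * (\<integral>\<^sup>+y. g y \<partial>lborel) \<partial>lborel)"
      unfolding fA W_def by (rule nn_integral_multc[symmetric]) measurable
    also have "\<dots> = (\<integral>\<^sup>+x. (\<integral>\<^sup>+y. f (A x) * g (A x + y) \<partial>lborel) \<partial>lborel)"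
      by (rule nn_integral_cong, subst nn_integral_cmult) (simp_all add: shift(1)[OF g])
    also have "\<dots> = (\<integral>\<^sup>+y. (\<integral>\<^sup>+x. f (A x) * g (A x + y) \<partial>lborel) \<partial>lborel)"
      by (rule lborel_pair.Fubini') measurable
    \<comment> \<open>Translating \<open>x\<close> by \<open>- inv A y\<close> moves
      \<open>y\<close> from the argument of \<open>g\<close> to that of \<open>f\<close>, by
      linearity of \<open>A\<close>.\<close>
    also have "\<dots> = (\<integral>\<^sup>+y. (\<integral>\<^sup>+x. f (A x - y) * g (A x) \<partial>lborel) \<partial>lborel)"
    proof (rule nn_integral_cong)
      fix y :: 'a
      have "(\<integral>\<^sup>+x. f (A x) * g (A x + y) \<partial>lborel) = (\<integral>\<^sup>+x. f (A (- inv A y + x)) * g (A (- inv A y + x) + y) \<partial>lborel)"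
        by (rule shift(1)[symmetric]) measurable
      also have "\<dots> = (\<integral>\<^sup>+x. f (A x - y) * g (A x) \<partial>lborel)"
      proof -
        have "A (- inv A y + x) = A x - y" for x by (simp only: linear_add[OF lin] linear_neg[OF lin] surj) simp
        then show ?thesis by simp
      qed
      finally show "(\<integral>\<^sup>+x. f (A x) * g (A x + y) \<partial>lborel) = (\<integral>\<^sup>+x. f (A x - y) * g (A x) \<partial>lborel)" .
    qed
    also have "\<dots> = (\<integral>\<^sup>+x. (\<integral>\<^sup>+y. f (A x - y) * g (A x) \<partial>lborel) \<partial>lborel)"
      by (rule lborel_pair.Fubini') measurable
    also have "\<dots> = (\<integral>\<^sup>+x. W * g (A x) \<partial>lborel)"
    proof (rule nn_integral_cong)
      fix x :: 'a
      have "(\<integral>\<^sup>+y. f (A x - y) * g (A x) \<partial>lborel) = (\<integral>\<^sup>+y. f (A x - y) \<partial>lborel) * g (A x)"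
        by (rule nn_integral_multc) measurable
      then show "(\<integral>\<^sup>+y. f (A x - y) * g (A x) \<partial>lborel) = W * g (A x)" by (simp add: shift(2) W_def)
    qed
    also have "\<dots> = W * (\<integral>\<^sup>+x. g (A x) \<partial>lborel)" by (rule nn_integral_cmult) measurable
    finally show ?thesis using W0 Wfin by (simp add: ennreal_mult_cancel_left)
  qed
  show ?thesis
  proof (rule measure_eqI)
    fix S :: "'a set" assume "S \<in> sets (distr lborel borel A)"
    then have S [measurable]: "S \<in> sets borel" by simp
    have "emeasure (distr lborel borel A) S = (\<integral>\<^sup>+x. indicator S x \<partial>(distr lborel borel A))" by simp
    also have "\<dots> = (\<integral>\<^sup>+x. indicator S (A x) \<partial>lborel)" by (rule nn_integral_distr) measurable
    also have "\<dots> = (\<integral>\<^sup>+x. indicator S x \<partial>lborel)" by (rule eq) measurable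
    finally show "emeasure (distr lborel borel A) S = emeasure lborel S" by simp
  qed simp
qed

lemma lborel_integral_orthogonal:
  fixes A :: "real^'n \<Rightarrow> real^'n" and F :: "real^'n \<Rightarrow> complex"
  assumes A: "orthogonal_transformation A" and [measurable]: "F \<in> borel_measurable borel"
  shows "(\<integral>x. F (A x) \<partial>lborel) = (\<integral>x. F x \<partial>lborel)"
proof -
  have lin: "linear A" using A orthogonal_transformation_linear by blast
  have [measurable]: "A \<in> borel_measurable borel"
    by (intro borel_measurable_continuous_onI linear_continuous_on linear_conv_bounded_linear[THEN iffD1] lin)
  have "(\<integral>x. F x \<partial>lborel) = (\<integral>x. F x \<partial>(distr lborel borel A))" by (simp add: lborel_distr_orthogonal[OF A])
  also have "\<dots> = (\<integral>x. F (A x) \<partial>lborel)" by (rule integral_distr) measurable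
  finally show ?thesis by simp
qed

text \<open>The chain rule mixes all partial derivatives of \<open>g\<close>, so the class is the
  sum closure of multiples of \<open>g (A x)\<close> with \<open>g\<close> Schwartz. Decay passes to
  the class because \<open>A\<close> preserves the norm.\<close>

lemma schwartz_compose_orthogonal:
  fixes A :: "real^'n \<Rightarrow> real^'n"
  assumes A: "orthogonal_transformation A" and f: "f \<in> schwartz"
  shows "f \<circ> A \<in> schwartz"
proof -
  have lin: "linear A" using A orthogonal_transformation_linear by blast
  have nA: "norm (A x) = norm x" for x using A orthogonal_transformation_norm by blast
  let ?X = "{\<lambda>x. c * g (A x) |c g. g \<in> schwartz}"
  let ?Y = "sum_closure ?X"
  have D: "((\<lambda>x. c * g (A x)) has_derivative (\<lambda>h. c * (\<Sum>b\<in>Basis. (A h \<bullet> b) *\<^sub>R partial_deriv b g (A x)))) (at x)"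
    if g: "g \<in> schwartz" for c g x
  proof -
    have "(A has_derivative A) (at x)" using lin by (rule linear_imp_has_derivative)
    from has_derivative_compose[OF this has_derivative_partial_deriv[OF smooth_imp_differentiable[OF schwartz_smooth[OF g]]]]
    show ?thesis by (rule has_derivative_mult_right)
  qed
  have dX: "h differentiable (at x)" if h: "h \<in> ?X" for h x
  proof -
    obtain c g where "h = (\<lambda>x. c * g (A x))" "g \<in> schwartz" using h by auto
    then show ?thesis unfolding differentiable_def using D[of g c x] by blast
  qed
  have sumY: "(\<lambda>x. \<Sum>b\<in>I. h b x) \<in> ?Y" if "finite I" "I \<noteq> {}" "\<And>b. b \<in> I \<Longrightarrow> h b \<in> ?Y" for I and h :: "real^'n \<Rightarrow> real^'n \<Rightarrow> complex"
    using that
  proof (induction I rule: finite_ne_induct)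
    case (insert b I)
    then have "(\<lambda>x. h b x + (\<Sum>b\<in>I. h b x)) \<in> ?Y" by (intro sum_closure.add) auto
    then show ?case using insert by simp
  qed simp
  have pX: "partial_deriv b h \<in> ?Y" if h: "h \<in> ?X" for h b
  proof -
    obtain c g where hg: "h = (\<lambda>x. c * g (A x))" "g \<in> schwartz" using h by auto
    have "partial_deriv b h = (\<lambda>x. \<Sum>e\<in>Basis. (c * of_real (A b \<bullet> e)) * partial_deriv e g (A x))"
    proof
      fix x
      show "partial_deriv b h x = (\<Sum>e\<in>Basis. (c * of_real (A b \<bullet> e)) * partial_deriv e g (A x))"
        unfolding hg(1) using partial_deriv_eqI[OF D[OF hg(2)], of b c x]
        by (simp add: sum_distrib_left scaleR_conv_of_real mult.assoc)
    qed
    also have "\<dots> \<in> ?Y"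
    proof (rule sumY)
      fix e :: "real^'n" assume "e \<in> Basis"
      then have "partial_deriv e g \<in> schwartz" by (rule schwartz_partial_deriv[OF hg(2)])
      then show "(\<lambda>x. (c * of_real (A b \<bullet> e)) * partial_deriv e g (A x)) \<in> ?Y" by (intro base) blast
    qed auto
    finally show ?thesis .
  qed
  have dY: "h differentiable (at x)" if "h \<in> ?Y" for h x
    using that by induction (rule dX, assumption, rule differentiable_add)
  have pY: "partial_deriv b h \<in> ?Y" if "h \<in> ?Y" "b \<in> Basis" for h b
    using that(1)
  proof induction
    case (base h) then show ?case by (rule pX)
  next
    case (add h k)
    have "partial_deriv b (\<lambda>x. h x + k x) = (\<lambda>x. partial_deriv b h x + partial_deriv b k x)"
      by (rule ext, rule partial_deriv_add[OF dY[OF add(1)] dY[OF add(2)]])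
    then show ?case using sum_closure.add[OF add(3,4)] by simp
  qed
  have fX: "f \<circ> A \<in> ?X" using f by (intro CollectI exI[of _ 1] exI[of _ f]) (auto simp: o_def)
  have fY: "f \<circ> A \<in> ?Y" using fX by (rule base)
  have rapidY: "rapid h" if "h \<in> ?Y" for h
    using that
  proof induction
    case (base h)
    then obtain c g where hg: "h = (\<lambda>x. c * g (A x))" "g \<in> schwartz" by auto
    show ?case
    proof (rule rapidI)
      fix n
      obtain C where C: "\<And>x. norm (g x) \<le> C * wt n x" using rapidD[OF schwartz_rapid[OF hg(2)]] by blast
      have "norm (h x) \<le> (norm c * C) * wt n x" for x
        using mult_left_mono[OF C[of "A x"] norm_ge_zero[of c]] by (simp add: hg(1) norm_mult wt_def nA mult.assoc)
      then show "\<exists>C. \<forall>x. norm (h x) \<le> C * wt n x" by blast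
    qed
  next
    case (add h k)
    show ?case
    proof (rule rapidI)
      fix n
      obtain C where C: "\<And>x. norm (h x) \<le> C * wt n x" using rapidD[OF add(3)] by blast
      obtain D where D: "\<And>x. norm (k x) \<le> D * wt n x" using rapidD[OF add(4)] by blast
      have "norm (h x + k x) \<le> (C + D) * wt n x" for x
        using C[of x] D[of x] norm_triangle_ineq[of "h x" "k x"] by (simp add: distrib_right)
      then show "\<exists>C. \<forall>x. norm (h x + k x) \<le> C * wt n x" by blast
    qed
  qed
  show ?thesis unfolding schwartz_iff
  proof (intro conjI allI impI)
    show "smooth (f \<circ> A)" by (rule smooth_coinduct(1)[where X="?Y"]) (fact fY, fact dY, fact pY)
    fix bs :: "(real^'n) list" assume bs: "set bs \<subseteq> Basis"
    have "iterated_partial bs (f \<circ> A) \<in> ?Y"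
      by (rule smooth_coinduct(2)[where X="?Y"]) (fact fY, fact dY, fact pY, fact bs)
    then show "rapid (iterated_partial bs (f \<circ> A))" by (rule rapidY)
  qed
qed

lemma kern_orthogonal:
  fixes A :: "real^'n \<Rightarrow> real^'n" and m :: "real^'n \<Rightarrow> complex"
  assumes A: "orthogonal_transformation A" and [measurable]: "m \<in> borel_measurable borel"
    and rad: "\<And>\<xi> \<eta>. norm \<xi> = norm \<eta> \<Longrightarrow> m \<xi> = m \<eta>"
  shows "kern m (A z) = kern m z"
proof -
  have mA: "m (A \<xi>) = m \<xi>" for \<xi> by (rule rad) (use A orthogonal_transformation_norm in blast)
  have iA: "A \<xi> \<bullet> A z = \<xi> \<bullet> z" for \<xi> using A by (simp add: orthogonal_transformation_def)
  have "(\<integral>\<xi>. exp (- (\<i> * of_real (\<xi> \<bullet> A z))) * m \<xi> \<partial>lborel) = (\<integral>\<xi>. exp (- (\<i> * of_real (A \<xi> \<bullet> A z))) * m (A \<xi>) \<partial>lborel)"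
    by (rule lborel_integral_orthogonal[OF A, symmetric]) measurable
  then show ?thesis unfolding kern_def' iA mA by simp
qed

lemma conv_orthogonal:
  fixes A :: "real^'n \<Rightarrow> real^'n" and k :: "real^'n \<Rightarrow> complex"
  assumes A: "orthogonal_transformation A" and [measurable]: "k \<in> borel_measurable borel" "\<psi> \<in> borel_measurable borel"
    and kA: "\<And>z. k (A z) = k z"
  shows "conv k (\<psi> \<circ> A) = conv k \<psi> \<circ> A"
proof
  fix x
  have lin: "linear A" using A orthogonal_transformation_linear by blast
  have "conv k \<psi> (A x) = (\<integral>y. k (A x - A y) * \<psi> (A y) \<partial>lborel)"
    unfolding conv_def by (rule lborel_integral_orthogonal[OF A, symmetric]) measurable
  also have "\<dots> = conv k (\<psi> \<circ> A) x" unfolding conv_def linear_diff[OF lin, symmetric] kA by simp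
  finally show "conv k (\<psi> \<circ> A) x = (conv k \<psi> \<circ> A) x" by simp
qed

text \<open>For shifts of length at most 1 the difference of the translated kernels is bounded by
  the length of the shift times an integrable weight, so a bounded \<open>v\<close> gives a
  Lipschitz estimate at small distances.\<close>

lemma corr_bounded_uniformly_continuous:
  fixes v :: "'a::euclidean_space \<Rightarrow> complex"
  assumes [measurable]: "v \<in> borel_measurable borel" and B: "\<And>x. norm (v x) \<le> B" and k: "k \<in> schwartz"
  shows "uniformly_continuous_on UNIV (corr v k)" and "\<exists>D. \<forall>x. norm (corr v k x) \<le> D"
proof -
  note [measurable] = schwartz_measurable[OF k]
  have B0: "B \<ge> 0" using order_trans[OF norm_ge_zero B] by blast
  have int: "integrable lborel (\<lambda>y. v y * k (y - x))" for x
  proof (rule Bochner_Integration.integrable_bound)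
    show "integrable lborel (\<lambda>y. B *\<^sub>R k (y - x))"
      by (intro integrable_scaleR_right lborel_integrable_shift_reflect schwartz_integrable k)
  qed (use B B0 in \<open>auto simp: norm_mult intro!: mult_right_mono\<close>)
  have "norm (corr v k x) \<le> B * (\<integral>y. norm (k y) \<partial>lborel)" for x
  proof -
    have "norm (corr v k x) \<le> (\<integral>y. B * norm (k (y - x)) \<partial>lborel)" unfolding corr_def
      by (rule Bochner_Integration.integral_norm_bound_integral[OF int])
        (auto simp: norm_mult intro!: mult_right_mono B integrable_mult_right integrable_norm lborel_integrable_shift_reflect schwartz_integrable k)
    also have "\<dots> = B * (\<integral>y. norm (k y) \<partial>lborel)"
      using lborel_integral_shift_reflect(2)[of "\<lambda>y. norm (k y)" x] by simp
    finally show ?thesis .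
  qed
  then show "\<exists>D. \<forall>x. norm (corr v k x) \<le> D" by blast
  define n where "n = 2 * DIM('a)"
  obtain C where C: "C \<ge> 0" "\<And>x y. norm (k (x + y) - k x) \<le> C * norm y * (1 + norm y)^n * wt n x"
    using schwartz_lipschitz[OF k] by blast
  let ?J = "\<integral>y. wt n (y::'a) \<partial>lborel"
  have iw: "integrable lborel (wt n :: 'a \<Rightarrow> real)" by (rule integrable_wt) (simp add: n_def)
  have lip: "norm (corr v k x' - corr v k x) \<le> (B * C * 2^n * ?J) * norm (x' - x)" if le1: "norm (x' - x) \<le> 1" for x x'
  proof -
    have "corr v k x' - corr v k x = (\<integral>y. v y * k (y - x') - v y * k (y - x) \<partial>lborel)"
      unfolding corr_def by (rule Bochner_Integration.integral_diff[OF int int, symmetric])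
    also have "norm \<dots> \<le> (\<integral>y. (B * C * 2^n * norm (x' - x)) * wt n (y - x) \<partial>lborel)"
    proof (rule Bochner_Integration.integral_norm_bound_integral)
      show "integrable lborel (\<lambda>y. v y * k (y - x') - v y * k (y - x))" by (intro Bochner_Integration.integrable_diff int)
      show "integrable lborel (\<lambda>y. (B * C * 2^n * norm (x' - x)) * wt n (y - x))"
        by (intro integrable_mult_right lborel_integrable_shift_reflect iw)
      fix y
      have "norm (k (y - x') - k (y - x)) \<le> C * norm (x - x') * (1 + norm (x - x'))^n * wt n (y - x)"
        using C(2)[of "y - x" "x - x'"] by simp
      also have "\<dots> \<le> C * norm (x - x') * 2^n * wt n (y - x)"
        using le1 C(1) by (intro mult_right_mono mult_left_mono power_mono) (auto simp: norm_minus_commute)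
      finally have "norm (v y) * norm (k (y - x') - k (y - x)) \<le> B * (C * norm (x - x') * 2^n * wt n (y - x))"
        using B0 by (intro mult_mono B) auto
      then show "norm (v y * k (y - x') - v y * k (y - x)) \<le> (B * C * 2^n * norm (x' - x)) * wt n (y - x)"
        by (simp add: right_diff_distrib[symmetric] norm_mult mult_ac norm_minus_commute)
    qed
    also have "\<dots> = (B * C * 2^n * norm (x' - x)) * ?J"
      using lborel_integral_shift_reflect(2)[of "wt n :: 'a \<Rightarrow> real" x] by simp
    finally show ?thesis by (simp add: mult_ac)
  qed
  define H where "H = B * C * 2^n * ?J"
  have H0: "H \<ge> 0" unfolding H_def using B0 C(1) by simp
  show "uniformly_continuous_on UNIV (corr v k)"
    unfolding uniformly_continuous_on_def
  proof (intro allI impI)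
    fix e :: real assume e: "e > 0"
    define d where "d = min 1 (e / (H + 1))"
    have d: "d > 0" using e H0 by (simp add: d_def)
    have "dist (corr v k x') (corr v k x) < e" if "dist x' x < d" for x x'
    proof -
      have n: "norm (x' - x) \<le> 1" "norm (x' - x) \<le> e / (H + 1)" "norm (x' - x) < e / (H + 1)"
        using that by (auto simp: dist_norm d_def)
      have "norm (corr v k x' - corr v k x) \<le> H * norm (x' - x)" using lip[OF n(1)] by (simp add: H_def)
      also have "\<dots> \<le> (H + 1) * norm (x' - x)" by (simp add: distrib_right)
      also have "\<dots> < e" using n(3) H0 by (simp add: pos_less_divide_eq mult.commute)
      finally show ?thesis by (simp add: dist_norm)
    qed
    with d show "\<exists>d>0. \<forall>x\<in>UNIV. \<forall>x'\<in>UNIV. dist x' x < d \<longrightarrow> dist (corr v k x') (corr v k x) < e" by blast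
  qed
qed

text \<open>The set where the two functions differ is open, and a nonempty open set is not a null
  set.\<close>

lemma continuous_AE_eq:
  fixes F G :: "'a::euclidean_space \<Rightarrow> complex"
  assumes "continuous_on UNIV F" "continuous_on UNIV G" "AE x in lborel. F x = G x"
  shows "F x = G x"
proof (rule ccontr)
  assume ne: "F x \<noteq> G x"
  let ?S = "{x. F x \<noteq> G x}"
  have "open ?S" using assms(1,2) by (intro open_Collect_neq)
  moreover have "?S \<noteq> {}" using ne by blast
  ultimately have "\<not> negligible ?S" by (rule open_not_negligible)
  moreover have "?S \<in> null_sets lborel"
    using assms(3) \<open>open ?S\<close> by (subst (asm) AE_iff_null) auto
  then have "negligible ?S" by (simp add: negligible_iff_null_sets null_sets_completionI)
  ultimately show False by blast
qed

section \<open>Boundedness of the blocks and the pointwise radial estimate\<close>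

lemma corr_le_nn_integral:
  fixes h :: "'a::euclidean_space \<Rightarrow> complex"
  assumes int: "integrable lborel (\<lambda>y. h y * k (y - x))" and kb: "\<And>z. norm (k z) \<le> A * (a^DIM('a) * wt N (a *\<^sub>R z))"
  shows "ennreal (norm (corr h k x)) \<le> (\<integral>\<^sup>+y. ennreal (A * norm (h y) * (a^DIM('a) * wt N (a *\<^sub>R (x - y)))) \<partial>lborel)"
proof -
  have "ennreal (norm (corr h k x)) \<le> (\<integral>\<^sup>+y. ennreal (norm (h y * k (y - x))) \<partial>lborel)"
    unfolding corr_def by (rule integral_norm_bound_ennreal[OF int])
  also have "\<dots> \<le> (\<integral>\<^sup>+y. ennreal (A * norm (h y) * (a^DIM('a) * wt N (a *\<^sub>R (x - y)))) \<partial>lborel)"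
  proof (intro nn_integral_mono ennreal_leI)
    fix y
    have "a *\<^sub>R (y - x) = - (a *\<^sub>R (x - y))" by (simp add: scaleR_diff_right)
    then have "wt N (a *\<^sub>R (y - x)) = wt N (a *\<^sub>R (x - y))" by (simp only: wt_minus)
    then show "norm (h y * k (y - x)) \<le> A * norm (h y) * (a^DIM('a) * wt N (a *\<^sub>R (x - y)))"
      using mult_left_mono[OF kb[of "y - x"] norm_ge_zero[of "h y"]] by (simp add: norm_mult mult_ac)
  qed
  finally show ?thesis .
qed

text \<open>A qualitative statement whose bound may depend on the block. The growth exponent
  \<open>L\<close> varies with the block, whereas the exponent \<open>M\<close> in
  \<open>radial_estimate\<close> must be common to all of them; boundedness removes this dependence,
  since a bounded function grows slower than any power.\<close>

lemma p_integrable_imp_bounded: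
  fixes v :: "'a::euclidean_space \<Rightarrow> complex"
  assumes v [measurable]: "v \<in> borel_measurable borel" and a: "a \<ge> 1" and p: "p > 0"
    and rep: "\<And>N. \<exists>A>0. \<forall>x. ennreal (norm (v x)) \<le> (\<integral>\<^sup>+y. ennreal (A * norm (v y) * (a^DIM('a) * wt N (a *\<^sub>R (x - y)))) \<partial>lborel)"
    and growth: "\<And>y. norm (v y) \<le> G * (1 + norm y)^L"
    and fin: "(\<integral>\<^sup>+y. ennreal (norm (v y) powr p) \<partial>lborel) < \<infinity>"
  shows "\<exists>B. \<forall>x. norm (v x) \<le> B"
proof -
  let ?I = "\<integral>\<^sup>+y. ennreal (norm (v y) powr p) \<partial>lborel"
  have a0: "a > 0" using a by simp
  have "\<exists>K\<ge>0. \<forall>x. ennreal (norm (v x) powr p) \<le> ennreal K * (\<integral>\<^sup>+y. ennreal (norm (v y) powr p * a^DIM('a)) \<partial>lborel)"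
  proof (cases "p \<le> 1")
    case True
    define N where "N = L + 2 * DIM('a)"
    obtain A where A: "A > 0" "\<And>x. ennreal (norm (v x)) \<le> (\<integral>\<^sup>+y. ennreal (A * norm (v y) * (a^DIM('a) * wt N (a *\<^sub>R (x - y)))) \<partial>lborel)"
      using rep[of N] by blast
    have G0: "G \<ge> 0" using order_trans[OF norm_ge_zero growth[of 0]] by simp
    have g: "norm (v y) \<le> G * (1 + norm (a *\<^sub>R y))^L" for y
    proof -
      have "1 * norm y \<le> a * norm y" using a by (intro mult_right_mono) auto
      then have "G * (1 + norm y)^L \<le> G * (1 + norm (a *\<^sub>R y))^L"
        using a by (intro mult_left_mono power_mono G0) auto
      then show ?thesis using growth[of y] by linarith
    qed
    have "ennreal (norm (v x) powr p) \<le> ennreal (2 * A * (A * wt_mass TYPE('a) (N - L)) powr p) *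
       (\<integral>\<^sup>+y. indicator (- {}) y * ennreal (norm (v y) powr p * (a^DIM('a) * wt 0 (a *\<^sub>R (x - y)))) \<partial>lborel)" for x
      by (rule quasi_local_bound_le1[OF v a0 A(1) p True _ _ A(2) _ _ g _ A(2)]) (auto simp: N_def p less_imp_le)
    then show ?thesis using A(1) by (intro exI[of _ "2 * A * (A * wt_mass TYPE('a) (N - L)) powr p"]) simp
  next
    case False
    obtain A where A: "A > 0" "\<And>x. ennreal (norm (v x)) \<le> (\<integral>\<^sup>+y. ennreal (A * norm (v y) * (a^DIM('a) * wt (2 * DIM('a)) (a *\<^sub>R (x - y)))) \<partial>lborel)"
      using rep[of "2 * DIM('a)"] by blast
    let ?K = "(A * (wt_mass TYPE('a) (2 * DIM('a)) + 1)) powr p"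
    have "ennreal (norm (v x) powr p) \<le> ennreal ?K * (\<integral>\<^sup>+y. ennreal (norm (v y) powr p * a^DIM('a)) \<partial>lborel)" for x
    proof -
      have "ennreal (norm (v x) powr p) \<le> ennreal ?K * (\<integral>\<^sup>+y. ennreal (norm (v y) powr p * (a^DIM('a) * wt (2 * DIM('a)) (a *\<^sub>R (x - y)))) \<partial>lborel)"
        by (rule quasi_local_bound_ge1[OF v a0 A(1) _ _ _ A(2)]) (use False in auto)
      also have "\<dots> \<le> ennreal ?K * (\<integral>\<^sup>+y. ennreal (norm (v y) powr p * a^DIM('a)) \<partial>lborel)"
        using a by (intro mult_left_mono nn_integral_mono ennreal_leI) (auto simp: mult_left_le wt_le_1)
      finally show ?thesis .
    qed
    then show ?thesis by (intro exI[of _ ?K]) auto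
  qed
  then obtain K where K: "K \<ge> 0" "\<And>x. ennreal (norm (v x) powr p) \<le> ennreal K * (\<integral>\<^sup>+y. ennreal (norm (v y) powr p * a^DIM('a)) \<partial>lborel)" by blast
  have "(\<integral>\<^sup>+y. ennreal (norm (v y) powr p * a^DIM('a)) \<partial>lborel) = ?I * ennreal (a^DIM('a))"
    using a by (subst nn_integral_multc[symmetric]) (auto simp: ennreal_mult)
  then have "ennreal K * (\<integral>\<^sup>+y. ennreal (norm (v y) powr p * a^DIM('a)) \<partial>lborel) < \<infinity>"
    using fin by (simp add: ennreal_mult_less_top)
  then obtain Z where Z: "Z \<ge> 0" "ennreal K * (\<integral>\<^sup>+y. ennreal (norm (v y) powr p * a^DIM('a)) \<partial>lborel) = ennreal Z"
    by (cases "ennreal K * (\<integral>\<^sup>+y. ennreal (norm (v y) powr p * a^DIM('a)) \<partial>lborel)") auto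
  have "norm (v x) \<le> Z powr (1 / p)" for x
  proof -
    have "norm (v x) powr p \<le> Z" using K(2)[of x] Z by simp
    then have "(norm (v x) powr p) powr (1 / p) \<le> Z powr (1 / p)" using p by (intro powr_mono2) auto
    then show ?thesis using p by (simp add: powr_powr)
  qed
  then show ?thesis by blast
qed

text \<open>The sum of the constants of the cases \<open>p \<le> 1\<close> and
  \<open>p \<ge> 1\<close>, so that one expression serves both, times the loss in
  \<open>radial_shell_average\<close>. It does not depend on \<open>a\<close>, hence is common to
  all blocks.\<close>

definition shell_const :: "'a::euclidean_space itself \<Rightarrow> real \<Rightarrow> real \<Rightarrow> real \<Rightarrow> real" where
  "shell_const _ A p t = (2 * A * (A * wt_mass TYPE('a) (2 * DIM('a))) powr p + (A * (wt_mass TYPE('a) (2 * DIM('a) + 1) + 1)) powr p)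
     * 2^(2 * DIM('a) + 1) * 2^1 * wt_mass TYPE('a) (2 * DIM('a)) / (measure lborel (ball (0::'a) 1) * t^(DIM('a) - 1))"

lemma shell_const_nonneg: "A > 0 \<Longrightarrow> t > 0 \<Longrightarrow> shell_const TYPE('a::euclidean_space) A p t \<ge> 0"
  unfolding shell_const_def by (intro divide_nonneg_nonneg mult_nonneg_nonneg add_nonneg_nonneg) (auto simp: wt_mass_nonneg)

text \<open>The local bound for \<open>p \<le> 1\<close> or \<open>p > 1\<close> holds at every
  point of the sphere through \<open>x0\<close>, with the same left-hand side as \<open>F\<close> is
  radial, and is then averaged. Only the case \<open>p \<le> 1\<close> can leave out a set
  \<open>D\<close>, since only there is the maximal function absorbed.\<close>

lemma radial_estimate:
  fixes v F :: "'a::euclidean_space \<Rightarrow> complex"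
  assumes v [measurable]: "v \<in> borel_measurable borel" and a: "a > 0" and A: "A > 0" and p: "p > 0"
    and N: "N = M + 2 * DIM('a)" and MQ: "real (2 * DIM('a) + 1) \<le> real M * p" "2 * DIM('a) + 1 \<le> M"
    and repv: "\<And>x. ennreal (norm (v x)) \<le> (\<integral>\<^sup>+y. ennreal (A * norm (v y) * (a^DIM('a) * wt N (a *\<^sub>R (x - y)))) \<partial>lborel)"
    and repF: "\<And>x. ennreal (norm (F x)) \<le> (\<integral>\<^sup>+y. ennreal (A * norm (v y) * (a^DIM('a) * wt N (a *\<^sub>R (x - y)))) \<partial>lborel)"
    and B: "\<And>x. norm (v x) \<le> B"
    and bad: "D \<in> sets borel" "D = {} \<or> p \<le> 1 \<and> (\<forall>x. (\<integral>\<^sup>+y. indicator D y * ennreal (A * (a^DIM('a) * wt (2 * DIM('a)) (a *\<^sub>R (x - y)))) \<partial>lborel) \<le> ennreal (1/2))"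
    and rad: "\<And>x y. norm x = norm y \<Longrightarrow> F x = F y" and t: "0 < t" "t \<le> norm x0"
  shows "ennreal (norm (F x0) powr p) \<le> ennreal (shell_const TYPE('a) A p t * a) *
    (\<integral>\<^sup>+z. indicator (- D) z * ennreal (norm (v z) powr p) * ennreal (wt 1 (a * (norm z - norm x0))) \<partial>lborel)"
proof -
  \<comment> \<open>\<open>2 * DIM('a)\<close> powers make the kernel integrable; one more survives
    the averaging as \<open>wt 1\<close>.\<close>
  let ?Q = "2 * DIM('a) + 1"
  let ?C1 = "2 * A * (A * wt_mass TYPE('a) (2 * DIM('a))) powr p"
  let ?C2 = "(A * (wt_mass TYPE('a) ?Q + 1)) powr p"
  note [measurable] = bad(1)
  have B0: "B \<ge> 0" using order_trans[OF norm_ge_zero B] by blast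
  have C: "?C1 \<ge> 0" "?C2 \<ge> 0" using A by auto
  have main: "ennreal (norm (F x) powr p) \<le> ennreal (?C1 + ?C2) * (\<integral>\<^sup>+z. (indicator (- D) z * ennreal (norm (v z) powr p)) * ennreal (a^DIM('a) * wt ?Q (a *\<^sub>R (x - z))) \<partial>lborel)" for x
  proof -
    have eq: "(\<integral>\<^sup>+z. indicator (- D) z * ennreal (norm (v z) powr p * (a^DIM('a) * wt ?Q (a *\<^sub>R (x - z)))) \<partial>lborel)
        = (\<integral>\<^sup>+z. (indicator (- D) z * ennreal (norm (v z) powr p)) * ennreal (a^DIM('a) * wt ?Q (a *\<^sub>R (x - z))) \<partial>lborel)"
      by (simp only: ennreal_mult'[OF powr_ge_zero] mult.assoc)
    show ?thesis
    proof (cases "p \<le> 1")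
      case True
      have bad': "(\<integral>\<^sup>+y. indicator D y * ennreal (A * (a^DIM('a) * wt (N - M) (a *\<^sub>R (x - y)))) \<partial>lborel) \<le> ennreal (1/2)" for x
        using bad(2) by (auto simp: N)
      have g: "norm (v y) \<le> B * (1 + norm (a *\<^sub>R y))^M" for y
      proof -
        have "B * 1 \<le> B * (1 + norm (a *\<^sub>R y))^M" by (intro mult_left_mono one_le_power B0) auto
        then show ?thesis using B[of y] by linarith
      qed
      have "ennreal (norm (F x) powr p) \<le> ennreal (2 * A * (A * wt_mass TYPE('a) (N - M)) powr p) *
         (\<integral>\<^sup>+y. indicator (- D) y * ennreal (norm (v y) powr p * (a^DIM('a) * wt ?Q (a *\<^sub>R (x - y)))) \<partial>lborel)"
        by (rule quasi_local_bound_le1[OF v a A p True _ MQ(1) repv bad(1) bad' g _ repF]) (auto simp: N)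
      also have "\<dots> \<le> ennreal (?C1 + ?C2) * (\<integral>\<^sup>+y. indicator (- D) y * ennreal (norm (v y) powr p * (a^DIM('a) * wt ?Q (a *\<^sub>R (x - y)))) \<partial>lborel)"
        using C by (intro mult_right_mono ennreal_leI) (auto simp: N)
      finally show ?thesis unfolding eq .
    next
      case False
      then have D: "D = {}" using bad(2) by blast
      have repF': "ennreal (norm (F x)) \<le> (\<integral>\<^sup>+y. ennreal (A * norm (v y) * (a^DIM('a) * wt ?Q (a *\<^sub>R (x - y)))) \<partial>lborel)"
        by (rule order_trans[OF repF], intro nn_integral_mono ennreal_leI mult_left_mono wt_mono) (use A a MQ N in auto)
      have "ennreal (norm (F x) powr p) \<le> ennreal ?C2 * (\<integral>\<^sup>+y. ennreal (norm (v y) powr p * (a^DIM('a) * wt ?Q (a *\<^sub>R (x - y)))) \<partial>lborel)"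
        by (rule quasi_local_bound_ge1[OF v a A _ _ _ repF']) (use False in auto)
      also have "\<dots> = ennreal ?C2 * (\<integral>\<^sup>+y. indicator (- D) y * ennreal (norm (v y) powr p * (a^DIM('a) * wt ?Q (a *\<^sub>R (x - y)))) \<partial>lborel)"
        by (simp add: D)
      also have "\<dots> \<le> ennreal (?C1 + ?C2) * (\<integral>\<^sup>+y. indicator (- D) y * ennreal (norm (v y) powr p * (a^DIM('a) * wt ?Q (a *\<^sub>R (x - y)))) \<partial>lborel)"
        using C by (intro mult_right_mono ennreal_leI) auto
      finally show ?thesis unfolding eq .
    qed
  qed
  have "ennreal (norm (F x0) powr p) \<le> ennreal ((?C1 + ?C2) * 2^?Q * 2^1 * wt_mass TYPE('a) (2 * DIM('a)) / (measure lborel (ball (0::'a) 1) * t^(DIM('a) - 1)) * a) *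
     (\<integral>\<^sup>+z. (indicator (- D) z * ennreal (norm (v z) powr p)) * ennreal (wt 1 (a * (norm z - norm x0))) \<partial>lborel)"
  proof (rule radial_shell_average[OF a t])
    fix x :: 'a assume "norm x = norm x0"
    then have "F x0 = F x" by (intro rad) simp
    then show "ennreal (norm (F x0) powr p) \<le> ennreal (?C1 + ?C2) * (\<integral>\<^sup>+z. (indicator (- D) z * ennreal (norm (v z) powr p)) * ennreal (a^DIM('a) * wt ?Q (a *\<^sub>R (x - z))) \<partial>lborel)"
      using main[of x] by simp
  qed (use C in auto)
  then show ?thesis unfolding shell_const_def .
qed

section \<open>Summation of the blocks\<close>

lemma ennpowr_ennreal: "t \<ge> 0 \<Longrightarrow> ennpowr (ennreal t) r = ennreal (t powr r)"
  by (simp add: ennpowr_def)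

lemma ennpowr_mono:
  assumes "x \<le> y" "r > 0"
  shows "ennpowr x r \<le> ennpowr y r"
proof (cases "y = \<infinity>")
  case False
  then have "x \<noteq> \<infinity>" using assms(1) by (auto simp: top_unique)
  have "enn2real x \<le> enn2real y" using assms(1) False by (intro enn2real_mono) (auto simp: top.not_eq_extremum)
  then have "enn2real x powr r \<le> enn2real y powr r" using assms(2) by (intro powr_mono2) auto
  then show ?thesis using False \<open>x \<noteq> \<infinity>\<close> by (simp add: ennpowr_def ennreal_leI)
qed (simp add: ennpowr_def)

lemma ennpowr_less_top: "ennpowr x r < \<infinity> \<longleftrightarrow> x < \<infinity>"
  by (auto simp: ennpowr_def top.not_eq_extremum)

lemma lq_qnorm_ge:
  assumes q: "0 < q"
  shows "a j \<le> lq_qnorm q a"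
proof (cases "q = \<infinity>")
  case True then show ?thesis by (simp add: lq_qnorm_def SUP_upper)
next
  case False
  define r where "r = enn2real q"
  have r: "r > 0" using q False by (simp add: r_def enn2real_positive_iff top.not_eq_extremum)
  have lq: "lq_qnorm q a = ennpowr (\<Sum>j. ennpowr (a j) r) (1 / r)" using False by (simp add: lq_qnorm_def r_def)
  have "ennpowr (a j) r \<le> (\<Sum>j. ennpowr (a j) r)"
    using sum_le_suminf[of "\<lambda>j. ennpowr (a j) r" "{j}"] by simp
  then have "ennpowr (ennpowr (a j) r) (1 / r) \<le> lq_qnorm q a" unfolding lq using r by (intro ennpowr_mono) auto
  moreover have "ennpowr (ennpowr (a j) r) (1 / r) = a j"
    using r by (cases "a j") (auto simp: ennpowr_def powr_powr)
  ultimately show ?thesis by simp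
qed

text \<open>At most three terms occur, so the sum is at most three times the largest; this treats
  all \<open>p > 0\<close> alike.\<close>

lemma norm_sum_near_powr:
  fixes g :: "nat \<Rightarrow> complex"
  assumes p: "p > 0"
  shows "norm (\<Sum>i\<in>{j-1..Suc j}. g i) powr p \<le> 3 powr p * (\<Sum>i\<in>{j-1..Suc j}. norm (g i) powr p)"
proof -
  let ?I = "{j-1..Suc j}"
  have ne: "finite ?I" "?I \<noteq> {}" by auto
  define m where "m = Max ((\<lambda>i. norm (g i)) ` ?I)"
  have m: "norm (g i) \<le> m" if "i \<in> ?I" for i unfolding m_def using that by (intro Max_ge) auto
  have "m \<in> (\<lambda>i. norm (g i)) ` ?I" unfolding m_def using ne by (intro Max_in) auto
  then obtain k where k: "k \<in> ?I" "m = norm (g k)" by blast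
  have "norm (\<Sum>i\<in>?I. g i) \<le> (\<Sum>i\<in>?I. m)" by (rule sum_norm_le) (rule m)
  also have "\<dots> = real (card ?I) * m" by simp
  also have "\<dots> \<le> 3 * m" using k(2) by (intro mult_right_mono) auto
  finally have "norm (\<Sum>i\<in>?I. g i) powr p \<le> (3 * m) powr p" using p by (intro powr_mono2) auto
  also have "\<dots> = 3 powr p * norm (g k) powr p" using k(2) by (simp add: powr_mult)
  also have "\<dots> \<le> 3 powr p * (\<Sum>i\<in>?I. norm (g i) powr p)"
    by (intro mult_left_mono member_le_sum k) auto
  finally show ?thesis .
qed

text \<open>The tails are uniformly small off every ball about the origin, so the limit is uniformly
  continuous there. It represents \<open>f\<close>: paired with \<open>\<psi>\<close>, a partial sum
  gives \<open>f\<close> of a convolution of \<open>\<psi>\<close> with an approximate identity,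
  which tends to \<open>f \<psi>\<close>, while dominated convergence gives the integral of the
  limit.\<close>

lemma uniformly_continuous_outside_of_series:
  fixes f :: "'a::euclidean_space distr" and F :: "nat \<Rightarrow> 'a \<Rightarrow> complex"
  assumes f: "tempered f" and \<Phi>: "dyadic_generator (\<Phi> :: 'a \<Rightarrow> complex)" and \<tau>: "\<tau> > 0"
    and rep: "\<And>j \<psi>. \<psi> \<in> schwartz \<Longrightarrow> f (conv (kern (ann \<Phi> j)) \<psi>) = (\<integral>x. F j x * \<psi> x \<partial>lborel)"
    and uc: "\<And>j. uniformly_continuous_on UNIV (F j)" and bd: "\<And>j. \<exists>D. \<forall>x. norm (F j x) \<le> D"
    and cauchy: "\<And>t e. t > 0 \<Longrightarrow> e > 0 \<Longrightarrow> \<exists>J. \<forall>n x. norm x \<ge> t \<longrightarrow> (\<Sum>j\<in>{J..<n}. norm (F j x)) \<le> e"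
  shows "uniformly_continuous_outside \<tau> f"
proof -
  define S where "S n x = (\<Sum>j<n. F j x)" for n x
  \<comment> \<open>At the origin the series may diverge; the value of \<open>lim\<close> there does
    not matter, because the test functions considered vanish near the origin.\<close>
  define Fs where "Fs x = lim (\<lambda>n. S n x)" for x
  have contF: "continuous_on UNIV (F j)" for j using uc by (rule uniformly_continuous_imp_continuous)
  have [measurable]: "F j \<in> borel_measurable borel" for j using contF by (rule borel_measurable_continuous_onI)
  have [measurable]: "S n \<in> borel_measurable borel" for n unfolding S_def[abs_def] by measurable
  have diff: "norm (S n x - S m x) \<le> e" if "\<And>n. (\<Sum>j\<in>{J..<n}. norm (F j x)) \<le> e" "J \<le> m" "m \<le> n" for J m n x e
  proof -
    have "S n x - S m x = (\<Sum>j\<in>{m..<n}. F j x)"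
      unfolding S_def using that(3) by (simp add: sum_diff_nat_ivl lessThan_atLeast0)
    also have "norm \<dots> \<le> (\<Sum>j\<in>{m..<n}. norm (F j x))" by (rule norm_sum)
    also have "\<dots> \<le> (\<Sum>j\<in>{J..<n}. norm (F j x))" using that(2) by (intro sum_mono2) auto
    finally show ?thesis using that(1)[of n] by linarith
  qed
  have conv: "(\<lambda>n. S n x) \<longlonglongrightarrow> Fs x" if x: "x \<noteq> 0" for x
  proof -
    have "Cauchy (\<lambda>n. S n x)"
    proof (rule metric_CauchyI)
      fix e :: real assume e: "e > 0"
      obtain J where J: "\<And>n y. norm y \<ge> norm x \<Longrightarrow> (\<Sum>j\<in>{J..<n}. norm (F j y)) \<le> e / 2"
        using cauchy[of "norm x" "e / 2"] x e by auto
      have "dist (S m x) (S n x) < e" if "J \<le> m" "J \<le> n" for m n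
      proof (cases "m \<le> n")
        case True
        have "norm (S n x - S m x) \<le> e / 2" by (rule diff[OF J[OF order_refl] that(1) True])
        then show ?thesis using e by (simp add: dist_norm norm_minus_commute)
      next
        case False
        have "norm (S m x - S n x) \<le> e / 2" by (rule diff[OF J[OF order_refl] that(2)]) (use False in simp)
        then show ?thesis using e by (simp add: dist_norm)
      qed
      then show "\<exists>M. \<forall>m\<ge>M. \<forall>n\<ge>M. dist (S m x) (S n x) < e" by blast
    qed
    then show ?thesis unfolding Fs_def by (simp add: Cauchy_convergent convergent_LIMSEQ_iff[symmetric])
  qed
  have unif: "\<exists>J. \<forall>n\<ge>J. \<forall>x. norm x \<ge> t \<longrightarrow> norm (Fs x - S n x) \<le> e" if t: "t > 0" and e: "e > 0" for t e
  proof -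
    obtain J where J: "\<And>n x. norm x \<ge> t \<Longrightarrow> (\<Sum>j\<in>{J..<n}. norm (F j x)) \<le> e" using cauchy[OF t e] by blast
    have "norm (Fs x - S n x) \<le> e" if "n \<ge> J" "norm x \<ge> t" for n x
    proof -
      have x0: "x \<noteq> 0" using that(2) t by auto
      have "(\<lambda>m. norm (S m x - S n x)) \<longlonglongrightarrow> norm (Fs x - S n x)"
        by (intro tendsto_intros conv x0)
      moreover have "\<forall>\<^sub>F m in sequentially. norm (S m x - S n x) \<le> e"
        unfolding eventually_sequentially using diff[OF J[OF that(2)] that(1)] by (intro exI[of _ n]) simp
      ultimately show ?thesis by (rule tendsto_upperbound) simp
    qed
    then show ?thesis by blast
  qed
  have ucS: "uniformly_continuous_on UNIV (S n)" for n
  proof (induction n)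
    case 0 show ?case by (simp add: S_def uniformly_continuous_on_const)
  next
    case (Suc n)
    have "S (Suc n) = (\<lambda>x. S n x + F n x)" by (simp add: S_def fun_eq_iff)
    then show ?case using uniformly_continuous_on_add[OF Suc uc[of n]] by simp
  qed
  have ucFs: "uniformly_continuous_on {x. norm x \<ge> t} Fs" if t: "t > 0" for t
    unfolding uniformly_continuous_on_def
  proof (intro allI impI)
    fix e :: real assume e: "e > 0"
    obtain J where J: "\<And>x. norm x \<ge> t \<Longrightarrow> norm (Fs x - S J x) \<le> e / 4" using unif[OF t, of "e / 4"] e by auto
    obtain d where d: "d > 0" "\<And>x x'. dist x' x < d \<Longrightarrow> dist (S J x') (S J x) < e / 4"
    proof -
      have "e / 4 > 0" using e by simp
      then show ?thesis using ucS[of J] that unfolding uniformly_continuous_on_def by blast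
    qed
    have "dist (Fs x') (Fs x) < e" if "norm x \<ge> t" "norm x' \<ge> t" "dist x' x < d" for x x'
    proof -
      have n: "norm (Fs x' - Fs x) = norm ((Fs x' - S J x') + (S J x' - S J x) - (Fs x - S J x))" by simp
      have "norm (Fs x' - Fs x) \<le> norm (Fs x' - S J x') + norm (S J x' - S J x) + norm (Fs x - S J x)"
        unfolding n using norm_triangle_ineq4[of "(Fs x' - S J x') + (S J x' - S J x)" "Fs x - S J x"] norm_triangle_ineq[of "Fs x' - S J x'" "S J x' - S J x"] by linarith
      also have "\<dots> < e" using J[OF that(1)] J[OF that(2)] d(2)[OF that(3)] e by (simp add: dist_norm)
      finally show ?thesis by (simp add: dist_norm)
    qed
    with d(1) show "\<exists>d>0. \<forall>x\<in>{x. t \<le> norm x}. \<forall>x'\<in>{x. t \<le> norm x}. dist x' x < d \<longrightarrow> dist (Fs x') (Fs x) < e" by blast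
  qed
  have "isCont Fs x" if x: "x \<noteq> 0" for x
  proof -
    have "continuous_on {y. norm y \<ge> norm x / 2} Fs" using x by (intro uniformly_continuous_imp_continuous ucFs) simp
    moreover have "open {y::'a. norm y > norm x / 2}" by (intro open_Collect_less continuous_intros)
    ultimately have "continuous_on {y. norm y > norm x / 2} Fs" "open {y::'a. norm y > norm x / 2}"
      by (auto elim: continuous_on_subset)
    then show ?thesis using x by (simp add: continuous_on_eq_continuous_at)
  qed
  then have contFs: "continuous_on (- {0}) Fs" by (intro continuous_at_imp_continuous_on) auto
  have "given_off_origin_by f Fs"
    unfolding given_off_origin_by_def
  proof (intro allI impI)
    fix \<psi> :: "'a \<Rightarrow> complex" assume \<psi>: "test_function \<psi> \<and> 0 \<notin> support \<psi>"
    have \<psi>S: "\<psi> \<in> schwartz" using \<psi> test_function_schwartz by blast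
    note [measurable] = schwartz_measurable[OF \<psi>S]
    have "open (- support \<psi>)" by (simp add: support_def open_Compl)
    moreover have "0 \<in> - support \<psi>" using \<psi> by simp
    ultimately obtain t where t: "t > 0" "ball 0 t \<subseteq> - support \<psi>" by (rule openE)
    have \<psi>0: "\<psi> x = 0" if "norm x < t" for x
    proof (rule ccontr)
      assume "\<psi> x \<noteq> 0"
      then have "x \<in> support \<psi>" unfolding support_def by (intro subsetD[OF closure_subset]) simp
      moreover have "x \<in> ball 0 t" using that by simp
      then have "x \<in> - support \<psi>" by (rule subsetD[OF t(2)])
      ultimately show False by simp
    qed
    \<comment> \<open>From \<open>J\<close> on the partial sums stay within 1 of the limit where
      \<open>norm x \<ge> t\<close>. Two such differences and the bounded \<open>S J\<close> yield
      the majorant \<open>sum D {..<J} + 2\<close>.\<close>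
    obtain J where J: "\<And>n x. n \<ge> J \<Longrightarrow> norm x \<ge> t \<Longrightarrow> norm (Fs x - S n x) \<le> 1" using unif[OF t(1), of 1] by auto
    have "\<forall>j. \<exists>D. \<forall>x. norm (F j x) \<le> D" using bd by blast
    from choice[OF this] obtain D where D': "\<forall>j. \<forall>x. norm (F j x) \<le> D j" by (elim exE)
    then have D: "norm (F j x) \<le> D j" for j x by simp
    have SJ: "norm (S J x) \<le> sum D {..<J}" for x unfolding S_def by (rule sum_norm_le) (rule D)
    have Sb: "norm (S (n + J) x) \<le> sum D {..<J} + 2" if "norm x \<ge> t" for n x
    proof -
      have n: "norm (S (n + J) x) = norm (S J x + (Fs x - S J x) - (Fs x - S (n + J) x))" by simp
      have "norm (S (n + J) x) \<le> norm (S J x) + norm (Fs x - S J x) + norm (Fs x - S (n + J) x)"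
        unfolding n using norm_triangle_ineq4[of "S J x + (Fs x - S J x)" "Fs x - S (n + J) x"] norm_triangle_ineq[of "S J x" "Fs x - S J x"] by linarith
      then show ?thesis using SJ[of x] J[of J x] J[of "n + J" x] that by simp
    qed
    have ptw: "(\<lambda>n. S (n + J) x * \<psi> x) \<longlonglongrightarrow> Fs x * \<psi> x" for x
    proof (cases "x = 0")
      case True then show ?thesis using \<psi>0[of x] t(1) by simp
    next
      case False
      then show ?thesis by (intro tendsto_mult_right LIMSEQ_ignore_initial_segment conv)
    qed
    have m [measurable]: "(\<lambda>x. Fs x * \<psi> x) \<in> borel_measurable borel"
      by (rule borel_measurable_LIMSEQ_metric[where f="\<lambda>n x. S (n + J) x * \<psi> x"]) (measurable, rule ptw)
    have w: "integrable lborel (\<lambda>x. (sum D {..<J} + 2) *\<^sub>R norm (\<psi> x))"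
      by (intro integrable_scaleR_right integrable_norm schwartz_integrable \<psi>S)
    have dom: "norm (S (n + J) x * \<psi> x) \<le> (sum D {..<J} + 2) *\<^sub>R norm (\<psi> x)" for n x
    proof (cases "norm x < t")
      case True then show ?thesis by (simp add: \<psi>0)
    next
      case False
      then show ?thesis using mult_right_mono[OF Sb[of x n] norm_ge_zero[of "\<psi> x"]] by (simp add: norm_mult)
    qed
    have lim: "(\<lambda>n. \<integral>x. S (n + J) x * \<psi> x \<partial>lborel) \<longlonglongrightarrow> (\<integral>x. Fs x * \<psi> x \<partial>lborel)" and int: "integrable lborel (\<lambda>x. Fs x * \<psi> x)"
      by (rule integral_dominated_convergence[OF _ _ w] integrable_dominated_convergence[OF _ _ w, where s="\<lambda>n x. S (n + J) x * \<psi> x"];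
          (intro AE_I2 ptw dom)?; measurable)+
    \<comment> \<open>\<open>S (Suc n)\<close> collects the blocks \<open>0\<close> to
      \<open>n\<close>, whose multipliers telescope to \<open>dil \<Phi> n\<close>.\<close>
    have "(\<integral>x. S (Suc n) x * \<psi> x \<partial>lborel) = f (conv (kern (dil \<Phi> n)) \<psi>)" for n
    proof -
      have iF: "integrable lborel (\<lambda>x. F j x * \<psi> x)" for j
      proof (rule Bochner_Integration.integrable_bound)
        show "integrable lborel (\<lambda>x. D j *\<^sub>R \<psi> x)" by (intro integrable_scaleR_right schwartz_integrable \<psi>S)
      qed (auto simp: norm_mult intro!: AE_I2 mult_right_mono order_trans[OF D abs_ge_self])
      have ta: "test_function (ann \<Phi> j)" for j by (rule test_function_ann[OF gen_test[OF \<Phi>]])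
      have SS: "conv (kern (ann \<Phi> j)) \<psi> \<in> schwartz" for j
        by (intro schwartz_conv schwartz_kern ta schwartz_rapid schwartz_measurable \<psi>S)
      have "conv (kern (dil \<Phi> n)) \<psi> = (\<lambda>x. \<Sum>j\<in>{..n}. conv (kern (ann \<Phi> j)) \<psi> x)"
      proof
        fix x
        have "kern (dil \<Phi> n) z = (\<Sum>j\<in>{..n}. kern (ann \<Phi> j) z)" for z
        proof -
          have "dil \<Phi> n = (\<lambda>\<xi>. \<Sum>j\<in>{..n}. ann \<Phi> j \<xi>)" by (rule ext) (rule sum_ann[symmetric])
          then show ?thesis by (simp only: kern_sum[OF test_function_integrable[OF ta]])
        qed
        then have "conv (kern (dil \<Phi> n)) \<psi> x = (\<integral>y. (\<Sum>j\<in>{..n}. kern (ann \<Phi> j) (x - y) * \<psi> y) \<partial>lborel)"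
          unfolding conv_def by (simp only: sum_distrib_right)
        also have "\<dots> = (\<Sum>j\<in>{..n}. conv (kern (ann \<Phi> j)) \<psi> x)"
          unfolding conv_def by (rule Bochner_Integration.integral_sum) (rule conv_integrable[OF schwartz_kern[OF ta] schwartz_integrable[OF \<psi>S]])
        finally show "conv (kern (dil \<Phi> n)) \<psi> x = (\<Sum>j\<in>{..n}. conv (kern (ann \<Phi> j)) \<psi> x)" .
      qed
      then have "f (conv (kern (dil \<Phi> n)) \<psi>) = (\<Sum>j\<in>{..n}. f (conv (kern (ann \<Phi> j)) \<psi>))"
        using tempered_sum[OF f, of "{..n}" "\<lambda>j. conv (kern (ann \<Phi> j)) \<psi>"] SS by simp
      also have "\<dots> = (\<integral>x. (\<Sum>j\<in>{..n}. F j x * \<psi> x) \<partial>lborel)"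
        unfolding rep[OF \<psi>S] by (rule Bochner_Integration.integral_sum[symmetric]) (rule iF)
      finally show ?thesis unfolding S_def lessThan_Suc_atMost by (simp only: sum_distrib_right)
    qed
    moreover have "(\<lambda>n. f (conv (kern (dil \<Phi> n)) \<psi>)) \<longlonglongrightarrow> f \<psi>"
      unfolding dil_def by (rule tempered_conv_approx[OF f gen_test[OF \<Phi>] _ \<psi>S]) (rule gen_1[OF \<Phi>], simp)
    ultimately have "(\<lambda>n. \<integral>x. S (Suc n) x * \<psi> x \<partial>lborel) \<longlonglongrightarrow> f \<psi>" by simp
    then have "(\<lambda>n. \<integral>x. S n x * \<psi> x \<partial>lborel) \<longlonglongrightarrow> f \<psi>" by (rule LIMSEQ_imp_Suc)
    then have "(\<lambda>n. \<integral>x. S (n + J) x * \<psi> x \<partial>lborel) \<longlonglongrightarrow> f \<psi>" by (rule LIMSEQ_ignore_initial_segment)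
    from LIMSEQ_unique[OF this lim] int
    show "integrable lborel (\<lambda>x. Fs x * \<psi> x) \<and> f \<psi> = (\<integral>x. Fs x * \<psi> x \<partial>lborel)" by simp
  qed
  then show ?thesis unfolding uniformly_continuous_outside_def using contFs ucFs[OF \<tau>] by blast
qed

text \<open>The near sums \<open>h j\<close> of the given blocks carry the integrability, but they
  are fixed only up to null sets. They are replaced by \<open>v j\<close>, for which the reproducing
  inequality holds pointwise, and the blocks \<open>F j\<close> of the radial generator are obtained
  from them by a multiplier.\<close>

lemma block_functions:
  fixes \<phi> :: "real^'d \<Rightarrow> complex"
  assumes gen: "dyadic_generator \<phi>" and f: "tempered f" and rad: "radial f"
    and g: "\<And>j. given_by (dyadic_block \<phi> j f) (g j)" and p: "p > 0"
    and fin: "\<And>j. (\<integral>\<^sup>+x. ennreal (norm (g j x) powr p) \<partial>lborel) < \<infinity>"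
  obtains \<Phi> :: "real^'d \<Rightarrow> complex" and F v where "dyadic_generator \<Phi>"
    "\<And>j \<psi>. \<psi> \<in> schwartz \<Longrightarrow> f (conv (kern (ann \<Phi> j)) \<psi>) = (\<integral>x. F j x * \<psi> x \<partial>lborel)"
    "\<And>j. uniformly_continuous_on UNIV (F j)" "\<And>j. \<exists>D. \<forall>x. norm (F j x) \<le> D"
    "\<And>j x y. norm x = norm y \<Longrightarrow> F j x = F j y"
    "\<And>j. v j \<in> borel_measurable borel" "\<And>j. AE x in lborel. v j x = (\<Sum>i\<in>{j-1..Suc j}. g i x)"
    "\<And>j. \<exists>B. \<forall>x. norm (v j x) \<le> B"
    "\<And>N. \<exists>A>0. \<forall>j x. ennreal (norm (v j x)) \<le> (\<integral>\<^sup>+y. ennreal (A * norm (v j y) * ((2^(j+2))^DIM(real^'d) * wt N ((2^(j+2)) *\<^sub>R (x - y)))) \<partial>lborel)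
       \<and> ennreal (norm (F j x)) \<le> (\<integral>\<^sup>+y. ennreal (A * norm (v j y) * ((2^(j+2))^DIM(real^'d) * wt N ((2^(j+2)) *\<^sub>R (x - y)))) \<partial>lborel)"
proof -
  obtain \<Phi> :: "real^'d \<Rightarrow> complex" where \<Phi>: "dyadic_generator \<Phi>" and \<Phi>rad: "\<And>\<xi> \<eta>. norm \<xi> = norm \<eta> \<Longrightarrow> \<Phi> \<xi> = \<Phi> \<eta>"
    using radial_generator[OF gen] by (elim exE conjE) (rule that, assumption, (drule spec)+, erule mp)
  note t\<Phi> = gen_test[OF \<Phi>]
  define \<eta> where "\<eta> j \<xi> = (\<Sum>i\<in>{j-1..Suc j}. ann \<phi> i \<xi>)" for j \<xi>
  define h where "h j x = (\<Sum>i\<in>{j-1..Suc j}. g i x)" for j x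
  note nb = near_block[OF gen f g, folded \<eta>_def h_def]
  have hm [measurable]: "h j \<in> borel_measurable borel" for j using nb(1)[of j] by (simp add: h_def[abs_def])
  have \<eta>t: "test_function (\<eta> j)" for j using nb(2)[of j] by (simp add: \<eta>_def[abs_def])
  have "\<exists>L. integrable lborel (\<lambda>x. wt L x *\<^sub>R h j x)" for j using nb(3)[of j] by (simp add: h_def[abs_def])
  then obtain L where L: "\<And>j. integrable lborel (\<lambda>x. wt (L j) x *\<^sub>R h j x)" using choice[of "\<lambda>j L. integrable lborel (\<lambda>x. wt L x *\<^sub>R h j x)"] by auto
  have hrep: "f (conv (kern (\<eta> j)) \<psi>) = (\<integral>x. h j x * \<psi> x \<partial>lborel)" if "\<psi> \<in> schwartz" for j \<psi>
    using nb(4)[OF that, of j] by (simp only: h_def[abs_def] \<eta>_def[abs_def])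
  have tE: "test_function (dil \<Phi> n)" for n by (rule test_function_dil[OF t\<Phi>])
  have tA: "test_function (ann \<Phi> j)" for j by (rule test_function_ann[OF t\<Phi>])
  note KE = schwartz_kern[OF tE] and KA = schwartz_kern[OF tA]
  note [measurable] = schwartz_measurable[OF KE] schwartz_measurable[OF KA]
  \<comment> \<open>This version of \<open>h j\<close> satisfies the reproducing inequality at every
    point and not only almost everywhere; the supremum in the maximal estimate demands it.\<close>
  define v where "v j = corr (h j) (kern (dil \<Phi> (j + 2)))" for j
  define F where "F j = corr (h j) (kern (ann \<Phi> j))" for j
  have vm [measurable]: "v j \<in> borel_measurable borel" for j unfolding v_def by measurable
  have vh: "AE x in lborel. v j x = h j x" for j
    unfolding v_def by (rule reproducing_AE[OF \<Phi> hrep L hm \<eta>t tE]) (auto simp only: \<eta>_def sum_near_ann_mult_dil[OF gen \<Phi>])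
  \<comment> \<open>Correlations ignore null sets, so \<open>h j\<close> may be replaced by
    \<open>v j\<close> under the integral, which closes the reproducing formula for
    \<open>v j\<close> itself.\<close>
  have cv: "corr (h j) k = corr (v j) k" if "k \<in> borel_measurable borel" for j k
    using vh[of j] by (intro corr_cong_AE that vm hm) (auto simp: eq_commute)
  have vg: "\<exists>C\<ge>0. \<forall>x. norm (v j x) \<le> C * (1 + norm x)^L j" for j
    unfolding v_def by (rule corr_growth(1)[OF L hm KE])
  have vint: "integrable lborel (\<lambda>y. v j y * k (y - x))" if k: "k \<in> schwartz" for j k x
  proof -
    obtain C where C: "\<And>x. norm (v j x) \<le> C * (1 + norm x)^L j" using vg[of j] by blast
    show ?thesis by (rule corr_growth(2)[OF growth_imp_wt_integrable[OF vm C] vm k])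
  qed
  have reps: "\<exists>A>0. \<forall>j x. ennreal (norm (v j x)) \<le> (\<integral>\<^sup>+y. ennreal (A * norm (v j y) * ((2^(j+2))^DIM(real^'d) * wt N ((2^(j+2)) *\<^sub>R (x - y)))) \<partial>lborel)
       \<and> ennreal (norm (F j x)) \<le> (\<integral>\<^sup>+y. ennreal (A * norm (v j y) * ((2^(j+2))^DIM(real^'d) * wt N ((2^(j+2)) *\<^sub>R (x - y)))) \<partial>lborel)" for N
  proof -
    obtain A where A: "A > 0" "\<And>j z. norm (kern (dil \<Phi> (j + 2)) z) \<le> A * ((2^(j+2))^DIM(real^'d) * wt N ((2^(j+2)) *\<^sub>R z))"
      "\<And>j z. norm (kern (ann \<Phi> j) z) \<le> A * ((2^(j+2))^DIM(real^'d) * wt N ((2^(j+2)) *\<^sub>R z))"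
      using kern_block_bounds[OF t\<Phi>, of N] by blast
    have "ennreal (norm (corr (v j) (kern (dil \<Phi> (j + 2))) x)) \<le> (\<integral>\<^sup>+y. ennreal (A * norm (v j y) * ((2^(j+2))^DIM(real^'d) * wt N ((2^(j+2)) *\<^sub>R (x - y)))) \<partial>lborel)" for j x
      by (rule corr_le_nn_integral[OF vint[OF KE] A(2)])
    moreover have "ennreal (norm (corr (v j) (kern (ann \<Phi> j)) x)) \<le> (\<integral>\<^sup>+y. ennreal (A * norm (v j y) * ((2^(j+2))^DIM(real^'d) * wt N ((2^(j+2)) *\<^sub>R (x - y)))) \<partial>lborel)" for j x
      by (rule corr_le_nn_integral[OF vint[OF KA] A(3)])
    moreover have "corr (v j) (kern (dil \<Phi> (j + 2))) = v j" "corr (v j) (kern (ann \<Phi> j)) = F j" for j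
      by (rule trans[OF cv[OF schwartz_measurable[OF KE], symmetric] v_def[symmetric]],
          rule trans[OF cv[OF schwartz_measurable[OF KA], symmetric] F_def[symmetric]])
    ultimately show ?thesis using A(1) by (intro exI[of _ A]) auto
  qed
  have vfin: "(\<integral>\<^sup>+x. ennreal (norm (v j x) powr p) \<partial>lborel) < \<infinity>" for j
  proof -
    have gm [measurable]: "g i \<in> borel_measurable borel" for i using g[of i] by (simp add: given_by_def)
    have "(\<integral>\<^sup>+x. ennreal (norm (v j x) powr p) \<partial>lborel) \<le> (\<integral>\<^sup>+x. ennreal (3 powr p) * (\<Sum>i\<in>{j-1..Suc j}. ennreal (norm (g i x) powr p)) \<partial>lborel)"
    proof (rule nn_integral_mono_AE)
      show "AE x in lborel. ennreal (norm (v j x) powr p) \<le> ennreal (3 powr p) * (\<Sum>i\<in>{j-1..Suc j}. ennreal (norm (g i x) powr p))"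
        using vh[of j]
      proof eventually_elim
        case (elim x)
        have "ennreal (norm (v j x) powr p) \<le> ennreal (3 powr p * (\<Sum>i\<in>{j-1..Suc j}. norm (g i x) powr p))"
          unfolding elim h_def by (rule ennreal_leI) (rule norm_sum_near_powr[OF p])
        also have "\<dots> = ennreal (3 powr p) * (\<Sum>i\<in>{j-1..Suc j}. ennreal (norm (g i x) powr p))"
          by (subst ennreal_mult') (simp, subst sum_ennreal, auto)
        finally show ?case .
      qed
    qed
    also have "\<dots> = ennreal (3 powr p) * (\<Sum>i\<in>{j-1..Suc j}. \<integral>\<^sup>+x. ennreal (norm (g i x) powr p) \<partial>lborel)"
      by (subst nn_integral_cmult) (measurable, subst nn_integral_sum, auto)
    also have "\<dots> < \<infinity>"
    proof -
      have "(\<Sum>i\<in>{j-1..Suc j}. \<integral>\<^sup>+x. ennreal (norm (g i x) powr p) \<partial>lborel) < top" using fin by (subst ennreal_sum_less_top) auto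
      then show ?thesis by (simp add: ennreal_mult_less_top)
    qed
    finally show ?thesis .
  qed
  have vb: "\<exists>B. \<forall>x. norm (v j x) \<le> B" for j
  proof -
    obtain C where C: "\<And>x. norm (v j x) \<le> C * (1 + norm x)^L j" using vg[of j] by blast
    show ?thesis
    proof (rule p_integrable_imp_bounded[OF vm _ p _ C vfin])
      show "(1::real) \<le> 2^(j+2)" by (rule one_le_power) simp
      fix N show "\<exists>A>0. \<forall>x. ennreal (norm (v j x)) \<le> (\<integral>\<^sup>+y. ennreal (A * norm (v j y) * ((2^(j+2))^DIM(real^'d) * wt N ((2^(j+2)) *\<^sub>R (x - y)))) \<partial>lborel)"
        using reps[of N] by blast
    qed
  qed
  have Fc: "F j = corr (v j) (kern (ann \<Phi> j))" for j unfolding F_def by (rule cv[OF schwartz_measurable[OF KA]])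
  have ucF: "uniformly_continuous_on UNIV (F j)" and bdF: "\<exists>D. \<forall>x. norm (F j x) \<le> D" for j
  proof -
    obtain B where B: "\<And>x. norm (v j x) \<le> B" using vb[of j] by blast
    show "uniformly_continuous_on UNIV (F j)" "\<exists>D. \<forall>x. norm (F j x) \<le> D"
      unfolding Fc by (rule corr_bounded_uniformly_continuous[OF vm B KA])+
  qed
  have Frep: "f (conv (kern (ann \<Phi> j)) \<psi>) = (\<integral>x. F j x * \<psi> x \<partial>lborel)" if \<psi>: "\<psi> \<in> schwartz" for j \<psi>
  proof -
    have "(\<lambda>\<xi>. \<eta> j \<xi> * ann \<Phi> j \<xi>) = ann \<Phi> j" by (rule ext) (simp only: \<eta>_def sum_near_ann_mult_ann[OF gen \<Phi>])
    then show ?thesis using block_representation[OF hrep L hm \<eta>t tA \<psi>, of j j] by (simp only: F_def)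
  qed
  have Frad: "F j x = F j y" if xy: "norm x = norm y" for j x y
  proof -
    obtain B where B: "orthogonal_transformation B" "B y = x" using orthogonal_transformation_exists[of y x] xy by auto
    define A where "A = inv B"
    have A: "orthogonal_transformation A" unfolding A_def using B(1) orthogonal_transformation_inv by blast
    have AB: "A (B z) = z" for z unfolding A_def using orthogonal_transformation_inj[OF B(1)] by (rule inv_f_f)
    have linB: "linear B" using B(1) orthogonal_transformation_linear by blast
    have cB: "continuous_on UNIV B" by (intro linear_continuous_on linear_conv_bounded_linear[THEN iffD1] linB)
    have cF: "continuous_on UNIV (F j)" using ucF by (rule uniformly_continuous_imp_continuous)
    have cFB: "continuous_on UNIV (\<lambda>z. F j (B z))" using continuous_on_compose2[OF cF cB] by simp
    have linA: "linear A" using A orthogonal_transformation_linear by blast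
    have cA: "continuous_on UNIV A" by (intro linear_continuous_on linear_conv_bounded_linear[THEN iffD1] linA)
    note [measurable] = borel_measurable_continuous_onI[OF cF] borel_measurable_continuous_onI[OF cFB] borel_measurable_continuous_onI[OF cA]
    obtain D where D: "\<And>x. norm (F j x) \<le> D" using bdF[of j] by blast
    have ki: "kern (ann \<Phi> j) (A z) = kern (ann \<Phi> j) z" for z
    proof (rule kern_orthogonal[OF A schwartz_measurable[OF test_function_schwartz[OF tA]]])
      fix \<xi> \<zeta> :: "real^'d" assume "norm \<xi> = norm \<zeta>"
      then have "\<Phi> (\<xi> /\<^sub>R 2^n) = \<Phi> (\<zeta> /\<^sub>R 2^n)" for n by (intro \<Phi>rad) simp
      then show "ann \<Phi> j \<xi> = ann \<Phi> j \<zeta>" by (simp only: ann_def dil_def)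
    qed
    have int: "integrable lborel (\<lambda>x. G x * \<psi> x)" if G: "\<And>x. norm (G x) \<le> D" and [measurable]: "G \<in> borel_measurable borel" and \<psi>: "\<psi> \<in> schwartz" for G \<psi> :: "real^'d \<Rightarrow> complex"
    proof (rule Bochner_Integration.integrable_bound)
      note [measurable] = schwartz_measurable[OF \<psi>]
      show "integrable lborel (\<lambda>x. D *\<^sub>R \<psi> x)" by (intro integrable_scaleR_right schwartz_integrable \<psi>)
      show "(\<lambda>x. G x * \<psi> x) \<in> borel_measurable lborel" by measurable
    qed (auto simp: norm_mult intro!: AE_I2 mult_right_mono order_trans[OF G abs_ge_self])
    \<comment> \<open>\<open>F j\<close> and its rotation have the same pairing with every Schwartz
      function, because \<open>f\<close> is radial and the kernel is invariant under
      \<open>A\<close>. Continuity then turns equality almost everywhere into equality at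
      \<open>y\<close>.\<close>
    have "AE z in lborel. F j (B z) - F j z = 0"
    proof (rule AE_zero_of_schwartz_pairing[OF t\<Phi>])
      show "\<Phi> 0 = 1" by (rule gen_1[OF \<Phi>]) simp
      have "norm (F j (B z) - F j z) \<le> (D + D) * (1 + norm z)^0" for z
        using norm_triangle_ineq4[of "F j (B z)" "F j z"] D[of "B z"] D[of z] by simp
      then show "integrable lborel (\<lambda>z. wt (0 + 2 * DIM(real^'d)) z *\<^sub>R (F j (B z) - F j z))"
        by (intro growth_imp_wt_integrable) measurable
      fix \<psi> :: "real^'d \<Rightarrow> complex" assume \<psi>: "\<psi> \<in> schwartz"
      note [measurable] = schwartz_measurable[OF \<psi>]
      have \<psi>A: "\<psi> \<circ> A \<in> schwartz" by (rule schwartz_compose_orthogonal[OF A \<psi>])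
      have S: "conv (kern (ann \<Phi> j)) \<psi> \<in> schwartz" by (intro schwartz_conv KA schwartz_rapid schwartz_measurable \<psi>)
      have "(\<integral>x. F j x * (\<psi> \<circ> A) x \<partial>lborel) = f (conv (kern (ann \<Phi> j)) (\<psi> \<circ> A))" by (rule Frep[OF \<psi>A, symmetric])
      also have "\<dots> = f (conv (kern (ann \<Phi> j)) \<psi> \<circ> A)"
        using conv_orthogonal[OF A schwartz_measurable[OF KA] schwartz_measurable[OF \<psi>] ki] by simp
      also have "\<dots> = f (conv (kern (ann \<Phi> j)) \<psi>)" using rad A S unfolding radial_def by blast
      also have "\<dots> = (\<integral>x. F j x * \<psi> x \<partial>lborel)" by (rule Frep[OF \<psi>])
      finally have "(\<integral>x. F j x * \<psi> (A x) \<partial>lborel) = (\<integral>x. F j x * \<psi> x \<partial>lborel)" by simp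
      moreover have "(\<integral>x. F j (B x) * \<psi> (A (B x)) \<partial>lborel) = (\<integral>x. F j x * \<psi> (A x) \<partial>lborel)"
        by (rule lborel_integral_orthogonal[OF B(1)]) measurable
      ultimately have "(\<integral>x. F j (B x) * \<psi> x \<partial>lborel) = (\<integral>x. F j x * \<psi> x \<partial>lborel)" by (simp add: AB)
      moreover have "integrable lborel (\<lambda>x. F j (B x) * \<psi> x)" "integrable lborel (\<lambda>x. F j x * \<psi> x)"
        by (rule int[OF _ _ \<psi>]; (rule D | measurable))+
      ultimately show "(\<integral>x. (F j (B x) - F j x) * \<psi> x \<partial>lborel) = 0" by (simp add: left_diff_distrib)
    qed measurable
    then have "AE z in lborel. F j (B z) = F j z" by simp
    from continuous_AE_eq[OF cFB cF this, of y] show ?thesis by (simp add: B(2))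
  qed
  show ?thesis
  proof (rule that[OF \<Phi> Frep ucF bdF Frad vm _ vb reps])
    show "AE x in lborel. v j x = (\<Sum>i\<in>{j-1..Suc j}. g i x)" for j using vh[of j] by (simp add: h_def)
  qed
qed

lemma large_exponent: "p > 0 \<Longrightarrow> \<exists>M::nat. real q \<le> real M * p \<and> q \<le> M"
proof -
  assume p: "p > 0"
  obtain n :: nat where n: "real q / p \<le> real n" using real_arch_simple by blast
  then have "real q \<le> real n * p" using p by (simp add: divide_le_eq)
  also have "\<dots> \<le> real (max n q) * p" using p by (intro mult_right_mono) auto
  finally show ?thesis by (intro exI[of _ "max n q"]) auto
qed

lemma sum_near_root:
  fixes b :: "nat \<Rightarrow> real"
  assumes b: "\<And>i. b i \<ge> 0" and p: "p > 0"
  shows "(\<Sum>i\<in>{j-1..Suc j}. b i) powr (1 / p) \<le> 3 powr (1 / p) * (\<Sum>i\<in>{j-1..Suc j}. b i powr (1 / p))"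
  using norm_sum_near_powr[of "1 / p" "\<lambda>i. complex_of_real (b i)" j] p b
  by (simp add: sum_nonneg flip: of_real_sum)

text \<open>Here nothing is left out of the mean and the weight in the radial estimate is bounded by
  1: the bounds on the single blocks are already summable, so all \<open>p > 0\<close> are treated
  together.\<close>

lemma uniformly_continuous_outside_summable:
  fixes \<phi> :: "real^'d \<Rightarrow> complex"
  assumes gen: "dyadic_generator \<phi>" and f: "tempered f" and rad: "radial f" and \<tau>: "\<tau> > 0"
    and g: "\<And>j. given_by (dyadic_block \<phi> j f) (g j)" and p: "p > 0"
    and \<alpha>: "\<And>j. (\<integral>\<^sup>+x. ennreal (norm (g j x) powr p) \<partial>lborel) = ennreal (\<alpha> j)" "\<And>j. \<alpha> j \<ge> 0"
    and sm: "summable (\<lambda>j. (2^j * \<alpha> j) powr (1 / p))"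
  shows "uniformly_continuous_outside \<tau> f"
proof -
  have fin: "(\<integral>\<^sup>+x. ennreal (norm (g j x) powr p) \<partial>lborel) < \<infinity>" for j by (simp add: \<alpha>(1))
  obtain \<Phi> :: "real^'d \<Rightarrow> complex" and F v where \<Phi>: "dyadic_generator \<Phi>"
    and rep: "\<And>j \<psi>. \<psi> \<in> schwartz \<Longrightarrow> f (conv (kern (ann \<Phi> j)) \<psi>) = (\<integral>x. F j x * \<psi> x \<partial>lborel)"
    and uc: "\<And>j. uniformly_continuous_on UNIV (F j)" and bd: "\<And>j. \<exists>D. \<forall>x. norm (F j x) \<le> D"
    and Frad: "\<And>j x y. norm x = norm y \<Longrightarrow> F j x = F j y"
    and vm: "\<And>j. v j \<in> borel_measurable borel" and vh: "\<And>j. AE x in lborel. v j x = (\<Sum>i\<in>{j-1..Suc j}. g i x)"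
    and vb: "\<And>j. \<exists>B. \<forall>x. norm (v j x) \<le> B"
    and reps: "\<And>N. \<exists>A>0. \<forall>j x. ennreal (norm (v j x)) \<le> (\<integral>\<^sup>+y. ennreal (A * norm (v j y) * ((2^(j+2))^DIM(real^'d) * wt N ((2^(j+2)) *\<^sub>R (x - y)))) \<partial>lborel)
       \<and> ennreal (norm (F j x)) \<le> (\<integral>\<^sup>+y. ennreal (A * norm (v j y) * ((2^(j+2))^DIM(real^'d) * wt N ((2^(j+2)) *\<^sub>R (x - y)))) \<partial>lborel)"
  proof (rule block_functions[OF gen f rad g p fin], goal_cases)
    case (1 \<Phi> F v)
    show ?thesis by (rule that[OF 1(2-10)])
  qed
  have gm [measurable]: "g i \<in> borel_measurable borel" for i using g[of i] by (simp add: given_by_def)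
  note [measurable] = vm
  obtain M where M: "real (2 * DIM(real^'d) + 1) \<le> real M * p" "2 * DIM(real^'d) + 1 \<le> M"
    using large_exponent[OF p] by blast
  obtain A where A: "A > 0" "\<And>j x. ennreal (norm (v j x)) \<le> (\<integral>\<^sup>+y. ennreal (A * norm (v j y) * ((2^(j+2))^DIM(real^'d) * wt (M + 2 * DIM(real^'d)) ((2^(j+2)) *\<^sub>R (x - y)))) \<partial>lborel)"
    "\<And>j x. ennreal (norm (F j x)) \<le> (\<integral>\<^sup>+y. ennreal (A * norm (v j y) * ((2^(j+2))^DIM(real^'d) * wt (M + 2 * DIM(real^'d)) ((2^(j+2)) *\<^sub>R (x - y)))) \<partial>lborel)"
    using reps[of "M + 2 * DIM(real^'d)"] by blast
  let ?I = "\<lambda>j. {j-1..Suc j}"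
  show ?thesis
  proof (rule uniformly_continuous_outside_of_series[OF f \<Phi> \<tau> rep uc bd])
    fix t e :: real assume t: "t > 0" and e: "e > 0"
    define C where "C = shell_const TYPE(real^'d) A p t"
    have C0: "C \<ge> 0" unfolding C_def by (rule shell_const_nonneg[OF A(1) t])
    \<comment> \<open>The 8 is 4 from \<open>2^(j + 2)\<close> times 2 from
      \<open>2^j \<le> 2 * 2^i\<close> for neighbouring \<open>i\<close>; \<open>3 powr p\<close>
      comes from \<open>norm_sum_near_powr\<close>, and \<open>3 powr (1 / p)\<close> from taking
      the root of a sum of at most three terms.\<close>
    define R where "R = (C * 8 * 3 powr p) powr (1 / p) * 3 powr (1 / p)"
    let ?\<beta> = "\<lambda>j. (2^j * \<alpha> j) powr (1 / p)"
    have bound: "norm (F j x) \<le> R * (\<Sum>i\<in>?I j. ?\<beta> i)" if x: "t \<le> norm x" for j x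
    proof -
      obtain B where B: "\<And>x. norm (v j x) \<le> B" using vb[of j] by blast
      have "ennreal (norm (F j x) powr p) \<le> ennreal (C * 2^(j+2)) *
        (\<integral>\<^sup>+z. indicator (- {}) z * ennreal (norm (v j z) powr p) * ennreal (wt 1 (2^(j+2) * (norm z - norm x))) \<partial>lborel)"
        unfolding C_def
        by (rule radial_estimate[OF vm _ A(1) p refl M A(2,3) B _ _ Frad t x]) auto
      also have "\<dots> \<le> ennreal (C * 2^(j+2)) * (\<integral>\<^sup>+z. ennreal (3 powr p) * (\<Sum>i\<in>?I j. ennreal (norm (g i z) powr p)) \<partial>lborel)"
      proof (rule mult_left_mono[OF nn_integral_mono_AE])
        show "AE z in lborel. indicator (- {}) z * ennreal (norm (v j z) powr p) * ennreal (wt 1 (2^(j+2) * (norm z - norm x)))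
           \<le> ennreal (3 powr p) * (\<Sum>i\<in>?I j. ennreal (norm (g i z) powr p))"
          using vh[of j]
        proof eventually_elim
          case (elim z)
          have "ennreal (norm (v j z) powr p) * ennreal (wt 1 (2^(j+2) * (norm z - norm x))) \<le> ennreal (norm (v j z) powr p) * 1"
            by (intro mult_left_mono) (auto simp: wt_le_1)
          also have "\<dots> \<le> ennreal (3 powr p * (\<Sum>i\<in>?I j. norm (g i z) powr p))"
            unfolding elim mult_1_right by (rule ennreal_leI) (rule norm_sum_near_powr[OF p])
          also have "\<dots> = ennreal (3 powr p) * (\<Sum>i\<in>?I j. ennreal (norm (g i z) powr p))"
            by (subst ennreal_mult') (simp, subst sum_ennreal, auto)
          finally show ?case by simp
        qed
      qed simp
      also have "(\<integral>\<^sup>+z. ennreal (3 powr p) * (\<Sum>i\<in>?I j. ennreal (norm (g i z) powr p)) \<partial>lborel) = ennreal (3 powr p) * (\<Sum>i\<in>?I j. ennreal (\<alpha> i))"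
        unfolding \<alpha>(1)[symmetric] by (subst nn_integral_cmult) (measurable, subst nn_integral_sum, auto)
      also have "(\<Sum>i\<in>?I j. ennreal (\<alpha> i)) = ennreal (\<Sum>i\<in>?I j. \<alpha> i)" by (rule sum_ennreal) (rule \<alpha>(2))
      also have "ennreal (C * 2^(j+2)) * (ennreal (3 powr p) * ennreal (\<Sum>i\<in>?I j. \<alpha> i)) = ennreal (C * 2^(j+2) * (3 powr p * (\<Sum>i\<in>?I j. \<alpha> i)))"
        using C0 by (simp only: ennreal_mult'[symmetric] powr_ge_zero mult_nonneg_nonneg zero_le_power zero_le_numeral)
      finally have "norm (F j x) powr p \<le> C * 2^(j+2) * (3 powr p * (\<Sum>i\<in>?I j. \<alpha> i))"
      proof (subst (asm) ennreal_le_iff)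
        show "0 \<le> C * 2^(j+2) * (3 powr p * (\<Sum>i\<in>?I j. \<alpha> i))" using C0 by (intro mult_nonneg_nonneg sum_nonneg \<alpha>(2)) auto
      qed
      also have "\<dots> = (C * 4 * 3 powr p) * (\<Sum>i\<in>?I j. 2^j * \<alpha> i)" by (simp add: sum_distrib_left[symmetric] power_add)
      also have "\<dots> \<le> (C * 4 * 3 powr p) * (\<Sum>i\<in>?I j. 2 * (2^i * \<alpha> i))"
      proof (intro mult_left_mono sum_mono)
        fix i assume i: "i \<in> ?I j"
        have "(2::real)^j \<le> 2^Suc i" using i by (intro power_increasing) auto
        then have "2^j * \<alpha> i \<le> 2^Suc i * \<alpha> i" by (intro mult_right_mono \<alpha>(2))
        then show "2^j * \<alpha> i \<le> 2 * (2^i * \<alpha> i)" by simp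
      qed (use C0 in auto)
      also have "\<dots> = (C * 8 * 3 powr p) * (\<Sum>i\<in>?I j. 2^i * \<alpha> i)" by (simp only: sum_distrib_left[symmetric])
      finally have "(norm (F j x) powr p) powr (1 / p) \<le> ((C * 8 * 3 powr p) * (\<Sum>i\<in>?I j. 2^i * \<alpha> i)) powr (1 / p)"
        using p by (intro powr_mono2) auto
      then have "norm (F j x) \<le> ((C * 8 * 3 powr p) * (\<Sum>i\<in>?I j. 2^i * \<alpha> i)) powr (1 / p)"
        using p by (simp only: powr_powr) simp
      also have "\<dots> = (C * 8 * 3 powr p) powr (1 / p) * (\<Sum>i\<in>?I j. 2^i * \<alpha> i) powr (1 / p)"
        by (rule powr_mult)
      also have "\<dots> \<le> (C * 8 * 3 powr p) powr (1 / p) * (3 powr (1 / p) * (\<Sum>i\<in>?I j. ?\<beta> i))"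
        by (intro mult_left_mono sum_near_root p) (auto simp: \<alpha>(2))
      finally show ?thesis by (simp only: R_def mult.assoc)
    qed
    have R0: "R \<ge> 0" by (simp add: R_def)
    have sm1: "summable (\<lambda>j. ?\<beta> (j - 1))"
      by (subst summable_Suc_iff[symmetric]) (simp add: sm)
    have "summable (\<lambda>j. ?\<beta> (j - 1) + ?\<beta> j + ?\<beta> (Suc j))"
      by (intro summable_add sm1 sm) (use sm in \<open>subst summable_Suc_iff\<close>, assumption)
    then have "summable (\<lambda>j. R * (?\<beta> (j - 1) + ?\<beta> j + ?\<beta> (Suc j)))" by (rule summable_mult)
    then obtain J where J: "\<And>n. norm (\<Sum>j\<in>{J..<n}. R * (?\<beta> (j - 1) + ?\<beta> j + ?\<beta> (Suc j))) < e"
      using e unfolding summable_Cauchy by blast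
    \<comment> \<open>For \<open>j = 0\<close> the truncated \<open>j - 1\<close> counts the term at
      \<open>0\<close> twice on the right, hence only an inequality.\<close>
    have near3: "(\<Sum>i\<in>?I j. ?\<beta> i) \<le> ?\<beta> (j - 1) + ?\<beta> j + ?\<beta> (Suc j)" for j
    proof (cases j)
      case 0
      then have "?I j = {0, Suc 0}" by auto
      then show ?thesis using 0 by simp
    next
      case (Suc k)
      then have "?I j = {k, Suc k, Suc (Suc k)}" by auto
      then show ?thesis using Suc by simp
    qed
    show "\<exists>J. \<forall>n x. t \<le> norm x \<longrightarrow> (\<Sum>j\<in>{J..<n}. norm (F j x)) \<le> e"
    proof (intro exI allI impI)
      fix n :: nat and x :: "real^'d" assume x: "t \<le> norm x"
      have "(\<Sum>j\<in>{J..<n}. norm (F j x)) \<le> (\<Sum>j\<in>{J..<n}. R * (?\<beta> (j - 1) + ?\<beta> j + ?\<beta> (Suc j)))"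
        by (intro sum_mono order_trans[OF bound[OF x] mult_left_mono[OF near3 R0]])
      also have "\<dots> \<le> e" using J[of n] by simp
      finally show "(\<Sum>j\<in>{J..<n}. norm (F j x)) \<le> e" .
    qed
  qed
qed

text \<open>\<open>norm (v j z) powr p\<close> is at most a constant times \<open>G z / 2^j\<close>
  for almost every \<open>z\<close>, which cancels the factor \<open>2^(j + 2)\<close> of the radial
  estimate. What is left is the sum of shell integrals controlled by
  \<open>uniform_dyadic_shell_tail\<close>.\<close>

lemma uniformly_continuous_outside_maximal:
  fixes \<phi> :: "real^'d \<Rightarrow> complex"
  assumes gen: "dyadic_generator \<phi>" and f: "tempered f" and rad: "radial f" and \<tau>: "\<tau> > 0"
    and g: "\<And>j. given_by (dyadic_block \<phi> j f) (g j)" and p: "p > 0" "p \<le> 1"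
    and mx: "(\<integral>\<^sup>+x. (SUP j. ennreal (2^j * norm (g j x) powr p)) \<partial>lborel) < \<infinity>"
  shows "uniformly_continuous_outside \<tau> f"
proof -
  have gm [measurable]: "g i \<in> borel_measurable borel" for i using g[of i] by (simp add: given_by_def)
  define H where "H x = (SUP j. ennreal (2^j * norm (g j x) powr p))" for x
  have Hm [measurable]: "H \<in> borel_measurable borel" unfolding H_def by measurable
  have Hfin: "(\<integral>\<^sup>+x. H x \<partial>lborel) < \<infinity>" using mx by (simp add: H_def)
  have Hge: "ennreal (2^j * norm (g j x) powr p) \<le> H x" for j x unfolding H_def by (rule SUP_upper) simp
  have fin: "(\<integral>\<^sup>+x. ennreal (norm (g j x) powr p) \<partial>lborel) < \<infinity>" for j
  proof (rule le_less_trans[OF nn_integral_mono Hfin])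
    fix x
    have "1 * norm (g j x) powr p \<le> 2^j * norm (g j x) powr p" by (intro mult_right_mono one_le_power) auto
    then have "ennreal (norm (g j x) powr p) \<le> ennreal (2^j * norm (g j x) powr p)" by (intro ennreal_leI) simp
    then show "ennreal (norm (g j x) powr p) \<le> H x" using Hge by (rule order_trans)
  qed
  define G where "G x = enn2real (H x)" for x
  have HG: "AE x in lborel. H x = ennreal (G x)"
  proof -
    have "AE x in lborel. H x \<noteq> \<infinity>" by (rule nn_integral_PInf_AE) (use Hfin in auto)
    then show ?thesis by eventually_elim (simp add: G_def top.not_eq_extremum)
  qed
  have G0: "G x \<ge> 0" for x by (simp add: G_def)
  have Gm [measurable]: "G \<in> borel_measurable borel" unfolding G_def by measurable
  have Gint: "integrable lborel G"
  proof (rule integrableI_nonneg)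
    have "(\<integral>\<^sup>+x. ennreal (G x) \<partial>lborel) = (\<integral>\<^sup>+x. H x \<partial>lborel)" using HG by (intro nn_integral_cong_AE) auto
    then show "(\<integral>\<^sup>+x. ennreal (G x) \<partial>lborel) < \<infinity>" using Hfin by simp
  qed (auto simp: G0)
  obtain \<Phi> :: "real^'d \<Rightarrow> complex" and F v where \<Phi>: "dyadic_generator \<Phi>"
    and rep: "\<And>j \<psi>. \<psi> \<in> schwartz \<Longrightarrow> f (conv (kern (ann \<Phi> j)) \<psi>) = (\<integral>x. F j x * \<psi> x \<partial>lborel)"
    and uc: "\<And>j. uniformly_continuous_on UNIV (F j)" and bd: "\<And>j. \<exists>D. \<forall>x. norm (F j x) \<le> D"
    and Frad: "\<And>j x y. norm x = norm y \<Longrightarrow> F j x = F j y"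
    and vm: "\<And>j. v j \<in> borel_measurable borel" and vh: "\<And>j. AE x in lborel. v j x = (\<Sum>i\<in>{j-1..Suc j}. g i x)"
    and vb: "\<And>j. \<exists>B. \<forall>x. norm (v j x) \<le> B"
    and reps: "\<And>N. \<exists>A>0. \<forall>j x. ennreal (norm (v j x)) \<le> (\<integral>\<^sup>+y. ennreal (A * norm (v j y) * ((2^(j+2))^DIM(real^'d) * wt N ((2^(j+2)) *\<^sub>R (x - y)))) \<partial>lborel)
       \<and> ennreal (norm (F j x)) \<le> (\<integral>\<^sup>+y. ennreal (A * norm (v j y) * ((2^(j+2))^DIM(real^'d) * wt N ((2^(j+2)) *\<^sub>R (x - y)))) \<partial>lborel)"
  proof (rule block_functions[OF gen f rad g p(1) fin], goal_cases)
    case (1 \<Phi> F v)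
    show ?thesis by (rule that[OF 1(2-10)])
  qed
  note [measurable] = vm
  obtain M where M: "real (2 * DIM(real^'d) + 1) \<le> real M * p" "2 * DIM(real^'d) + 1 \<le> M"
    using large_exponent[OF p(1)] by blast
  obtain A where A: "A > 0" "\<And>j x. ennreal (norm (v j x)) \<le> (\<integral>\<^sup>+y. ennreal (A * norm (v j y) * ((2^(j+2))^DIM(real^'d) * wt (M + 2 * DIM(real^'d)) ((2^(j+2)) *\<^sub>R (x - y)))) \<partial>lborel)"
    "\<And>j x. ennreal (norm (F j x)) \<le> (\<integral>\<^sup>+y. ennreal (A * norm (v j y) * ((2^(j+2))^DIM(real^'d) * wt (M + 2 * DIM(real^'d)) ((2^(j+2)) *\<^sub>R (x - y)))) \<partial>lborel)"
    using reps[of "M + 2 * DIM(real^'d)"] by blast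
  let ?I = "\<lambda>j. {j-1..Suc j}"
  let ?K = "2 * DIM(real^'d)"
  let ?Y = "2^?K * wt_mass TYPE(real^'d) ?K"
  have Y0: "?Y \<ge> 0" by (intro mult_nonneg_nonneg wt_mass_nonneg) simp
  \<comment> \<open>The number of disjoint copies in \<open>thin_shell_mass\<close> is chosen so
    large that the shell carries kernel mass at most 1/2 after multiplication by \<open>A\<close>;
    this fixes \<open>c\<close> independently of \<open>j\<close>.\<close>
  obtain m0 :: nat where m0: "2 * A * ?Y \<le> real m0" using real_arch_simple by blast
  define m where "m = Suc m0"
  have m: "m \<ge> 1" "2 * A * ?Y \<le> real m" using m0 by (auto simp: m_def)
  define c where "c = 1 / (6 * real m)"
  have c: "c > 0" using m by (simp add: c_def)
  have bad: "(\<integral>\<^sup>+y. indicator {y. \<bar>norm y - r\<bar> < c / a} y * ennreal (A * (a^DIM(real^'d) * wt ?K (a *\<^sub>R (x - y)))) \<partial>lborel) \<le> ennreal (1/2)"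
    if a: "a > 0" "a * r \<ge> 1" for a r and x :: "real^'d"
  proof -
    let ?X = "\<integral>\<^sup>+y. indicator {y. \<bar>norm y - r\<bar> < c / a} y * ennreal (a^DIM(real^'d) * wt ?K (a *\<^sub>R (x - y))) \<partial>lborel"
    have X: "ennreal (real m) * ?X \<le> ennreal ?Y" unfolding c_def by (rule thin_shell_mass[OF a m(1) order_refl])
    have "(\<integral>\<^sup>+y. indicator {y. \<bar>norm y - r\<bar> < c / a} y * ennreal (A * (a^DIM(real^'d) * wt ?K (a *\<^sub>R (x - y)))) \<partial>lborel)
        = (\<integral>\<^sup>+y. ennreal A * (indicator {y. \<bar>norm y - r\<bar> < c / a} y * ennreal (a^DIM(real^'d) * wt ?K (a *\<^sub>R (x - y)))) \<partial>lborel)"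
      using A(1) by (intro nn_integral_cong) (simp only: ennreal_mult'[OF less_imp_le] mult_ac)
    also have "\<dots> = ennreal A * ?X" by (rule nn_integral_cmult) measurable
    also have "\<dots> = ennreal (A / real m) * (ennreal (real m) * ?X)"
    proof -
      have "ennreal (A / real m) * ennreal (real m) = ennreal A" using A(1) m(1) by (subst ennreal_mult'[symmetric]) auto
      then show ?thesis by (simp only: mult.assoc[symmetric])
    qed
    also have "\<dots> \<le> ennreal (A / real m) * ennreal ?Y" by (rule mult_left_mono[OF X]) simp
    also have "\<dots> = ennreal (A / real m * ?Y)" by (rule ennreal_mult'[symmetric]) (use A(1) in simp)
    also have "\<dots> \<le> ennreal (1/2)" by (rule ennreal_leI) (use m in \<open>simp add: divide_le_eq mult.assoc\<close>)
    finally show ?thesis .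
  qed
  show ?thesis
  proof (rule uniformly_continuous_outside_of_series[OF f \<Phi> \<tau> rep uc bd])
    fix t e :: real assume t: "t > 0" and e: "e > 0"
    define C where "C = shell_const TYPE(real^'d) A p t"
    have C0: "C \<ge> 0" unfolding C_def by (rule shell_const_nonneg[OF A(1) t])
    \<comment> \<open>The 4 comes from \<open>2^(j + 2)\<close>, the 6 from three neighbouring terms
      each at most \<open>2 * G z / 2^j\<close>; adding 1 makes \<open>R\<close> positive, so that
      one can divide by it.\<close>
    define R where "R = C * 4 * (3 powr p * 6) + 1"
    have R0: "R > 0" unfolding R_def using C0 by (intro add_nonneg_pos mult_nonneg_nonneg) auto
    let ?T = "\<lambda>j r. \<integral>\<^sup>+z. indicator (- {z. \<bar>norm z - r\<bar> < (c / 4) / 2^j}) z * ennreal (G z * wt 1 (2^j * (norm z - r))) \<partial>lborel"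
    \<comment> \<open>The condition \<open>2^j * t \<ge> 1\<close> gives
      \<open>2^(j + 2) * norm x \<ge> 1\<close>, as \<open>thin_shell_mass\<close> requires;
      \<open>J0\<close> below secures it for the tail.\<close>
    have bound: "ennreal (norm (F j x) powr p) \<le> ennreal R * ?T j (norm x)" if x: "t \<le> norm x" and j: "2^j * t \<ge> 1" for j x
    proof -
      obtain B where B: "\<And>x. norm (v j x) \<le> B" using vb[of j] by blast
      let ?a = "2^(j+2) :: real"
      let ?D = "{y::real^'d. \<bar>norm y - norm x\<bar> < c / ?a}"
      have "1 \<le> 2^j * t" by (rule j)
      also have "\<dots> \<le> ?a * norm x" using t x by (intro mult_mono power_increasing) auto
      finally have ar: "?a * norm x \<ge> 1" .
      have "ennreal (norm (F j x) powr p) \<le> ennreal (C * ?a) *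
        (\<integral>\<^sup>+z. indicator (- ?D) z * ennreal (norm (v j z) powr p) * ennreal (wt 1 (?a * (norm z - norm x))) \<partial>lborel)"
        unfolding C_def
      proof (rule radial_estimate[OF vm _ A(1) p(1) refl M A(2,3) B _ _ Frad t x])
        show "?D = {} \<or> p \<le> 1 \<and> (\<forall>x. (\<integral>\<^sup>+y. indicator ?D y * ennreal (A * (?a^DIM(real^'d) * wt ?K (?a *\<^sub>R (x - y)))) \<partial>lborel) \<le> ennreal (1/2))"
          using bad[of ?a "norm x", OF _ ar] p(2) by simp
      qed auto
      also have "\<dots> \<le> ennreal (C * ?a) * (\<integral>\<^sup>+z. ennreal (3 powr p * 6 / 2^j) * (indicator (- {z. \<bar>norm z - norm x\<bar> < (c / 4) / 2^j}) z * ennreal (G z * wt 1 (2^j * (norm z - norm x)))) \<partial>lborel)"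
      proof (rule mult_left_mono[OF nn_integral_mono_AE])
        show "AE z in lborel. indicator (- ?D) z * ennreal (norm (v j z) powr p) * ennreal (wt 1 (?a * (norm z - norm x)))
           \<le> ennreal (3 powr p * 6 / 2^j) * (indicator (- {z. \<bar>norm z - norm x\<bar> < (c / 4) / 2^j}) z * ennreal (G z * wt 1 (2^j * (norm z - norm x))))"
          using vh[of j] HG
        proof eventually_elim
          case (elim z)
          have gG: "2^i * norm (g i z) powr p \<le> G z" for i
            using Hge[of i z] unfolding elim(2) by (subst (asm) ennreal_le_iff) (simp_all add: G0)
          have "2^j * (\<Sum>i\<in>?I j. norm (g i z) powr p) \<le> (\<Sum>i\<in>?I j. 2 * G z)"
            unfolding sum_distrib_left
          proof (rule sum_mono)
            fix i assume i: "i \<in> ?I j"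
            have "(2::real)^j \<le> 2^Suc i" using i by (intro power_increasing) auto
            then have "2^j * norm (g i z) powr p \<le> 2^Suc i * norm (g i z) powr p" by (intro mult_right_mono) auto
            also have "\<dots> = 2 * (2^i * norm (g i z) powr p)" by simp
            also have "\<dots> \<le> 2 * G z" using gG[of i] by simp
            finally show "2^j * norm (g i z) powr p \<le> 2 * G z" .
          qed
          also have "\<dots> = real (card (?I j)) * (2 * G z)" by simp
          also have "\<dots> \<le> 3 * (2 * G z)" using G0[of z] by (intro mult_right_mono) auto
          finally have "2^j * (\<Sum>i\<in>?I j. norm (g i z) powr p) \<le> 6 * G z" by simp
          then have s: "(\<Sum>i\<in>?I j. norm (g i z) powr p) \<le> 6 * G z / 2^j" by (simp add: pos_le_divide_eq mult.commute)
          have "norm (v j z) powr p \<le> 3 powr p * (\<Sum>i\<in>?I j. norm (g i z) powr p)"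
            unfolding elim(1) by (rule norm_sum_near_powr[OF p(1)])
          also have "\<dots> \<le> 3 powr p * (6 * G z / 2^j)" by (intro mult_left_mono s) simp
          finally have vG: "norm (v j z) powr p \<le> 3 powr p * 6 / 2^j * G z" by simp
          have "wt 1 (?a * (norm z - norm x)) \<le> wt 1 (2^j * (norm z - norm x))"
          proof (rule wt_antimono_norm)
            have "(2::real)^j \<le> ?a" by (intro power_increasing) auto
            then show "norm (2^j * (norm z - norm x)) \<le> norm (?a * (norm z - norm x))"
              unfolding real_norm_def abs_mult by (intro mult_right_mono) auto
          qed
          then have "norm (v j z) powr p * wt 1 (?a * (norm z - norm x)) \<le> (3 powr p * 6 / 2^j * G z) * wt 1 (2^j * (norm z - norm x))"
            using vG G0[of z] by (intro mult_mono) auto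
          then have "norm (v j z) powr p * wt 1 (?a * (norm z - norm x)) \<le> (3 powr p * 6 / 2^j) * (G z * wt 1 (2^j * (norm z - norm x)))"
            by (simp only: mult.assoc)
          note le = ennreal_leI[OF this]
          have K0: "0 \<le> 3 powr p * 6 / (2::real)^j" by simp
          have "ennreal (norm (v j z) powr p) * ennreal (wt 1 (?a * (norm z - norm x))) \<le> ennreal (3 powr p * 6 / 2^j) * ennreal (G z * wt 1 (2^j * (norm z - norm x)))"
            using le unfolding ennreal_mult'[OF powr_ge_zero] ennreal_mult'[OF K0] .
          then have "indicator (- ?D) z * (ennreal (norm (v j z) powr p) * ennreal (wt 1 (?a * (norm z - norm x)))) \<le> indicator (- ?D) z * (ennreal (3 powr p * 6 / 2^j) * ennreal (G z * wt 1 (2^j * (norm z - norm x))))"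
            by (rule mult_left_mono) simp
          note main = this
          have cD: "c / ?a = (c / 4) / 2^j" by (simp add: power_add)
          show ?case
            using main unfolding cD mult.assoc mult.left_commute[of "ennreal (3 powr p * 6 / 2^j)"] .
        qed
      qed simp
      also have "\<dots> = ennreal (C * ?a) * (ennreal (3 powr p * 6 / 2^j) * ?T j (norm x))"
      proof -
        have [measurable]: "(\<lambda>z. indicator (- {z. \<bar>norm z - norm x\<bar> < (c / 4) / 2^j}) z :: ennreal) \<in> borel_measurable borel"
          by (intro borel_measurable_indicator borel_comp) measurable
        have [measurable]: "(\<lambda>z. ennreal (G z * wt 1 (2^j * (norm z - norm x)))) \<in> borel_measurable borel"
          by measurable
        show ?thesis
          by (rule arg_cong[OF nn_integral_cmult]) measurable
      qed
      also have "\<dots> = ennreal (C * 4 * (3 powr p * 6)) * ?T j (norm x)"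
      proof -
        have "ennreal (C * ?a) * ennreal (3 powr p * 6 / 2^j) = ennreal (C * ?a * (3 powr p * 6 / 2^j))"
          by (rule ennreal_mult'[symmetric]) (use C0 in simp)
        also have "C * ?a * (3 powr p * 6 / 2^j) = C * 4 * (3 powr p * 6)" by (simp add: power_add)
        finally show ?thesis by (simp only: mult.assoc[symmetric])
      qed
      also have "\<dots> \<le> ennreal R * ?T j (norm x)" by (intro mult_right_mono ennreal_leI) (auto simp: R_def)
      finally show ?thesis .
    qed
    \<comment> \<open>Bounding the sum of \<open>p\<close>-th powers by \<open>e' \<le> 1\<close>
      makes every \<open>norm (F j x)\<close> at most 1, so that it is at most its own
      \<open>p\<close>-th power.\<close>
    define e' where "e' = min 1 e"
    have e': "e' > 0" "e' \<le> 1" "e' \<le> e" using e by (auto simp: e'_def)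
    obtain J1 where J1: "\<And>n r. (\<Sum>j\<in>{J1..<n}. ?T j r) \<le> ennreal (e' / R)"
      using uniform_dyadic_shell_tail[OF Gint G0, of "c / 4" "e' / R"] c e'(1) R0 by auto
    obtain J0 :: nat where J0: "1 / t < 2^J0" using real_arch_pow[of 2 "1 / t"] by auto
    define J where "J = max J0 J1"
    have small: "(\<Sum>j\<in>{J..<n}. norm (F j x) powr p) \<le> e'" if x: "t \<le> norm x" for n x
    proof -
      have "ennreal (\<Sum>j\<in>{J..<n}. norm (F j x) powr p) = (\<Sum>j\<in>{J..<n}. ennreal (norm (F j x) powr p))"
        by (rule sum_ennreal[symmetric]) simp
      also have "\<dots> \<le> (\<Sum>j\<in>{J..<n}. ennreal R * ?T j (norm x))"
      proof (rule sum_mono)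
        fix j assume "j \<in> {J..<n}"
        then have "(2::real)^J0 \<le> 2^j" by (intro power_increasing) (auto simp: J_def)
        then have "1 / t < 2^j" using J0 by linarith
        then have "2^j * t \<ge> 1" using t by (simp add: divide_less_eq)
        then show "ennreal (norm (F j x) powr p) \<le> ennreal R * ?T j (norm x)" by (rule bound[OF x])
      qed
      also have "\<dots> = ennreal R * (\<Sum>j\<in>{J..<n}. ?T j (norm x))" by (rule sum_distrib_left[symmetric])
      also have "\<dots> \<le> ennreal R * (\<Sum>j\<in>{J1..<n}. ?T j (norm x))"
        by (intro mult_left_mono sum_mono2) (auto simp: J_def)
      also have "\<dots> \<le> ennreal R * ennreal (e' / R)" by (rule mult_left_mono[OF J1]) simp
      also have "\<dots> = ennreal e'" using R0 e'(1) by (subst ennreal_mult'[symmetric]) auto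
      finally show ?thesis by (subst (asm) ennreal_le_iff) (use e'(1) in auto)
    qed
    show "\<exists>J. \<forall>n x. t \<le> norm x \<longrightarrow> (\<Sum>j\<in>{J..<n}. norm (F j x)) \<le> e"
    proof (intro exI allI impI)
      fix n :: nat and x :: "real^'d" assume x: "t \<le> norm x"
      have "(\<Sum>j\<in>{J..<n}. norm (F j x)) \<le> (\<Sum>j\<in>{J..<n}. norm (F j x) powr p)"
      proof (rule sum_mono)
        fix j assume j: "j \<in> {J..<n}"
        have "norm (F j x) powr p \<le> (\<Sum>j\<in>{J..<n}. norm (F j x) powr p)" by (rule member_le_sum[OF j]) auto
        also have "\<dots> \<le> 1" using small[OF x, of n] e'(2) by linarith
        finally have le: "norm (F j x) powr p \<le> 1" .
        have "norm (F j x) \<le> 1"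
        proof (rule ccontr)
          assume "\<not> norm (F j x) \<le> 1"
          then have "1 powr p < norm (F j x) powr p" using p(1) by (intro powr_less_mono2) auto
          then show False using le by simp
        qed
        then have "norm (F j x) powr 1 \<le> norm (F j x) powr p" using p(2) by (intro powr_mono') auto
        then show "norm (F j x) \<le> norm (F j x) powr p" by simp
      qed
      also have "\<dots> \<le> e" using small[OF x, of n] e'(3) by linarith
      finally show "(\<Sum>j\<in>{J..<n}. norm (F j x)) \<le> e" .
    qed
  qed
qed

text \<open>The surplus \<open>s - 1 / p\<close> of smoothness turns a uniform bound into the
  geometric series of ratio \<open>2 powr (- (s - 1 / p))\<close>.\<close>

lemma summable_of_smoothness:
  assumes s: "s > 1 / p" and p: "p > 0" and \<alpha>: "\<And>j. \<alpha> j \<ge> 0"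
    and K: "\<And>j::nat. 2 powr (real j * s) * \<alpha> j powr (1 / p) \<le> K"
  shows "summable (\<lambda>j. (2^j * \<alpha> j) powr (1 / p))"
proof (rule summable_comparison_test')
  let ?r = "2 powr (- (s - 1 / p)) :: real"
  have "?r < 2 powr 0" using s by (intro powr_less_mono) auto
  then have "norm ?r < 1" by simp
  then show "summable (\<lambda>j. K * ?r ^ j)" by (intro summable_mult summable_geometric)
  fix j :: nat
  have "(2^j * \<alpha> j) powr (1 / p) = 2 powr (real j / p) * \<alpha> j powr (1 / p)"
    using \<alpha>[of j] by (simp add: powr_mult powr_realpow[symmetric] powr_powr)
  also have "2 powr (real j / p) = 2 powr (real j * s) * ?r ^ j"
    by (simp add: powr_realpow[symmetric] powr_powr powr_add[symmetric] algebra_simps)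
  also have "2 powr (real j * s) * ?r ^ j * \<alpha> j powr (1 / p) = (2 powr (real j * s) * \<alpha> j powr (1 / p)) * ?r ^ j"
    by (simp only: mult_ac)
  also have "\<dots> \<le> K * ?r ^ j" by (intro mult_right_mono K) simp
  finally show "norm ((2^j * \<alpha> j) powr (1 / p)) \<le> K * ?r ^ j" by simp
qed

text \<open>The terms tend to 0, so eventually they are below 1 and at most their own
  \<open>r\<close>-th powers, where \<open>r \<le> 1\<close> is the real value of
  \<open>q\<close>.\<close>

lemma summable_of_lq:
  assumes q: "0 < q" "q \<le> 1" and \<beta>: "\<And>j. \<beta> j \<ge> 0" and lq: "lq_qnorm q (\<lambda>j. ennreal (\<beta> j)) < \<infinity>"
  shows "summable \<beta>"
proof -
  have qi: "q \<noteq> \<infinity>" using q(2) by (auto simp: top_unique)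
  define r where "r = enn2real q"
  have r: "r > 0" using q qi by (simp add: r_def enn2real_positive_iff top.not_eq_extremum)
  have "enn2real q \<le> enn2real 1" using q(2) by (intro enn2real_mono) auto
  then have r1: "r \<le> 1" by (simp add: r_def)
  have "ennpowr (\<Sum>j. ennpowr (ennreal (\<beta> j)) r) (1 / r) < \<infinity>" using lq qi by (simp add: lq_qnorm_def r_def)
  then have "(\<Sum>j. ennreal (\<beta> j powr r)) < \<infinity>" unfolding ennpowr_less_top by (simp add: ennpowr_ennreal \<beta>)
  then have sr: "summable (\<lambda>j. \<beta> j powr r)" by (intro summable_suminf_not_top) auto
  have "(\<lambda>j. \<beta> j powr r) \<longlonglongrightarrow> 0" using sr by (rule summable_LIMSEQ_zero)
  then have "\<forall>\<^sub>F j in sequentially. \<beta> j powr r < 1" by (rule order_tendstoD) simp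
  then have "\<forall>\<^sub>F j in sequentially. norm (\<beta> j) \<le> \<beta> j powr r"
  proof eventually_elim
    case (elim j)
    have "\<beta> j \<le> 1"
    proof (rule ccontr)
      assume "\<not> \<beta> j \<le> 1"
      then have "1 powr r < \<beta> j powr r" using r by (intro powr_less_mono2) auto
      then show False using elim by simp
    qed
    then have "\<beta> j powr 1 \<le> \<beta> j powr r" using r1 \<beta>[of j] by (intro powr_mono') auto
    then show ?case using \<beta>[of j] by simp
  qed
  then show ?thesis by (rule summable_comparison_test_ev[OF _ sr])
qed

text \<open>Every sequence quasi-norm dominates each single term. This gives the uniform bounds for
  \<open>s > 1 / p\<close> in both scales and, raised to the power \<open>p\<close> inside the
  integral, the integrable supremum for \<open>s = 1 / p\<close> in the Lizorkin-Triebel scale. The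
  Besov case with \<open>s = 1 / p\<close> uses summability in \<open>j\<close> through
  \<open>summable_of_lq\<close>.\<close>

theorem corollary4:
  fixes \<phi>0 :: "real ^ 'd \<Rightarrow> complex" and \<tau> s p :: real and q :: ennreal
  assumes "dyadic_generator \<phi>0"
    and "\<tau> > 0" and "CARD('d) \<ge> 2" and "0 < p" and "0 < q"
  shows "(s > 1 / p \<or> (s = 1 / p \<and> q \<le> 1) \<longrightarrow>
            (\<forall>f \<in> radial_besov \<phi>0 s p q. uniformly_continuous_outside \<tau> f)) \<and>
         (s > 1 / p \<or> (s = 1 / p \<and> p \<le> 1) \<longrightarrow>
            (\<forall>f \<in> radial_lizorkin_triebel \<phi>0 s p q. uniformly_continuous_outside \<tau> f))"
proof (intro conjI impI ballI)
  note p = \<open>0 < p\<close> and q = \<open>0 < q\<close>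
  fix f assume sq: "s > 1 / p \<or> (s = 1 / p \<and> q \<le> 1)" and f: "f \<in> radial_besov \<phi>0 s p q"
  then obtain g where g: "\<And>j. given_by (dyadic_block \<phi>0 j f) (g j)"
    and lq: "lq_qnorm q (\<lambda>j. ennreal (2 powr (real j * s)) * Lp_qnorm p (\<lambda>x. ennreal (norm (g j x)))) < \<infinity>"
    and T: "tempered f" and R: "radial f"
    by (auto simp: radial_besov_def besov_def)
  define I where "I j = (\<integral>\<^sup>+x. ennreal (norm (g j x) powr p) \<partial>lborel)" for j
  have Lp: "Lp_qnorm p (\<lambda>x. ennreal (norm (g j x))) = ennpowr (I j) (1 / p)" for j
    by (simp add: Lp_qnorm_def I_def ennpowr_ennreal)
  \<comment> \<open>A single term of the sequence; it shows that every \<open>I j\<close> is finite,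
    and for \<open>s > 1 / p\<close> it is the bound \<open>K\<close>.\<close>
  have le: "ennreal (2 powr (real j * s)) * ennpowr (I j) (1 / p) \<le> lq_qnorm q (\<lambda>j. ennreal (2 powr (real j * s)) * ennpowr (I j) (1 / p))" for j
    by (rule lq_qnorm_ge[OF q])
  note lq' = lq[unfolded Lp]
  have Ifin: "I j < \<infinity>" for j
  proof (rule ccontr)
    assume "\<not> I j < \<infinity>"
    then have "ennpowr (I j) (1 / p) = \<infinity>" by (simp add: ennpowr_def top.not_eq_extremum)
    then have "ennreal (2 powr (real j * s)) * ennpowr (I j) (1 / p) = \<infinity>" by (simp add: ennreal_mult_top)
    then show False using le_less_trans[OF le[of j] lq'] by simp
  qed
  define \<alpha> where "\<alpha> j = enn2real (I j)" for j
  have \<alpha>: "I j = ennreal (\<alpha> j)" "\<alpha> j \<ge> 0" for j using Ifin[of j] by (auto simp: \<alpha>_def)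
  have a: "ennreal (2 powr (real j * s)) * ennpowr (I j) (1 / p) = ennreal (2 powr (real j * s) * \<alpha> j powr (1 / p))" for j
    by (simp add: \<alpha> ennpowr_ennreal ennreal_mult')
  show "uniformly_continuous_outside \<tau> f"
  proof (rule uniformly_continuous_outside_summable[OF assms(1) T R assms(2) g p \<alpha>[unfolded I_def]])
    show "summable (\<lambda>j. (2^j * \<alpha> j) powr (1 / p))"
    proof (cases "s > 1 / p")
      case True
      define K where "K = enn2real (lq_qnorm q (\<lambda>j. ennreal (2 powr (real j * s)) * ennpowr (I j) (1 / p)))"
      have "2 powr (real j * s) * \<alpha> j powr (1 / p) \<le> K" for j
        using enn2real_mono[OF le[of j]] lq' unfolding K_def a by (simp add: \<alpha>(2))
      then show ?thesis by (rule summable_of_smoothness[OF True p \<alpha>(2)])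
    next
      case False
      then have s: "s = 1 / p" "q \<le> 1" using sq by auto
      have b: "2 powr (real j * s) * \<alpha> j powr (1 / p) = (2^j * \<alpha> j) powr (1 / p)" for j
        using \<alpha>(2)[of j] by (simp add: s powr_mult powr_realpow[symmetric] powr_powr)
      show ?thesis by (rule summable_of_lq[OF q s(2)]) (use lq' in \<open>simp_all add: a b\<close>)
    qed
  qed
next
  note p = \<open>0 < p\<close> and q = \<open>0 < q\<close>
  fix f assume sp: "s > 1 / p \<or> (s = 1 / p \<and> p \<le> 1)" and f: "f \<in> radial_lizorkin_triebel \<phi>0 s p q"
  then obtain g where g: "\<And>j. given_by (dyadic_block \<phi>0 j f) (g j)"
    and LT: "Lp_qnorm p (\<lambda>x. lq_qnorm q (\<lambda>j. ennreal (2 powr (real j * s) * norm (g j x)))) < \<infinity>"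
    and T: "tempered f" and R: "radial f"
    by (auto simp: radial_lizorkin_triebel_def lizorkin_triebel_def)
  have gm [measurable]: "g i \<in> borel_measurable borel" for i using g[of i] by (simp add: given_by_def)
  define W where "W = (\<integral>\<^sup>+x. ennpowr (lq_qnorm q (\<lambda>j. ennreal (2 powr (real j * s) * norm (g j x)))) p \<partial>lborel)"
  have Wfin: "W < \<infinity>" using LT unfolding Lp_qnorm_def ennpowr_less_top W_def .
  \<comment> \<open>Pointwise comparison before integration, so that it bounds each integral
    \<open>I j\<close> as well as the integral of the supremum over \<open>j\<close>.\<close>
  have pt: "ennreal (2 powr (real j * s * p) * norm (g j x) powr p) \<le> ennpowr (lq_qnorm q (\<lambda>j. ennreal (2 powr (real j * s) * norm (g j x)))) p" for j x
  proof -
    have "ennpowr (ennreal (2 powr (real j * s) * norm (g j x))) p \<le> ennpowr (lq_qnorm q (\<lambda>j. ennreal (2 powr (real j * s) * norm (g j x)))) p"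
      using lq_qnorm_ge[OF q, of "\<lambda>j. ennreal (2 powr (real j * s) * norm (g j x))" j] p by (rule ennpowr_mono)
    then show ?thesis by (simp add: ennpowr_ennreal powr_mult powr_powr)
  qed
  show "uniformly_continuous_outside \<tau> f"
  proof (cases "s > 1 / p")
    case True
    define I where "I j = (\<integral>\<^sup>+x. ennreal (norm (g j x) powr p) \<partial>lborel)" for j
    have le: "ennreal (2 powr (real j * s * p)) * I j \<le> W" for j
    proof -
      have "ennreal (2 powr (real j * s * p)) * I j = (\<integral>\<^sup>+x. ennreal (2 powr (real j * s * p) * norm (g j x) powr p) \<partial>lborel)"
        unfolding I_def by (subst nn_integral_cmult[symmetric]) (auto simp: ennreal_mult')
      also have "\<dots> \<le> W" unfolding W_def by (rule nn_integral_mono) (rule pt)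
      finally show ?thesis .
    qed
    have Ifin: "I j < \<infinity>" for j
    proof (rule ccontr)
      assume "\<not> I j < \<infinity>"
      then have "ennreal (2 powr (real j * s * p)) * I j = \<infinity>" by (simp add: ennreal_mult_top not_less top_unique)
      then show False using le_less_trans[OF le[of j] Wfin] by simp
    qed
    define \<alpha> where "\<alpha> j = enn2real (I j)" for j
    have \<alpha>: "I j = ennreal (\<alpha> j)" "\<alpha> j \<ge> 0" for j using Ifin[of j] by (auto simp: \<alpha>_def)
    have K: "2 powr (real j * s) * \<alpha> j powr (1 / p) \<le> enn2real W powr (1 / p)" for j
    proof -
      have "enn2real (ennreal (2 powr (real j * s * p) * \<alpha> j)) \<le> enn2real W"
        using le[of j] Wfin by (intro enn2real_mono) (auto simp: \<alpha> ennreal_mult')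
      then have "2 powr (real j * s * p) * \<alpha> j \<le> enn2real W" using \<alpha>(2) by simp
      then have "(2 powr (real j * s * p) * \<alpha> j) powr (1 / p) \<le> enn2real W powr (1 / p)"
        using \<alpha>(2) p by (intro powr_mono2) auto
      then show ?thesis using \<alpha>(2)[of j] p by (simp add: powr_mult powr_powr)
    qed
    show ?thesis
      by (rule uniformly_continuous_outside_summable[OF assms(1) T R assms(2) g p \<alpha>[unfolded I_def] summable_of_smoothness[OF True p \<alpha>(2) K]])
  next
    case False
    then have s: "s = 1 / p" and p1: "p \<le> 1" using sp by auto
    have "(\<integral>\<^sup>+x. (SUP j. ennreal (2^j * norm (g j x) powr p)) \<partial>lborel) \<le> W"
      unfolding W_def
    proof (intro nn_integral_mono SUP_least)
      fix x and j :: nat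
      \<comment> \<open>At \<open>s = 1 / p\<close> the product \<open>s * p\<close> is 1, which
        makes the weight exactly the factor \<open>2^j\<close> gained by the averaging.\<close>
      have "2 powr (real j * s * p) = 2^j" using p by (simp add: s powr_realpow)
      then show "ennreal (2^j * norm (g j x) powr p) \<le> ennpowr (lq_qnorm q (\<lambda>j. ennreal (2 powr (real j * s) * norm (g j x)))) p"
        using pt[of j x] by simp
    qed
    then have "(\<integral>\<^sup>+x. (SUP j. ennreal (2^j * norm (g j x) powr p)) \<partial>lborel) < \<infinity>" using Wfin by (rule le_less_trans)
    then show ?thesis by (rule uniformly_continuous_outside_maximal[OF assms(1) T R assms(2) g p p1])
  qed
qed

end
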